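(* Let $\mathfrak g$ be a Lie algebra over a field $\mathbb F$, $I\subset\mathfrak g$ an ideal, $\mathfrak k\subset\mathfrak g$ a subalgebra reductive in $\mathfrak g$, $I_{\mathfrak k}=I\cap\mathfrak k$, and let $M,N,P$ be $\mathfrak g$-modules with a $\mathfrak g$-module map $M\otimes N\to P$. Let $e\in E_2^{p_1,q_1}(M)$ and $e'\in E_2^{p_2,q_2}(N)$. Then $$\psi_P(e\cup e')=(-1)^{p_2q_1}\,\psi_M(e)\cup\psi_N(e').$$
   Context: "Reductive in $\mathfrak g$": any $\mathfrak k$-submodules $U\subset V$ of $\mathfrak g$ admit a $\mathfrak k$-invariant complement of $U$ in $V$. Relative cochains: $C^n(\mathfrak g,\mathfrak k;M)\subset C^n(\mathfrak g;M)=\mathrm{Hom}(\Lambda^n\mathfrak g,M)$ is the subcomplex (for the Chevalley-Eilenberg differential) of $f$ with $i_xf=0$ and $\theta_xf=0$ for all $x\in\mathfrak k$, where $(i_xf)(x_2,\dots,x_n)=f(x,x_2,\dots,x_n)$ and $(\theta_xf)(x_1,\dots,x_n)=x\cdot f(x_1,\dots,x_n)-\sum_jf(\dots,[x,x_j],\dots)$. Cohomology: $H^n(\mathfrak g,\mathfrak k;M)$; similarly for other pairs, with cocycles $Z^n$ and coboundaries $B^n$. Cup product: for $a\in C^r(\mathfrak g;M)$, $b\in C^s(\mathfrak g;N)$, $(a\cup b)(x_1,\dots,x_{r+s})=\sum_\sigma(-1)^\sigma a(x_{\sigma(1)},\dots,x_{\sigma(r)})\cdot b(x_{\sigma(r+1)},\dots,x_{\sigma(r+s)})$,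 over permutations with $\sigma(1)<\dots<\sigma(r)$, $\sigma(r+1)<\dots<\sigma(r+s)$, where $\cdot$ is the map $M\otimes N\to P$. It induces pairings of relative cochains and cohomology. Action of $\mathfrak g/I$ on $H^q(I,I_{\mathfrak k};M)$: fix a $\mathfrak k$-module decomposition $\mathfrak g=I_{\mathfrak k}\oplus I_L\oplus J_{\mathfrak k}\oplus J_L$ with $I=I_{\mathfrak k}\oplus I_L$, $\mathfrak k=I_{\mathfrak k}\oplus J_{\mathfrak k}$; let $J=J_{\mathfrak k}\oplus J_L$ and $x\mapsto x^+$ the projection $\mathfrak g=I\oplus J\to J$; then $x\cdot[c]=[\theta_{x^+}c]$. Write $H^p(H^q(M))=H^p(\mathfrak g/I,\mathfrak k/I_{\mathfrak k};H^q(I,I_{\mathfrak k};M))$. The cup product $H^{q_1}(I,I_{\mathfrak k};M)\otimes H^{q_2}(I,I_{\mathfrak k};N)\to H^{q_1+q_2}(I,I_{\mathfrak k};P)$ is a $\mathfrak g/I$-module pairing, so induces a pairing $\cup:H^{p_1}(H^{q_1}(M))\otimes H^{p_2}(H^{q_2}(N))\to H^{p_1+p_2}(H^{q_1+q_2}(P))$. Spectral sequence: $E_r^{pq}(M)$ is that of $C^n=C^n(\mathfrak g,\mathfrak k;M)$ filtered by $F_pC^n=\{f: f$ vanishes when at least $n-p+1$ arguments lie in $I\}$ ($F_pC^n=C^n$ for $p\le0$). With $F_pC^n(r)=\{c\in F_pC^n:dc\in F_{p+r}C^{n+1}\}$, $Z_r^{pq}=F_pC^{p+q}(r)+F_{p+1}C^{p+q}$,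 $B_r^{pq}=dF_{p-r+1}C^{p+q-1}(r-1)+F_{p+1}C^{p+q}$, $E_r^{pq}=Z_r^{pq}/B_r^{pq}$. The pairing $E_r^{p_1,q_1}(M)\otimes E_r^{p_2,q_2}(N)\to E_r^{p_1+p_2,q_1+q_2}(P)$ sends $[a]\otimes[b]$ to $[a\cup b]$, for representatives $a,b$ in the spaces $F_{p_i}C^{p_i+q_i}(r)$. The isomorphism $\psi_M:E_2^{pq}(M)\to H^p(H^q(M))$ is $\psi_M(c+B_2^{pq})=\beta\alpha s_p(c)$, where $s_p:F_pC^{p+q}\to C^p(\mathfrak g/I,\mathfrak k/I_{\mathfrak k};C^q(I,I_{\mathfrak k};M))$ is $(s_pf)(x_1,\dots,x_p)(x_{p+1},\dots,x_{p+q})=f(x_1,\dots,x_{p+q})$ ($x_1,\dots,x_p\in\mathfrak g$, $x_{p+1},\dots,x_{p+q}\in I$); $\alpha:C^p(\mathfrak g/I,\mathfrak k/I_{\mathfrak k};Z^q(I,I_{\mathfrak k};M))\to C^p(\mathfrak g/I,\mathfrak k/I_{\mathfrak k};H^q(I,I_{\mathfrak k};M))$ and $\beta:Z^p(\mathfrak g/I,\mathfrak k/I_{\mathfrak k};H^q(I,I_{\mathfrak k};M))\to H^p(H^q(M))$ are induced by passing from cocycles to cohomology. (Here $\mathfrak k$ acts on $C^q(I,I_{\mathfrak k};M)$ by $\theta$, with $I_{\mathfrak k}$ acting trivially.) *)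

theory Defs
  imports "HOL-Combinatorics.Permutations" "HOL-Algebra.Module" "HOL-Algebra.AbelCoset"
begin

section \<open>Lie algebras and their modules\<close>

text \<open>
  The records extend \<open>module\<close>, whose fields \<open>mult\<close> and \<open>one\<close> are inherited from \<open>ring\<close>;
  they play no role here and are \<open>undefined\<close> in all structures built below.
\<close>

record ('f, 'g) lie = "('f, 'g) module" +
  bracket :: "'g \<Rightarrow> 'g \<Rightarrow> 'g"

record ('f, 'g, 'm) lmod = "('f, 'm) module" +
  act :: "'g \<Rightarrow> 'm \<Rightarrow> 'm"

locale lie_algebra = F?: field F + L?: module F L
  for F :: "'f ring" (structure) and L :: "('f, 'g) lie" (structure) +
  assumes bracket_closed:
      "\<lbrakk>x \<in> carrier L; y \<in> carrier L\<rbrakk> \<Longrightarrow> bracket L x y \<in> carrier L"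
    and bracket_add_left:
      "\<lbrakk>x \<in> carrier L; y \<in> carrier L; z \<in> carrier L\<rbrakk>
        \<Longrightarrow> bracket L (x \<oplus>\<^bsub>L\<^esub> y) z = bracket L x z \<oplus>\<^bsub>L\<^esub> bracket L y z"
    and bracket_add_right:
      "\<lbrakk>x \<in> carrier L; y \<in> carrier L; z \<in> carrier L\<rbrakk>
        \<Longrightarrow> bracket L x (y \<oplus>\<^bsub>L\<^esub> z) = bracket L x y \<oplus>\<^bsub>L\<^esub> bracket L x z"
    and bracket_smult_left:
      "\<lbrakk>a \<in> carrier F; x \<in> carrier L; y \<in> carrier L\<rbrakk>
        \<Longrightarrow> bracket L (a \<odot>\<^bsub>L\<^esub> x) y = a \<odot>\<^bsub>L\<^esub> bracket L x y"
    and bracket_smult_right: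
      "\<lbrakk>a \<in> carrier F; x \<in> carrier L; y \<in> carrier L\<rbrakk>
        \<Longrightarrow> bracket L x (a \<odot>\<^bsub>L\<^esub> y) = a \<odot>\<^bsub>L\<^esub> bracket L x y"
    and bracket_self:
      "x \<in> carrier L \<Longrightarrow> bracket L x x = \<zero>\<^bsub>L\<^esub>"
    and jacobi:
      "\<lbrakk>x \<in> carrier L; y \<in> carrier L; z \<in> carrier L\<rbrakk>
        \<Longrightarrow> bracket L x (bracket L y z) \<oplus>\<^bsub>L\<^esub> bracket L y (bracket L z x)
              \<oplus>\<^bsub>L\<^esub> bracket L z (bracket L x y) = \<zero>\<^bsub>L\<^esub>"

locale lie_module = lie_algebra F L + M: module F M
  for F :: "'f ring" (structure) and L :: "('f, 'g) lie" (structure)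
    and M :: "('f, 'g, 'm) lmod" +
  assumes act_closed:
      "\<lbrakk>x \<in> carrier L; m \<in> carrier M\<rbrakk> \<Longrightarrow> act M x m \<in> carrier M"
    and act_add_left:
      "\<lbrakk>x \<in> carrier L; y \<in> carrier L; m \<in> carrier M\<rbrakk>
        \<Longrightarrow> act M (x \<oplus>\<^bsub>L\<^esub> y) m = act M x m \<oplus>\<^bsub>M\<^esub> act M y m"
    and act_add_right:
      "\<lbrakk>x \<in> carrier L; m \<in> carrier M; n \<in> carrier M\<rbrakk>
        \<Longrightarrow> act M x (m \<oplus>\<^bsub>M\<^esub> n) = act M x m \<oplus>\<^bsub>M\<^esub> act M x n"
    and act_smult_left:
      "\<lbrakk>a \<in> carrier F; x \<in> carrier L; m \<in> carrier M\<rbrakk>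
        \<Longrightarrow> act M (a \<odot>\<^bsub>L\<^esub> x) m = a \<odot>\<^bsub>M\<^esub> act M x m"
    and act_smult_right:
      "\<lbrakk>a \<in> carrier F; x \<in> carrier L; m \<in> carrier M\<rbrakk>
        \<Longrightarrow> act M x (a \<odot>\<^bsub>M\<^esub> m) = a \<odot>\<^bsub>M\<^esub> act M x m"
    and act_bracket:
      "\<lbrakk>x \<in> carrier L; y \<in> carrier L; m \<in> carrier M\<rbrakk>
        \<Longrightarrow> act M (bracket L x y) m = act M x (act M y m) \<ominus>\<^bsub>M\<^esub> act M y (act M x m)"

text \<open>A homomorphism of Lie modules \<open>M \<otimes> N \<rightarrow> P\<close>, given as an equivariant bilinear map.\<close>

locale lie_pairing = M: lie_module F L M + N: lie_module F L N + P: lie_module F L P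
  for F :: "'f ring" and L :: "('f, 'g) lie" and M :: "('f, 'g, 'm) lmod"
    and N :: "('f, 'g, 'n) lmod" and P :: "('f, 'g, 'p) lmod" +
  fixes \<mu> :: "'m \<Rightarrow> 'n \<Rightarrow> 'p"
  assumes pair_closed:
      "\<lbrakk>m \<in> carrier M; n \<in> carrier N\<rbrakk> \<Longrightarrow> \<mu> m n \<in> carrier P"
    and pair_add_left:
      "\<lbrakk>m \<in> carrier M; m' \<in> carrier M; n \<in> carrier N\<rbrakk>
        \<Longrightarrow> \<mu> (m \<oplus>\<^bsub>M\<^esub> m') n = \<mu> m n \<oplus>\<^bsub>P\<^esub> \<mu> m' n"
    and pair_add_right:
      "\<lbrakk>m \<in> carrier M; n \<in> carrier N; n' \<in> carrier N\<rbrakk>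
        \<Longrightarrow> \<mu> m (n \<oplus>\<^bsub>N\<^esub> n') = \<mu> m n \<oplus>\<^bsub>P\<^esub> \<mu> m n'"
    and pair_smult_left:
      "\<lbrakk>a \<in> carrier F; m \<in> carrier M; n \<in> carrier N\<rbrakk>
        \<Longrightarrow> \<mu> (a \<odot>\<^bsub>M\<^esub> m) n = a \<odot>\<^bsub>P\<^esub> \<mu> m n"
    and pair_smult_right:
      "\<lbrakk>a \<in> carrier F; m \<in> carrier M; n \<in> carrier N\<rbrakk>
        \<Longrightarrow> \<mu> m (a \<odot>\<^bsub>N\<^esub> n) = a \<odot>\<^bsub>P\<^esub> \<mu> m n"
    and pair_equivariant:
      "\<lbrakk>x \<in> carrier L; m \<in> carrier M; n \<in> carrier N\<rbrakk>
        \<Longrightarrow> act P x (\<mu> m n) = \<mu> (act M x m) n \<oplus>\<^bsub>P\<^esub> \<mu> m (act N x n)"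

definition lie_subalgebra :: "'f ring \<Rightarrow> ('f, 'g) lie \<Rightarrow> 'g set \<Rightarrow> bool" where
  "lie_subalgebra F L K \<longleftrightarrow> submodule K F L \<and> (\<forall>x\<in>K. \<forall>y\<in>K. bracket L x y \<in> K)"

definition lie_ideal :: "'f ring \<Rightarrow> ('f, 'g) lie \<Rightarrow> 'g set \<Rightarrow> bool" where
  "lie_ideal F L I \<longleftrightarrow> submodule I F L \<and> (\<forall>x\<in>carrier L. \<forall>y\<in>I. bracket L x y \<in> I)"

definition ad_submodule :: "'f ring \<Rightarrow> ('f, 'g) lie \<Rightarrow> 'g set \<Rightarrow> 'g set \<Rightarrow> bool" where
  "ad_submodule F L K U \<longleftrightarrow> submodule U F L \<and> (\<forall>x\<in>K. \<forall>u\<in>U. bracket L x u \<in> U)"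

definition direct_sum_of :: "('f, 'g) lie \<Rightarrow> 'g set \<Rightarrow> 'g set \<Rightarrow> 'g set \<Rightarrow> bool" where
  "direct_sum_of L V U W \<longleftrightarrow> U <+>\<^bsub>L\<^esub> W = V \<and> U \<inter> W = {\<zero>\<^bsub>L\<^esub>}"

definition reductive_in :: "'f ring \<Rightarrow> ('f, 'g) lie \<Rightarrow> 'g set \<Rightarrow> bool" where
  "reductive_in F L K \<longleftrightarrow>
     (\<forall>U V. ad_submodule F L K U \<and> ad_submodule F L K V \<and> U \<subseteq> V \<longrightarrow>
        (\<exists>W. ad_submodule F L K W \<and> direct_sum_of L V U W))"

abbreviation restrict_lie :: "('f, 'g) lie \<Rightarrow> 'g set \<Rightarrow> ('f, 'g) lie" where
  "restrict_lie L I \<equiv> L\<lparr>carrier := I\<rparr>"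


section \<open>Quotients\<close>

text \<open>
  Quotients consist of cosets.  Maps induced on a quotient are written as unions over all
  representatives of a class, in the style of \<open>rcoset_mult\<close> in HOL-Algebra: where the induced map
  is well defined, all members of the union are the same coset.
\<close>

definition subquotient :: "('f, 'c, 'r) module_scheme \<Rightarrow> 'c set \<Rightarrow> 'c set \<Rightarrow> ('f, 'c set) module" where
  "subquotient C Z B =
     \<lparr>carrier = (\<lambda>z. B +>\<^bsub>C\<^esub> z) ` Z, mult = undefined, one = undefined, zero = B,
      add = (\<lambda>X Y. X <+>\<^bsub>C\<^esub> Y),
      smult = (\<lambda>a X. \<Union>x\<in>X. B +>\<^bsub>C\<^esub> (a \<odot>\<^bsub>C\<^esub> x))\<rparr>"

definition quotient_lie :: "('f, 'g) lie \<Rightarrow> 'g set \<Rightarrow> ('f, 'g set) lie" where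
  "quotient_lie L I =
     module.extend (subquotient L (carrier L) I)
       (lie.fields (\<lambda>X Y. \<Union>x\<in>X. \<Union>y\<in>Y. I +>\<^bsub>L\<^esub> bracket L x y))"

text \<open>The subalgebra \<open>K/(I \<inter> K)\<close>, realised as the image of \<open>K\<close> in \<open>L/I\<close>.\<close>

definition image_in_quotient :: "('f, 'g) lie \<Rightarrow> 'g set \<Rightarrow> 'g set \<Rightarrow> 'g set set" where
  "image_in_quotient L I K = (\<lambda>x. I +>\<^bsub>L\<^esub> x) ` K"


section \<open>Relative Chevalley-Eilenberg cohomology\<close>

definition tuples :: "('f, 'g) lie \<Rightarrow> nat \<Rightarrow> 'g list set" where
  "tuples L n = {xs. length xs = n \<and> set xs \<subseteq> carrier L}"

text \<open>
  The space \<open>C\<^sup>n(L; M)\<close> of alternating multilinear maps.  Arguments are lists, and cochains are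
  \<open>undefined\<close> outside \<open>tuples L n\<close>, so that equality of cochains is equality of functions.
  Alternating means vanishing on repeated arguments, as appropriate in every characteristic.
\<close>

definition cochains ::
    "'f ring \<Rightarrow> ('f, 'g) lie \<Rightarrow> ('f, 'g, 'm) lmod \<Rightarrow> nat \<Rightarrow> ('f, 'g list \<Rightarrow> 'm) module" where
  "cochains F L M n =
     \<lparr>carrier = {f \<in> tuples L n \<rightarrow>\<^sub>E carrier M.
        (\<forall>xs\<in>tuples L n. \<forall>i<n. \<forall>x\<in>carrier L. \<forall>y\<in>carrier L.
           f (xs[i := x \<oplus>\<^bsub>L\<^esub> y]) = f (xs[i := x]) \<oplus>\<^bsub>M\<^esub> f (xs[i := y])) \<and>
        (\<forall>xs\<in>tuples L n. \<forall>i<n. \<forall>a\<in>carrier F. \<forall>x\<in>carrier L.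
           f (xs[i := a \<odot>\<^bsub>L\<^esub> x]) = a \<odot>\<^bsub>M\<^esub> f (xs[i := x])) \<and>
        (\<forall>xs\<in>tuples L n. \<not> distinct xs \<longrightarrow> f xs = \<zero>\<^bsub>M\<^esub>)},
      mult = undefined, one = undefined,
      zero = (\<lambda>xs\<in>tuples L n. \<zero>\<^bsub>M\<^esub>),
      add = (\<lambda>f g. \<lambda>xs\<in>tuples L n. f xs \<oplus>\<^bsub>M\<^esub> g xs),
      smult = (\<lambda>a f. \<lambda>xs\<in>tuples L n. a \<odot>\<^bsub>M\<^esub> f xs)\<rparr>"

text \<open>
  The operator \<open>\<theta>\<^sub>x\<close> uses the bracket of \<open>x\<close> with the arguments only, so \<open>x\<close> may also be taken
  from a larger Lie algebra in which \<open>L\<close> is an ideal.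
\<close>

definition theta ::
    "('f, 'g) lie \<Rightarrow> ('f, 'g, 'm) lmod \<Rightarrow> nat \<Rightarrow> 'g \<Rightarrow> ('g list \<Rightarrow> 'm) \<Rightarrow> 'g list \<Rightarrow> 'm" where
  "theta L M n x f =
     (\<lambda>xs\<in>tuples L n. act M x (f xs) \<ominus>\<^bsub>M\<^esub> (\<Oplus>\<^bsub>M\<^esub>j\<in>{..<n}. f (xs[j := bracket L x (xs ! j)])))"

text \<open>
  The differential, with arguments numbered from \<open>0\<close>:
  \<open>(df)(x\<^sub>0,\<dots>,x\<^sub>n) = \<Sum>\<^sub>i (-1)\<^sup>i x\<^sub>i \<cdot> f(\<dots>,x\<^sub>i omitted,\<dots>)
     + \<Sum>\<^sub>i\<^sub><\<^sub>j (-1)\<^sup>i\<^sup>+\<^sup>j f([x\<^sub>i,x\<^sub>j],\<dots>,x\<^sub>i,x\<^sub>j omitted,\<dots>)\<close>.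
\<close>

definition ce_diff ::
    "('f, 'g) lie \<Rightarrow> ('f, 'g, 'm) lmod \<Rightarrow> nat \<Rightarrow> ('g list \<Rightarrow> 'm) \<Rightarrow> 'g list \<Rightarrow> 'm" where
  "ce_diff L M n f =
     (\<lambda>xs\<in>tuples L (Suc n).
        (\<Oplus>\<^bsub>M\<^esub>i\<in>{..n}. [((- 1 :: int) ^ i)] \<cdot>\<^bsub>M\<^esub> act M (xs ! i) (f (nths xs (- {i}))))
        \<oplus>\<^bsub>M\<^esub> (\<Oplus>\<^bsub>M\<^esub>ij\<in>{(i, j). i < j \<and> j \<le> n}. [((- 1 :: int) ^ (fst ij + snd ij))] \<cdot>\<^bsub>M\<^esub>
             f (bracket L (xs ! fst ij) (xs ! snd ij) # nths xs (- {fst ij, snd ij}))))"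

text \<open>
  \<open>C\<^sup>n(L, K; M)\<close>.  Only the action of \<open>K\<close> on \<open>M\<close> enters.  For \<open>n = 0\<close> the condition
  \<open>i\<^sub>x f = 0\<close> is vacuous.
\<close>

definition rel_cochains ::
    "'f ring \<Rightarrow> ('f, 'g) lie \<Rightarrow> 'g set \<Rightarrow> ('f, 'g, 'm) lmod \<Rightarrow> nat \<Rightarrow> ('g list \<Rightarrow> 'm) set" where
  "rel_cochains F L K M n =
     {f \<in> carrier (cochains F L M n). \<forall>x\<in>K.
        (\<forall>xs. x # xs \<in> tuples L n \<longrightarrow> f (x # xs) = \<zero>\<^bsub>M\<^esub>) \<and>
        theta L M n x f = \<zero>\<^bsub>cochains F L M n\<^esub>}"

text \<open>The image under the differential of a subspace \<open>S (n - 1)\<close> of \<open>C\<^sup>n\<^sup>-\<^sup>1\<close>, where \<open>C\<^sup>-\<^sup>1 = 0\<close>.\<close>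

definition diff_image ::
    "'f ring \<Rightarrow> ('f, 'g) lie \<Rightarrow> ('f, 'g, 'm) lmod \<Rightarrow> (nat \<Rightarrow> ('g list \<Rightarrow> 'm) set) \<Rightarrow> nat
      \<Rightarrow> ('g list \<Rightarrow> 'm) set" where
  "diff_image F L M S n =
     (case n of 0 \<Rightarrow> {\<zero>\<^bsub>cochains F L M 0\<^esub>} | Suc m \<Rightarrow> ce_diff L M m ` S m)"

definition cocycles ::
    "'f ring \<Rightarrow> ('f, 'g) lie \<Rightarrow> 'g set \<Rightarrow> ('f, 'g, 'm) lmod \<Rightarrow> nat \<Rightarrow> ('g list \<Rightarrow> 'm) set" where
  "cocycles F L K M n =
     {f \<in> rel_cochains F L K M n. ce_diff L M n f = \<zero>\<^bsub>cochains F L M (Suc n)\<^esub>}"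

definition coboundaries ::
    "'f ring \<Rightarrow> ('f, 'g) lie \<Rightarrow> 'g set \<Rightarrow> ('f, 'g, 'm) lmod \<Rightarrow> nat \<Rightarrow> ('g list \<Rightarrow> 'm) set" where
  "coboundaries F L K M n = diff_image F L M (rel_cochains F L K M) n"

abbreviation cohomology_class ::
    "'f ring \<Rightarrow> ('f, 'g) lie \<Rightarrow> 'g set \<Rightarrow> ('f, 'g, 'm) lmod \<Rightarrow> nat
      \<Rightarrow> ('g list \<Rightarrow> 'm) \<Rightarrow> ('g list \<Rightarrow> 'm) set" where
  "cohomology_class F L K M n c \<equiv> coboundaries F L K M n +>\<^bsub>cochains F L M n\<^esub> c"

definition cohomology ::
    "'f ring \<Rightarrow> ('f, 'g) lie \<Rightarrow> 'g set \<Rightarrow> ('f, 'g, 'm) lmod \<Rightarrow> nat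
      \<Rightarrow> ('f, ('g list \<Rightarrow> 'm) set) module" where
  "cohomology F L K M n =
     subquotient (cochains F L M n) (cocycles F L K M n) (coboundaries F L K M n)"


section \<open>Cup products\<close>

definition shuffle_perms :: "nat \<Rightarrow> nat \<Rightarrow> (nat \<Rightarrow> nat) set" where
  "shuffle_perms r s =
     {\<sigma>. \<sigma> permutes {..<r + s} \<and> strict_mono_on {..<r} \<sigma> \<and> strict_mono_on {r..<r + s} \<sigma>}"

definition cup ::
    "('f, 'g) lie \<Rightarrow> ('f, 'g, 'p) lmod \<Rightarrow> ('m \<Rightarrow> 'n \<Rightarrow> 'p) \<Rightarrow> nat \<Rightarrow> nat
      \<Rightarrow> ('g list \<Rightarrow> 'm) \<Rightarrow> ('g list \<Rightarrow> 'n) \<Rightarrow> 'g list \<Rightarrow> 'p" where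
  "cup L P \<mu> r s a b =
     (\<lambda>xs\<in>tuples L (r + s). \<Oplus>\<^bsub>P\<^esub>\<sigma>\<in>shuffle_perms r s. [sign \<sigma>] \<cdot>\<^bsub>P\<^esub>
        \<mu> (a (map (\<lambda>i. xs ! \<sigma> i) [0..<r])) (b (map (\<lambda>i. xs ! \<sigma> i) [r..<r + s])))"

text \<open>The pairing \<open>H\<^sup>r(L, K; M) \<otimes> H\<^sup>s(L, K; N) \<rightarrow> H\<^sup>r\<^sup>+\<^sup>s(L, K; P)\<close>.\<close>

definition cohomology_cup ::
    "'f ring \<Rightarrow> ('f, 'g) lie \<Rightarrow> 'g set \<Rightarrow> ('f, 'g, 'p) lmod \<Rightarrow> ('m \<Rightarrow> 'n \<Rightarrow> 'p) \<Rightarrow> nat \<Rightarrow> nat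
      \<Rightarrow> ('g list \<Rightarrow> 'm) set \<Rightarrow> ('g list \<Rightarrow> 'n) set \<Rightarrow> ('g list \<Rightarrow> 'p) set" where
  "cohomology_cup F L K P \<mu> r s X Y =
     (\<Union>a\<in>X. \<Union>b\<in>Y. cohomology_class F L K P (r + s) (cup L P \<mu> r s a b))"


section \<open>The module \<open>H\<^sup>q(I, I \<inter> K; M)\<close> over \<open>L/I\<close>\<close>

text \<open>
  A decomposition of \<open>L\<close> into submodules for the adjoint action of \<open>K\<close>, namely
  \<open>L = (I \<inter> K) \<oplus> IL \<oplus> JK \<oplus> JL\<close> with \<open>I = (I \<inter> K) \<oplus> IL\<close> and \<open>K = (I \<inter> K) \<oplus> JK\<close>.
\<close>

definition decomposition ::
    "'f ring \<Rightarrow> ('f, 'g) lie \<Rightarrow> 'g set \<Rightarrow> 'g set \<Rightarrow> 'g set \<Rightarrow> 'g set \<Rightarrow> 'g set \<Rightarrow> bool" where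
  "decomposition F L I K IL JK JL \<longleftrightarrow>
     ad_submodule F L K (I \<inter> K) \<and> ad_submodule F L K IL \<and>
     ad_submodule F L K JK \<and> ad_submodule F L K JL \<and>
     direct_sum_of L I (I \<inter> K) IL \<and> direct_sum_of L K (I \<inter> K) JK \<and>
     direct_sum_of L (JK <+>\<^bsub>L\<^esub> JL) JK JL \<and> direct_sum_of L (carrier L) I (JK <+>\<^bsub>L\<^esub> JL)"

text \<open>The projection \<open>x \<mapsto> x\<^sup>+\<close> onto \<open>J\<close> along \<open>I\<close>, for \<open>L = I \<oplus> J\<close>.\<close>

definition proj_compl :: "('f, 'g) lie \<Rightarrow> 'g set \<Rightarrow> 'g set \<Rightarrow> 'g \<Rightarrow> 'g" where
  "proj_compl L I J x = (THE y. y \<in> J \<and> x \<ominus>\<^bsub>L\<^esub> y \<in> I)"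

definition ideal_cohomology ::
    "'f ring \<Rightarrow> ('f, 'g) lie \<Rightarrow> 'g set \<Rightarrow> 'g set \<Rightarrow> 'g set \<Rightarrow> ('f, 'g, 'm) lmod \<Rightarrow> nat
      \<Rightarrow> ('f, 'g set, ('g list \<Rightarrow> 'm) set) lmod" where
  "ideal_cohomology F L I K J M q =
     module.extend (cohomology F (restrict_lie L I) (I \<inter> K) M q)
       (lmod.fields (\<lambda>X C. \<Union>x\<in>X. \<Union>c\<in>C.
          cohomology_class F (restrict_lie L I) (I \<inter> K) M q
            (theta (restrict_lie L I) M q (proj_compl L I J x) c)))"

text \<open>\<open>H\<^sup>p(H\<^sup>q(M)) = H\<^sup>p(L/I, K/(I \<inter> K); H\<^sup>q(I, I \<inter> K; M))\<close>\<close>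

definition double_cohomology ::
    "'f ring \<Rightarrow> ('f, 'g) lie \<Rightarrow> 'g set \<Rightarrow> 'g set \<Rightarrow> 'g set \<Rightarrow> ('f, 'g, 'm) lmod \<Rightarrow> nat \<Rightarrow> nat
      \<Rightarrow> ('f, ('g set list \<Rightarrow> ('g list \<Rightarrow> 'm) set) set) module" where
  "double_cohomology F L I K J M p q =
     cohomology F (quotient_lie L I) (image_in_quotient L I K) (ideal_cohomology F L I K J M q) p"

text \<open>
  The pairing \<open>H\<^sup>p\<^sup>1(H\<^sup>q\<^sup>1(M)) \<otimes> H\<^sup>p\<^sup>2(H\<^sup>q\<^sup>2(N)) \<rightarrow> H\<^sup>p\<^sup>1\<^sup>+\<^sup>p\<^sup>2(H\<^sup>q\<^sup>1\<^sup>+\<^sup>q\<^sup>2(P))\<close>: the cup product over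
  \<open>L/I\<close> with respect to the pairing of coefficients given by the cup product over \<open>I\<close>.
\<close>

definition double_cup ::
    "'f ring \<Rightarrow> ('f, 'g) lie \<Rightarrow> 'g set \<Rightarrow> 'g set \<Rightarrow> 'g set \<Rightarrow> ('f, 'g, 'p) lmod \<Rightarrow> ('m \<Rightarrow> 'n \<Rightarrow> 'p)
      \<Rightarrow> nat \<Rightarrow> nat \<Rightarrow> nat \<Rightarrow> nat
      \<Rightarrow> ('g set list \<Rightarrow> ('g list \<Rightarrow> 'm) set) set
      \<Rightarrow> ('g set list \<Rightarrow> ('g list \<Rightarrow> 'n) set) set
      \<Rightarrow> ('g set list \<Rightarrow> ('g list \<Rightarrow> 'p) set) set" where
  "double_cup F L I K J P \<mu> p1 q1 p2 q2 =
     cohomology_cup F (quotient_lie L I) (image_in_quotient L I K)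
       (ideal_cohomology F L I K J P (q1 + q2))
       (cohomology_cup F (restrict_lie L I) (I \<inter> K) P \<mu> q1 q2) p1 p2"


section \<open>The spectral sequence\<close>

text \<open>
  The filtration degree \<open>p\<close> and the page \<open>r\<close> are integers, since \<open>B\<^sub>r\<^sup>p\<^sup>q\<close> involves
  \<open>F\<^sub>p\<^sub>-\<^sub>r\<^sub>+\<^sub>1\<close>.  For \<open>p \<le> 0\<close> the condition below is vacuous and \<open>F\<^sub>pC\<^sup>n = C\<^sup>n\<close>.
\<close>

definition filt ::
    "'f ring \<Rightarrow> ('f, 'g) lie \<Rightarrow> 'g set \<Rightarrow> 'g set \<Rightarrow> ('f, 'g, 'm) lmod \<Rightarrow> int \<Rightarrow> nat
      \<Rightarrow> ('g list \<Rightarrow> 'm) set" where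
  "filt F L I K M p n =
     {f \<in> rel_cochains F L K M n. \<forall>xs\<in>tuples L n.
        int (length (filter (\<lambda>x. x \<in> I) xs)) \<ge> int n - p + 1 \<longrightarrow> f xs = \<zero>\<^bsub>M\<^esub>}"

text \<open>\<open>F\<^sub>pC\<^sup>n(r)\<close>\<close>

definition filt_page ::
    "'f ring \<Rightarrow> ('f, 'g) lie \<Rightarrow> 'g set \<Rightarrow> 'g set \<Rightarrow> ('f, 'g, 'm) lmod \<Rightarrow> int \<Rightarrow> int \<Rightarrow> nat
      \<Rightarrow> ('g list \<Rightarrow> 'm) set" where
  "filt_page F L I K M r p n =
     {c \<in> filt F L I K M p n. ce_diff L M n c \<in> filt F L I K M (p + r) (Suc n)}"

definition spec_Z ::
    "'f ring \<Rightarrow> ('f, 'g) lie \<Rightarrow> 'g set \<Rightarrow> 'g set \<Rightarrow> ('f, 'g, 'm) lmod \<Rightarrow> int \<Rightarrow> nat \<Rightarrow> nat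
      \<Rightarrow> ('g list \<Rightarrow> 'm) set" where
  "spec_Z F L I K M r p q =
     filt_page F L I K M r (int p) (p + q)
       <+>\<^bsub>cochains F L M (p + q)\<^esub> filt F L I K M (int p + 1) (p + q)"

definition spec_B ::
    "'f ring \<Rightarrow> ('f, 'g) lie \<Rightarrow> 'g set \<Rightarrow> 'g set \<Rightarrow> ('f, 'g, 'm) lmod \<Rightarrow> int \<Rightarrow> nat \<Rightarrow> nat
      \<Rightarrow> ('g list \<Rightarrow> 'm) set" where
  "spec_B F L I K M r p q =
     diff_image F L M (filt_page F L I K M (r - 1) (int p - r + 1)) (p + q)
       <+>\<^bsub>cochains F L M (p + q)\<^esub> filt F L I K M (int p + 1) (p + q)"

definition spec_E ::
    "'f ring \<Rightarrow> ('f, 'g) lie \<Rightarrow> 'g set \<Rightarrow> 'g set \<Rightarrow> ('f, 'g, 'm) lmod \<Rightarrow> int \<Rightarrow> nat \<Rightarrow> nat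
      \<Rightarrow> ('f, ('g list \<Rightarrow> 'm) set) module" where
  "spec_E F L I K M r p q =
     subquotient (cochains F L M (p + q)) (spec_Z F L I K M r p q) (spec_B F L I K M r p q)"

text \<open>
  The pairing \<open>E\<^sub>r\<^sup>p\<^sup>1\<^sup>q\<^sup>1(M) \<otimes> E\<^sub>r\<^sup>p\<^sup>2\<^sup>q\<^sup>2(N) \<rightarrow> E\<^sub>r\<^sup>p\<^sup>1\<^sup>+\<^sup>p\<^sup>2\<^sup>,\<^sup>q\<^sup>1\<^sup>+\<^sup>q\<^sup>2(P)\<close>.
  Only representatives in \<open>F\<^sub>pC\<^sup>p\<^sup>+\<^sup>q(r)\<close> are used: a class also contains elements which are in
  \<open>Z\<^sub>r\<^sup>p\<^sup>q\<close> merely modulo \<open>F\<^sub>p\<^sub>+\<^sub>1\<close>.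
\<close>

definition spec_cup ::
    "'f ring \<Rightarrow> ('f, 'g) lie \<Rightarrow> 'g set \<Rightarrow> 'g set \<Rightarrow> ('f, 'g, 'm) lmod \<Rightarrow> ('f, 'g, 'n) lmod
      \<Rightarrow> ('f, 'g, 'p) lmod \<Rightarrow> ('m \<Rightarrow> 'n \<Rightarrow> 'p) \<Rightarrow> int \<Rightarrow> nat \<Rightarrow> nat \<Rightarrow> nat \<Rightarrow> nat
      \<Rightarrow> ('g list \<Rightarrow> 'm) set \<Rightarrow> ('g list \<Rightarrow> 'n) set \<Rightarrow> ('g list \<Rightarrow> 'p) set" where
  "spec_cup F L I K M N P \<mu> r p1 q1 p2 q2 e e' =
     (\<Union>a \<in> e \<inter> filt_page F L I K M r (int p1) (p1 + q1).
      \<Union>b \<in> e' \<inter> filt_page F L I K N r (int p2) (p2 + q2).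
        spec_B F L I K P r (p1 + p2) (q1 + q2)
          +>\<^bsub>cochains F L P ((p1 + p2) + (q1 + q2))\<^esub> cup L P \<mu> (p1 + q1) (p2 + q2) a b)"


section \<open>The isomorphism \<open>\<psi>\<close>\<close>

text \<open>
  \<open>s\<^sub>p f\<close> has arguments in \<open>L/I\<close>, for which representatives are chosen; for \<open>f\<close> in
  \<open>F\<^sub>pC\<^sup>p\<^sup>+\<^sup>q\<close> its values do not depend on the choice.
\<close>

definition s_map ::
    "('f, 'g) lie \<Rightarrow> 'g set \<Rightarrow> nat \<Rightarrow> nat \<Rightarrow> ('g list \<Rightarrow> 'm) \<Rightarrow> 'g set list \<Rightarrow> 'g list \<Rightarrow> 'm" where
  "s_map L I p q f =
     (\<lambda>Xs\<in>tuples (quotient_lie L I) p. \<lambda>ys\<in>tuples (restrict_lie L I) q.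
        f (map (\<lambda>X. SOME x. x \<in> X) Xs @ ys))"

definition alpha_map ::
    "'f ring \<Rightarrow> ('f, 'g) lie \<Rightarrow> 'g set \<Rightarrow> 'g set \<Rightarrow> ('f, 'g, 'm) lmod \<Rightarrow> nat \<Rightarrow> nat
      \<Rightarrow> ('g set list \<Rightarrow> 'g list \<Rightarrow> 'm) \<Rightarrow> 'g set list \<Rightarrow> ('g list \<Rightarrow> 'm) set" where
  "alpha_map F L I K M p q h =
     (\<lambda>Xs\<in>tuples (quotient_lie L I) p.
        cohomology_class F (restrict_lie L I) (I \<inter> K) M q (h Xs))"

definition beta_map ::
    "'f ring \<Rightarrow> ('f, 'g) lie \<Rightarrow> 'g set \<Rightarrow> 'g set \<Rightarrow> 'g set \<Rightarrow> ('f, 'g, 'm) lmod \<Rightarrow> nat \<Rightarrow> nat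
      \<Rightarrow> ('g set list \<Rightarrow> ('g list \<Rightarrow> 'm) set) \<Rightarrow> ('g set list \<Rightarrow> ('g list \<Rightarrow> 'm) set) set" where
  "beta_map F L I K J M p q z =
     cohomology_class F (quotient_lie L I) (image_in_quotient L I K)
       (ideal_cohomology F L I K J M q) p z"

definition psi ::
    "'f ring \<Rightarrow> ('f, 'g) lie \<Rightarrow> 'g set \<Rightarrow> 'g set \<Rightarrow> 'g set \<Rightarrow> ('f, 'g, 'm) lmod \<Rightarrow> nat \<Rightarrow> nat
      \<Rightarrow> ('g list \<Rightarrow> 'm) set \<Rightarrow> ('g set list \<Rightarrow> ('g list \<Rightarrow> 'm) set) set" where
  "psi F L I K J M p q e =
     (\<Union>c\<in>e. beta_map F L I K J M p q (alpha_map F L I K M p q (s_map L I p q c)))"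

end

theory Submission
  imports Defs
begin

text \<open>
  All operators on cochains are governed by their behaviour under contraction \<open>i\<^sub>x\<close>:
  \<open>i\<^sub>z \<theta>\<^sub>x = \<theta>\<^sub>x i\<^sub>z - i\<^bsub>[x,z]\<^esub>\<close>, Cartan's formula \<open>i\<^sub>x d = \<theta>\<^sub>x - d i\<^sub>x\<close>, and
  \<open>i\<^sub>x (a \<union> b) = i\<^sub>x a \<union> b + (-1)\<^sup>r a \<union> i\<^sub>x b\<close> for \<open>a\<close> of degree \<open>r\<close>.  These are recursions on the
  degree, so \<open>d d = 0\<close>, the Leibniz rule and the commutation relations follow by induction.

  The composite \<open>w = \<alpha> s\<^sub>p\<close> fits the same scheme.  Let \<open>x\<close> centralize \<open>I \<inter> K\<close>; such elements
  represent every class \<open>X\<close> of the quotient by \<open>I\<close>.  Then \<open>i\<^sub>X w(u) = w(i\<^sub>x u)\<close>, and induction on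
  \<open>p\<close> gives \<open>w(\<theta>\<^sub>x u) = \<theta>\<^sub>X w(u)\<close>, \<open>w(d u) = d w(u)\<close> and
  \<open>w(a \<union> b) = (-1)\<^sup>k w(a) \<union> w(b)\<close> with \<open>k = p\<^sub>2 q\<^sub>1\<close>.  In the last induction the contraction
  of \<open>b\<close> passes \<open>a\<close> with sign \<open>(-1)\<close> to the power \<open>p\<^sub>1 + q\<^sub>1\<close> on the left but \<open>p\<^sub>1\<close> on the right;
  each of the \<open>p\<^sub>2\<close> arguments of \<open>b\<close> thus contributes \<open>q\<^sub>1\<close> to the exponent.
\<close>

section \<open>Abelian groups, finite sums and sublists\<close>

text \<open>A contraction of a cochain relative to \<open>I \<inter> K\<close> stays relative if the
  contracting element commutes with \<open>I \<inter> K\<close>, but invariance under all of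
  \<open>K\<close> is lost. The inductions therefore run over a larger space \<open>W p q\<close>,
  and \<open>K\<close> returns only in \<open>w_rel\<close>. There, \<open>u\<close> in
  \<open>F_p\<close> with \<open>d u\<close> in \<open>F_{p+1}\<close> makes the values of
  \<open>s_p u\<close> cocycles on \<open>I\<close>, and the pair of conditions survives
  contraction.

  Everything closes up because \<open>w\<close> kills \<open>F_{p+1}\<close>. This single fact makes
  \<open>w\<close> independent of representatives modulo \<open>I\<close>, turns elements of the
  second page into cocycles, and settles the critical case of the cup product: if
  \<open>p2 = 0\<close>, the factor \<open>b\<close> has no outer argument left, yet
  \<open>i_x b\<close> need not vanish. The stray term \<open>a \<union> i_x b\<close> has
  filtration one higher than its outer degree and disappears under \<open>w\<close>; likewise for
  \<open>p1 = 0\<close>.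

  The same calculus is needed for cochains on \<open>I\<close>, on the whole algebra, and on the
  quotient with coefficients in the cohomology of \<open>I\<close>. It is developed once, for an
  ideal and a module over the ambient algebra, and instantiated three times.\<close>

context abelian_group
begin

lemma minus_simps:
  assumes "a \<in> carrier G" "b \<in> carrier G" "c \<in> carrier G"
  shows "a \<oplus> (b \<ominus> c) = (a \<oplus> b) \<ominus> c"
    and "(a \<ominus> b) \<oplus> c = (a \<oplus> c) \<ominus> b"
    and "a \<ominus> (b \<ominus> c) = (a \<oplus> c) \<ominus> b"
    and "(a \<ominus> b) \<ominus> c = a \<ominus> (b \<oplus> c)"
  using assms by (simp_all add: minus_eq minus_add a_ac)

lemma minus_eq_iff:
  assumes "a \<in> carrier G" "b \<in> carrier G" "c \<in> carrier G"
  shows "a \<ominus> b = c \<longleftrightarrow> a = c \<oplus> b"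
  using assms by (metis a_minus_def add.inv_solve_right)

lemma eq_minus_iff:
  assumes "a \<in> carrier G" "b \<in> carrier G" "c \<in> carrier G"
  shows "c = a \<ominus> b \<longleftrightarrow> c \<oplus> b = a"
  using assms by (metis minus_eq_iff)

lemma minus_zero_right [simp]: "a \<in> carrier G \<Longrightarrow> a \<ominus> \<zero> = a"
  by (simp add: minus_eq_iff)

lemma minus_self [simp]: "a \<in> carrier G \<Longrightarrow> a \<ominus> a = \<zero>"
  by (simp add: minus_eq_iff)

lemma minus_add_cancel:
  "a \<in> carrier G \<Longrightarrow> b \<in> carrier G \<Longrightarrow> (a \<ominus> b) \<oplus> b = a"
  by (simp add: minus_eq a_assoc l_neg)

lemma minus_add_minus:
  assumes "a \<in> carrier G" "b \<in> carrier G" "c \<in> carrier G" "e \<in> carrier G"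
  shows "(a \<ominus> b) \<oplus> (c \<ominus> e) = (a \<oplus> c) \<ominus> (b \<oplus> e)"
  using assms by (simp add: minus_simps a_ac)

lemma a_inv_conv_minus: "a \<in> carrier G \<Longrightarrow> \<ominus> a = \<zero> \<ominus> a"
  by (simp add: minus_eq)

text \<open>
  These rules move every negative term to the other side of an equation, which decides the
  equational theory of abelian groups up to associativity and commutativity.
\<close>

lemmas ag_simps = minus_simps minus_eq_iff eq_minus_iff a_inv_conv_minus a_ac

lemma add_middle:
  "a \<in> carrier G \<Longrightarrow> b \<in> carrier G \<Longrightarrow> c \<in> carrier G \<Longrightarrow> e \<in> carrier G
    \<Longrightarrow> (a \<oplus> b) \<oplus> (c \<oplus> e) = (a \<oplus> c) \<oplus> (b \<oplus> e)"
  by (simp add: a_ac)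

lemma add_pow_minus_one: "x \<in> carrier G \<Longrightarrow> [(- 1 :: int)] \<cdot> x = \<ominus> x"
  by (simp add: add_pow_int_lt)

text \<open>Signs act as integer multiples in the additive group, so every sign identity reduces to
  a case split on parities.\<close>

lemma add_pow_sign:
  "x \<in> carrier G \<Longrightarrow> [((- 1 :: int) ^ n)] \<cdot> x = (if even n then x else \<ominus> x)"
  by (cases "even n") (simp_all add: add_pow_minus_one)

lemma finsum_a_inv:
  assumes "finite A" "f \<in> A \<rightarrow> carrier G"
  shows "(\<Oplus>i\<in>A. \<ominus> f i) = \<ominus> (\<Oplus>i\<in>A. f i)"
  using assms
proof (induction rule: finite_induct)
  case (insert x A)
  then have "f x \<in> carrier G" "f \<in> A \<rightarrow> carrier G" "finsum G f A \<in> carrier G"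
    by auto
  with insert show ?case
    by (simp add: minus_add Pi_def)
qed (simp add: minus_equality[of "\<zero>" "\<zero>"])

text \<open>Splitting off index \<open>0\<close> instead of the last one matches contraction, which
  fills the first argument.\<close>

lemma finsum_lessThan_Suc2:
  assumes "f \<in> {..<Suc n} \<rightarrow> carrier G"
  shows "(\<Oplus>i\<in>{..<Suc n}. f i) = f 0 \<oplus> (\<Oplus>i\<in>{..<n}. f (Suc i))"
proof -
  have "{..<Suc n} = insert 0 (Suc ` {..<n})"
    by (simp add: lessThan_Suc_eq_insert_0)
  moreover have "(\<Oplus>i\<in>Suc ` {..<n}. f i) = (\<Oplus>i\<in>{..<n}. f (Suc i))"
    by (rule finsum_reindex) (use assms in auto)
  moreover have "f \<in> Suc ` {..<n} \<rightarrow> carrier G" "f 0 \<in> carrier G"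
    using assms by auto
  ultimately show ?thesis
    by (simp add: finsum_insert)
qed

lemma finsum_atMost_Suc2:
  assumes "f \<in> {..Suc n} \<rightarrow> carrier G"
  shows "(\<Oplus>i\<in>{..Suc n}. f i) = f 0 \<oplus> (\<Oplus>i\<in>{..n}. f (Suc i))"
  using finsum_lessThan_Suc2[of f "Suc n"] assms by (simp add: lessThan_Suc_atMost)

text \<open>In \<open>d f (x # ys)\<close> the pairs with first index \<open>0\<close> are those
  whose bracket involves \<open>x\<close>; the others, shifted down by one, are the pairs of
  \<open>ys\<close>.\<close>

lemma finsum_pairs_Suc:
  assumes "f \<in> {(i, j). i < j \<and> j \<le> Suc n} \<rightarrow> carrier G"
  shows "(\<Oplus>ij\<in>{(i, j). i < j \<and> j \<le> Suc n}. f ij)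
      = (\<Oplus>j\<in>{..n}. f (0, Suc j)) \<oplus> (\<Oplus>ij\<in>{(i, j). i < j \<and> j \<le> n}. f (Suc (fst ij), Suc (snd ij)))"
proof -
  let ?A = "(\<lambda>j. (0, Suc j)) ` {..n}" and ?S = "{(i, j). i < j \<and> j \<le> n}"
  let ?B = "(\<lambda>ij. (Suc (fst ij), Suc (snd ij))) ` ?S"
  have fin: "finite ?S"
    by (rule finite_subset[of _ "{..n} \<times> {..n}"]) auto
  have un: "{(i, j). i < j \<and> j \<le> Suc n} = ?A \<union> ?B"
  proof (intro equalityI subsetI)
    fix ij assume "ij \<in> {(i, j). i < j \<and> j \<le> Suc n}"
    then obtain i j where ij: "ij = (i, j)" "i < j" "j \<le> Suc n" by auto
    then obtain j' where j: "j = Suc j'" by (cases j) auto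
    show "ij \<in> ?A \<union> ?B"
    proof (cases i)
      case (Suc i')
      then have "(i', j') \<in> ?S" using ij j by auto
      then show ?thesis using ij j Suc by (force simp: image_iff)
    qed (use ij j in auto)
  qed auto
  have A: "f \<in> ?A \<rightarrow> carrier G" and B: "f \<in> ?B \<rightarrow> carrier G"
    using assms un by auto
  have "?A \<inter> ?B = {}" by auto
  then have "finsum G f (?A \<union> ?B) = finsum G f ?A \<oplus> finsum G f ?B"
    using fin A B by (intro finsum_Un_disjoint) auto
  also have "finsum G f ?A = (\<Oplus>j\<in>{..n}. f (0, Suc j))"
    by (rule finsum_reindex[OF A]) (auto simp: inj_on_def)
  also have "finsum G f ?B = (\<Oplus>ij\<in>?S. f (Suc (fst ij), Suc (snd ij)))"
    by (rule finsum_reindex[OF B]) (auto simp: inj_on_def)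
  finally show ?thesis using un by simp
qed

end

section \<open>Omitting one or two arguments from a list with a new head\<close>

lemma nths_Cons_Compl_0: "nths (x # ys) (- {0}) = ys"
  by (simp add: nths_Cons) (rule nths_all, auto)

lemma nths_Cons_Compl_Suc: "nths (x # ys) (- {Suc i}) = x # nths ys (- {i})"
  by (simp add: nths_Cons Compl_eq)

lemma nths_Cons_Compl_0_Suc: "nths (x # ys) (- {0, Suc j}) = nths ys (- {j})"
  by (simp add: nths_Cons Compl_eq)

lemma nths_Cons_Compl_Suc_Suc: "nths (x # ys) (- {Suc i, Suc j}) = x # nths ys (- {i, j})"
  by (simp add: nths_Cons Compl_eq)

lemma length_nths_Compl_1: "i < length ys \<Longrightarrow> length (nths ys (- {i})) = length ys - 1"
proof (induction ys arbitrary: i)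
  case (Cons y ys)
  then show ?case by (cases i) (auto simp: nths_Cons_Compl_0 nths_Cons_Compl_Suc)
qed simp

lemma length_nths_Compl_2:
  "i < j \<Longrightarrow> j < length ys \<Longrightarrow> length (nths ys (- {i, j})) = length ys - 2"
proof (induction ys arbitrary: i j)
  case (Cons y ys)
  obtain j' where j: "j = Suc j'" using Cons.prems by (cases j) auto
  show ?case
    using Cons j
    by (cases i) (auto simp: nths_Cons_Compl_0_Suc nths_Cons_Compl_Suc_Suc length_nths_Compl_1)
qed simp

section \<open>Lie algebras and ideals\<close>

text \<open>Polarization: expand \<open>[x + y, x + y] = 0\<close>.\<close>

lemma (in lie_algebra) bracket_swap:
  assumes "x \<in> carrier L" "y \<in> carrier L"
  shows "bracket L x y = \<ominus>\<^bsub>L\<^esub> bracket L y x"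
proof -
  note [simp] = bracket_closed assms
  have "\<zero>\<^bsub>L\<^esub> = bracket L (x \<oplus>\<^bsub>L\<^esub> y) (x \<oplus>\<^bsub>L\<^esub> y)"
    by (rule bracket_self[symmetric]) simp
  also have "\<dots> = bracket L x y \<oplus>\<^bsub>L\<^esub> bracket L y x"
    by (simp add: bracket_add_left bracket_add_right bracket_self[of x] bracket_self[of y] L.M.a_comm)
  finally show ?thesis
    by (metis L.M.minus_equality assms bracket_closed)
qed

lemma (in lie_algebra) bracket_minus:
  assumes "x \<in> carrier L" "y \<in> carrier L"
  shows "bracket L (\<ominus>\<^bsub>L\<^esub> x) y = \<ominus>\<^bsub>L\<^esub> bracket L x y" "bracket L x (\<ominus>\<^bsub>L\<^esub> y) = \<ominus>\<^bsub>L\<^esub> bracket L x y"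
    "bracket L \<zero>\<^bsub>L\<^esub> y = \<zero>\<^bsub>L\<^esub>" "bracket L x \<zero>\<^bsub>L\<^esub> = \<zero>\<^bsub>L\<^esub>"
proof -
  note [simp] = bracket_closed assms
  have z: "bracket L \<zero>\<^bsub>L\<^esub> y = \<zero>\<^bsub>L\<^esub>" if "y \<in> carrier L" for y
    using bracket_add_left[of "\<zero>\<^bsub>L\<^esub>" "\<zero>\<^bsub>L\<^esub>" y] that by simp
  then show "bracket L \<zero>\<^bsub>L\<^esub> y = \<zero>\<^bsub>L\<^esub>" by simp
  have z': "bracket L x \<zero>\<^bsub>L\<^esub> = \<zero>\<^bsub>L\<^esub>"
    using bracket_add_right[of x "\<zero>\<^bsub>L\<^esub>" "\<zero>\<^bsub>L\<^esub>"] by simp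
  then show "bracket L x \<zero>\<^bsub>L\<^esub> = \<zero>\<^bsub>L\<^esub>" .
  have "bracket L (\<ominus>\<^bsub>L\<^esub> x) y \<oplus>\<^bsub>L\<^esub> bracket L x y = \<zero>\<^bsub>L\<^esub>"
    using bracket_add_left[of "\<ominus>\<^bsub>L\<^esub> x" x y] z by (simp add: L.M.l_neg)
  then show "bracket L (\<ominus>\<^bsub>L\<^esub> x) y = \<ominus>\<^bsub>L\<^esub> bracket L x y"
    by (simp add: L.M.minus_equality)
  have "bracket L x (\<ominus>\<^bsub>L\<^esub> y) \<oplus>\<^bsub>L\<^esub> bracket L x y = \<zero>\<^bsub>L\<^esub>"
    using bracket_add_right[of x "\<ominus>\<^bsub>L\<^esub> y" y] z' by (simp add: L.M.l_neg)
  then show "bracket L x (\<ominus>\<^bsub>L\<^esub> y) = \<ominus>\<^bsub>L\<^esub> bracket L x y"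
    by (simp add: L.M.minus_equality)
qed

text \<open>Since an algebra is an ideal of itself, the calculus for ideals also covers cochains on
  the whole algebra and on the quotient.\<close>

lemma (in lie_algebra) carrier_lie_ideal: "lie_ideal F L (carrier L)"
  unfolding lie_ideal_def using L.carrier_is_submodule bracket_closed by blast

lemma restrict_lie_carrier: "restrict_lie L (carrier L) = L"
  by simp

lemma (in lie_module) act_zero:
  shows "m \<in> carrier M \<Longrightarrow> act M \<zero>\<^bsub>L\<^esub> m = \<zero>\<^bsub>M\<^esub>" and "x \<in> carrier L \<Longrightarrow> act M x \<zero>\<^bsub>M\<^esub> = \<zero>\<^bsub>M\<^esub>"
proof -
  show "act M \<zero>\<^bsub>L\<^esub> m = \<zero>\<^bsub>M\<^esub>" if "m \<in> carrier M"
    using act_add_left[of "\<zero>\<^bsub>L\<^esub>" "\<zero>\<^bsub>L\<^esub>" m] that act_closed[of "\<zero>\<^bsub>L\<^esub>" m] by simp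
  show "act M x \<zero>\<^bsub>M\<^esub> = \<zero>\<^bsub>M\<^esub>" if "x \<in> carrier L"
    using act_add_right[of x "\<zero>\<^bsub>M\<^esub>" "\<zero>\<^bsub>M\<^esub>"] that act_closed[of x "\<zero>\<^bsub>M\<^esub>"] by simp
qed

lemma (in module) submoduleD:
  assumes "submodule H R M"
  shows "H \<subseteq> carrier M" "\<zero>\<^bsub>M\<^esub> \<in> H" "x \<in> H \<Longrightarrow> \<ominus>\<^bsub>M\<^esub> x \<in> H" "x \<in> H \<Longrightarrow> y \<in> H \<Longrightarrow> x \<oplus>\<^bsub>M\<^esub> y \<in> H"
    "a \<in> carrier R \<Longrightarrow> x \<in> H \<Longrightarrow> a \<odot>\<^bsub>M\<^esub> x \<in> H" "x \<in> H \<Longrightarrow> y \<in> H \<Longrightarrow> x \<ominus>\<^bsub>M\<^esub> y \<in> H"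
  using submoduleE[OF assms] submodule.axioms(1)[OF assms] subgroup.one_closed[of H "add_monoid M"]
  by (auto simp: a_minus_def)

text \<open>The interior product \<open>i_x\<close>. The number \<open>n\<close> is the degree of
  the result, so \<open>f\<close> has degree \<open>Suc n\<close>. In degree \<open>0\<close> there
  is no contraction, which is why later arguments treat that degree separately.\<close>

definition contract :: "('f, 'g) lie \<Rightarrow> nat \<Rightarrow> 'g \<Rightarrow> ('g list \<Rightarrow> 'm) \<Rightarrow> 'g list \<Rightarrow> 'm" where
  "contract L n x f = (\<lambda>ys\<in>tuples L n. f (x # ys))"

text \<open>Cochains live on \<open>I\<close>, but \<open>M\<close> is a module over all of
  \<open>L\<close>, and \<theta>_x is studied for every \<open>x \<in> carrier L\<close>: the action
  of the quotient on the cohomology of \<open>I\<close> comes from elements outside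
  \<open>I\<close>.\<close>

locale ideal_coeff = lie_module F L M
  for F :: "'f ring" and L :: "('f, 'g) lie" and M :: "('f, 'g, 'm) lmod" +
  fixes I :: "'g set"
  assumes ideal: "lie_ideal F L I"
begin

abbreviation "R \<equiv> restrict_lie L I"
abbreviation "C \<equiv> cochains F R M"
abbreviation "\<theta> \<equiv> theta R M"
abbreviation "d \<equiv> ce_diff R M"
abbreviation "\<iota> \<equiv> contract R"

lemma I_submodule: "submodule I F L"
  using ideal by (simp add: lie_ideal_def)

lemmas I_facts = L.submoduleD[OF I_submodule]

lemma I_carrier [simp, intro]: "x \<in> I \<Longrightarrow> x \<in> carrier L"
  using I_facts by auto

lemma I_closed [simp, intro]:
  "\<zero>\<^bsub>L\<^esub> \<in> I" "x \<in> I \<Longrightarrow> \<ominus>\<^bsub>L\<^esub> x \<in> I" "x \<in> I \<Longrightarrow> y \<in> I \<Longrightarrow> x \<oplus>\<^bsub>L\<^esub> y \<in> I"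
  "a \<in> carrier F \<Longrightarrow> x \<in> I \<Longrightarrow> a \<odot>\<^bsub>L\<^esub> x \<in> I" "x \<in> I \<Longrightarrow> y \<in> I \<Longrightarrow> x \<ominus>\<^bsub>L\<^esub> y \<in> I"
  using I_facts by auto

lemma I_bracket [simp, intro]:
  "x \<in> carrier L \<Longrightarrow> y \<in> I \<Longrightarrow> bracket L x y \<in> I"
  "x \<in> carrier L \<Longrightarrow> y \<in> I \<Longrightarrow> bracket L y x \<in> I"
proof -
  show *: "bracket L x y \<in> I" if "x \<in> carrier L" "y \<in> I" for x y
    using ideal that by (auto simp: lie_ideal_def)
  show "bracket L y x \<in> I" if "x \<in> carrier L" "y \<in> I"
    using *[OF that] that bracket_swap[of y x] by simp
qed

declare bracket_closed [simp, intro] act_closed [simp, intro]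

lemma tuples_0: "tuples R 0 = {[]}"
  by (auto simp: tuples_def)

lemma Nil_tuples [simp]: "[] \<in> tuples R n \<longleftrightarrow> n = 0"
  by (auto simp: tuples_def)

lemma Cons_tuples [simp]: "x # xs \<in> tuples R (Suc n) \<longleftrightarrow> x \<in> I \<and> xs \<in> tuples R n"
  by (auto simp: tuples_def)

lemma tuples_SucE:
  assumes "xs \<in> tuples R (Suc n)"
  obtains y ys where "xs = y # ys" "y \<in> I" "ys \<in> tuples R n"
  using assms by (cases xs) (auto simp: tuples_def)

lemma tuples_update: "xs \<in> tuples R n \<Longrightarrow> x \<in> I \<Longrightarrow> xs[i := x] \<in> tuples R n"
  using set_update_subset_insert[of xs i x] by (auto simp: tuples_def)

lemma tuples_nth: "xs \<in> tuples R n \<Longrightarrow> i < n \<Longrightarrow> xs ! i \<in> I"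
  by (auto simp: tuples_def)

lemma tuples_nths_1: "xs \<in> tuples R (Suc n) \<Longrightarrow> i \<le> n \<Longrightarrow> nths xs (- {i}) \<in> tuples R n"
  using set_nths_subset[of xs "-{i}"] by (auto simp: tuples_def length_nths_Compl_1)

lemma tuples_nths_2:
  "xs \<in> tuples R (Suc (Suc n)) \<Longrightarrow> i < j \<Longrightarrow> j \<le> Suc n \<Longrightarrow> nths xs (- {i, j}) \<in> tuples R n"
  using set_nths_subset[of xs "-{i,j}"] by (auto simp: tuples_def length_nths_Compl_2)

section \<open>The module of cochains\<close>

lemma C_carrier:
  "carrier (C n) = {f \<in> tuples R n \<rightarrow>\<^sub>E carrier M.
        (\<forall>xs\<in>tuples R n. \<forall>i<n. \<forall>x\<in>I. \<forall>y\<in>I.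
           f (xs[i := x \<oplus>\<^bsub>L\<^esub> y]) = f (xs[i := x]) \<oplus>\<^bsub>M\<^esub> f (xs[i := y])) \<and>
        (\<forall>xs\<in>tuples R n. \<forall>i<n. \<forall>a\<in>carrier F. \<forall>x\<in>I.
           f (xs[i := a \<odot>\<^bsub>L\<^esub> x]) = a \<odot>\<^bsub>M\<^esub> f (xs[i := x])) \<and>
        (\<forall>xs\<in>tuples R n. \<not> distinct xs \<longrightarrow> f xs = \<zero>\<^bsub>M\<^esub>)}"
  by (simp add: cochains_def)

lemma C_simps:
  "\<zero>\<^bsub>C n\<^esub> = (\<lambda>xs\<in>tuples R n. \<zero>\<^bsub>M\<^esub>)"
  "f \<oplus>\<^bsub>C n\<^esub> g = (\<lambda>xs\<in>tuples R n. f xs \<oplus>\<^bsub>M\<^esub> g xs)"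
  "a \<odot>\<^bsub>C n\<^esub> f = (\<lambda>xs\<in>tuples R n. a \<odot>\<^bsub>M\<^esub> f xs)"
  by (simp_all add: cochains_def)

lemma C_closed [simp, intro]: "f \<in> carrier (C n) \<Longrightarrow> xs \<in> tuples R n \<Longrightarrow> f xs \<in> carrier M"
  unfolding C_carrier by blast

lemma C_multi_add:
  "f \<in> carrier (C n) \<Longrightarrow> xs \<in> tuples R n \<Longrightarrow> i < n \<Longrightarrow> x \<in> I \<Longrightarrow> y \<in> I
    \<Longrightarrow> f (xs[i := x \<oplus>\<^bsub>L\<^esub> y]) = f (xs[i := x]) \<oplus>\<^bsub>M\<^esub> f (xs[i := y])"
  unfolding C_carrier by blast

lemma C_multi_smult:
  "f \<in> carrier (C n) \<Longrightarrow> xs \<in> tuples R n \<Longrightarrow> i < n \<Longrightarrow> a \<in> carrier F \<Longrightarrow> x \<in> I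
    \<Longrightarrow> f (xs[i := a \<odot>\<^bsub>L\<^esub> x]) = a \<odot>\<^bsub>M\<^esub> f (xs[i := x])"
  unfolding C_carrier by blast

lemma C_alternating:
  "f \<in> carrier (C n) \<Longrightarrow> xs \<in> tuples R n \<Longrightarrow> \<not> distinct xs \<Longrightarrow> f xs = \<zero>\<^bsub>M\<^esub>"
  unfolding C_carrier by blast

lemmas C_multi = C_multi_add C_multi_smult C_alternating

lemma C_I:
  assumes "f \<in> extensional (tuples R n)" "\<And>xs. xs \<in> tuples R n \<Longrightarrow> f xs \<in> carrier M"
    and "\<And>xs i x y. xs \<in> tuples R n \<Longrightarrow> i < n \<Longrightarrow> x \<in> I \<Longrightarrow> y \<in> I
      \<Longrightarrow> f (xs[i := x \<oplus>\<^bsub>L\<^esub> y]) = f (xs[i := x]) \<oplus>\<^bsub>M\<^esub> f (xs[i := y])"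
    and "\<And>xs i a x. xs \<in> tuples R n \<Longrightarrow> i < n \<Longrightarrow> a \<in> carrier F \<Longrightarrow> x \<in> I
      \<Longrightarrow> f (xs[i := a \<odot>\<^bsub>L\<^esub> x]) = a \<odot>\<^bsub>M\<^esub> f (xs[i := x])"
    and "\<And>xs. xs \<in> tuples R n \<Longrightarrow> \<not> distinct xs \<Longrightarrow> f xs = \<zero>\<^bsub>M\<^esub>"
  shows "f \<in> carrier (C n)"
  unfolding C_carrier PiE_def
  by (intro CollectI conjI ballI allI impI IntI Pi_I) (rule assms; assumption)+

lemma C_0I: "f \<in> extensional (tuples R 0) \<Longrightarrow> f [] \<in> carrier M \<Longrightarrow> f \<in> carrier (C 0)"
  by (rule C_I) (auto simp: tuples_0)

lemma C_ext: "f \<in> carrier (C n) \<Longrightarrow> f \<in> extensional (tuples R n)"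
  unfolding C_carrier PiE_def by blast

lemma C_add_mem:
  assumes "f \<in> carrier (C n)" "g \<in> carrier (C n)"
  shows "f \<oplus>\<^bsub>C n\<^esub> g \<in> carrier (C n)"
proof (rule C_I)
  note [simp] = C_multi[OF assms(1)] C_multi[OF assms(2)] C_closed[OF assms(1)] C_closed[OF assms(2)]
  show "(f \<oplus>\<^bsub>C n\<^esub> g) (xs[i := x \<oplus>\<^bsub>L\<^esub> y]) = (f \<oplus>\<^bsub>C n\<^esub> g) (xs[i := x]) \<oplus>\<^bsub>M\<^esub> (f \<oplus>\<^bsub>C n\<^esub> g) (xs[i := y])"
    if "xs \<in> tuples R n" "i < n" "x \<in> I" "y \<in> I" for xs i x y
    using that by (simp add: C_simps tuples_update M.add_middle)
qed (use assms in \<open>simp_all add: C_simps tuples_update M.smult_r_distr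
  C_multi[OF assms(1)] C_multi[OF assms(2)] C_closed[OF assms(1)] C_closed[OF assms(2)]\<close>)

lemma C_smult_mem:
  assumes "f \<in> carrier (C n)" "a \<in> carrier F"
  shows "a \<odot>\<^bsub>C n\<^esub> f \<in> carrier (C n)"
proof (rule C_I)
  note [simp] = C_multi[OF assms(1)] C_closed[OF assms(1)]
  show "(a \<odot>\<^bsub>C n\<^esub> f) (xs[i := b \<odot>\<^bsub>L\<^esub> x]) = b \<odot>\<^bsub>M\<^esub> (a \<odot>\<^bsub>C n\<^esub> f) (xs[i := x])"
    if "xs \<in> tuples R n" "i < n" "b \<in> carrier F" "x \<in> I" for xs i b x
    using that assms(2) by (simp add: C_simps tuples_update M.smult_assoc1[symmetric] F.m_comm)
qed (use assms in \<open>simp_all add: C_simps tuples_update M.smult_r_distr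
  C_multi[OF assms(1)] C_closed[OF assms(1)]\<close>)

lemma C_module: "module F (C n)"
proof (rule moduleI)
  show "cring F" by (rule F.is_cring)
  show "abelian_group (C n)"
  proof (rule abelian_groupI)
    fix f assume f: "f \<in> carrier (C n)"
    have "(\<lambda>xs\<in>tuples R n. \<ominus>\<^bsub>M\<^esub> f xs) \<in> carrier (C n)"
      using f C_multi[OF f] C_closed[OF f]
      by (intro C_I) (auto simp: tuples_update M.smult_r_minus M.minus_add)
    moreover have "(\<lambda>xs\<in>tuples R n. \<ominus>\<^bsub>M\<^esub> f xs) \<oplus>\<^bsub>C n\<^esub> f = \<zero>\<^bsub>C n\<^esub>"
      using f by (auto simp: C_simps M.l_neg intro!: restrict_ext)
    ultimately show "\<exists>g\<in>carrier (C n). g \<oplus>\<^bsub>C n\<^esub> f = \<zero>\<^bsub>C n\<^esub>" by blast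
    show "\<zero>\<^bsub>C n\<^esub> \<oplus>\<^bsub>C n\<^esub> f = f"
      using f C_ext[OF f] by (auto simp: C_simps extensional_def fun_eq_iff)
  next
    show "\<zero>\<^bsub>C n\<^esub> \<in> carrier (C n)"
      by (auto simp: C_carrier C_simps tuples_update)
    qed (rule C_add_mem, auto simp: C_simps M.a_ac intro!: restrict_ext)
next
  fix f assume f: "f \<in> carrier (C n)"
  show "\<one>\<^bsub>F\<^esub> \<odot>\<^bsub>C n\<^esub> f = f"
    using f C_ext[OF f] by (auto simp: C_simps extensional_def fun_eq_iff)
qed (rule C_smult_mem, auto simp: C_simps M.smult_l_distr M.smult_r_distr M.smult_assoc1 intro!:
  restrict_ext)

sublocale C: module F "C n" for n
  by (rule C_module)

lemma C_minus_eval: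
  assumes "f \<in> carrier (C n)" "xs \<in> tuples R n"
  shows "(\<ominus>\<^bsub>C n\<^esub> f) xs = \<ominus>\<^bsub>M\<^esub> f xs"
proof -
  have "\<ominus>\<^bsub>C n\<^esub> f \<oplus>\<^bsub>C n\<^esub> f = \<zero>\<^bsub>C n\<^esub>" using assms by (simp add: C.l_neg)
  then have "(\<ominus>\<^bsub>C n\<^esub> f) xs \<oplus>\<^bsub>M\<^esub> f xs = \<zero>\<^bsub>M\<^esub>"
    using assms(2) by (auto simp: C_simps fun_eq_iff restrict_def split: if_splits)
  then show ?thesis using assms by (metis C.a_inv_closed C_closed M.minus_equality)
qed

lemma C_eval:
  assumes "xs \<in> tuples R n"
  shows "\<zero>\<^bsub>C n\<^esub> xs = \<zero>\<^bsub>M\<^esub>" "(f \<oplus>\<^bsub>C n\<^esub> g) xs = f xs \<oplus>\<^bsub>M\<^esub> g xs" "(a \<odot>\<^bsub>C n\<^esub> f) xs = a \<odot>\<^bsub>M\<^esub> f xs"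
    "f \<in> carrier (C n) \<Longrightarrow> (\<ominus>\<^bsub>C n\<^esub> f) xs = \<ominus>\<^bsub>M\<^esub> f xs"
    "g \<in> carrier (C n) \<Longrightarrow> (f \<ominus>\<^bsub>C n\<^esub> g) xs = f xs \<ominus>\<^bsub>M\<^esub> g xs"
  using assms by (simp_all add: C_simps C_minus_eval a_minus_def)

lemma C_sign_eval:
  "f \<in> carrier (C n) \<Longrightarrow> xs \<in> tuples R n \<Longrightarrow> ([((- 1 :: int) ^ k)] \<cdot>\<^bsub>C n\<^esub> f) xs
    = [((- 1 :: int) ^ k)] \<cdot>\<^bsub>M\<^esub> f xs"
  by (simp only: C.add_pow_sign M.add_pow_sign C_closed) (simp add: C_eval)

lemma C_eqI:
  assumes "f \<in> carrier (C n)" "g \<in> carrier (C n)" "\<And>xs. xs \<in> tuples R n \<Longrightarrow> f xs = g xs"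
  shows "f = g"
  using assms C_ext by (meson extensionalityI)

section \<open>Contractions\<close>

lemma contract_apply [simp]: "ys \<in> tuples R n \<Longrightarrow> \<iota> n x f ys = f (x # ys)"
  by (simp add: contract_def)

lemma contract_closed [simp, intro]:
  assumes "f \<in> carrier (C (Suc n))" "x \<in> I"
  shows "\<iota> n x f \<in> carrier (C n)"
proof (rule C_I)
  have upd: "f (x # xs[i := z]) = f ((x # xs)[Suc i := z])" for xs i z by simp
  note [simp] = C_multi[OF assms(1)] C_closed[OF assms(1)]
  show "\<iota> n x f (xs[i := y \<oplus>\<^bsub>L\<^esub> z]) = \<iota> n x f (xs[i := y]) \<oplus>\<^bsub>M\<^esub> \<iota> n x f (xs[i := z])"
    if "xs \<in> tuples R n" "i < n" "y \<in> I" "z \<in> I" for xs i y z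
    using that assms(2) by (simp add: contract_def tuples_update upd del: list_update.simps)
  show "\<iota> n x f (xs[i := a \<odot>\<^bsub>L\<^esub> y]) = a \<odot>\<^bsub>M\<^esub> \<iota> n x f (xs[i := y])"
    if "xs \<in> tuples R n" "i < n" "a \<in> carrier F" "y \<in> I" for xs i a y
    using that assms(2) by (simp add: contract_def tuples_update upd del: list_update.simps)
qed (use assms C_alternating[OF assms(1)] in \<open>auto simp: contract_def\<close>)

text \<open>Every nonempty tuple has a head, so a function on such tuples is recovered from its
  contractions. This is the extensionality principle behind all inductions on the degree.\<close>

lemma contract_ext:
  assumes "f \<in> extensional (tuples R (Suc n))" "g \<in> extensional (tuples R (Suc n))"
    and "\<And>x. x \<in> I \<Longrightarrow> \<iota> n x f = \<iota> n x g"
  shows "f = g"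
proof (rule extensionalityI[OF assms(1,2)])
  fix xs assume "xs \<in> tuples R (Suc n)"
  then obtain y ys where "xs = y # ys" "y \<in> I" "ys \<in> tuples R n" by (rule tuples_SucE)
  then show "f xs = g xs" using assms(3)[of y] by (metis contract_apply)
qed

lemma contract_eqI:
  assumes "f \<in> carrier (C (Suc n))" "g \<in> carrier (C (Suc n))"
    and "\<And>x. x \<in> I \<Longrightarrow> \<iota> n x f = \<iota> n x g"
  shows "f = g"
  using contract_ext[OF C_ext C_ext] assms by blast

lemma contract_add: "\<iota> n x (f \<oplus>\<^bsub>C (Suc n)\<^esub> g) = \<iota> n x f \<oplus>\<^bsub>C n\<^esub> \<iota> n x g" if "x \<in> I"
  using that by (auto simp: contract_def C_simps intro!: restrict_ext)

lemma contract_smult: "\<iota> n x (a \<odot>\<^bsub>C (Suc n)\<^esub> f) = a \<odot>\<^bsub>C n\<^esub> \<iota> n x f" if "x \<in> I"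
  using that by (auto simp: contract_def C_simps intro!: restrict_ext)

lemma contract_zero: "\<iota> n x \<zero>\<^bsub>C (Suc n)\<^esub> = \<zero>\<^bsub>C n\<^esub>" if "x \<in> I"
  using that by (auto simp: contract_def C_simps intro!: restrict_ext)

lemma contract_minus:
  assumes "x \<in> I" "g \<in> carrier (C (Suc n))"
  shows "\<iota> n x (\<ominus>\<^bsub>C (Suc n)\<^esub> g) = \<ominus>\<^bsub>C n\<^esub> \<iota> n x g"
  by (rule C_eqI[of _ n]) (use assms in \<open>auto simp: C_minus_eval\<close>)

lemma contract_diff:
  assumes "x \<in> I" "g \<in> carrier (C (Suc n))"
  shows "\<iota> n x (f \<ominus>\<^bsub>C (Suc n)\<^esub> g) = \<iota> n x f \<ominus>\<^bsub>C n\<^esub> \<iota> n x g"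
  using assms by (simp add: a_minus_def contract_add contract_minus)

lemma contract_add_left:
  assumes "f \<in> carrier (C (Suc n))" "x \<in> I" "y \<in> I"
  shows "\<iota> n (x \<oplus>\<^bsub>L\<^esub> y) f = \<iota> n x f \<oplus>\<^bsub>C n\<^esub> \<iota> n y f"
proof (rule C_eqI[of _ n])
  fix xs assume xs: "xs \<in> tuples R n"
  then have "x # xs \<in> tuples R (Suc n)" using assms by simp
  then have "f ((x # xs)[0 := x \<oplus>\<^bsub>L\<^esub> y]) = f ((x # xs)[0 := x]) \<oplus>\<^bsub>M\<^esub> f ((x # xs)[0 := y])"
    using assms by (intro C_multi_add) auto
  then show "\<iota> n (x \<oplus>\<^bsub>L\<^esub> y) f xs = (\<iota> n x f \<oplus>\<^bsub>C n\<^esub> \<iota> n y f) xs"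
    using xs by (simp add: C_eval)
qed (use assms in auto)

lemma contract_smult_left:
  assumes "f \<in> carrier (C (Suc n))" "x \<in> I" "a \<in> carrier F"
  shows "\<iota> n (a \<odot>\<^bsub>L\<^esub> x) f = a \<odot>\<^bsub>C n\<^esub> \<iota> n x f"
proof (rule C_eqI[of _ n])
  fix xs assume xs: "xs \<in> tuples R n"
  then have "x # xs \<in> tuples R (Suc n)" using assms by simp
  then have "f ((x # xs)[0 := a \<odot>\<^bsub>L\<^esub> x]) = a \<odot>\<^bsub>M\<^esub> f ((x # xs)[0 := x])"
    using assms by (intro C_multi_smult) auto
  then show "\<iota> n (a \<odot>\<^bsub>L\<^esub> x) f xs = (a \<odot>\<^bsub>C n\<^esub> \<iota> n x f) xs"
    using xs by (simp add: C_eval)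
qed (use assms in auto)

lemma contract_zero_left:
  assumes "f \<in> carrier (C (Suc n))"
  shows "\<iota> n \<zero>\<^bsub>L\<^esub> f = \<zero>\<^bsub>C n\<^esub>"
  using contract_add_left[OF assms, of "\<zero>\<^bsub>L\<^esub>" "\<zero>\<^bsub>L\<^esub>"] contract_closed[OF assms, of "\<zero>\<^bsub>L\<^esub>"] by simp

lemma contract_minus_left:
  assumes "f \<in> carrier (C (Suc n))" "x \<in> I"
  shows "\<iota> n (\<ominus>\<^bsub>L\<^esub> x) f = \<ominus>\<^bsub>C n\<^esub> \<iota> n x f"
proof -
  have "\<iota> n (\<ominus>\<^bsub>L\<^esub> x) f \<oplus>\<^bsub>C n\<^esub> \<iota> n x f = \<zero>\<^bsub>C n\<^esub>"
    using contract_add_left[OF assms(1), of "\<ominus>\<^bsub>L\<^esub> x" x] assms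
    by (simp add: contract_zero_left L.M.l_neg)
  then show ?thesis using assms by (metis C.minus_equality I_closed(2) contract_closed)
qed

lemma contract_diff_left:
  assumes "f \<in> carrier (C (Suc n))" "x \<in> I" "y \<in> I"
  shows "\<iota> n (x \<ominus>\<^bsub>L\<^esub> y) f = \<iota> n x f \<ominus>\<^bsub>C n\<^esub> \<iota> n y f"
  using assms by (simp add: a_minus_def contract_add_left contract_minus_left)

lemma contract_self:
  assumes "f \<in> carrier (C (Suc (Suc n)))" "x \<in> I"
  shows "\<iota> n x (\<iota> (Suc n) x f) = \<zero>\<^bsub>C n\<^esub>"
proof (rule C_eqI[of _ n])
  fix xs assume "xs \<in> tuples R n"
  moreover from this have "x # x # xs \<in> tuples R (Suc (Suc n))" using assms by simp
  then have "f (x # x # xs) = \<zero>\<^bsub>M\<^esub>" using C_alternating[OF assms(1)] by auto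
  ultimately show "\<iota> n x (\<iota> (Suc n) x f) xs = \<zero>\<^bsub>C n\<^esub> xs"
    using assms by (simp add: C_eval)
qed (use assms in auto)

text \<open>Polarization of \<open>contract_self\<close> in the contracting element.\<close>

lemma contract_swap:
  assumes "f \<in> carrier (C (Suc (Suc n)))" "x \<in> I" "y \<in> I"
  shows "\<iota> n x (\<iota> (Suc n) y f) = \<ominus>\<^bsub>C n\<^esub> \<iota> n y (\<iota> (Suc n) x f)"
proof -
  have "\<zero>\<^bsub>C n\<^esub> = \<iota> n (x \<oplus>\<^bsub>L\<^esub> y) (\<iota> (Suc n) (x \<oplus>\<^bsub>L\<^esub> y) f)"
    using assms contract_self by simp
  also have "\<dots> = \<iota> n x (\<iota> (Suc n) y f) \<oplus>\<^bsub>C n\<^esub> \<iota> n y (\<iota> (Suc n) x f)"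
    using assms by (simp add: contract_add_left contract_add contract_self C.a_comm)
  finally show ?thesis using assms by (metis C.minus_equality contract_closed)
qed

text \<open>The counterpart of \<open>contract_eqI\<close> for membership: operators known only
  through a recursion on contractions are shown to have cochains as values. Alternation has to be
  tested on the first two arguments only. A repetition in the tail is seen by one contraction, and a
  later repetition of the head moves behind a new head after one swap.\<close>

lemma C_SucI:
  assumes ext: "f \<in> extensional (tuples R (Suc n))"
    and closed: "\<And>x. x \<in> I \<Longrightarrow> \<iota> n x f \<in> carrier (C n)"
    and add: "\<And>x y. x \<in> I \<Longrightarrow> y \<in> I \<Longrightarrow> \<iota> n (x \<oplus>\<^bsub>L\<^esub> y) f = \<iota> n x f \<oplus>\<^bsub>C n\<^esub> \<iota> n y f"
    and smult: "\<And>a x. a \<in> carrier F \<Longrightarrow> x \<in> I \<Longrightarrow> \<iota> n (a \<odot>\<^bsub>L\<^esub> x) f = a \<odot>\<^bsub>C n\<^esub> \<iota> n x f"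
    and alt: "\<And>m x. n = Suc m \<Longrightarrow> x \<in> I \<Longrightarrow> \<iota> m x (\<iota> n x f) = \<zero>\<^bsub>C m\<^esub>"
  shows "f \<in> carrier (C (Suc n))"
proof -
  have f: "f (y # ys) = \<iota> n y f ys" if "ys \<in> tuples R n" for y ys
    using that by simp
  \<comment> \<open>Polarization of \<open>alt\<close>. The rule \<open>contract_swap\<close> does
    not apply, since \<open>f\<close> is not yet known to be a cochain.\<close>
  have swap: "\<iota> m x (\<iota> n y f) = \<ominus>\<^bsub>C m\<^esub> \<iota> m y (\<iota> n x f)" if "n = Suc m" "x \<in> I" "y \<in> I" for m x y
  proof -
    have cl: "\<iota> n z f \<in> carrier (C (Suc m))" if "z \<in> I" for z using closed that \<open>n = Suc m\<close> by simp
    have alt': "\<iota> m z (\<iota> (Suc m) z f) = \<zero>\<^bsub>C m\<^esub>" if "z \<in> I" for z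
      using alt[OF \<open>n = Suc m\<close> that] \<open>n = Suc m\<close> by simp
    have "\<zero>\<^bsub>C m\<^esub> = \<iota> m (x \<oplus>\<^bsub>L\<^esub> y) (\<iota> n (x \<oplus>\<^bsub>L\<^esub> y) f)"
      using that alt by simp
    also have "\<dots> = \<iota> m x (\<iota> n y f) \<oplus>\<^bsub>C m\<^esub> \<iota> m y (\<iota> n x f)"
      using that add[of x y] cl alt' by (simp add: contract_add_left contract_add C.a_comm)
    finally show ?thesis using that cl by (metis C.minus_equality contract_closed)
  qed
  show ?thesis
    unfolding C_carrier
  proof (intro CollectI conjI ballI allI impI)
    have "f xs \<in> carrier M" if xs: "xs \<in> tuples R (Suc n)" for xs
    proof -
      obtain y ys where "xs = y # ys" "y \<in> I" "ys \<in> tuples R n" using xs by (rule tuples_SucE)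
      then show ?thesis using C_closed[OF closed, of y ys] by simp
    qed
    then show "f \<in> tuples R (Suc n) \<rightarrow>\<^sub>E carrier M"
      using ext by (simp add: PiE_def)
  next
    fix xs i x y assume *: "xs \<in> tuples R (Suc n)" "i < Suc n" "x \<in> I" "y \<in> I"
    then obtain z zs where xs: "xs = z # zs" "z \<in> I" "zs \<in> tuples R n" by (auto elim: tuples_SucE)
    show "f (xs[i := x \<oplus>\<^bsub>L\<^esub> y]) = f (xs[i := x]) \<oplus>\<^bsub>M\<^esub> f (xs[i := y])"
    proof (cases i)
      case 0
      then show ?thesis using add[of x y] xs * by (simp add: f C_eval del: contract_apply)
    next
      case (Suc j)
      then show ?thesis
        using C_multi[OF closed[OF xs(2)]] xs * by (simp add: f tuples_update del: contract_apply)
    qed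
  next
    fix xs i a x assume *: "xs \<in> tuples R (Suc n)" "i < Suc n" "x \<in> I" "a \<in> carrier F"
    then obtain z zs where xs: "xs = z # zs" "z \<in> I" "zs \<in> tuples R n" by (auto elim: tuples_SucE)
    show "f (xs[i := a \<odot>\<^bsub>L\<^esub> x]) = a \<odot>\<^bsub>M\<^esub> f (xs[i := x])"
    proof (cases i)
      case 0
      then show ?thesis using smult[of a x] xs * by (simp add: f C_eval del: contract_apply)
    next
      case (Suc j)
      then show ?thesis
        using C_multi[OF closed[OF xs(2)]] xs * by (simp add: f tuples_update del: contract_apply)
    qed
  next
    fix xs assume *: "xs \<in> tuples R (Suc n)" "\<not> distinct xs"
    then obtain z zs where xs: "xs = z # zs" "z \<in> I" "zs \<in> tuples R n" by (auto elim: tuples_SucE)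
    show "f xs = \<zero>\<^bsub>M\<^esub>"
    proof (cases "distinct zs")
      case False
      then show ?thesis using C_multi[OF closed[OF xs(2)]] xs by (simp add: f del: contract_apply)
    next
      case True
      then have z: "z \<in> set zs" using * xs by simp
      then obtain m where n: "n = Suc m" using xs by (cases n) (auto simp: tuples_def)
      with xs obtain y ys where zs: "zs = y # ys" "y \<in> I" "ys \<in> tuples R m" by (auto elim: tuples_SucE)
      have cl: "\<iota> n y f \<in> carrier (C (Suc m))" using closed zs n by simp
      have ev: "\<iota> m z (\<iota> n y f) ys = f (y # z # ys)" using zs xs n by simp
      show ?thesis
      proof (cases "z = y")
        case True
        then have "\<iota> m z (\<iota> n y f) = \<zero>\<^bsub>C m\<^esub>" using alt n zs by simp
        then show ?thesis using xs zs True ev by (simp add: C_eval)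
      next
        case False
        \<comment> \<open>After the swap both copies of \<open>z\<close> stand behind
          \<open>y\<close>, where \<open>\<iota> n y f\<close> is already alternating.\<close>
        then have "\<not> distinct (z # ys)" using z zs by auto
        moreover have "z # ys \<in> tuples R (Suc m)" using xs zs by simp
        ultimately have "\<iota> n y f (z # ys) = \<zero>\<^bsub>M\<^esub>" using C_alternating[OF cl] by blast
        then have "f (y # z # ys) = \<zero>\<^bsub>M\<^esub>" using ev zs xs n by simp
        moreover have "f xs = \<iota> m y (\<iota> n z f) ys" using xs zs n by simp
        moreover have "\<iota> m y (\<iota> n z f) ys = \<ominus>\<^bsub>M\<^esub> \<iota> m z (\<iota> n y f) ys"
          unfolding swap[OF n zs(2) xs(2)] by (rule C_minus_eval) (use xs zs cl in auto)
        moreover have "\<ominus>\<^bsub>M\<^esub> \<zero>\<^bsub>M\<^esub> = \<zero>\<^bsub>M\<^esub>" by (simp add: M.minus_equality)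
        ultimately show ?thesis using ev by simp
      qed
    qed
  qed
qed

end

section \<open>The operators theta and the differential\<close>

context ideal_coeff
begin

lemma theta_ext: "\<theta> n x f \<in> extensional (tuples R n)"
  by (simp add: theta_def)

lemma d_ext: "d n f \<in> extensional (tuples R (Suc n))"
  by (simp add: ce_diff_def)

lemma theta_apply:
  "xs \<in> tuples R n \<Longrightarrow> \<theta> n x f xs
    = act M x (f xs) \<ominus>\<^bsub>M\<^esub> (\<Oplus>\<^bsub>M\<^esub>j\<in>{..<n}. f (xs[j := bracket L x (xs ! j)]))"
  by (simp add: theta_def)

lemma theta_summand [simp, intro]:
  "f \<in> carrier (C n) \<Longrightarrow> xs \<in> tuples R n \<Longrightarrow> x \<in> carrier L \<Longrightarrow> j < n
    \<Longrightarrow> f (xs[j := bracket L x (xs ! j)]) \<in> carrier M"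
  by (intro C_closed tuples_update I_bracket tuples_nth)

lemma theta_0:
  assumes "f \<in> carrier (C 0)" "x \<in> carrier L"
  shows "\<theta> 0 x f = (\<lambda>xs\<in>tuples R 0. act M x (f xs))"
  using assms by (auto simp: theta_def a_minus_def intro!: restrict_ext) 

text \<open>The summand of slot \<open>0\<close> replaces \<open>z\<close> by \<open>[x,z]\<close>;
  the others form the sum in \<theta>_x of \<open>\<iota> n z f\<close>. Evaluating the difference
  only requires the subtracted function to be a cochain, so the rule is available before
  \<open>theta_closed\<close>.\<close>

lemma contract_theta:
  assumes "f \<in> carrier (C (Suc n))" "x \<in> carrier L" "z \<in> I"
  shows "\<iota> n z (\<theta> (Suc n) x f) = \<theta> n x (\<iota> n z f) \<ominus>\<^bsub>C n\<^esub> \<iota> n (bracket L x z) f"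
proof (rule extensionalityI[where A = "tuples R n"])
  fix ys assume ys: "ys \<in> tuples R n"
  have zys: "z # ys \<in> tuples R (Suc n)" using ys assms by simp
  let ?f = "\<lambda>j. f ((z # ys)[j := bracket L x ((z # ys) ! j)])"
  have cl: "?f j \<in> carrier M" if "j < Suc n" for j
    using theta_summand[OF assms(1) zys assms(2) that] .
  define S where "S = (\<Oplus>\<^bsub>M\<^esub>j\<in>{..<n}. \<iota> n z f (ys[j := bracket L x (ys ! j)]))"
  have S: "S \<in> carrier M"
    unfolding S_def using ys assms by (intro M.finsum_closed) auto
  have "(\<Oplus>\<^bsub>M\<^esub>j\<in>{..<Suc n}. ?f j) = ?f 0 \<oplus>\<^bsub>M\<^esub> (\<Oplus>\<^bsub>M\<^esub>j\<in>{..<n}. ?f (Suc j))"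
    using cl by (intro M.finsum_lessThan_Suc2) auto
  moreover have "(\<Oplus>\<^bsub>M\<^esub>j\<in>{..<n}. ?f (Suc j)) = S"
    unfolding S_def using ys assms
    by (intro M.finsum_cong') (auto simp: tuples_update tuples_nth)
  ultimately have sum: "(\<Oplus>\<^bsub>M\<^esub>j\<in>{..<Suc n}. ?f j) = ?f 0 \<oplus>\<^bsub>M\<^esub> S" by simp
  have 1: "\<theta> (Suc n) x f (z # ys) = act M x (f (z # ys)) \<ominus>\<^bsub>M\<^esub> (f (bracket L x z # ys) \<oplus>\<^bsub>M\<^esub> S)"
    unfolding theta_apply[OF zys] sum by simp
  have 2: "(\<theta> n x (\<iota> n z f) \<ominus>\<^bsub>C n\<^esub> \<iota> n (bracket L x z) f) ys = act M x (f (z # ys)) \<ominus>\<^bsub>M\<^esub> S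
    \<ominus>\<^bsub>M\<^esub> f (bracket L x z # ys)"
    unfolding S_def using ys assms by (simp add: C_eval theta_apply)
  show "\<iota> n z (\<theta> (Suc n) x f) ys = (\<theta> n x (\<iota> n z f) \<ominus>\<^bsub>C n\<^esub> \<iota> n (bracket L x z) f) ys"
    using ys zys assms cl[of 0] C_closed[OF assms(1) zys] S
    by (simp add: 1 2 M.ag_simps)
qed (use assms in \<open>auto simp: contract_def a_minus_def C_simps\<close>)

lemma theta_add:
  assumes "f \<in> carrier (C n)" "g \<in> carrier (C n)" "x \<in> carrier L"
  shows "\<theta> n x (f \<oplus>\<^bsub>C n\<^esub> g) = \<theta> n x f \<oplus>\<^bsub>C n\<^esub> \<theta> n x g"
proof (rule extensionalityI[where A = "tuples R n"])
  fix xs assume xs: "xs \<in> tuples R n"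
  let ?s = "\<lambda>f j. f (xs[j := bracket L x (xs ! j)])"
  have "(\<Oplus>\<^bsub>M\<^esub>j\<in>{..<n}. ?s (f \<oplus>\<^bsub>C n\<^esub> g) j) = (\<Oplus>\<^bsub>M\<^esub>j\<in>{..<n}. ?s f j \<oplus>\<^bsub>M\<^esub> ?s g j)"
    using assms xs by (intro M.finsum_cong') (auto simp: C_eval tuples_update tuples_nth)
  also have "\<dots> = (\<Oplus>\<^bsub>M\<^esub>j\<in>{..<n}. ?s f j) \<oplus>\<^bsub>M\<^esub> (\<Oplus>\<^bsub>M\<^esub>j\<in>{..<n}. ?s g j)"
    using assms xs by (intro M.finsum_addf) auto
  finally have sum: "(\<Oplus>\<^bsub>M\<^esub>j\<in>{..<n}. ?s (f \<oplus>\<^bsub>C n\<^esub> g) j) = \<dots>" .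
  have "(\<Oplus>\<^bsub>M\<^esub>j\<in>{..<n}. ?s h j) \<in> carrier M" if "h \<in> carrier (C n)" for h
    using that assms xs by (intro M.finsum_closed) auto
  from this[OF assms(1)] this[OF assms(2)]
  show "\<theta> n x (f \<oplus>\<^bsub>C n\<^esub> g) xs = (\<theta> n x f \<oplus>\<^bsub>C n\<^esub> \<theta> n x g) xs"
    using assms xs C_closed[OF assms(1) xs] C_closed[OF assms(2) xs]
    by (simp add: theta_apply C_eval sum act_add_right M.ag_simps)
qed (auto simp: theta_ext C_simps)

lemma theta_smult:
  assumes "f \<in> carrier (C n)" "a \<in> carrier F" "x \<in> carrier L"
  shows "\<theta> n x (a \<odot>\<^bsub>C n\<^esub> f) = a \<odot>\<^bsub>C n\<^esub> \<theta> n x f"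
proof (rule extensionalityI[where A = "tuples R n"])
  fix xs assume xs: "xs \<in> tuples R n"
  let ?s = "\<lambda>f j. f (xs[j := bracket L x (xs ! j)])"
  have "(\<Oplus>\<^bsub>M\<^esub>j\<in>{..<n}. ?s (a \<odot>\<^bsub>C n\<^esub> f) j) = (\<Oplus>\<^bsub>M\<^esub>j\<in>{..<n}. a \<odot>\<^bsub>M\<^esub> ?s f j)"
    using assms xs by (intro M.finsum_cong') (auto simp: C_eval tuples_update tuples_nth)
  also have "\<dots> = a \<odot>\<^bsub>M\<^esub> (\<Oplus>\<^bsub>M\<^esub>j\<in>{..<n}. ?s f j)"
    using assms xs by (intro M.finsum_smult_ldistr[symmetric]) auto
  finally have sum: "(\<Oplus>\<^bsub>M\<^esub>j\<in>{..<n}. ?s (a \<odot>\<^bsub>C n\<^esub> f) j) = \<dots>" .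
  have "(\<Oplus>\<^bsub>M\<^esub>j\<in>{..<n}. ?s f j) \<in> carrier M"
    using assms xs by (intro M.finsum_closed) auto
  then show "\<theta> n x (a \<odot>\<^bsub>C n\<^esub> f) xs = (a \<odot>\<^bsub>C n\<^esub> \<theta> n x f) xs"
    using assms xs C_closed[OF assms(1) xs]
    by (simp add: theta_apply C_eval sum act_smult_right M.smult_r_distr M.smult_r_minus a_minus_def)
qed (auto simp: theta_ext C_simps)

lemma theta_closed [simp, intro]:
  assumes "f \<in> carrier (C n)" "x \<in> carrier L"
  shows "\<theta> n x f \<in> carrier (C n)"
  using assms(1)
proof (induction n arbitrary: f)
  case 0
  then show ?case
    using assms(2) C_closed[of f 0 "[]"] by (intro C_0I theta_ext) (simp add: theta_apply)
next
  case (Suc n)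
  note IH = Suc.IH and f = Suc.prems and rec = contract_theta[OF Suc.prems assms(2)]
  have cl: "\<theta> n x (\<iota> n z f) \<in> carrier (C n)" if "z \<in> I" for z using IH f that by auto
  show ?case
  proof (rule C_SucI)
    show "\<iota> n z (\<theta> (Suc n) x f) \<in> carrier (C n)" if "z \<in> I" for z
      using that f assms(2) cl by (simp add: rec)
    show "\<iota> n (y \<oplus>\<^bsub>L\<^esub> z) (\<theta> (Suc n) x f) = \<iota> n y (\<theta> (Suc n) x f) \<oplus>\<^bsub>C n\<^esub> \<iota> n z (\<theta> (Suc n) x f)"
      if "y \<in> I" "z \<in> I" for y z
      using that f assms(2) cl
      by (simp add: rec contract_add_left theta_add bracket_add_right C.minus_add_minus)
    show "\<iota> n (a \<odot>\<^bsub>L\<^esub> y) (\<theta> (Suc n) x f) = a \<odot>\<^bsub>C n\<^esub> \<iota> n y (\<theta> (Suc n) x f)"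
      if "a \<in> carrier F" "y \<in> I" for a y
      using that f assms(2) cl
      by (simp add: rec contract_smult_left theta_smult bracket_smult_right a_minus_def
          C.smult_r_distr C.smult_r_minus)
    show "\<iota> m y (\<iota> n y (\<theta> (Suc n) x f)) = \<zero>\<^bsub>C m\<^esub>" if n: "n = Suc m" and y: "y \<in> I" for m y
    proof -
      have "\<theta> m x \<zero>\<^bsub>C m\<^esub> \<oplus>\<^bsub>C m\<^esub> \<theta> m x \<zero>\<^bsub>C m\<^esub> = \<theta> m x \<zero>\<^bsub>C m\<^esub>"
        using theta_add[of "\<zero>\<^bsub>C m\<^esub>" m "\<zero>\<^bsub>C m\<^esub>" x] assms(2) by simp
      \<comment> \<open>Contracting twice with \<open>y\<close> leaves \<theta>_x of a vanishing
        double contraction and two terms that cancel after swapping \<open>y\<close> with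
        \<open>[x,y]\<close>.\<close>
      have "\<iota> m y (\<iota> n y (\<theta> (Suc n) x f)) 
          = \<theta> m x (\<iota> m y (\<iota> n y f)) \<ominus>\<^bsub>C m\<^esub> \<iota> m (bracket L x y) (\<iota> n y f) \<ominus>\<^bsub>C m\<^esub> \<iota> m y (\<iota> n (bracket L x
            y) f)"
        using n y f assms(2) cl[OF y]
        by (simp add: rec contract_diff contract_theta)
      \<comment> \<open>Evaluated from the definition, because \<open>theta_zero\<close> already
        relies on closure.\<close>
      also have "\<theta> m x (\<iota> m y (\<iota> n y f)) = \<zero>\<^bsub>C m\<^esub>"
        using n y f assms(2) 
        by (auto simp: contract_self theta_def C_simps act_zero tuples_update tuples_nth a_minus_def
          intro!: restrict_ext M.finsum_zero cong: M.finsum_cong)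
      also have "\<iota> m (bracket L x y) (\<iota> n y f) = \<ominus>\<^bsub>C m\<^esub> \<iota> m y (\<iota> n (bracket L x y) f)"
        using contract_swap[of f m "bracket L x y" y] n f y assms(2) by simp
      finally show ?thesis
        using n f y assms(2) by (simp add: C.ag_simps)
    qed
  qed (rule theta_ext)
qed

lemma theta_zero: "x \<in> carrier L \<Longrightarrow> \<theta> n x \<zero>\<^bsub>C n\<^esub> = \<zero>\<^bsub>C n\<^esub>"
  using theta_smult[of "\<zero>\<^bsub>C n\<^esub>" n "\<zero>\<^bsub>F\<^esub>" x] by simp

lemma theta_minus:
  assumes "f \<in> carrier (C n)" "x \<in> carrier L"
  shows "\<theta> n x (\<ominus>\<^bsub>C n\<^esub> f) = \<ominus>\<^bsub>C n\<^esub> \<theta> n x f"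
proof -
  have "\<theta> n x (\<ominus>\<^bsub>C n\<^esub> f) \<oplus>\<^bsub>C n\<^esub> \<theta> n x f = \<zero>\<^bsub>C n\<^esub>"
    using theta_add[of "\<ominus>\<^bsub>C n\<^esub> f" n f x] assms by (simp add: C.l_neg theta_zero)
  then show ?thesis using assms by (simp add: C.minus_equality)
qed

lemma theta_diff:
  assumes "f \<in> carrier (C n)" "g \<in> carrier (C n)" "x \<in> carrier L"
  shows "\<theta> n x (f \<ominus>\<^bsub>C n\<^esub> g) = \<theta> n x f \<ominus>\<^bsub>C n\<^esub> \<theta> n x g"
  using assms by (simp add: a_minus_def theta_add theta_minus)

lemma theta_add_left:
  assumes "f \<in> carrier (C n)" "x \<in> carrier L" "y \<in> carrier L"
  shows "\<theta> n (x \<oplus>\<^bsub>L\<^esub> y) f = \<theta> n x f \<oplus>\<^bsub>C n\<^esub> \<theta> n y f"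
  using assms(1)
proof (induction n arbitrary: f)
  case 0
  then show ?case using assms
    by (auto simp: theta_0 C_simps act_add_left intro!: restrict_ext)
next
  case (Suc n)
  then show ?case
    using assms(2,3)
    by - (rule contract_eqI[where n = n], simp_all add: contract_theta contract_add bracket_add_left
      contract_add_left C.minus_add_minus)
qed

lemma theta_smult_left:
  assumes "f \<in> carrier (C n)" "a \<in> carrier F" "x \<in> carrier L"
  shows "\<theta> n (a \<odot>\<^bsub>L\<^esub> x) f = a \<odot>\<^bsub>C n\<^esub> \<theta> n x f"
  using assms(1)
proof (induction n arbitrary: f)
  case 0
  then show ?case using assms
    by (auto simp: theta_0 C_simps act_smult_left intro!: restrict_ext)
next
  case (Suc n)
  then show ?case
    using assms(2,3)
    by - (rule contract_eqI[where n = n], simp_all add: contract_theta contract_smult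
      bracket_smult_left contract_smult_left a_minus_def
          C.smult_r_distr C.smult_r_minus)
qed

text \<open>The Jacobi identity as the statement that \<open>ad\<close> is a representation, the
  shape needed in \<open>theta_bracket\<close>.\<close>

lemma bracket_jacobi:
  assumes "x \<in> carrier L" "y \<in> carrier L" "z \<in> carrier L"
  shows "bracket L (bracket L x y) z = bracket L x (bracket L y z) \<ominus>\<^bsub>L\<^esub> bracket L y (bracket L x z)"
proof -
  have "bracket L y (bracket L z x) = \<ominus>\<^bsub>L\<^esub> bracket L y (bracket L x z)"
    using assms bracket_swap[of z x] by (simp add: bracket_minus)
  moreover have "bracket L z (bracket L x y) = \<ominus>\<^bsub>L\<^esub> bracket L (bracket L x y) z"
    using assms bracket_swap[of z "bracket L x y"] by simp
  ultimately have "bracket L x (bracket L y z) \<oplus>\<^bsub>L\<^esub> \<ominus>\<^bsub>L\<^esub> bracket L y (bracket L x z) \<oplus>\<^bsub>L\<^esub>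
    \<ominus>\<^bsub>L\<^esub> bracket L (bracket L x y) z = \<zero>\<^bsub>L\<^esub>"
    using jacobi[OF assms] by simp
  then show ?thesis
    using assms by (simp add: L.M.ag_simps)
qed

text \<open>In the commutator the mixed terms, \<theta> of one element and contraction by the
  bracket with the other, cancel; the remaining contractions are settled by
  \<open>bracket_jacobi\<close>.\<close>

lemma theta_bracket:
  assumes "f \<in> carrier (C n)" "x \<in> carrier L" "y \<in> carrier L"
  shows "\<theta> n (bracket L x y) f = \<theta> n x (\<theta> n y f) \<ominus>\<^bsub>C n\<^esub> \<theta> n y (\<theta> n x f)"
  using assms(1)
proof (induction n arbitrary: f)
  case 0
  show ?case
  proof (rule C_eqI[of _ 0])
    fix xs assume "xs \<in> tuples R 0"
    then show "\<theta> 0 (bracket L x y) f xs = (\<theta> 0 x (\<theta> 0 y f) \<ominus>\<^bsub>C 0\<^esub> \<theta> 0 y (\<theta> 0 x f)) xs"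
      using 0 assms(2,3) theta_closed[OF 0 assms(2)] theta_closed[OF 0 assms(3)] C_closed[OF 0]
      by (simp add: C_eval theta_apply act_bracket)
  qed (use 0 assms in auto)
next
  case (Suc n)
  show ?case
  proof (rule contract_eqI[where n = n])
    fix z assume z: "z \<in> I"
    let ?z = "\<iota> n z f" and ?xz = "\<iota> n (bracket L x z) f" and ?yz = "\<iota> n (bracket L y z) f"
    have *: "\<iota> n z (\<theta> (Suc n) x (\<theta> (Suc n) y f))
        = \<theta> n x (\<theta> n y ?z) \<ominus>\<^bsub>C n\<^esub> \<theta> n x ?yz \<ominus>\<^bsub>C n\<^esub> (\<theta> n y ?xz \<ominus>\<^bsub>C n\<^esub> \<iota> n (bracket L y (bracket L x z)) f)"
      using z Suc.prems assms(2,3) by (simp add: contract_theta theta_diff)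
    have **: "\<iota> n z (\<theta> (Suc n) y (\<theta> (Suc n) x f))
        = \<theta> n y (\<theta> n x ?z) \<ominus>\<^bsub>C n\<^esub> \<theta> n y ?xz \<ominus>\<^bsub>C n\<^esub> (\<theta> n x ?yz \<ominus>\<^bsub>C n\<^esub> \<iota> n (bracket L x (bracket L y z)) f)"
      using z Suc.prems assms(2,3) by (simp add: contract_theta theta_diff)
    have ***: "\<iota> n z (\<theta> (Suc n) (bracket L x y) f)
        = \<theta> n x (\<theta> n y ?z) \<ominus>\<^bsub>C n\<^esub> \<theta> n y (\<theta> n x ?z)
          \<ominus>\<^bsub>C n\<^esub> (\<iota> n (bracket L x (bracket L y z)) f \<ominus>\<^bsub>C n\<^esub> \<iota> n (bracket L y (bracket L x z)) f)"
      using z Suc.prems assms(2,3) by (simp add: contract_theta Suc.IH bracket_jacobi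
        contract_diff_left)
    have "\<theta> n x (\<theta> n y ?z) \<in> carrier (C n)" "\<theta> n y (\<theta> n x ?z) \<in> carrier (C n)"
      "\<theta> n x ?yz \<in> carrier (C n)" "\<theta> n y ?xz \<in> carrier (C n)"
      "\<iota> n (bracket L x (bracket L y z)) f \<in> carrier (C n)"
        "\<iota> n (bracket L y (bracket L x z)) f \<in> carrier (C n)"
      using z Suc.prems assms(2,3) by auto
    then show "\<iota> n z (\<theta> (Suc n) (bracket L x y) f)
      = \<iota> n z (\<theta> (Suc n) x (\<theta> (Suc n) y f) \<ominus>\<^bsub>C (Suc n)\<^esub> \<theta> (Suc n) y (\<theta> (Suc n) x f))"
      using z Suc.prems assms(2,3)
      by (simp only: contract_diff theta_closed * ** ***) (simp add: C.ag_simps)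
  qed (use Suc.prems assms in auto)
qed

text \<open>Moving the replaced argument to the front takes \<open>j\<close> transpositions. This
  identifies the terms \<open>f([x,y_j], ...)\<close> of the differential with the summands of
  \<theta>_x.\<close>

lemma C_move_front:
  assumes "f \<in> carrier (C (Suc n))" "ys \<in> tuples R (Suc n)" "j \<le> n" "z \<in> I"
  shows "f (ys[j := z]) = [((- 1 :: int) ^ j)] \<cdot>\<^bsub>M\<^esub> f (z # nths ys (- {j}))"
  using assms(1-3)
proof (induction n arbitrary: f ys j)
  case 0
  then obtain y where "ys = [y]" by (auto elim!: tuples_SucE simp: tuples_0)
  then show ?case using 0 assms(4) C_closed[OF 0(1), of "[z]"] by (simp add: nths_Cons_Compl_0 tuples_0)
next
  case (Suc n)
  obtain y zs where ys: "ys = y # zs" "y \<in> I" "zs \<in> tuples R (Suc n)" using Suc.prems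
    by (auto elim: tuples_SucE)
  show ?case
  proof (cases j)
    case 0
    then show ?thesis using ys assms(4) C_closed[OF Suc.prems(1), of "z # zs"]
      by (simp add: nths_Cons_Compl_0)
  next
    case (Suc i)
    let ?zs = "nths zs (- {i})"
    have i: "i \<le> n" using Suc Suc.prems by simp
    have t: "?zs \<in> tuples R n" using ys i by (intro tuples_nths_1)
    have cl: "f (z # y # ?zs) \<in> carrier M" "f (y # z # ?zs) \<in> carrier M"
      using t ys assms(4) by (auto intro!: C_closed[OF Suc.prems(1)])
    have sw: "f (y # z # ?zs) = \<ominus>\<^bsub>M\<^esub> f (z # y # ?zs)"
      using contract_swap[OF Suc.prems(1) assms(4) ys(2)] t ys assms(4) Suc.prems(1)
      by (auto dest!: fun_cong[where x = ?zs] simp: C_eval)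
    have "f (ys[j := z]) = \<iota> (Suc n) y f (zs[i := z])"
      using ys Suc assms(4) by (simp add: tuples_update)
    also have "\<dots> = [((- 1 :: int) ^ i)] \<cdot>\<^bsub>M\<^esub> \<iota> (Suc n) y f (z # ?zs)"
      using Suc.IH[of "\<iota> (Suc n) y f" zs i] Suc.prems ys i by simp
    also have "\<dots> = [((- 1 :: int) ^ i)] \<cdot>\<^bsub>M\<^esub> f (y # z # ?zs)"
      using t assms(4) by simp
    finally show ?thesis
      using Suc cl ys by (simp add: sw nths_Cons_Compl_Suc M.add_pow_sign M.add_pow_minus_one)
  qed
qed

text \<open>Cartan's formula, read as a recursion for the differential.\<close>

lemma contract_d_0:
  assumes "f \<in> carrier (C 0)" "x \<in> I"
  shows "\<iota> 0 x (d 0 f) = \<theta> 0 x f"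
proof (rule extensionalityI[where A = "tuples R 0"])
  fix xs assume "xs \<in> tuples R 0"
  moreover have emp: "{(i, j). i < j \<and> j = (0 :: nat)} = {}" by auto
  ultimately show "\<iota> 0 x (d 0 f) xs = \<theta> 0 x f xs"
    using assms C_closed[of f 0 "[]"]
    by (simp add: tuples_0 theta_0 ce_diff_def nths_Cons_Compl_0 emp)
qed (simp_all add: contract_def theta_ext)

text \<open>Closure of \<open>d n (\<iota> n x f)\<close> is a premise because this recursion is
  itself an ingredient of the proof that \<open>d\<close> preserves cochains;
  \<open>contract_d_Suc\<close> discharges it.\<close>

lemma contract_d_Suc_aux:
  assumes f: "f \<in> carrier (C (Suc n))" and x: "x \<in> I"
    and closed: "d n (\<iota> n x f) \<in> carrier (C (Suc n))"
  shows "\<iota> (Suc n) x (d (Suc n) f) = \<theta> (Suc n) x f \<ominus>\<^bsub>C (Suc n)\<^esub> d n (\<iota> n x f)"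
proof (rule extensionalityI[where A = "tuples R (Suc n)"])
  fix ys assume ys: "ys \<in> tuples R (Suc n)"
  let ?S = "{(i, j). i < j \<and> j \<le> n}" and ?S' = "{(i, j). i < j \<and> j \<le> Suc n}"
  have nth: "ys ! i \<in> I" if "i \<le> n" for i using ys that by (simp add: tuples_nth)
  \<comment> \<open>Besides the term in which \<open>x\<close> acts, \<open>d f (x # ys)\<close> has
    terms where \<open>y_i\<close> acts (\<open>a\<close>), where \<open>x\<close> is bracketed with
    \<open>y_j\<close> (\<open>b\<close>), and where \<open>y_i\<close> is bracketed with
    \<open>y_j\<close> (\<open>c\<close>). The signed sum of \<open>b\<close> is the sum in
    \<theta>_x; the other two make up \<open>d (i_x f)\<close>.\<close>
  define a where "a i = act M (ys ! i) (f (x # nths ys (- {i})))" for i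
  define b where "b j = f (bracket L x (ys ! j) # nths ys (- {j}))" for j
  define c where "c ij = f (x # bracket L (ys ! fst ij) (ys ! snd ij) # nths ys (- {fst ij, snd
    ij}))" for ij
  have two: "bracket L (ys ! i) (ys ! j) # nths ys (- {i, j}) \<in> tuples R n" if ij: "i < j" "j \<le> n"
    for i j
  proof -
    obtain m where n: "n = Suc m" using ij by (cases n) auto
    then show ?thesis using ys ij nth[of i] nth[of j] tuples_nths_2[of ys m i j] by simp
  qed
  have one: "nths ys (- {i}) \<in> tuples R n" if "i \<le> n" for i
    using ys that by (rule tuples_nths_1)
  have cl: "a i \<in> carrier M" "b i \<in> carrier M" if "i \<le> n" for i
    unfolding a_def b_def using one[OF that] nth[OF that] x by (auto intro!: C_closed[OF f])
  have clc: "c ij \<in> carrier M" if ij: "ij \<in> ?S" for ij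
  proof -
    obtain i j where "ij = (i, j)" "i < j" "j \<le> n" using ij by blast
    then show ?thesis unfolding c_def using two x by (auto intro!: C_closed[OF f])
  qed
  define sa where "sa = (\<Oplus>\<^bsub>M\<^esub>i\<in>{..n}. [((- 1 :: int) ^ i)] \<cdot>\<^bsub>M\<^esub> a i)"
  define sb where "sb = (\<Oplus>\<^bsub>M\<^esub>i\<in>{..n}. [((- 1 :: int) ^ i)] \<cdot>\<^bsub>M\<^esub> b i)"
  define sc where "sc = (\<Oplus>\<^bsub>M\<^esub>ij\<in>?S. [((- 1 :: int) ^ (fst ij + snd ij))] \<cdot>\<^bsub>M\<^esub> c ij)"
  have fin: "finite ?S" by (rule finite_subset[of _ "{..n} \<times> {..n}"]) auto
  have scl: "sa \<in> carrier M" "sb \<in> carrier M" "sc \<in> carrier M"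
    unfolding sa_def sb_def sc_def using cl clc
    by (auto intro!: M.finsum_closed simp: M.add_pow_sign simp del: mem_Collect_eq split_paired_All)
  \<comment> \<open>Prepending \<open>x\<close> raises the index of every entry of \<open>ys\<close>
    by one, which flips the sign of terms with a single shifted index.\<close>
  have neg: "[((- 1 :: int) ^ Suc k)] \<cdot>\<^bsub>M\<^esub> m = \<ominus>\<^bsub>M\<^esub> ([((- 1 :: int) ^ k)] \<cdot>\<^bsub>M\<^esub> m)" if "m \<in> carrier M" for m k
    unfolding M.add_pow_sign[OF that] using that by simp
  let ?t = "\<lambda>i. [((- 1 :: int) ^ i)] \<cdot>\<^bsub>M\<^esub> act M ((x # ys) ! i) (f (nths (x # ys) (- {i})))"
  let ?u = "\<lambda>ij. [((- 1 :: int) ^ (fst ij + snd ij))] \<cdot>\<^bsub>M\<^esub>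
             f (bracket L ((x # ys) ! fst ij) ((x # ys) ! snd ij) # nths (x # ys) (- {fst ij, snd ij}))"
  have fys: "f ys \<in> carrier M" using f ys by simp
  have t0: "?t 0 = act M x (f ys)" using x fys by (simp add: nths_Cons_Compl_0)
  have t1: "?t (Suc i) = \<ominus>\<^bsub>M\<^esub> ([((- 1 :: int) ^ i)] \<cdot>\<^bsub>M\<^esub> a i)" if "i \<le> n" for i
    unfolding neg[OF cl(1)[OF that], symmetric] by (simp add: a_def nths_Cons_Compl_Suc)
  have u0: "?u (0, Suc j) = \<ominus>\<^bsub>M\<^esub> ([((- 1 :: int) ^ j)] \<cdot>\<^bsub>M\<^esub> b j)" if "j \<le> n" for j
    unfolding neg[OF cl(2)[OF that], symmetric] by (simp add: b_def nths_Cons_Compl_0_Suc)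
  \<comment> \<open>Two shifted indices leave the sign alone; the minus comes from swapping
    \<open>x\<close> with the bracket in front of it.\<close>
  have u1: "?u (Suc (fst ij), Suc (snd ij)) = \<ominus>\<^bsub>M\<^esub> ([((- 1 :: int) ^ (fst ij + snd ij))] \<cdot>\<^bsub>M\<^esub> c ij)"
    if ij: "ij \<in> ?S" for ij
  proof -
    obtain i j where ij': "ij = (i, j)" "i < j" "j \<le> n" using ij by blast
    then obtain m where n: "n = Suc m" by (cases n) auto
    let ?z = "bracket L (ys ! i) (ys ! j)" and ?zs = "nths ys (- {i, j})"
    have z: "?z \<in> I" "?zs \<in> tuples R m"
      using nth ij' n ys by (auto intro!: tuples_nths_2)
    have f': "f \<in> carrier (C (Suc (Suc m)))" using f n by simp
    have "\<iota> m x (\<iota> (Suc m) ?z f) ?zs = (\<ominus>\<^bsub>C m\<^esub> \<iota> m ?z (\<iota> (Suc m) x f)) ?zs"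
      using contract_swap[OF f' x z(1)] by simp
    then have "f (?z # x # ?zs) = \<ominus>\<^bsub>M\<^esub> c ij"
      using z x f' ij' by (simp add: C_minus_eval c_def)
    then show ?thesis
      using clc[OF ij] ij' by (simp add: nths_Cons_Compl_Suc_Suc M.add_pow_sign)
  qed
  have tcl: "?t i \<in> carrier M" if "i \<le> Suc n" for i
    using that cl t0 t1 fys x by (cases i) (simp_all add: M.add_pow_sign del: power_Suc nth_Cons_Suc)
  have ucl: "?u ij \<in> carrier M" if ij_mem: "ij \<in> ?S'" for ij
  proof -
    obtain i j where ij: "ij = (i, Suc j)" "i < Suc j" "j \<le> n"
      using ij_mem by (cases ij; cases "snd ij") auto
    show ?thesis
    proof (cases i)
      case 0
      then show ?thesis using u0[of j] cl(2)[of j] ij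
        by (simp add: M.add_pow_sign del: power_Suc nth_Cons_Suc)
    next
      case (Suc k)
      then have "(k, j) \<in> ?S" using ij by auto
      then show ?thesis using u1[of "(k, j)"] clc[of "(k, j)"] ij Suc
        by (simp add: M.add_pow_sign del: power_Suc nth_Cons_Suc)
    qed
  qed
  have "(\<Oplus>\<^bsub>M\<^esub>i\<in>{..Suc n}. ?t i) = ?t 0 \<oplus>\<^bsub>M\<^esub> (\<Oplus>\<^bsub>M\<^esub>i\<in>{..n}. ?t (Suc i))"
    by (rule M.finsum_atMost_Suc2) (use tcl in auto)
  also have "(\<Oplus>\<^bsub>M\<^esub>i\<in>{..n}. ?t (Suc i)) = (\<Oplus>\<^bsub>M\<^esub>i\<in>{..n}. \<ominus>\<^bsub>M\<^esub> ([((- 1 :: int) ^ i)] \<cdot>\<^bsub>M\<^esub> a i))"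
    by (rule M.finsum_cong') (use t1 cl in \<open>auto simp: M.add_pow_sign\<close>)
  also have "\<dots> = \<ominus>\<^bsub>M\<^esub> sa"
    unfolding sa_def by (rule M.finsum_a_inv) (use cl in \<open>auto simp: M.add_pow_sign\<close>)
  finally have sum1: "(\<Oplus>\<^bsub>M\<^esub>i\<in>{..Suc n}. ?t i) = act M x (f ys) \<oplus>\<^bsub>M\<^esub> \<ominus>\<^bsub>M\<^esub> sa" by (simp only: t0)
  have "(\<Oplus>\<^bsub>M\<^esub>ij\<in>?S'. ?u ij) = (\<Oplus>\<^bsub>M\<^esub>j\<in>{..n}. ?u (0, Suc j)) \<oplus>\<^bsub>M\<^esub> (\<Oplus>\<^bsub>M\<^esub>ij\<in>?S. ?u (Suc (fst ij), Suc (snd ij)))"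
    by (rule M.finsum_pairs_Suc) (use ucl in blast)
  also have "(\<Oplus>\<^bsub>M\<^esub>j\<in>{..n}. ?u (0, Suc j)) = (\<Oplus>\<^bsub>M\<^esub>i\<in>{..n}. \<ominus>\<^bsub>M\<^esub> ([((- 1 :: int) ^ i)] \<cdot>\<^bsub>M\<^esub> b i))"
    by (rule M.finsum_cong') (use u0 cl in \<open>auto simp: M.add_pow_sign\<close>)
  also have "\<dots> = \<ominus>\<^bsub>M\<^esub> sb"
    unfolding sb_def by (rule M.finsum_a_inv) (use cl in \<open>auto simp: M.add_pow_sign\<close>)
  also have "(\<Oplus>\<^bsub>M\<^esub>ij\<in>?S. ?u (Suc (fst ij), Suc (snd ij))) = (\<Oplus>\<^bsub>M\<^esub>ij\<in>?S.
    \<ominus>\<^bsub>M\<^esub> ([((- 1 :: int) ^ (fst ij + snd ij))] \<cdot>\<^bsub>M\<^esub> c ij))"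
    by (rule M.finsum_cong'[OF refl _ u1]) (use clc in \<open>auto simp: M.add_pow_sign\<close>)
  also have "\<dots> = \<ominus>\<^bsub>M\<^esub> sc"
    unfolding sc_def by (rule M.finsum_a_inv[OF fin]) (use clc in \<open>auto simp: M.add_pow_sign\<close>)
  finally have sum2: "(\<Oplus>\<^bsub>M\<^esub>ij\<in>?S'. ?u ij) = \<ominus>\<^bsub>M\<^esub> sb \<oplus>\<^bsub>M\<^esub> \<ominus>\<^bsub>M\<^esub> sc" .
  have "x # ys \<in> tuples R (Suc (Suc n))" using x ys by simp
  then have "d (Suc n) f (x # ys) = (\<Oplus>\<^bsub>M\<^esub>i\<in>{..Suc n}. ?t i) \<oplus>\<^bsub>M\<^esub> (\<Oplus>\<^bsub>M\<^esub>ij\<in>?S'. ?u ij)"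
    by (simp add: ce_diff_def)
  then have lhs: "\<iota> (Suc n) x (d (Suc n) f) ys = (act M x (f ys) \<oplus>\<^bsub>M\<^esub> \<ominus>\<^bsub>M\<^esub> sa) \<oplus>\<^bsub>M\<^esub> (\<ominus>\<^bsub>M\<^esub> sb \<oplus>\<^bsub>M\<^esub> \<ominus>\<^bsub>M\<^esub> sc)"
    unfolding sum1 sum2 using ys by simp
  have "(\<Oplus>\<^bsub>M\<^esub>j\<in>{..<Suc n}. f (ys[j := bracket L x (ys ! j)])) = sb"
    unfolding sb_def b_def
  proof (rule M.finsum_cong')
    fix j assume "j \<in> {..n}"
    then have "j \<le> n" by simp
    then show "f (ys[j := bracket L x (ys ! j)])
      = [((- 1 :: int) ^ j)] \<cdot>\<^bsub>M\<^esub> f (bracket L x (ys ! j) # nths ys (- {j}))"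
      by (intro C_move_front[OF f ys]) (use nth x in auto)
  qed (use cl in \<open>auto simp: b_def M.add_pow_sign lessThan_Suc_atMost\<close>)
  then have th: "\<theta> (Suc n) x f ys = act M x (f ys) \<ominus>\<^bsub>M\<^esub> sb"
    using ys by (simp add: theta_apply)
  have "(\<Oplus>\<^bsub>M\<^esub>i\<in>{..n}. [((- 1 :: int) ^ i)] \<cdot>\<^bsub>M\<^esub> act M (ys ! i) (\<iota> n x f (nths ys (- {i})))) = sa"
    unfolding sa_def by (rule M.finsum_cong') (use one cl in \<open>auto simp: a_def M.add_pow_sign\<close>)
  moreover have "(\<Oplus>\<^bsub>M\<^esub>ij\<in>?S. [((- 1 :: int) ^ (fst ij + snd ij))] \<cdot>\<^bsub>M\<^esub>
             \<iota> n x f (bracket L (ys ! fst ij) (ys ! snd ij) # nths ys (- {fst ij, snd ij}))) = sc"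
    unfolding sc_def by (rule M.finsum_cong') (use two clc in \<open>auto simp: c_def M.add_pow_sign
      M.add_pow_minus_one\<close>)
  ultimately have "d n (\<iota> n x f) ys = sa \<oplus>\<^bsub>M\<^esub> sc"
    using ys by (simp add: ce_diff_def)
  then have "(\<theta> (Suc n) x f \<ominus>\<^bsub>C (Suc n)\<^esub> d n (\<iota> n x f)) ys = act M x (f ys) \<ominus>\<^bsub>M\<^esub> sb \<ominus>\<^bsub>M\<^esub> (sa \<oplus>\<^bsub>M\<^esub> sc)"
    using ys f x closed by (simp add: C_eval th)
  then show "\<iota> (Suc n) x (d (Suc n) f) ys = (\<theta> (Suc n) x f \<ominus>\<^bsub>C (Suc n)\<^esub> d n (\<iota> n x f)) ys"
    unfolding lhs using scl fys x by (simp add: M.ag_simps)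
qed (use f x closed in \<open>auto simp: contract_def intro!: C_ext\<close>)

text \<open>The three claims depend on one another: by \<open>C_SucI\<close>, closure in degree
  \<open>Suc n\<close> requires linearity in degree \<open>n\<close>, and evaluating the recursion
  requires closure in degree \<open>n\<close>. Alternation reaches one degree further down, to
  \<open>d k\<close> of zero, hence the strong induction.\<close>

lemma d_linear:
  "(\<forall>f\<in>carrier (C n). d n f \<in> carrier (C (Suc n))) \<and>
   (\<forall>f\<in>carrier (C n). \<forall>g\<in>carrier (C n). d n (f \<oplus>\<^bsub>C n\<^esub> g) = d n f \<oplus>\<^bsub>C (Suc n)\<^esub> d n g) \<and>
   (\<forall>f\<in>carrier (C n). \<forall>a\<in>carrier F. d n (a \<odot>\<^bsub>C n\<^esub> f) = a \<odot>\<^bsub>C (Suc n)\<^esub> d n f)"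
proof (induction n rule: less_induct)
  case (less N)
  show ?case
  proof (cases N)
    case 0
    have closed: "d 0 f \<in> carrier (C (Suc 0))" if "f \<in> carrier (C 0)" for f
      by (rule C_SucI)
        (use that in \<open>simp_all add: d_ext contract_d_0 theta_add_left theta_smult_left\<close>)
    moreover have "d 0 (f \<oplus>\<^bsub>C 0\<^esub> g) = d 0 f \<oplus>\<^bsub>C (Suc 0)\<^esub> d 0 g"
      if "f \<in> carrier (C 0)" "g \<in> carrier (C 0)" for f g
      by (rule contract_eqI[where n = 0])
        (use that closed in \<open>simp_all add: contract_d_0 contract_add theta_add\<close>)
    moreover have "d 0 (a \<odot>\<^bsub>C 0\<^esub> f) = a \<odot>\<^bsub>C (Suc 0)\<^esub> d 0 f" if "f \<in> carrier (C 0)" "a \<in> carrier F" for f a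
      by (rule contract_eqI[where n = 0])
        (use that closed in \<open>simp_all add: contract_d_0 contract_smult theta_smult\<close>)
    ultimately show ?thesis unfolding 0 by blast
  next
    case (Suc n)
    then have cl: "d n f \<in> carrier (C (Suc n))"
      and add: "g \<in> carrier (C n) \<Longrightarrow> d n (f \<oplus>\<^bsub>C n\<^esub> g) = d n f \<oplus>\<^bsub>C (Suc n)\<^esub> d n g"
      and smult: "a \<in> carrier F \<Longrightarrow> d n (a \<odot>\<^bsub>C n\<^esub> f) = a \<odot>\<^bsub>C (Suc n)\<^esub> d n f"
      if "f \<in> carrier (C n)" for f g a
      using that less.IH[of n] by blast+
    have rec: "\<iota> (Suc n) x (d (Suc n) f) = \<theta> (Suc n) x f \<ominus>\<^bsub>C (Suc n)\<^esub> d n (\<iota> n x f)"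
      if "f \<in> carrier (C (Suc n))" "x \<in> I" for f x
      using that cl by (intro contract_d_Suc_aux) auto
    have closed: "d (Suc n) f \<in> carrier (C (Suc (Suc n)))" if f: "f \<in> carrier (C (Suc n))" for f
    proof (rule C_SucI)
      show "\<iota> (Suc n) x (d (Suc n) f) \<in> carrier (C (Suc n))" if "x \<in> I" for x
        using that f cl by (simp add: rec)
      show "\<iota> (Suc n) (x \<oplus>\<^bsub>L\<^esub> y) (d (Suc n) f) = \<iota> (Suc n) x (d (Suc n) f)
        \<oplus>\<^bsub>C (Suc n)\<^esub> \<iota> (Suc n) y (d (Suc n) f)"
        if "x \<in> I" "y \<in> I" for x y
        using that f cl by (simp add: rec theta_add_left contract_add_left add C.minus_add_minus)
      show "\<iota> (Suc n) (a \<odot>\<^bsub>L\<^esub> x) (d (Suc n) f) = a \<odot>\<^bsub>C (Suc n)\<^esub> \<iota> (Suc n) x (d (Suc n) f)"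
        if "x \<in> I" "a \<in> carrier F" for x a
        using that f cl by (simp add: rec theta_smult_left contract_smult_left smult a_minus_def
          C.smult_r_distr C.smult_r_minus)
      show "\<iota> m x (\<iota> (Suc n) x (d (Suc n) f)) = \<zero>\<^bsub>C m\<^esub>" if m: "Suc n = Suc m" and x: "x \<in> I" for m x
      proof -
        have [simp]: "m = n" using m by simp
        let ?g = "\<iota> n x f"
        have g: "?g \<in> carrier (C n)" using f x by simp
        \<comment> \<open>Since \<open>i_x i_x f = 0\<close>, Cartan's formula for
          \<open>i_x f\<close> has no second term. As \<open>[x,x] = 0\<close>,
          \<open>i_x i_x d f\<close> then becomes the difference of \<open>\<theta>_x i_x f\<close>
          with itself.\<close>
        have "\<iota> n x (d n ?g) = \<theta> n x ?g"
        proof (cases n)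
          case 0
          then show ?thesis using g x by (simp add: contract_d_0)
        next
          case (Suc k)
          have k: "k < N" using Suc \<open>N = Suc n\<close> by simp
          then have "d k (\<zero>\<^bsub>F\<^esub> \<odot>\<^bsub>C k\<^esub> \<zero>\<^bsub>C k\<^esub>) = \<zero>\<^bsub>F\<^esub> \<odot>\<^bsub>C (Suc k)\<^esub> d k \<zero>\<^bsub>C k\<^esub>"
            and "d k \<zero>\<^bsub>C k\<^esub> \<in> carrier (C (Suc k))"
            using less.IH[OF k] F.zero_closed C.zero_closed by blast+
          then have "d k \<zero>\<^bsub>C k\<^esub> = \<zero>\<^bsub>C (Suc k)\<^esub>" by simp
          moreover have "\<iota> k x ?g = \<zero>\<^bsub>C k\<^esub>"
            using contract_self[of f k x] f x Suc by simp
          ultimately show ?thesis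
            using contract_d_Suc_aux[of ?g k x] g x Suc by simp
        qed
        then show ?thesis
          using f x cl[OF g] by (simp add: rec contract_diff contract_theta bracket_self
            contract_zero_left)
      qed
    qed (rule d_ext)
    moreover have "d (Suc n) (f \<oplus>\<^bsub>C (Suc n)\<^esub> g) = d (Suc n) f \<oplus>\<^bsub>C (Suc (Suc n))\<^esub> d (Suc n) g"
      if "f \<in> carrier (C (Suc n))" "g \<in> carrier (C (Suc n))" for f g
      by (rule contract_eqI[where n = "Suc n"])
        (use that closed cl in \<open>simp_all add: rec contract_add theta_add add C.minus_add_minus\<close>)
    moreover have "d (Suc n) (a \<odot>\<^bsub>C (Suc n)\<^esub> f) = a \<odot>\<^bsub>C (Suc (Suc n))\<^esub> d (Suc n) f"
      if "f \<in> carrier (C (Suc n))" "a \<in> carrier F" for f a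
      by (rule contract_eqI[where n = "Suc n"])
        (use that closed cl in \<open>simp_all add: rec contract_smult theta_smult smult a_minus_def
          C.smult_r_distr C.smult_r_minus\<close>)
    ultimately show ?thesis unfolding Suc by blast
  qed
qed

lemma d_closed [simp, intro]: "f \<in> carrier (C n) \<Longrightarrow> d n f \<in> carrier (C (Suc n))"
  using d_linear by blast

lemma d_add:
  "f \<in> carrier (C n) \<Longrightarrow> g \<in> carrier (C n) \<Longrightarrow> d n (f \<oplus>\<^bsub>C n\<^esub> g) = d n f \<oplus>\<^bsub>C (Suc n)\<^esub> d n g"
  using d_linear by blast

lemma d_smult:
  "f \<in> carrier (C n) \<Longrightarrow> a \<in> carrier F \<Longrightarrow> d n (a \<odot>\<^bsub>C n\<^esub> f) = a \<odot>\<^bsub>C (Suc n)\<^esub> d n f"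
  using d_linear by blast

lemma d_zero: "d n \<zero>\<^bsub>C n\<^esub> = \<zero>\<^bsub>C (Suc n)\<^esub>"
  using d_smult[of "\<zero>\<^bsub>C n\<^esub>" n "\<zero>\<^bsub>F\<^esub>"] by simp

lemma d_minus: "d n (\<ominus>\<^bsub>C n\<^esub> f) = \<ominus>\<^bsub>C (Suc n)\<^esub> d n f" if "f \<in> carrier (C n)"
proof -
  have "d n (\<ominus>\<^bsub>C n\<^esub> f) \<oplus>\<^bsub>C (Suc n)\<^esub> d n f = \<zero>\<^bsub>C (Suc n)\<^esub>"
    using d_add[of "\<ominus>\<^bsub>C n\<^esub> f" n f] that by (simp add: C.l_neg d_zero)
  then show ?thesis using that by (simp add: C.minus_equality)
qed

lemma d_diff:
  "f \<in> carrier (C n) \<Longrightarrow> g \<in> carrier (C n) \<Longrightarrow> d n (f \<ominus>\<^bsub>C n\<^esub> g) = d n f \<ominus>\<^bsub>C (Suc n)\<^esub> d n g"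
  by (simp add: a_minus_def d_add d_minus)

lemma contract_d_Suc:
  assumes "f \<in> carrier (C (Suc n))" "x \<in> I"
  shows "\<iota> (Suc n) x (d (Suc n) f) = \<theta> (Suc n) x f \<ominus>\<^bsub>C (Suc n)\<^esub> d n (\<iota> n x f)"
  using assms by (intro contract_d_Suc_aux) auto

text \<open>Contracting with \<open>z\<close> reduces the claim to the commutator of \<theta>_x and
  \<theta>_z, supplied by \<open>theta_bracket\<close>, and to the induction hypothesis for
  \<open>i_z f\<close>.\<close>

lemma theta_d:
  assumes "f \<in> carrier (C n)" "x \<in> carrier L"
  shows "\<theta> (Suc n) x (d n f) = d n (\<theta> n x f)"
  using assms(1)
proof (induction n arbitrary: f)
  case 0
  show ?case
    by (rule contract_eqI[where n = 0])
      (use 0 assms(2) in \<open>simp_all add: contract_theta contract_d_0 theta_bracket C.ag_simps\<close>)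
next
  case (Suc n)
  show ?case
  proof (rule contract_eqI[where n = "Suc n"])
    fix z assume z: "z \<in> I"
    let ?N = "Suc n"
    let ?a = "\<theta> ?N x (\<theta> ?N z f)" and ?b = "d n (\<theta> n x (\<iota> n z f))" and ?c = "\<theta> ?N z (\<theta> ?N x f)"
      and ?e = "d n (\<iota> n (bracket L x z) f)"
    have "\<iota> ?N z (\<theta> (Suc ?N) x (d ?N f)) = ?a \<ominus>\<^bsub>C ?N\<^esub> ?b \<ominus>\<^bsub>C ?N\<^esub> ((?a \<ominus>\<^bsub>C ?N\<^esub> ?c) \<ominus>\<^bsub>C ?N\<^esub> ?e)"
      using Suc.prems assms(2) z
      by (simp add: contract_theta contract_d_Suc theta_diff theta_bracket Suc.IH)
    moreover have "\<iota> ?N z (d ?N (\<theta> ?N x f)) = ?c \<ominus>\<^bsub>C ?N\<^esub> (?b \<ominus>\<^bsub>C ?N\<^esub> ?e)"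
      using Suc.prems assms(2) z
      by (simp add: contract_theta contract_d_Suc d_diff)
    moreover have "?a \<in> carrier (C ?N)" "?b \<in> carrier (C ?N)" "?c \<in> carrier (C ?N)"
      "?e \<in> carrier (C ?N)"
      using Suc.prems assms(2) z by auto
    ultimately show "\<iota> ?N z (\<theta> (Suc ?N) x (d ?N f)) = \<iota> ?N z (d ?N (\<theta> ?N x f))"
      by (simp only:) (simp add: C.ag_simps)
  qed (use Suc.prems assms in auto)
qed

text \<open>Cartan's formula used twice gives
  \<open>i_x d d = \<theta>_x d - d \<theta>_x + d d i_x\<close>, and \<theta>_x commutes with
  \<open>d\<close>.\<close>

lemma d_d: "f \<in> carrier (C n) \<Longrightarrow> d (Suc n) (d n f) = \<zero>\<^bsub>C (Suc (Suc n))\<^esub>"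
proof (induction n arbitrary: f)
  case 0
  show ?case
    by (rule contract_eqI[where n = "Suc 0"])
      (use 0 in \<open>simp_all add: contract_d_Suc contract_d_0 contract_zero theta_d\<close>)
next
  case (Suc n)
  show ?case
    by (rule contract_eqI[where n = "Suc (Suc n)"])
      (use Suc in \<open>simp_all add: contract_d_Suc contract_zero theta_d d_diff\<close>)
qed

end

section \<open>Shuffles\<close>

text \<open>Together with \<open>front_cycle\<close> this parametrizes shuffles by the factor that
  receives argument \<open>0\<close>. Here \<open>0\<close> is added as a fixed point;
  \<open>front_cycle r\<close> is the cycle sending position \<open>r\<close>, the head of the
  second block, to \<open>0\<close>.\<close>

definition shift_perm :: "(nat \<Rightarrow> nat) \<Rightarrow> nat \<Rightarrow> nat" where
  "shift_perm \<tau> k = (case k of 0 \<Rightarrow> 0 | Suc i \<Rightarrow> Suc (\<tau> i))"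

definition front_cycle :: "nat \<Rightarrow> nat \<Rightarrow> nat" where
  "front_cycle r k = (if k < r then Suc k else if k = r then 0 else k)"

lemma shift_perm_simps [simp]: "shift_perm \<tau> 0 = 0" "shift_perm \<tau> (Suc i) = Suc (\<tau> i)"
  by (simp_all add: shift_perm_def)

lemma shift_perm_eq_map_permutation:
  assumes "\<tau> permutes {..<n}"
  shows "shift_perm \<tau> = map_permutation {..<n} Suc \<tau>"
proof
  fix k
  show "shift_perm \<tau> k = map_permutation {..<n} Suc \<tau> k"
  proof (cases "k \<in> Suc ` {..<n}")
    case True
    then obtain i where "k = Suc i" "i < n" by auto
    then show ?thesis using map_permutation_apply[of Suc "{..<n}" i \<tau>] by simp
  next
    case False
    then show ?thesis
      using permutes_not_in[OF assms] by (cases k) (auto simp: map_permutation_def restrict_id_def)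
  qed
qed

lemma shift_perm_permutes: "\<tau> permutes {..<n} \<Longrightarrow> shift_perm \<tau> permutes {..<Suc n}"
proof -
  assume *: "\<tau> permutes {..<n}"
  have "map_permutation {..<n} Suc \<tau> permutes Suc ` {..<n}"
    by (rule map_permutation_permutes[OF _ *]) (simp add: bij_betw_def)
  then show ?thesis
    unfolding shift_perm_eq_map_permutation[OF *] by (rule permutes_subset) auto
qed

lemma sign_shift_perm: "\<tau> permutes {..<n} \<Longrightarrow> sign (shift_perm \<tau>) = sign \<tau>"
  by (simp add: shift_perm_eq_map_permutation sign_map_permutation)

text \<open>Each step contributes one adjacent transposition, whence the sign
  \<open>(-1)^r\<close>.\<close>

lemma front_cycle_Suc: "front_cycle (Suc r) = front_cycle r \<circ> transpose r (Suc r)"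
  by (auto simp: front_cycle_def transpose_def fun_eq_iff)

lemma front_cycle_permutes_sign: "front_cycle r permutes {..r} \<and> sign (front_cycle r) = (- 1) ^ r"
proof (induction r)
  case 0
  have "front_cycle 0 = id" by (auto simp: front_cycle_def fun_eq_iff)
  then show ?case by (simp only: permutes_id sign_id) simp
next
  case (Suc r)
  have t: "transpose r (Suc r) permutes {..Suc r}" by (rule permutes_swap_id) auto
  have f: "front_cycle r permutes {..Suc r}" using Suc by (auto intro: permutes_subset)
  have "sign (front_cycle (Suc r)) = sign (front_cycle r) * sign (transpose r (Suc r))"
    unfolding front_cycle_Suc using f t by (intro sign_compose) (auto intro:
      permutes_imp_permutation[of "{..Suc r}"])
  moreover have "front_cycle (Suc r) permutes {..Suc r}"
    unfolding front_cycle_Suc by (rule permutes_compose[OF t f])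
  ultimately show ?case
    using Suc by (simp add: sign_swap_id)
qed

lemma front_cycle_permutes: "r < n \<Longrightarrow> front_cycle r permutes {..<n}"
  by (rule permutes_subset[of _ "{..r}"]) (use front_cycle_permutes_sign in auto)

lemma shift_perm_obtain:
  assumes \<sigma>: "\<sigma> permutes {..<Suc n}" "\<sigma> 0 = 0"
  obtains \<tau> where "\<tau> permutes {..<n}" "\<sigma> = shift_perm \<tau>"
proof -
  define \<tau> where "\<tau> i = \<sigma> (Suc i) - 1" for i
  have nz: "\<sigma> (Suc i) \<noteq> 0" for i
    using permutes_inj[OF \<sigma>(1)] \<sigma>(2) by (metis Zero_neq_Suc injD)
  have Suc\<tau>: "\<sigma> (Suc i) = Suc (\<tau> i)" for i using nz[of i] by (simp add: \<tau>_def)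
  have "inj \<tau>" 
    using permutes_inj[OF \<sigma>(1)] Suc\<tau> by (metis injD injI nat.inject)
  moreover have "\<tau> i < n" if "i < n" for i
    using permutes_in_image[OF \<sigma>(1), of "Suc i"] Suc\<tau>[of i] that by simp
  ultimately have "bij_betw \<tau> {..<n} {..<n}"
    unfolding bij_betw_def by (metis endo_inj_surj finite_lessThan image_subsetI inj_on_subset
      lessThan_iff subset_UNIV)
  moreover have "\<tau> i = i" if "i \<notin> {..<n}" for i
    using permutes_not_in[OF \<sigma>(1), of "Suc i"] that by (simp add: \<tau>_def)
  ultimately have "\<tau> permutes {..<n}" by (rule bij_imp_permutes)
  moreover have "\<sigma> = shift_perm \<tau>"
    using \<sigma>(2) Suc\<tau> by (auto simp: shift_perm_def fun_eq_iff split: nat.split)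
  ultimately show thesis by (rule that)
qed

lemma inj_shift_perm: "inj shift_perm"
proof (rule injI)
  fix \<tau> \<tau>' assume "shift_perm \<tau> = shift_perm \<tau>'"
  then show "\<tau> = \<tau>'" by (metis ext nat.inject shift_perm_simps(2))
qed

lemma finite_shuffle_perms: "finite (shuffle_perms r s)"
  by (rule finite_subset[OF _ finite_permutations[of "{..<r + s}"]]) (auto simp: shuffle_perms_def)

lemma shuffle_perms_0_0: "shuffle_perms 0 0 = {id}"
  by (auto simp: shuffle_perms_def permutes_empty strict_mono_on_def)

lemma shuffle_perms_fst_0:
  "{\<sigma> \<in> shuffle_perms (Suc r) s. \<sigma> 0 = 0} = shift_perm ` shuffle_perms r s"
proof (intro equalityI subsetI)
  fix \<sigma> assume "\<sigma> \<in> {\<sigma> \<in> shuffle_perms (Suc r) s. \<sigma> 0 = 0}"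
  then have \<sigma>: "\<sigma> permutes {..<Suc (r + s)}" "strict_mono_on {..<Suc r} \<sigma>"
      "strict_mono_on {Suc r..<Suc r + s} \<sigma>" "\<sigma> 0 = 0"
    by (auto simp: shuffle_perms_def)
  then obtain \<tau> where \<tau>: "\<tau> permutes {..<r + s}" "\<sigma> = shift_perm \<tau>"
    by (elim shift_perm_obtain)
  have "\<tau> i < \<tau> j" if "i < j" "i \<in> {..<r}" "j \<in> {..<r}" for i j
    using strict_mono_onD[OF \<sigma>(2), of "Suc i" "Suc j"] that \<tau>(2) by simp
  moreover have "\<tau> i < \<tau> j" if "i < j" "i \<in> {r..<r + s}" "j \<in> {r..<r + s}" for i j
    using strict_mono_onD[OF \<sigma>(3), of "Suc i" "Suc j"] that \<tau>(2) by simp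
  ultimately show "\<sigma> \<in> shift_perm ` shuffle_perms r s"
    using \<tau> by (auto simp: shuffle_perms_def strict_mono_on_def)
next
  fix \<sigma> assume "\<sigma> \<in> shift_perm ` shuffle_perms r s"
  then obtain \<tau> where \<tau>: "\<sigma> = shift_perm \<tau>" "\<tau> permutes {..<r + s}" "strict_mono_on {..<r} \<tau>"
      "strict_mono_on {r..<r + s} \<tau>"
    by (auto simp: shuffle_perms_def)
  have "\<sigma> i < \<sigma> j" if "i < j" "i \<in> {..<Suc r}" "j \<in> {..<Suc r}" for i j
    using \<tau>(1) that strict_mono_onD[OF \<tau>(3)] by (cases i; cases j) auto
  moreover have "\<sigma> i < \<sigma> j" if "i < j" "i \<in> {Suc r..<Suc r + s}" "j \<in> {Suc r..<Suc r + s}" for i j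
    using \<tau>(1) that strict_mono_onD[OF \<tau>(4)] by (cases i; cases j) auto
  ultimately show "\<sigma> \<in> {\<sigma> \<in> shuffle_perms (Suc r) s. \<sigma> 0 = 0}"
    using \<tau> shift_perm_permutes[OF \<tau>(2)] by (auto simp: shuffle_perms_def strict_mono_on_def)
qed

lemma shuffle_perms_snd_0:
  "{\<sigma> \<in> shuffle_perms r (Suc s). \<sigma> r = 0} = (\<lambda>\<tau>. shift_perm \<tau> \<circ> front_cycle r) ` shuffle_perms r s"
proof (intro equalityI subsetI)
  fix \<sigma> assume "\<sigma> \<in> {\<sigma> \<in> shuffle_perms r (Suc s). \<sigma> r = 0}"
  then have \<sigma>: "\<sigma> permutes {..<Suc (r + s)}" "strict_mono_on {..<r} \<sigma>"
      "strict_mono_on {r..<Suc (r + s)} \<sigma>" "\<sigma> r = 0"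
    by (auto simp: shuffle_perms_def)
  have fc: "front_cycle r permutes {..<Suc (r + s)}" by (rule front_cycle_permutes) simp
  \<comment> \<open>Undoing the cycle moves the value \<open>0\<close> back to position
    \<open>0\<close>, so that a shifted permutation is left.\<close>
  have "\<sigma> \<circ> inv_into UNIV (front_cycle r) permutes {..<Suc (r + s)}"
    using permutes_compose[OF permutes_inv[OF fc] \<sigma>(1)] .
  moreover have "inv_into UNIV (front_cycle r) 0 = r"
    by (rule inv_f_eq[OF permutes_inj[OF fc]]) (simp add: front_cycle_def)
  ultimately obtain \<tau> where \<tau>: "\<tau> permutes {..<r + s}" "\<sigma> \<circ> inv_into UNIV (front_cycle r)
    = shift_perm \<tau>"
    using \<sigma>(4) by (elim shift_perm_obtain[where \<sigma> = "\<sigma> \<circ> inv_into UNIV (front_cycle r)"]) auto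
  have \<sigma>_eq: "\<sigma> = shift_perm \<tau> \<circ> front_cycle r"
    unfolding \<tau>(2)[symmetric] using permutes_inv_o(2)[OF fc] by (simp add: comp_assoc)
  have "\<tau> i < \<tau> j" if "i < j" "i \<in> {..<r}" "j \<in> {..<r}" for i j
    using strict_mono_onD[OF \<sigma>(2), of i j] that by (simp add: \<sigma>_eq front_cycle_def)
  moreover have "\<tau> i < \<tau> j" if "i < j" "i \<in> {r..<r + s}" "j \<in> {r..<r + s}" for i j
    using strict_mono_onD[OF \<sigma>(3), of "Suc i" "Suc j"] that by (simp add: \<sigma>_eq front_cycle_def)
  ultimately show "\<sigma> \<in> (\<lambda>\<tau>. shift_perm \<tau> \<circ> front_cycle r) ` shuffle_perms r s"
    using \<tau> \<sigma>_eq by (auto simp: shuffle_perms_def strict_mono_on_def)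
next
  fix \<sigma> assume "\<sigma> \<in> (\<lambda>\<tau>. shift_perm \<tau> \<circ> front_cycle r) ` shuffle_perms r s"
  then obtain \<tau> where \<tau>: "\<sigma> = shift_perm \<tau> \<circ> front_cycle r" "\<tau> permutes {..<r + s}"
    "strict_mono_on {..<r} \<tau>"
      "strict_mono_on {r..<r + s} \<tau>"
    by (auto simp: shuffle_perms_def)
  have "\<sigma> i < \<sigma> j" if "i < j" "i \<in> {..<r}" "j \<in> {..<r}" for i j
    using \<tau>(1) that strict_mono_onD[OF \<tau>(3)] by (simp add: front_cycle_def)
  moreover have "\<sigma> i < \<sigma> j" if ij: "i < j" "i \<in> {r..<r + Suc s}" "j \<in> {r..<r + Suc s}" for i j
  proof -
    obtain j' where j: "j = Suc j'" using ij(1) by (cases j) auto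
    show ?thesis
      using \<tau>(1) ij j strict_mono_onD[OF \<tau>(4), of "i - 1" j'] 
      by (cases i) (auto simp: front_cycle_def)
  qed
  moreover have "\<sigma> permutes {..<r + Suc s}"
    unfolding \<tau>(1) using permutes_compose[OF front_cycle_permutes shift_perm_permutes[OF \<tau>(2)], of
      r] by simp
  moreover have "\<sigma> r = 0" using \<tau>(1) by (simp add: front_cycle_def)
  ultimately show "\<sigma> \<in> {\<sigma> \<in> shuffle_perms r (Suc s). \<sigma> r = 0}"
    by (auto simp: shuffle_perms_def strict_mono_on_def)
qed

text \<open>A shuffle is increasing on each block, so its least value can only be taken at the
  beginning of a block.\<close>

lemma shuffle_perms_cases:
  assumes "\<sigma> \<in> shuffle_perms r s" "0 < r + s"
  shows "0 < r \<and> \<sigma> 0 = 0 \<or> 0 < s \<and> \<sigma> r = 0"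
proof -
  have \<sigma>: "\<sigma> permutes {..<r + s}" "strict_mono_on {..<r} \<sigma>" "strict_mono_on {r..<r + s} \<sigma>"
    using assms by (auto simp: shuffle_perms_def)
  have "0 \<in> \<sigma> ` {..<r + s}" using permutes_image[OF \<sigma>(1)] assms(2) by simp
  then obtain k where k: "k < r + s" "\<sigma> k = 0" by auto
  show ?thesis
  proof (cases "k < r")
    case True
    then show ?thesis using strict_mono_onD[OF \<sigma>(2), of 0 k] k by (cases "k = 0") auto
  next
    case False
    then show ?thesis using strict_mono_onD[OF \<sigma>(3), of r k] k by (cases "k = r") auto
  qed
qed

lemma shuffle_perms_Suc_0: "shuffle_perms (Suc r) 0 = shift_perm ` shuffle_perms r 0"
  using shuffle_perms_cases[of _ "Suc r" 0] shuffle_perms_fst_0[of r 0] by auto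

lemma shuffle_perms_0_Suc: "shuffle_perms 0 (Suc s)
  = (\<lambda>\<tau>. shift_perm \<tau> \<circ> front_cycle 0) ` shuffle_perms 0 s"
  using shuffle_perms_cases[of _ 0 "Suc s"] shuffle_perms_snd_0[of 0 s] by auto

lemma shuffle_perms_Suc_Suc:
  "shuffle_perms (Suc r) (Suc s) = shift_perm ` shuffle_perms r (Suc s)
      \<union> (\<lambda>\<tau>. shift_perm \<tau> \<circ> front_cycle (Suc r)) ` shuffle_perms (Suc r) s"
  using shuffle_perms_cases[of _ "Suc r" "Suc s"] shuffle_perms_fst_0[of r "Suc s"]
    shuffle_perms_snd_0[of "Suc r" s]
  by blast

lemma shuffle_perms_disjoint:
  "shift_perm ` shuffle_perms r (Suc s) \<inter> (\<lambda>\<tau>. shift_perm \<tau> \<circ> front_cycle (Suc r)) ` shuffle_perms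
    (Suc r) s = {}"
proof -
  have "\<sigma> 0 \<noteq> \<sigma> (Suc r)" if "\<sigma> \<in> shuffle_perms (Suc r) (Suc s)" for \<sigma>
    using that permutes_inj[of \<sigma>] by (auto simp: shuffle_perms_def dest: injD)
  then have "{\<sigma> \<in> shuffle_perms (Suc r) (Suc s). \<sigma> 0
    = 0} \<inter> {\<sigma> \<in> shuffle_perms (Suc r) (Suc s). \<sigma> (Suc r) = 0} = {}"
    by (intro equals0I) (simp, metis)
  then show ?thesis
    unfolding shuffle_perms_fst_0 shuffle_perms_snd_0 .
qed

lemma inj_shift_front: "inj (\<lambda>\<tau>. shift_perm \<tau> \<circ> front_cycle r)"
proof (rule injI)
  fix \<tau> \<tau>' assume *: "shift_perm \<tau> \<circ> front_cycle r = shift_perm \<tau>' \<circ> front_cycle r"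
  have "bij (front_cycle r)" using front_cycle_permutes_sign permutes_bij by blast
  then have "shift_perm \<tau> = shift_perm \<tau>'"
    using * by (metis bij_is_surj surj_fun_eq comp_apply ext)
  then show "\<tau> = \<tau>'" using inj_shift_perm by (simp add: inj_def)
qed

text \<open>The source of the sign with which contraction passes the first factor of a cup
  product.\<close>

lemma sign_shift_front:
  assumes "\<tau> permutes {..<n}"
  shows "sign (shift_perm \<tau> \<circ> front_cycle r) = (- 1) ^ r * sign \<tau>"
proof -
  have "sign (shift_perm \<tau> \<circ> front_cycle r) = sign (shift_perm \<tau>) * sign (front_cycle r)"
    using shift_perm_permutes[OF assms] front_cycle_permutes_sign
    by (intro sign_compose) (auto intro: permutes_imp_permutation[rotated])
  then show ?thesis using sign_shift_perm[OF assms] front_cycle_permutes_sign by simp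
qed

lemma map_nth_shift:
  "map (\<lambda>i. (x # ys) ! shift_perm \<tau> i) [0..<Suc r] = x # map (\<lambda>i. ys ! \<tau> i) [0..<r]"
  "map (\<lambda>i. (x # ys) ! shift_perm \<tau> i) [Suc r..<Suc r + s] = map (\<lambda>i. ys ! \<tau> i) [r..<r + s]"
  by (auto simp: upt_conv_Cons map_Suc_upt[symmetric] simp del: upt_Suc)

lemma map_nth_shift_front:
  "map (\<lambda>i. (x # ys) ! (shift_perm \<tau> \<circ> front_cycle r) i) [0..<r] = map (\<lambda>i. ys ! \<tau> i) [0..<r]"
  "map (\<lambda>i. (x # ys) ! (shift_perm \<tau> \<circ> front_cycle r) i) [r..<r + Suc s]
    = x # map (\<lambda>i. ys ! \<tau> i) [r..<r + s]"
proof -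
  show "map (\<lambda>i. (x # ys) ! (shift_perm \<tau> \<circ> front_cycle r) i) [0..<r] = map (\<lambda>i. ys ! \<tau> i) [0..<r]"
    by (auto simp: front_cycle_def)
  have "[r..<r + Suc s] = r # map Suc [r..<r + s]"
    by (simp add: upt_conv_Cons map_Suc_upt del: upt_Suc)
  then show "map (\<lambda>i. (x # ys) ! (shift_perm \<tau> \<circ> front_cycle r) i) [r..<r + Suc s]
    = x # map (\<lambda>i. ys ! \<tau> i) [r..<r + s]"
    by (auto simp: front_cycle_def)
qed

section \<open>Cup products\<close>

lemma nat_pair_cases:
  fixes r s :: nat
  obtains (OO) "r = 0" "s = 0" | (SO) r' where "r = Suc r'" "s = 0" | (OS) s' where "r = 0" "s = Suc s'"
    | (SS) r' s' where "r = Suc r'" "s = Suc s'"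
  by (cases r; cases s) auto

locale ideal_pairing = lie_pairing F L M N P \<mu>
  for F :: "'f ring" and L :: "('f, 'g) lie" and M :: "('f, 'g, 'm) lmod"
    and N :: "('f, 'g, 'n) lmod" and P :: "('f, 'g, 'p) lmod" and \<mu> :: "'m \<Rightarrow> 'n \<Rightarrow> 'p" +
  fixes I :: "'g set"
  assumes ideal': "lie_ideal F L I"
begin

sublocale CM: ideal_coeff F L M I by unfold_locales (rule ideal')
sublocale CN: ideal_coeff F L N I by unfold_locales (rule ideal')
sublocale CP: ideal_coeff F L P I by unfold_locales (rule ideal')

declare pair_closed [simp, intro]

lemma pair_zero:
  shows "n \<in> carrier N \<Longrightarrow> \<mu> \<zero>\<^bsub>M\<^esub> n = \<zero>\<^bsub>P\<^esub>" "m \<in> carrier M \<Longrightarrow> \<mu> m \<zero>\<^bsub>N\<^esub> = \<zero>\<^bsub>P\<^esub>"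
  using pair_smult_left[of "\<zero>\<^bsub>F\<^esub>" "\<zero>\<^bsub>M\<^esub>" n] pair_smult_right[of "\<zero>\<^bsub>F\<^esub>" m "\<zero>\<^bsub>N\<^esub>"] by simp_all

abbreviation "cp \<equiv> cup CM.R P \<mu>"

abbreviation cup_summand where
  "cup_summand r s a b xs \<sigma> \<equiv> [sign \<sigma>] \<cdot>\<^bsub>P\<^esub>
     \<mu> (a (map (\<lambda>i. xs ! \<sigma> i) [0..<r])) (b (map (\<lambda>i. xs ! \<sigma> i) [r..<r + s]))"

lemma cup_ext: "cp r s a b \<in> extensional (tuples CM.R (r + s))"
  by (simp add: cup_def)

lemma cup_apply:
  "xs \<in> tuples CM.R (r + s) \<Longrightarrow> cp r s a b xs = (\<Oplus>\<^bsub>P\<^esub>\<sigma>\<in>shuffle_perms r s. cup_summand r s a b xs \<sigma>)"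
  by (simp add: cup_def)

lemma tuples_shuffle:
  assumes "xs \<in> tuples CM.R (r + s)" "\<sigma> \<in> shuffle_perms r s"
  shows "map (\<lambda>i. xs ! \<sigma> i) [0..<r] \<in> tuples CM.R r" "map (\<lambda>i. xs ! \<sigma> i) [r..<r + s] \<in> tuples CM.R s"
proof -
  have "xs ! \<sigma> i \<in> I" if "i < r + s" for i
  proof -
    have "\<sigma> permutes {..<r + s}" using assms(2) by (simp add: shuffle_perms_def)
    then have "\<sigma> i < r + s" using permutes_in_image[of \<sigma> "{..<r + s}" i] that by simp
    then show ?thesis using CM.tuples_nth[OF assms(1)] by simp
  qed
  then show "map (\<lambda>i. xs ! \<sigma> i) [0..<r] \<in> tuples CM.R r"
    "map (\<lambda>i. xs ! \<sigma> i) [r..<r + s] \<in> tuples CM.R s"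
    by (auto simp: tuples_def)
qed

lemma cup_pair_closed:
  assumes "a \<in> carrier (CM.C r)" "b \<in> carrier (CN.C s)" "xs \<in> tuples CM.R (r + s)"
    "\<sigma> \<in> shuffle_perms r s"
  shows "\<mu> (a (map (\<lambda>i. xs ! \<sigma> i) [0..<r])) (b (map (\<lambda>i. xs ! \<sigma> i) [r..<r + s])) \<in> carrier P"
  using tuples_shuffle[OF assms(3,4)] CM.C_closed[OF assms(1)] CN.C_closed[OF assms(2)] by blast

lemma cup_summand_closed [simp, intro]:
  assumes "a \<in> carrier (CM.C r)" "b \<in> carrier (CN.C s)" "xs \<in> tuples CM.R (r + s)"
    "\<sigma> \<in> shuffle_perms r s"
  shows "cup_summand r s a b xs \<sigma> \<in> carrier P"
  using cup_pair_closed[OF assms] by (rule P.M.add.int_pow_closed)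

lemma cup_apply_closed:
  assumes "a \<in> carrier (CM.C r)" "b \<in> carrier (CN.C s)" "xs \<in> tuples CM.R (r + s)"
  shows "cp r s a b xs \<in> carrier P"
  using assms by (auto simp: cup_apply intro!: P.M.finsum_closed)

text \<open>The premise concerns values of \<mu> only, so additivity in the left and in the right
  factor are both instances.\<close>

lemma cup_eq_add:
  assumes closed: "a \<in> carrier (CM.C r)" "b \<in> carrier (CN.C s)" "a' \<in> carrier (CM.C r)"
    "b' \<in> carrier (CN.C s)"
    and pair: "\<And>us vs. us \<in> tuples CM.R r \<Longrightarrow> vs \<in> tuples CM.R s
      \<Longrightarrow> \<mu> (a'' us) (b'' vs) = \<mu> (a us) (b vs) \<oplus>\<^bsub>P\<^esub> \<mu> (a' us) (b' vs)"
  shows "cp r s a'' b'' = cp r s a b \<oplus>\<^bsub>CP.C (r + s)\<^esub> cp r s a' b'"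
proof (rule extensionalityI[OF cup_ext])
  fix xs assume xs: "xs \<in> tuples CM.R (r + s)"
  have "(\<Oplus>\<^bsub>P\<^esub>\<sigma>\<in>shuffle_perms r s. cup_summand r s a'' b'' xs \<sigma>)
      = (\<Oplus>\<^bsub>P\<^esub>\<sigma>\<in>shuffle_perms r s. cup_summand r s a b xs \<sigma> \<oplus>\<^bsub>P\<^esub> cup_summand r s a' b' xs \<sigma>)"
  proof (rule P.M.finsum_cong')
    fix \<sigma> assume \<sigma>: "\<sigma> \<in> shuffle_perms r s"
    show "cup_summand r s a'' b'' xs \<sigma> = cup_summand r s a b xs \<sigma> \<oplus>\<^bsub>P\<^esub> cup_summand r s a' b' xs \<sigma>"
      unfolding pair[OF tuples_shuffle[OF xs \<sigma>]]
      using cup_pair_closed[OF closed(1,2) xs \<sigma>] cup_pair_closed[OF closed(3,4) xs \<sigma>]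
      by (intro P.M.add.int_pow_distrib)
  qed (use closed xs in auto)
  also have "\<dots> = cp r s a b xs \<oplus>\<^bsub>P\<^esub> cp r s a' b' xs"
    unfolding cup_apply[OF xs] by (rule P.M.finsum_addf) (use closed xs in auto)
  finally show "cp r s a'' b'' xs = (cp r s a b \<oplus>\<^bsub>CP.C (r + s)\<^esub> cp r s a' b') xs"
    using xs by (simp add: cup_apply CP.C_eval)
qed (simp add: CP.C_simps)

lemma cup_add_left:
  assumes "a \<in> carrier (CM.C r)" "a' \<in> carrier (CM.C r)" "b \<in> carrier (CN.C s)"
  shows "cp r s (a \<oplus>\<^bsub>CM.C r\<^esub> a') b = cp r s a b \<oplus>\<^bsub>CP.C (r + s)\<^esub> cp r s a' b"
  using assms by (intro cup_eq_add) (auto simp: CM.C_eval intro!: pair_add_left)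

lemma cup_add_right:
  assumes "a \<in> carrier (CM.C r)" "b \<in> carrier (CN.C s)" "b' \<in> carrier (CN.C s)"
  shows "cp r s a (b \<oplus>\<^bsub>CN.C s\<^esub> b') = cp r s a b \<oplus>\<^bsub>CP.C (r + s)\<^esub> cp r s a b'"
  using assms by (intro cup_eq_add) (auto simp: CN.C_eval intro!: pair_add_right)

lemma cup_eq_smult:
  assumes closed: "a \<in> carrier (CM.C r)" "b \<in> carrier (CN.C s)" "c \<in> carrier F"
    and pair: "\<And>us vs. us \<in> tuples CM.R r \<Longrightarrow> vs \<in> tuples CM.R s \<Longrightarrow> \<mu> (a' us) (b' vs)
      = c \<odot>\<^bsub>P\<^esub> \<mu> (a us) (b vs)"
  shows "cp r s a' b' = c \<odot>\<^bsub>CP.C (r + s)\<^esub> cp r s a b"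
proof (rule extensionalityI[OF cup_ext])
  fix xs assume xs: "xs \<in> tuples CM.R (r + s)"
  have sign: "[sign \<sigma>] \<cdot>\<^bsub>P\<^esub> (c \<odot>\<^bsub>P\<^esub> p) = c \<odot>\<^bsub>P\<^esub> ([sign \<sigma>] \<cdot>\<^bsub>P\<^esub> p)" if "p \<in> carrier P" for p and \<sigma> :: "nat \<Rightarrow> nat"
    using that closed(3) by (cases "evenperm \<sigma>") (simp_all add: sign_def P.M.add_pow_minus_one
      P.M.smult_r_minus)
  have "(\<Oplus>\<^bsub>P\<^esub>\<sigma>\<in>shuffle_perms r s. cup_summand r s a' b' xs \<sigma>)
      = (\<Oplus>\<^bsub>P\<^esub>\<sigma>\<in>shuffle_perms r s. c \<odot>\<^bsub>P\<^esub> cup_summand r s a b xs \<sigma>)"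
  proof (rule P.M.finsum_cong')
    fix \<sigma> assume \<sigma>: "\<sigma> \<in> shuffle_perms r s"
    show "cup_summand r s a' b' xs \<sigma> = c \<odot>\<^bsub>P\<^esub> cup_summand r s a b xs \<sigma>"
      unfolding pair[OF tuples_shuffle[OF xs \<sigma>]]
        by (rule sign) (rule cup_pair_closed[OF closed(1,2) xs \<sigma>])
  qed (use closed xs in auto)
  also have "\<dots> = c \<odot>\<^bsub>P\<^esub> cp r s a b xs"
    unfolding cup_apply[OF xs] by (rule P.M.finsum_smult_ldistr[symmetric]) (use closed xs
      finite_shuffle_perms in auto)
  finally show "cp r s a' b' xs = (c \<odot>\<^bsub>CP.C (r + s)\<^esub> cp r s a b) xs"
    using xs by (simp add: cup_apply CP.C_eval)
qed (simp add: CP.C_simps)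

lemma cup_smult_left:
  assumes "a \<in> carrier (CM.C r)" "c \<in> carrier F" "b \<in> carrier (CN.C s)"
  shows "cp r s (c \<odot>\<^bsub>CM.C r\<^esub> a) b = c \<odot>\<^bsub>CP.C (r + s)\<^esub> cp r s a b"
  using assms by (intro cup_eq_smult) (auto simp: CM.C_eval intro!: pair_smult_left)

lemma cup_smult_right:
  assumes "a \<in> carrier (CM.C r)" "c \<in> carrier F" "b \<in> carrier (CN.C s)"
  shows "cp r s a (c \<odot>\<^bsub>CN.C s\<^esub> b) = c \<odot>\<^bsub>CP.C (r + s)\<^esub> cp r s a b"
  using assms by (intro cup_eq_smult) (auto simp: CN.C_eval intro!: pair_smult_right)

lemma cup_zero:
  "b \<in> carrier (CN.C s) \<Longrightarrow> cp r s \<zero>\<^bsub>CM.C r\<^esub> b = \<zero>\<^bsub>CP.C (r + s)\<^esub>"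
  "a \<in> carrier (CM.C r) \<Longrightarrow> cp r s a \<zero>\<^bsub>CN.C s\<^esub> = \<zero>\<^bsub>CP.C (r + s)\<^esub>"
proof -
  show "cp r s \<zero>\<^bsub>CM.C r\<^esub> b = \<zero>\<^bsub>CP.C (r + s)\<^esub>" if "b \<in> carrier (CN.C s)"
    using cup_smult_left[of "\<zero>\<^bsub>CM.C r\<^esub>" r "\<zero>\<^bsub>F\<^esub>" b s] that cup_apply_closed[of "\<zero>\<^bsub>CM.C r\<^esub>" r b s]
    by (auto simp: CP.C_simps cong: restrict_cong)
  show "cp r s a \<zero>\<^bsub>CN.C s\<^esub> = \<zero>\<^bsub>CP.C (r + s)\<^esub>" if "a \<in> carrier (CM.C r)"
    using cup_smult_right[of a r "\<zero>\<^bsub>F\<^esub>" "\<zero>\<^bsub>CN.C s\<^esub>" s] that cup_apply_closed[of a r "\<zero>\<^bsub>CN.C s\<^esub>" s]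
    by (auto simp: CP.C_simps cong: restrict_cong)
qed

text \<open>These are the shuffles that give \<open>x\<close> to \<open>a\<close>. No sign arises,
  because adding a fixed point preserves \<open>sign\<close>.\<close>

lemma cup_apply_fst:
  assumes "a \<in> carrier (CM.C (Suc r))" "b \<in> carrier (CN.C s)" "x \<in> I" "ys \<in> tuples CM.R (r + s)"
  shows "(\<Oplus>\<^bsub>P\<^esub>\<sigma>\<in>shift_perm ` shuffle_perms r s. cup_summand (Suc r) s a b (x # ys) \<sigma>)
    = cp r s (CM.\<iota> r x a) b ys"
proof -
  have eq: "cup_summand (Suc r) s a b (x # ys) (shift_perm \<tau>) = cup_summand r s (CM.\<iota> r x a) b ys \<tau>"
    if "\<tau> \<in> shuffle_perms r s" for \<tau>
    using tuples_shuffle[OF assms(4) that] that unfolding map_nth_shift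
    by (simp add: sign_shift_perm[of \<tau> "r + s"] shuffle_perms_def)
  have cl: "cup_summand r s (CM.\<iota> r x a) b ys \<tau> \<in> carrier P" if "\<tau> \<in> shuffle_perms r s" for \<tau>
    using assms that by auto
  have "(\<Oplus>\<^bsub>P\<^esub>\<sigma>\<in>shift_perm ` shuffle_perms r s. cup_summand (Suc r) s a b (x # ys) \<sigma>)
    = (\<Oplus>\<^bsub>P\<^esub>\<tau>\<in>shuffle_perms r s. cup_summand (Suc r) s a b (x # ys) (shift_perm \<tau>))"
    using inj_shift_perm cl eq by (intro P.M.finsum_reindex) (auto intro: inj_on_subset)
  also have "\<dots> = cp r s (CM.\<iota> r x a) b ys"
    unfolding cup_apply[OF assms(4)] by (rule P.M.finsum_cong') (use cl eq in auto)
  finally show ?thesis .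
qed

text \<open>These are the shuffles that give \<open>x\<close> to \<open>b\<close>, where it becomes
  the first argument; the sign is that of \<open>front_cycle r\<close>.\<close>

lemma cup_apply_snd:
  assumes "a \<in> carrier (CM.C r)" "b \<in> carrier (CN.C (Suc s))" "x \<in> I" "ys \<in> tuples CM.R (r + s)"
  shows "(\<Oplus>\<^bsub>P\<^esub>\<sigma>\<in>(\<lambda>\<tau>. shift_perm \<tau> \<circ> front_cycle r) ` shuffle_perms r s. cup_summand r (Suc s) a b (x #
    ys) \<sigma>)
    = [((- 1 :: int) ^ r)] \<cdot>\<^bsub>P\<^esub> cp r s a (CN.\<iota> s x b) ys"
proof -
  have cl0: "cup_summand r s a (CN.\<iota> s x b) ys \<tau> \<in> carrier P" if "\<tau> \<in> shuffle_perms r s" for \<tau>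
    using assms that by auto
  have eq: "cup_summand r (Suc s) a b (x # ys) (shift_perm \<tau> \<circ> front_cycle r)
      = [((- 1 :: int) ^ r)] \<cdot>\<^bsub>P\<^esub> cup_summand r s a (CN.\<iota> s x b) ys \<tau>"
    if "\<tau> \<in> shuffle_perms r s" for \<tau>
  proof -
    have "sign (shift_perm \<tau> \<circ> front_cycle r) = (- 1) ^ r * sign \<tau>"
      using that by (intro sign_shift_front[of _ "r + s"]) (simp add: shuffle_perms_def)
    then show ?thesis
      using tuples_shuffle[OF assms(4) that] cup_pair_closed[OF assms(1) _ assms(4) that, of
        "CN.\<iota> s x b"] assms(2,3)
      unfolding map_nth_shift_front
      by (simp add: P.M.add.int_pow_pow mult.commute)
  qed
  have cl: "[((- 1 :: int) ^ r)] \<cdot>\<^bsub>P\<^esub> cup_summand r s a (CN.\<iota> s x b) ys \<tau> \<in> carrier P"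
    if "\<tau> \<in> shuffle_perms r s" for \<tau>
    using cl0[OF that] by simp
  have "(\<Oplus>\<^bsub>P\<^esub>\<sigma>\<in>(\<lambda>\<tau>. shift_perm \<tau> \<circ> front_cycle r) ` shuffle_perms r s. cup_summand r (Suc s) a b (x #
    ys) \<sigma>)
    = (\<Oplus>\<^bsub>P\<^esub>\<tau>\<in>shuffle_perms r s. cup_summand r (Suc s) a b (x # ys) (shift_perm \<tau> \<circ> front_cycle r))"
    using inj_shift_front cl eq by (intro P.M.finsum_reindex) (auto intro: inj_on_subset simp del:
      comp_apply)
  also have "\<dots> = (\<Oplus>\<^bsub>P\<^esub>\<tau>\<in>shuffle_perms r s. [((- 1 :: int) ^ r)] \<cdot>\<^bsub>P\<^esub> cup_summand r s a (CN.\<iota> s x b) ys \<tau>)"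
    by (rule P.M.finsum_cong'[OF refl _ eq]) (use cl in auto)
  also have "\<dots> = [((- 1 :: int) ^ r)] \<cdot>\<^bsub>P\<^esub> cp r s a (CN.\<iota> s x b) ys"
  proof (cases "even r")
    case True
    then show ?thesis
      unfolding cup_apply[OF assms(4)] using cl0
        by (auto intro!: P.M.finsum_cong' simp: P.M.finsum_closed)
  next
    case False
    have "(\<Oplus>\<^bsub>P\<^esub>\<tau>\<in>shuffle_perms r s. [((- 1 :: int) ^ r)] \<cdot>\<^bsub>P\<^esub> cup_summand r s a (CN.\<iota> s x b) ys \<tau>)
      = (\<Oplus>\<^bsub>P\<^esub>\<tau>\<in>shuffle_perms r s. \<ominus>\<^bsub>P\<^esub> cup_summand r s a (CN.\<iota> s x b) ys \<tau>)"
      by (rule P.M.finsum_cong') (use False cl0 in \<open>auto simp: P.M.add_pow_minus_one\<close>)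
    also have "\<dots> = \<ominus>\<^bsub>P\<^esub> cp r s a (CN.\<iota> s x b) ys"
      unfolding cup_apply[OF assms(4)] by (rule P.M.finsum_a_inv[OF finite_shuffle_perms]) (use cl0
        in auto)
    finally show ?thesis
      using False cup_apply_closed[of a r "CN.\<iota> s x b" s ys] assms by (simp add: P.M.add_pow_minus_one)
  qed
  finally show ?thesis .
qed

text \<open>A factor of degree \<open>0\<close> has no contraction, so the product rule for
  \<open>i_x\<close> comes in three versions: this one, its mirror image, and the one with both
  degrees positive.\<close>

lemma contract_cup_Suc_0:
  assumes "a \<in> carrier (CM.C (Suc r))" "b \<in> carrier (CN.C 0)" "x \<in> I"
  shows "CP.\<iota> r x (cp (Suc r) 0 a b) = cp r 0 (CM.\<iota> r x a) b"
proof (rule extensionalityI[where A = "tuples CM.R r"])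
  fix ys assume ys: "ys \<in> tuples CM.R r"
  then show "CP.\<iota> r x (cp (Suc r) 0 a b) ys = cp r 0 (CM.\<iota> r x a) b ys"
    using cup_apply_fst[OF assms, of ys] cup_apply[of "x # ys" "Suc r" 0 a b] assms(3)
    unfolding shuffle_perms_Suc_0 by simp
qed (use cup_ext[of r 0] in \<open>simp_all add: contract_def\<close>)

lemma contract_cup_0_Suc:
  assumes "a \<in> carrier (CM.C 0)" "b \<in> carrier (CN.C (Suc s))" "x \<in> I"
  shows "CP.\<iota> s x (cp 0 (Suc s) a b) = cp 0 s a (CN.\<iota> s x b)"
proof (rule extensionalityI[where A = "tuples CM.R s"])
  fix ys assume ys: "ys \<in> tuples CM.R s"
  then have "cp 0 s a (CN.\<iota> s x b) ys \<in> carrier P"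
    using assms by (intro cup_apply_closed) auto
  then show "CP.\<iota> s x (cp 0 (Suc s) a b) ys = cp 0 s a (CN.\<iota> s x b) ys"
    using cup_apply_snd[OF assms, of ys] cup_apply[of "x # ys" 0 "Suc s" a b] assms(3) ys
    unfolding shuffle_perms_0_Suc by simp
qed (use cup_ext[of 0 s] in \<open>simp_all add: contract_def\<close>)

lemma contract_cup_Suc_Suc_apply:
  assumes "a \<in> carrier (CM.C (Suc r))" "b \<in> carrier (CN.C (Suc s))" "x \<in> I"
    "ys \<in> tuples CM.R (Suc (r + s))"
  shows "cp (Suc r) (Suc s) a b (x # ys)
    = cp r (Suc s) (CM.\<iota> r x a) b ys \<oplus>\<^bsub>P\<^esub> [((- 1 :: int) ^ Suc r)] \<cdot>\<^bsub>P\<^esub> cp (Suc r) s a (CN.\<iota> s x b) ys"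
proof -
  let ?A = "shift_perm ` shuffle_perms r (Suc s)"
  let ?B = "(\<lambda>\<tau>. shift_perm \<tau> \<circ> front_cycle (Suc r)) ` shuffle_perms (Suc r) s"
  have xys: "x # ys \<in> tuples CM.R (Suc r + Suc s)" using assms by simp
  have cl: "cup_summand (Suc r) (Suc s) a b (x # ys) \<sigma> \<in> carrier P" if "\<sigma> \<in> ?A \<union> ?B" for \<sigma>
    using that unfolding shuffle_perms_Suc_Suc[symmetric]
    by (intro cup_summand_closed assms(1,2) xys)
  have "cp (Suc r) (Suc s) a b (x # ys) = (\<Oplus>\<^bsub>P\<^esub>\<sigma>\<in>?A \<union> ?B. cup_summand (Suc r) (Suc s) a b (x # ys) \<sigma>)"
    unfolding cup_apply[OF xys] shuffle_perms_Suc_Suc ..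
  also have "\<dots> = (\<Oplus>\<^bsub>P\<^esub>\<sigma>\<in>?A. cup_summand (Suc r) (Suc s) a b (x # ys) \<sigma>)
      \<oplus>\<^bsub>P\<^esub> (\<Oplus>\<^bsub>P\<^esub>\<sigma>\<in>?B. cup_summand (Suc r) (Suc s) a b (x # ys) \<sigma>)"
    by (rule P.M.finsum_Un_disjoint[OF _ _ shuffle_perms_disjoint])
      (use cl finite_shuffle_perms in \<open>blast+\<close>)
  also have "(\<Oplus>\<^bsub>P\<^esub>\<sigma>\<in>?A. cup_summand (Suc r) (Suc s) a b (x # ys) \<sigma>) = cp r (Suc s) (CM.\<iota> r x a) b ys"
    by (rule cup_apply_fst) (use assms in auto)
  also have "(\<Oplus>\<^bsub>P\<^esub>\<sigma>\<in>?B. cup_summand (Suc r) (Suc s) a b (x # ys) \<sigma>)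
      = [((- 1 :: int) ^ Suc r)] \<cdot>\<^bsub>P\<^esub> cp (Suc r) s a (CN.\<iota> s x b) ys"
    by (rule cup_apply_snd) (use assms in auto)
  finally show ?thesis .
qed

text \<open>The closure premise serves to evaluate the signed summand;
  \<open>contract_cup_Suc_Suc\<close> drops it once \<open>cup_closed\<close> is known.\<close>

lemma contract_cup_Suc_Suc_aux:
  assumes "a \<in> carrier (CM.C (Suc r))" "b \<in> carrier (CN.C (Suc s))" "x \<in> I"
    and closed: "cp (Suc r) s a (CN.\<iota> s x b) \<in> carrier (CP.C (Suc (r + s)))"
  shows "CP.\<iota> (Suc (r + s)) x (cp (Suc r) (Suc s) a b)
    = cp r (Suc s) (CM.\<iota> r x a) b \<oplus>\<^bsub>CP.C (Suc (r + s))\<^esub> [((- 1 :: int) ^ Suc r)] \<cdot>\<^bsub>CP.C (Suc (r + s))\<^esub>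
      cp (Suc r) s a (CN.\<iota> s x b)"
proof (rule extensionalityI[where A = "tuples CM.R (Suc (r + s))"])
  fix ys assume ys: "ys \<in> tuples CM.R (Suc (r + s))"
  show "CP.\<iota> (Suc (r + s)) x (cp (Suc r) (Suc s) a b) ys
    = (cp r (Suc s) (CM.\<iota> r x a) b \<oplus>\<^bsub>CP.C (Suc (r + s))\<^esub> [((- 1 :: int) ^ Suc r)] \<cdot>\<^bsub>CP.C (Suc (r + s))\<^esub>
      cp (Suc r) s a (CN.\<iota> s x b)) ys"
    unfolding CP.contract_apply[OF ys] contract_cup_Suc_Suc_apply[OF assms(1-3) ys]
    by (simp only: CP.C_eval[OF ys] CP.C_sign_eval[OF closed ys])
qed (simp_all add: contract_def CP.C_simps)

end

context ideal_pairing
begin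

lemma cup_closed [simp, intro]:
  assumes "a \<in> carrier (CM.C r)" "b \<in> carrier (CN.C s)"
  shows "cp r s a b \<in> carrier (CP.C (r + s))"
  using assms
proof (induction "r + s" arbitrary: r s a b rule: less_induct)
  case less
  note a = less.prems(1) and b = less.prems(2)
  consider (OO) "r = 0" "s = 0" | (S0) r' where "r = Suc r'" "s = 0" | (OS) s' where "r = 0" "s
    = Suc s'"
    | (SS) r' s' where "r = Suc r'" "s = Suc s'"
    by (cases r; cases s) auto
  then show ?case
  proof cases
    case OO
    then show ?thesis
      using a b cup_ext[of 0 0 a b] cup_apply_closed[of a 0 b 0 "[]"] by (auto intro!: CP.C_0I)
  next
    case S0
    have IH: "cp r' 0 a' b \<in> carrier (CP.C r')" if "a' \<in> carrier (CM.C r')" for a'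
      using less.hyps[of r' 0 a' b] b S0 that by simp
    have rec: "CP.\<iota> r' x (cp (Suc r') 0 a b) = cp r' 0 (CM.\<iota> r' x a) b" if "x \<in> I" for x
      using contract_cup_Suc_0 a b S0 that by blast
    have "cp (Suc r') 0 a b \<in> carrier (CP.C (Suc r'))"
    proof (rule CP.C_SucI)
      show "CP.\<iota> m x (CP.\<iota> r' x (cp (Suc r') 0 a b)) = \<zero>\<^bsub>CP.C m\<^esub>" if "r' = Suc m" "x \<in> I" for m x
        unfolding rec[OF that(2)]
        using that a b S0 contract_cup_Suc_0[of "CM.\<iota> r' x a" m b x] CM.contract_self[of a m x]
        by (simp add: cup_zero[where s = 0, simplified])
    qed (use a b S0 IH cup_ext[of "Suc r'" 0] in
        \<open>simp_all add: rec CM.contract_add_left CM.contract_smult_left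
          cup_add_left[where s = 0, simplified] cup_smult_left[where s = 0, simplified]\<close>)
    then show ?thesis using S0 by simp
  next
    case OS
    have IH: "cp 0 s' a b' \<in> carrier (CP.C s')" if "b' \<in> carrier (CN.C s')" for b'
      using less.hyps[of 0 s' a b'] a OS that by simp
    have rec: "CP.\<iota> s' x (cp 0 (Suc s') a b) = cp 0 s' a (CN.\<iota> s' x b)" if "x \<in> I" for x
      using contract_cup_0_Suc a b OS that by blast
    have "cp 0 (Suc s') a b \<in> carrier (CP.C (Suc s'))"
    proof (rule CP.C_SucI)
      show "CP.\<iota> m x (CP.\<iota> s' x (cp 0 (Suc s') a b)) = \<zero>\<^bsub>CP.C m\<^esub>" if "s' = Suc m" "x \<in> I" for m x
        unfolding rec[OF that(2)]
        using that a b OS contract_cup_0_Suc[of a "CN.\<iota> s' x b" m x] CN.contract_self[of b m x]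
        by (simp add: cup_zero[where r = 0, simplified])
    qed (use a b OS IH cup_ext[of 0 "Suc s'"] in
        \<open>simp_all add: rec CN.contract_add_left CN.contract_smult_left
          cup_add_right[where r = 0, simplified] cup_smult_right[where r = 0, simplified]\<close>)
    then show ?thesis using OS by simp
  next
    case SS
    let ?r = "Suc r'" and ?s = "Suc s'" and ?n = "Suc (r' + s')"
    have a: "a \<in> carrier (CM.C ?r)" and b: "b \<in> carrier (CN.C ?s)" using a b SS by auto
    have IH1: "cp r' ?s a' b \<in> carrier (CP.C ?n)" if "a' \<in> carrier (CM.C r')" for a'
      using less.hyps[of r' ?s a' b] SS b that by simp
    have IH2: "cp ?r s' a b' \<in> carrier (CP.C ?n)" if "b' \<in> carrier (CN.C s')" for b'
      using less.hyps[of ?r s' a b'] SS a that by simp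
    have rec: "CP.\<iota> ?n x (cp ?r ?s a b) = cp r' ?s (CM.\<iota> r' x a) b \<oplus>\<^bsub>CP.C ?n\<^esub>
       [((- 1 :: int) ^ ?r)] \<cdot>\<^bsub>CP.C ?n\<^esub> cp ?r s' a (CN.\<iota> s' x b)" if "x \<in> I" for x
      using a b that IH2 by (intro contract_cup_Suc_Suc_aux) auto
    have "cp ?r ?s a b \<in> carrier (CP.C (Suc ?n))"
    proof (rule CP.C_SucI)
      show "CP.\<iota> ?n x (cp ?r ?s a b) \<in> carrier (CP.C ?n)" if "x \<in> I" for x
        using that a b IH1 IH2 by (simp add: rec CP.C.add_pow_sign del: power_Suc)
      show "CP.\<iota> ?n (x \<oplus>\<^bsub>L\<^esub> y) (cp ?r ?s a b) = CP.\<iota> ?n x (cp ?r ?s a b)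
        \<oplus>\<^bsub>CP.C ?n\<^esub> CP.\<iota> ?n y (cp ?r ?s a b)"
        if "x \<in> I" "y \<in> I" for x y
        using that a b IH1 IH2
        by (simp add: rec CM.contract_add_left CN.contract_add_left cup_add_left cup_add_right
          CP.C.add_pow_sign CP.C.minus_add CP.C.add_middle del: power_Suc)
      show "CP.\<iota> ?n (c \<odot>\<^bsub>L\<^esub> x) (cp ?r ?s a b) = c \<odot>\<^bsub>CP.C ?n\<^esub> CP.\<iota> ?n x (cp ?r ?s a b)"
        if "x \<in> I" "c \<in> carrier F" for x c
        using that a b IH1 IH2
        by (simp add: rec CM.contract_smult_left CN.contract_smult_left cup_smult_left
          cup_smult_right CP.C.add_pow_sign CP.C.smult_r_distr CP.C.smult_r_minus del: power_Suc)
      show "CP.\<iota> m x (CP.\<iota> ?n x (cp ?r ?s a b)) = \<zero>\<^bsub>CP.C m\<^esub>" if m: "?n = Suc m" and x: "x \<in> I" for m x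
      proof -
        let ?a = "CM.\<iota> r' x a" and ?b = "CN.\<iota> s' x b"
        have m': "m = r' + s'" using m by simp
        have ab: "?a \<in> carrier (CM.C r')" "?b \<in> carrier (CN.C s')" using a b x by auto
        let ?z = "cp r' s' ?a ?b"
        have z: "?z \<in> carrier (CP.C m)"
          using less.hyps[of r' s' ?a ?b] SS ab m' by simp
        \<comment> \<open>In the double contraction \<open>?z\<close> arises twice: with sign
          \<open>(-1)^r'\<close> when \<open>a\<close> is contracted first, and with
          \<open>(-1)^(r'+1)\<close> when \<open>b\<close> is. These cancel, and terms in which one
          factor is contracted twice vanish. A factor of degree \<open>1\<close> is exhausted by one
          contraction, hence the cases.\<close>
        have 1: "CP.\<iota> m x (cp r' ?s ?a b) = [((- 1 :: int) ^ r')] \<cdot>\<^bsub>CP.C m\<^esub> ?z"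
        proof (cases r')
          case 0
          then show ?thesis
            using contract_cup_0_Suc[of ?a b s' x] ab b x m' z by simp
        next
          case (Suc k)
          have "cp r' s' ?a ?b \<in> carrier (CP.C (Suc (k + s')))" using z m' Suc by simp
          then have "CP.\<iota> m x (cp r' ?s ?a b) = cp k ?s (CM.\<iota> k x ?a) b
            \<oplus>\<^bsub>CP.C m\<^esub> [((- 1 :: int) ^ r')] \<cdot>\<^bsub>CP.C m\<^esub> ?z"
            using contract_cup_Suc_Suc_aux[of ?a k b s' x] ab b x m' Suc by simp
          also have "CM.\<iota> k x ?a = \<zero>\<^bsub>CM.C k\<^esub>"
            using CM.contract_self[of a k x] a x Suc by simp
          also have "cp k ?s \<zero>\<^bsub>CM.C k\<^esub> b = \<zero>\<^bsub>CP.C m\<^esub>"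
            using cup_zero(1)[OF b, of k] m' Suc by simp
          finally show ?thesis using z by (simp add: CP.C.add_pow_sign del: power_Suc)
        qed
        have 2: "CP.\<iota> m x (cp ?r s' a ?b) = ?z"
        proof (cases s')
          case 0
          then show ?thesis
            using contract_cup_Suc_0[of a r' ?b x] ab a x m' z by simp
        next
          case (Suc k)
          have bz: "CN.\<iota> k x ?b = \<zero>\<^bsub>CN.C k\<^esub>"
            using CN.contract_self[of b k x] b x Suc by simp
          have az: "cp ?r k a \<zero>\<^bsub>CN.C k\<^esub> = \<zero>\<^bsub>CP.C m\<^esub>"
            using cup_zero(2)[OF a, of k] m' Suc by simp
          have "CP.\<iota> m x (cp ?r s' a ?b) = ?z
            \<oplus>\<^bsub>CP.C m\<^esub> [((- 1 :: int) ^ ?r)] \<cdot>\<^bsub>CP.C m\<^esub> cp ?r k a (CN.\<iota> k x ?b)"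
            using contract_cup_Suc_Suc_aux[of a r' ?b k x] ab a x m' Suc unfolding bz az by simp
          also have "\<dots> = ?z"
            using z unfolding bz az by (simp add: CP.C.add_pow_sign del: power_Suc)
          finally show ?thesis .
        qed
        have m2: "CP.C ?n = CP.C (Suc m)" using m by simp
        have c1: "cp r' ?s ?a b \<in> carrier (CP.C (Suc m))" "cp ?r s' a ?b \<in> carrier (CP.C (Suc m))"
          using IH1[OF ab(1)] IH2[OF ab(2)] m by simp_all
        have "CP.\<iota> m x (CP.\<iota> ?n x (cp ?r ?s a b))
          = CP.\<iota> m x (cp r' ?s ?a b) \<oplus>\<^bsub>CP.C m\<^esub> [((- 1 :: int) ^ ?r)] \<cdot>\<^bsub>CP.C m\<^esub> CP.\<iota> m x (cp ?r s' a ?b)"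
          unfolding rec[OF x] m2 using c1 x
          by (simp add: CP.C.add_pow_sign CP.contract_add CP.contract_minus del: power_Suc)
        also have "\<dots> = \<zero>\<^bsub>CP.C m\<^esub>"
          unfolding 1 2 using z by (simp add: CP.C.add_pow_sign CP.C.l_neg CP.C.r_neg del: power_Suc)
        finally show ?thesis .
      qed
    qed (use cup_ext[of ?r ?s a b] in simp)
    then show ?thesis using SS by simp
  qed
qed

lemma contract_cup_Suc_Suc:
  assumes "a \<in> carrier (CM.C (Suc r))" "b \<in> carrier (CN.C (Suc s))" "x \<in> I"
  shows "CP.\<iota> (Suc (r + s)) x (cp (Suc r) (Suc s) a b)
    = cp r (Suc s) (CM.\<iota> r x a) b \<oplus>\<^bsub>CP.C (Suc (r + s))\<^esub> [((- 1 :: int) ^ Suc r)] \<cdot>\<^bsub>CP.C (Suc (r + s))\<^esub>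
      cp (Suc r) s a (CN.\<iota> s x b)"
  using assms cup_closed[of a "Suc r" "CN.\<iota> s x b" s] by (intro contract_cup_Suc_Suc_aux) auto

text \<open>Closure restated with degrees in the normal form that simplification produces.\<close>

lemma cup_closed' [simp, intro]:
  "a \<in> carrier (CM.C (Suc r)) \<Longrightarrow> b \<in> carrier (CN.C s) \<Longrightarrow> cp (Suc r) s a b \<in> carrier (CP.C (Suc (r + s)))"
  "a \<in> carrier (CM.C r) \<Longrightarrow> b \<in> carrier (CN.C (Suc s)) \<Longrightarrow> cp r (Suc s) a b \<in> carrier (CP.C (Suc (r + s)))"
  "a \<in> carrier (CM.C 0) \<Longrightarrow> b \<in> carrier (CN.C s) \<Longrightarrow> cp 0 s a b \<in> carrier (CP.C s)"
  "a \<in> carrier (CM.C r) \<Longrightarrow> b \<in> carrier (CN.C 0) \<Longrightarrow> cp r 0 a b \<in> carrier (CP.C r)"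
  "a \<in> carrier (CM.C (Suc r)) \<Longrightarrow> b \<in> carrier (CN.C (Suc s))
    \<Longrightarrow> cp (Suc r) (Suc s) a b \<in> carrier (CP.C (Suc (Suc (r + s))))"
  using cup_closed[of a "Suc r" b s] cup_closed[of a r b "Suc s"] cup_closed[of a 0 b s]
    cup_closed[of a r b 0]
    cup_closed[of a "Suc r" b "Suc s"] by simp_all

lemma cup_minus:
  assumes "a \<in> carrier (CM.C r)" "b \<in> carrier (CN.C s)"
  shows "cp r s (\<ominus>\<^bsub>CM.C r\<^esub> a) b = \<ominus>\<^bsub>CP.C (r + s)\<^esub> cp r s a b"
    "cp r s a (\<ominus>\<^bsub>CN.C s\<^esub> b) = \<ominus>\<^bsub>CP.C (r + s)\<^esub> cp r s a b"
proof -
  have "cp r s (\<ominus>\<^bsub>CM.C r\<^esub> a) b \<oplus>\<^bsub>CP.C (r + s)\<^esub> cp r s a b = \<zero>\<^bsub>CP.C (r + s)\<^esub>"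
    using cup_add_left[of "\<ominus>\<^bsub>CM.C r\<^esub> a" r a b s] assms by (simp add: CM.C.l_neg cup_zero)
  then show "cp r s (\<ominus>\<^bsub>CM.C r\<^esub> a) b = \<ominus>\<^bsub>CP.C (r + s)\<^esub> cp r s a b"
    using assms by (simp add: CP.C.minus_equality)
  have "cp r s a (\<ominus>\<^bsub>CN.C s\<^esub> b) \<oplus>\<^bsub>CP.C (r + s)\<^esub> cp r s a b = \<zero>\<^bsub>CP.C (r + s)\<^esub>"
    using cup_add_right[of a r "\<ominus>\<^bsub>CN.C s\<^esub> b" s b] assms by (simp add: CN.C.l_neg cup_zero)
  then show "cp r s a (\<ominus>\<^bsub>CN.C s\<^esub> b) = \<ominus>\<^bsub>CP.C (r + s)\<^esub> cp r s a b"
    using assms by (simp add: CP.C.minus_equality)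
qed

lemma cup_diff_left:
  assumes "a \<in> carrier (CM.C r)" "a' \<in> carrier (CM.C r)" "b \<in> carrier (CN.C s)"
  shows "cp r s (a \<ominus>\<^bsub>CM.C r\<^esub> a') b = cp r s a b \<ominus>\<^bsub>CP.C (r + s)\<^esub> cp r s a' b"
  using assms by (simp add: a_minus_def cup_add_left cup_minus)

lemma cup_diff_right:
  assumes "a \<in> carrier (CM.C r)" "b \<in> carrier (CN.C s)" "b' \<in> carrier (CN.C s)"
  shows "cp r s a (b \<ominus>\<^bsub>CN.C s\<^esub> b') = cp r s a b \<ominus>\<^bsub>CP.C (r + s)\<^esub> cp r s a b'"
  using assms by (simp add: a_minus_def cup_add_right cup_minus)

section \<open>Theta and the differential on cup products\<close>

lemma cup_0_0_Nil:
  assumes "a \<in> carrier (CM.C 0)" "b \<in> carrier (CN.C 0)"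
  shows "cp 0 0 a b [] = \<mu> (a []) (b [])"
  using CM.C_closed[OF assms(1), of "[]"] CN.C_closed[OF assms(2), of "[]"]
  by (simp add: cup_def shuffle_perms_0_0 CM.tuples_0)

text \<open>The base case is the equivariance of \<mu>. Above it, both sides obey the same
  recursion, by \<open>contract_theta\<close> and the product rule for contraction.\<close>

lemma theta_cup:
  assumes "a \<in> carrier (CM.C r)" "b \<in> carrier (CN.C s)" "x \<in> carrier L"
  shows "CP.\<theta> (r + s) x (cp r s a b)
    = cp r s (CM.\<theta> r x a) b \<oplus>\<^bsub>CP.C (r + s)\<^esub> cp r s a (CN.\<theta> s x b)"
  using assms(1,2)
proof (induction "r + s" arbitrary: r s a b rule: less_induct)
  case less
  note a = less.prems(1) and b = less.prems(2) and x = assms(3)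
  show ?case
  proof (cases rule: nat_pair_cases[of r s])
    case OO
    then show ?thesis
      using a b x CM.C_closed[of a 0 "[]"] CN.C_closed[of b 0 "[]"] cup_closed'(3)[of a b 0]
        cup_closed'(3)[of "CM.\<theta> 0 x a" b 0] cup_closed'(3)[of a "CN.\<theta> 0 x b" 0]
      by (simp, intro CP.C_eqI[where n = 0])
        (auto simp: CP.C_eval cup_0_0_Nil CM.theta_apply CN.theta_apply CP.theta_apply
          pair_equivariant CM.tuples_0)
  next
    case (SO r')
    have "CP.\<theta> (Suc r') x (cp (Suc r') 0 a b)
      = cp (Suc r') 0 (CM.\<theta> (Suc r') x a) b \<oplus>\<^bsub>CP.C (Suc r')\<^esub> cp (Suc r') 0 a (CN.\<theta> 0 x b)"
    proof (rule CP.contract_eqI[where n = r'])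
      fix z assume z: "z \<in> I"
      let ?a = "CM.\<iota> r' z a" and ?b = "CM.\<iota> r' (bracket L x z) a"
      have IH: "CP.\<theta> r' x (cp r' 0 ?a b) = cp r' 0 (CM.\<theta> r' x ?a) b \<oplus>\<^bsub>CP.C r'\<^esub> cp r' 0 ?a (CN.\<theta> 0 x b)"
        using less.hyps[of r' 0 ?a b] SO a b z by simp
      have c: "cp r' 0 (CM.\<theta> r' x ?a) b \<in> carrier (CP.C r')"
        "cp r' 0 ?a (CN.\<theta> 0 x b) \<in> carrier (CP.C r')"
        "cp r' 0 ?b b \<in> carrier (CP.C r')"
        using SO a b z x by auto
      have "CP.\<iota> r' z (CP.\<theta> (Suc r') x (cp (Suc r') 0 a b))
         = (cp r' 0 (CM.\<theta> r' x ?a) b \<oplus>\<^bsub>CP.C r'\<^esub> cp r' 0 ?a (CN.\<theta> 0 x b)) \<ominus>\<^bsub>CP.C r'\<^esub> cp r' 0 ?b b"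
        using SO a b z x by (simp add: CP.contract_theta contract_cup_Suc_0 IH)
      moreover have "CP.\<iota> r' z (cp (Suc r') 0 (CM.\<theta> (Suc r') x a) b
        \<oplus>\<^bsub>CP.C (Suc r')\<^esub> cp (Suc r') 0 a (CN.\<theta> 0 x b))
         = (cp r' 0 (CM.\<theta> r' x ?a) b \<ominus>\<^bsub>CP.C r'\<^esub> cp r' 0 ?b b) \<oplus>\<^bsub>CP.C r'\<^esub> cp r' 0 ?a (CN.\<theta> 0 x b)"
        using SO a b z x by (simp add: CP.contract_add contract_cup_Suc_0 CM.contract_theta
          cup_diff_left[where s = 0, simplified])
      ultimately show "CP.\<iota> r' z (CP.\<theta> (Suc r') x (cp (Suc r') 0 a b))
        = CP.\<iota> r' z (cp (Suc r') 0 (CM.\<theta> (Suc r') x a) b \<oplus>\<^bsub>CP.C (Suc r')\<^esub> cp (Suc r') 0 a (CN.\<theta> 0 x b))"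
        using c by (simp add: CP.C.ag_simps)
    qed (use SO a b x in auto)
    then show ?thesis using SO by simp
  next
    case (OS s')
    have "CP.\<theta> (Suc s') x (cp 0 (Suc s') a b)
      = cp 0 (Suc s') (CM.\<theta> 0 x a) b \<oplus>\<^bsub>CP.C (Suc s')\<^esub> cp 0 (Suc s') a (CN.\<theta> (Suc s') x b)"
    proof (rule CP.contract_eqI[where n = s'])
      fix z assume z: "z \<in> I"
      let ?a = "CN.\<iota> s' z b" and ?b = "CN.\<iota> s' (bracket L x z) b"
      have IH: "CP.\<theta> s' x (cp 0 s' a ?a) = cp 0 s' (CM.\<theta> 0 x a) ?a \<oplus>\<^bsub>CP.C s'\<^esub> cp 0 s' a (CN.\<theta> s' x ?a)"
        using less.hyps[of 0 s' a ?a] OS a b z by simp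
      have c: "cp 0 s' (CM.\<theta> 0 x a) ?a \<in> carrier (CP.C s')"
        "cp 0 s' a (CN.\<theta> s' x ?a) \<in> carrier (CP.C s')"
        "cp 0 s' a ?b \<in> carrier (CP.C s')"
        using OS a b z x by auto
      have "CP.\<iota> s' z (CP.\<theta> (Suc s') x (cp 0 (Suc s') a b))
         = (cp 0 s' (CM.\<theta> 0 x a) ?a \<oplus>\<^bsub>CP.C s'\<^esub> cp 0 s' a (CN.\<theta> s' x ?a)) \<ominus>\<^bsub>CP.C s'\<^esub> cp 0 s' a ?b"
        using OS a b z x by (simp add: CP.contract_theta contract_cup_0_Suc IH)
      moreover have "CP.\<iota> s' z (cp 0 (Suc s') (CM.\<theta> 0 x a) b
        \<oplus>\<^bsub>CP.C (Suc s')\<^esub> cp 0 (Suc s') a (CN.\<theta> (Suc s') x b))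
         = cp 0 s' (CM.\<theta> 0 x a) ?a \<oplus>\<^bsub>CP.C s'\<^esub> (cp 0 s' a (CN.\<theta> s' x ?a) \<ominus>\<^bsub>CP.C s'\<^esub> cp 0 s' a ?b)"
        using OS a b z x by (simp add: CP.contract_add contract_cup_0_Suc CN.contract_theta
          cup_diff_right[where r = 0, simplified])
      ultimately show "CP.\<iota> s' z (CP.\<theta> (Suc s') x (cp 0 (Suc s') a b))
        = CP.\<iota> s' z (cp 0 (Suc s') (CM.\<theta> 0 x a) b \<oplus>\<^bsub>CP.C (Suc s')\<^esub> cp 0 (Suc s') a (CN.\<theta> (Suc s') x b))"
        using c by (simp add: CP.C.ag_simps)
    qed (use OS a b x in auto)
    then show ?thesis using OS by simp
  next
    case (SS r' s')
    let ?r = "Suc r'" and ?s = "Suc s'" and ?n = "Suc (r' + s')"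
    have a: "a \<in> carrier (CM.C ?r)" and b: "b \<in> carrier (CN.C ?s)" using a b SS by auto
    have "CP.\<theta> (Suc ?n) x (cp ?r ?s a b)
      = cp ?r ?s (CM.\<theta> ?r x a) b \<oplus>\<^bsub>CP.C (Suc ?n)\<^esub> cp ?r ?s a (CN.\<theta> ?s x b)"
    proof (rule CP.contract_eqI[where n = ?n])
      fix z assume z: "z \<in> I"
      let ?a = "CM.\<iota> r' z a" and ?a' = "CM.\<iota> r' (bracket L x z) a"
      let ?b = "CN.\<iota> s' z b" and ?b' = "CN.\<iota> s' (bracket L x z) b"
      have c: "?a \<in> carrier (CM.C r')" "?a' \<in> carrier (CM.C r')" "?b \<in> carrier (CN.C s')"
        "?b' \<in> carrier (CN.C s')"
        using a b z x by auto
      have IH1: "CP.\<theta> ?n x (cp r' ?s ?a b) = cp r' ?s (CM.\<theta> r' x ?a) b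
        \<oplus>\<^bsub>CP.C ?n\<^esub> cp r' ?s ?a (CN.\<theta> ?s x b)"
        using less.hyps[of r' ?s ?a b] SS b c by simp
      have IH2: "CP.\<theta> ?n x (cp ?r s' a ?b) = cp ?r s' (CM.\<theta> ?r x a) ?b
        \<oplus>\<^bsub>CP.C ?n\<^esub> cp ?r s' a (CN.\<theta> s' x ?b)"
        using less.hyps[of ?r s' a ?b] SS a c by simp
      \<comment> \<open>With names for the six cochains that occur on both sides, the claim becomes
        an identity in an abelian group, decided for each parity of \<open>r'\<close>.\<close>
      define u1 u2 u3 v1 v2 v3 where
        u: "u1 = cp r' ?s (CM.\<theta> r' x ?a) b" "u2 = cp r' ?s ?a (CN.\<theta> ?s x b)" "u3 = cp r' ?s ?a' b" and
        v: "v1 = cp ?r s' (CM.\<theta> ?r x a) ?b" "v2 = cp ?r s' a (CN.\<theta> s' x ?b)" "v3 = cp ?r s' a ?b'"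
      have cl: "u1 \<in> carrier (CP.C ?n)" "u2 \<in> carrier (CP.C ?n)" "u3 \<in> carrier (CP.C ?n)"
        "v1 \<in> carrier (CP.C ?n)" "v2 \<in> carrier (CP.C ?n)" "v3 \<in> carrier (CP.C ?n)"
        unfolding u v using a b c x by auto
      let ?sg = "\<lambda>w. [((- 1 :: int) ^ ?r)] \<cdot>\<^bsub>CP.C ?n\<^esub> w"
      have cl': "cp r' ?s ?a b \<in> carrier (CP.C ?n)" "cp ?r s' a ?b \<in> carrier (CP.C ?n)"
        using a b c by auto
      have sg: "CP.\<theta> ?n x (?sg w) = ?sg (CP.\<theta> ?n x w)" "?sg w \<in> carrier (CP.C ?n)"
        if "w \<in> carrier (CP.C ?n)" for w
        using that x by (simp_all add: CP.C.add_pow_sign CP.theta_minus del: power_Suc)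
      have "CP.\<iota> ?n z (CP.\<theta> (Suc ?n) x (cp ?r ?s a b))
         = (u1 \<oplus>\<^bsub>CP.C ?n\<^esub> u2) \<oplus>\<^bsub>CP.C ?n\<^esub> ?sg (v1 \<oplus>\<^bsub>CP.C ?n\<^esub> v2) \<ominus>\<^bsub>CP.C ?n\<^esub> (u3 \<oplus>\<^bsub>CP.C ?n\<^esub> ?sg v3)"
        unfolding u v using a b z x cl' sg
        by (simp add: CP.contract_theta contract_cup_Suc_Suc CP.theta_add IH1 IH2 del: power_Suc)
      moreover have "CP.\<iota> ?n z (cp ?r ?s (CM.\<theta> ?r x a) b \<oplus>\<^bsub>CP.C (Suc ?n)\<^esub> cp ?r ?s a (CN.\<theta> ?s x b))
         = (u1 \<ominus>\<^bsub>CP.C ?n\<^esub> u3) \<oplus>\<^bsub>CP.C ?n\<^esub> ?sg v1 \<oplus>\<^bsub>CP.C ?n\<^esub> (u2 \<oplus>\<^bsub>CP.C ?n\<^esub> ?sg (v2 \<ominus>\<^bsub>CP.C ?n\<^esub> v3))"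
        unfolding u v using a b z x c
        by (simp add: CP.contract_add contract_cup_Suc_Suc CM.contract_theta CN.contract_theta
          cup_diff_left cup_diff_right del: power_Suc)
      ultimately show "CP.\<iota> ?n z (CP.\<theta> (Suc ?n) x (cp ?r ?s a b))
        = CP.\<iota> ?n z (cp ?r ?s (CM.\<theta> ?r x a) b \<oplus>\<^bsub>CP.C (Suc ?n)\<^esub> cp ?r ?s a (CN.\<theta> ?s x b))"
        using cl by (cases "even r'") (simp_all add: CP.C.add_pow_minus_one CP.C.ag_simps)
    qed (use a b x in auto)
    then show ?thesis using SS by simp
  qed
qed

text \<open>After contraction with \<open>z\<close>, Cartan's formula leaves \<theta>_z of the
  product, covered by \<open>theta_cup\<close>, and \<open>d\<close> of the two summands of
  \<open>i_z (a \<union> b)\<close>, covered by the induction hypothesis in lower total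
  degree.\<close>

theorem d_cup:
  assumes "a \<in> carrier (CM.C r)" "b \<in> carrier (CN.C s)"
  shows "CP.d (r + s) (cp r s a b)
    = cp (Suc r) s (CM.d r a) b \<oplus>\<^bsub>CP.C (Suc (r + s))\<^esub> [((- 1 :: int) ^ r)] \<cdot>\<^bsub>CP.C (Suc (r + s))\<^esub> cp r
      (Suc s) a (CN.d s b)"
  using assms
proof (induction "r + s" arbitrary: r s a b rule: less_induct)
  case less
  note a = less.prems(1) and b = less.prems(2)
  show ?case
  proof (rule CP.contract_eqI[where n = "r + s"])
    fix z assume z: "z \<in> I"
    show "CP.\<iota> (r + s) z (CP.d (r + s) (cp r s a b)) = CP.\<iota> (r + s) z
        (cp (Suc r) s (CM.d r a) b \<oplus>\<^bsub>CP.C (Suc (r + s))\<^esub> [((- 1 :: int) ^ r)] \<cdot>\<^bsub>CP.C (Suc (r + s))\<^esub> cp r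
          (Suc s) a (CN.d s b))"
    proof (cases rule: nat_pair_cases[of r s])
      case OO
      then show ?thesis
        using a b z cup_closed'(3)[of a b 0] theta_cup[of a 0 b 0 z] cup_closed'(1)[of "CM.d 0 a" 0
          b 0] cup_closed'(2)[of a 0 "CN.d 0 b" 0]
        by (simp add: CP.contract_d_0 CP.contract_add contract_cup_Suc_0 contract_cup_0_Suc
          CM.contract_d_0 CN.contract_d_0)
    next
      case (SO r')
      have ac: "a \<in> carrier (CM.C (Suc r'))" and bc: "b \<in> carrier (CN.C 0)" using a b SO by auto
      let ?n = "Suc r'" and ?a = "CM.\<iota> r' z a"
      have IH: "CP.d r' (cp r' 0 ?a b) = cp (Suc r') 0 (CM.d r' ?a) b
        \<oplus>\<^bsub>CP.C ?n\<^esub> [((- 1 :: int) ^ r')] \<cdot>\<^bsub>CP.C ?n\<^esub> cp r' (Suc 0) ?a (CN.d 0 b)"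
        using less.hyps[of r' 0 ?a b] SO ac bc z by simp
      have th: "CP.\<theta> ?n z (cp ?n 0 a b) = cp ?n 0 (CM.\<theta> ?n z a) b \<oplus>\<^bsub>CP.C ?n\<^esub> cp ?n 0 a (CN.\<theta> 0 z b)"
        using theta_cup[of a ?n b 0 z] ac bc z by simp
      define u1 u2 v1 v2 where
        u: "u1 = cp ?n 0 (CM.\<theta> ?n z a) b" "u2 = cp ?n 0 a (CN.\<theta> 0 z b)" and
        v: "v1 = cp ?n 0 (CM.d r' ?a) b" "v2 = cp r' (Suc 0) ?a (CN.d 0 b)"
      have cl: "u1 \<in> carrier (CP.C ?n)" "u2 \<in> carrier (CP.C ?n)" "v1 \<in> carrier (CP.C ?n)"
        "v2 \<in> carrier (CP.C ?n)"
        unfolding u v using ac bc z cup_closed'(1)[of _ r' _ 0] cup_closed'(2)[of _ r' _ 0] by auto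
      have W: "cp ?n (Suc 0) a (CN.d 0 b) \<in> carrier (CP.C (Suc ?n))"
        "cp (Suc ?n) 0 (CM.d ?n a) b \<in> carrier (CP.C (Suc ?n))"
        using ac bc cup_closed[of a ?n "CN.d 0 b" "Suc 0"] cup_closed[of "CM.d ?n a" "Suc ?n" b 0]
          by simp_all
      have 1: "CP.\<iota> ?n z (CP.d ?n (cp ?n 0 a b)) = (u1 \<oplus>\<^bsub>CP.C ?n\<^esub> u2) \<ominus>\<^bsub>CP.C ?n\<^esub> (v1
        \<oplus>\<^bsub>CP.C ?n\<^esub> [((- 1 :: int) ^ r')] \<cdot>\<^bsub>CP.C ?n\<^esub> v2)"
        unfolding u v th[symmetric] IH[symmetric] using ac bc z
        by (simp add: CP.contract_d_Suc contract_cup_Suc_0)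
      have 2: "CP.\<iota> ?n z (cp (Suc ?n) 0 (CM.d ?n a) b) = u1 \<ominus>\<^bsub>CP.C ?n\<^esub> v1"
        unfolding u v using ac bc z by (simp add: contract_cup_Suc_0 CM.contract_d_Suc
          cup_diff_left[where s = 0, simplified])
      \<comment> \<open>Although \<open>b\<close> has degree \<open>0\<close>, \<open>d b\<close>
        has degree \<open>1\<close>, and its contraction is \<theta>_z of \<open>b\<close> by
        \<open>contract_d_0\<close>. This supplies the summand \<open>u2\<close> of the left
        side.\<close>
      have 3: "CP.\<iota> ?n z (cp ?n (Suc 0) a (CN.d 0 b)) = v2 \<oplus>\<^bsub>CP.C ?n\<^esub> [((- 1 :: int) ^ ?n)] \<cdot>\<^bsub>CP.C ?n\<^esub> u2"
        unfolding u v using contract_cup_Suc_Suc[of a r' "CN.d 0 b" 0 z] ac bc z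
          by (simp add: CN.contract_d_0)
      have "CP.\<iota> ?n z (cp (Suc ?n) 0 (CM.d ?n a) b
        \<oplus>\<^bsub>CP.C (Suc ?n)\<^esub> [((- 1 :: int) ^ ?n)] \<cdot>\<^bsub>CP.C (Suc ?n)\<^esub> cp ?n (Suc 0) a (CN.d 0 b))
        = (u1 \<ominus>\<^bsub>CP.C ?n\<^esub> v1) \<oplus>\<^bsub>CP.C ?n\<^esub> [((- 1 :: int) ^ ?n)] \<cdot>\<^bsub>CP.C ?n\<^esub> (v2 \<oplus>\<^bsub>CP.C ?n\<^esub> [((- 1 :: int) ^
          ?n)] \<cdot>\<^bsub>CP.C ?n\<^esub> u2)"
        unfolding 2[symmetric] 3[symmetric] using W z
        by (simp add: CP.contract_add CP.C.add_pow_sign CP.contract_minus del: power_Suc)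
      also have "\<dots> = (u1 \<oplus>\<^bsub>CP.C ?n\<^esub> u2) \<ominus>\<^bsub>CP.C ?n\<^esub> (v1 \<oplus>\<^bsub>CP.C ?n\<^esub> [((- 1 :: int) ^ r')] \<cdot>\<^bsub>CP.C ?n\<^esub> v2)"
        using cl by (cases "even r'") (simp_all add: CP.C.add_pow_minus_one CP.C.ag_simps)
      finally show ?thesis using 1 SO by simp
    next
      case (OS s')
      have ac: "a \<in> carrier (CM.C 0)" and bc: "b \<in> carrier (CN.C (Suc s'))" using a b OS by auto
      let ?n = "Suc s'" and ?b = "CN.\<iota> s' z b"
      have IH: "CP.d s' (cp 0 s' a ?b) = cp (Suc 0) s' (CM.d 0 a) ?b \<oplus>\<^bsub>CP.C ?n\<^esub> cp 0 ?n a (CN.d s' ?b)"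
        using less.hyps[of 0 s' a ?b] OS ac bc z cup_closed'(2)[of a 0 "CN.d s' ?b" s'] by simp
      have th: "CP.\<theta> ?n z (cp 0 ?n a b) = cp 0 ?n (CM.\<theta> 0 z a) b \<oplus>\<^bsub>CP.C ?n\<^esub> cp 0 ?n a (CN.\<theta> ?n z b)"
        using theta_cup[of a 0 b ?n z] ac bc z by simp
      define u1 u2 v1 v2 where
        u: "u1 = cp 0 ?n (CM.\<theta> 0 z a) b" "u2 = cp 0 ?n a (CN.\<theta> ?n z b)" and
        v: "v1 = cp (Suc 0) s' (CM.d 0 a) ?b" "v2 = cp 0 ?n a (CN.d s' ?b)"
      have cl: "u1 \<in> carrier (CP.C ?n)" "u2 \<in> carrier (CP.C ?n)" "v1 \<in> carrier (CP.C ?n)"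
        "v2 \<in> carrier (CP.C ?n)"
        unfolding u v using ac bc z cup_closed'(1)[of _ 0 _ s'] cup_closed'(2)[of _ 0 _ s'] by auto
      have W: "cp (Suc 0) ?n (CM.d 0 a) b \<in> carrier (CP.C (Suc ?n))"
        "cp 0 (Suc ?n) a (CN.d ?n b) \<in> carrier (CP.C (Suc ?n))"
        using ac bc cup_closed[of "CM.d 0 a" "Suc 0" b ?n] cup_closed[of a 0 "CN.d ?n b" "Suc ?n"]
          by simp_all
      have 1: "CP.\<iota> ?n z (CP.d ?n (cp 0 ?n a b)) = (u1 \<oplus>\<^bsub>CP.C ?n\<^esub> u2) \<ominus>\<^bsub>CP.C ?n\<^esub> (v1 \<oplus>\<^bsub>CP.C ?n\<^esub> v2)"
        unfolding u v th[symmetric] IH[symmetric] using ac bc z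
        by (simp add: CP.contract_d_Suc contract_cup_0_Suc)
      have 2: "CP.\<iota> ?n z (cp (Suc 0) ?n (CM.d 0 a) b) = u1 \<ominus>\<^bsub>CP.C ?n\<^esub> v1"
        unfolding u v using contract_cup_Suc_Suc[of "CM.d 0 a" 0 b s' z] ac bc z cup_closed'(1)[of
          "CM.d 0 a" 0 ?b s']
        by (simp add: CM.contract_d_0 CP.C.add_pow_minus_one a_minus_def)
      have 3: "CP.\<iota> ?n z (cp 0 (Suc ?n) a (CN.d ?n b)) = u2 \<ominus>\<^bsub>CP.C ?n\<^esub> v2"
        unfolding u v using ac bc z by (simp add: contract_cup_0_Suc CN.contract_d_Suc
          cup_diff_right[where r = 0, simplified])
      have "CP.\<iota> ?n z (cp (Suc 0) ?n (CM.d 0 a) b \<oplus>\<^bsub>CP.C (Suc ?n)\<^esub> cp 0 (Suc ?n) a (CN.d ?n b))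
        = (u1 \<ominus>\<^bsub>CP.C ?n\<^esub> v1) \<oplus>\<^bsub>CP.C ?n\<^esub> (u2 \<ominus>\<^bsub>CP.C ?n\<^esub> v2)"
        unfolding 2[symmetric] 3[symmetric] using W z by (simp add: CP.contract_add)
      also have "\<dots> = (u1 \<oplus>\<^bsub>CP.C ?n\<^esub> u2) \<ominus>\<^bsub>CP.C ?n\<^esub> (v1 \<oplus>\<^bsub>CP.C ?n\<^esub> v2)"
        using cl by (simp add: CP.C.minus_add_minus)
      finally show ?thesis using 1 OS W by simp
    next
      case (SS r' s')
      let ?r = "Suc r'" and ?s = "Suc s'" and ?m = "Suc (r' + s')"
      let ?n = "Suc ?m"
      have ac: "a \<in> carrier (CM.C ?r)" and bc: "b \<in> carrier (CN.C ?s)" using a b SS by auto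
      let ?a = "CM.\<iota> r' z a" and ?b = "CN.\<iota> s' z b"
      have c: "?a \<in> carrier (CM.C r')" "?b \<in> carrier (CN.C s')" using ac bc z by auto
      let ?sg = "\<lambda>k w. [((- 1 :: int) ^ k)] \<cdot>\<^bsub>CP.C ?n\<^esub> w"
      define u1 u2 v1 v2 w1 w2 where
        u: "u1 = cp ?r ?s (CM.\<theta> ?r z a) b" "u2 = cp ?r ?s a (CN.\<theta> ?s z b)" and
        v: "v1 = cp ?r ?s (CM.d r' ?a) b" "v2 = cp r' (Suc ?s) ?a (CN.d ?s b)" and
        w: "w1 = cp (Suc ?r) s' (CM.d ?r a) ?b" "w2 = cp ?r ?s a (CN.d s' ?b)"
      have cl: "u1 \<in> carrier (CP.C ?n)" "u2 \<in> carrier (CP.C ?n)" "v1 \<in> carrier (CP.C ?n)"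
        "v2 \<in> carrier (CP.C ?n)"
         "w1 \<in> carrier (CP.C ?n)" "w2 \<in> carrier (CP.C ?n)"
        unfolding u v w using ac bc c z cup_closed[of _ ?r _ ?s] cup_closed[of _ r' _ "Suc ?s"]
          cup_closed[of _ "Suc ?r" _ s'] by auto
      have IH1: "CP.d ?m (cp r' ?s ?a b) = v1 \<oplus>\<^bsub>CP.C ?n\<^esub> ?sg r' v2"
        using less.hyps[of r' ?s ?a b] SS bc c by (simp add: v)
      have IH2: "CP.d ?m (cp ?r s' a ?b) = w1 \<oplus>\<^bsub>CP.C ?n\<^esub> ?sg ?r w2"
        using less.hyps[of ?r s' a ?b] SS ac c by (simp add: w)
      have th: "CP.\<theta> ?n z (cp ?r ?s a b) = u1 \<oplus>\<^bsub>CP.C ?n\<^esub> u2"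
        using theta_cup[of a ?r b ?s z] ac bc z by (simp add: u)
      have cc: "cp ?r ?s a b \<in> carrier (CP.C ?n)" "cp r' ?s ?a b \<in> carrier (CP.C ?m)"
        "cp ?r s' a ?b \<in> carrier (CP.C ?m)"
        using ac bc c cup_closed[of a ?r b ?s] by auto
      have W: "cp (Suc ?r) ?s (CM.d ?r a) b \<in> carrier (CP.C (Suc ?n))"
        "cp ?r (Suc ?s) a (CN.d ?s b) \<in> carrier (CP.C (Suc ?n))"
        using ac bc cup_closed[of "CM.d ?r a" "Suc ?r" b ?s] cup_closed[of a ?r "CN.d ?s b"
          "Suc ?s"] by simp_all
      have "CP.d ?m (CP.\<iota> ?m z (cp ?r ?s a b)) = CP.d ?m (cp r' ?s ?a b)
        \<oplus>\<^bsub>CP.C ?n\<^esub> ?sg ?r (CP.d ?m (cp ?r s' a ?b))"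
        using ac bc z cc by (simp add: contract_cup_Suc_Suc CP.d_add CP.d_minus CP.C.add_pow_sign
          del: power_Suc)
      then have 1: "CP.\<iota> ?n z (CP.d ?n (cp ?r ?s a b))
        = (u1 \<oplus>\<^bsub>CP.C ?n\<^esub> u2) \<ominus>\<^bsub>CP.C ?n\<^esub> ((v1 \<oplus>\<^bsub>CP.C ?n\<^esub> ?sg r' v2) \<oplus>\<^bsub>CP.C ?n\<^esub> ?sg ?r (w1 \<oplus>\<^bsub>CP.C ?n\<^esub> ?sg ?r w2))"
        using CP.contract_d_Suc[OF cc(1) z] unfolding th IH1 IH2 by simp
      have 2: "CP.\<iota> ?n z (cp (Suc ?r) ?s (CM.d ?r a) b) = (u1 \<ominus>\<^bsub>CP.C ?n\<^esub> v1) \<oplus>\<^bsub>CP.C ?n\<^esub> ?sg (Suc ?r) w1"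
        unfolding u v w using contract_cup_Suc_Suc[of "CM.d ?r a" ?r b s' z] cup_diff_left[of
          "CM.\<theta> ?r z a" ?r "CM.d r' ?a" b ?s] ac bc c z
        by (simp add: CM.contract_d_Suc del: power_Suc)
      have 3: "CP.\<iota> ?n z (cp ?r (Suc ?s) a (CN.d ?s b)) = v2 \<oplus>\<^bsub>CP.C ?n\<^esub> ?sg ?r (u2 \<ominus>\<^bsub>CP.C ?n\<^esub> w2)"
        unfolding u v w using contract_cup_Suc_Suc[of a r' "CN.d ?s b" ?s z] cup_diff_right[of a ?r
          "CN.\<theta> ?s z b" ?s "CN.d s' ?b"] ac bc c z
        by (simp add: CN.contract_d_Suc del: power_Suc)
      have "CP.\<iota> ?n z (cp (Suc ?r) ?s (CM.d ?r a) b
        \<oplus>\<^bsub>CP.C (Suc ?n)\<^esub> [((- 1 :: int) ^ ?r)] \<cdot>\<^bsub>CP.C (Suc ?n)\<^esub> cp ?r (Suc ?s) a (CN.d ?s b))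
        = ((u1 \<ominus>\<^bsub>CP.C ?n\<^esub> v1) \<oplus>\<^bsub>CP.C ?n\<^esub> ?sg (Suc ?r) w1) \<oplus>\<^bsub>CP.C ?n\<^esub> ?sg ?r (v2 \<oplus>\<^bsub>CP.C ?n\<^esub> ?sg ?r (u2
          \<ominus>\<^bsub>CP.C ?n\<^esub> w2))"
        unfolding 2[symmetric] 3[symmetric] using W z
        by (simp add: CP.contract_add CP.C.add_pow_sign CP.contract_minus del: power_Suc)
      also have "\<dots> = (u1 \<oplus>\<^bsub>CP.C ?n\<^esub> u2) \<ominus>\<^bsub>CP.C ?n\<^esub> ((v1 \<oplus>\<^bsub>CP.C ?n\<^esub> ?sg r' v2) \<oplus>\<^bsub>CP.C ?n\<^esub> ?sg ?r (w1
        \<oplus>\<^bsub>CP.C ?n\<^esub> ?sg ?r w2))"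
        using cl by (cases "even r'") (simp_all add: CP.C.add_pow_minus_one CP.C.ag_simps)
      finally show ?thesis using 1 SS by simp
    qed
  qed (use a b cup_closed[of a r "CN.d s b" "Suc s"] cup_closed[of "CM.d r a" "Suc r" b s] in
    \<open>simp_all add: CP.C.add_pow_sign\<close>)
qed

end

section \<open>Subquotients of modules\<close>

context module
begin

lemma submodule_abelian_subgroup: "submodule B R M \<Longrightarrow> abelian_subgroup B M"
  by (intro abelian_subgroupI3 additive_subgroup.intro)
    (auto simp: submodule_def abelian_group_axioms)

lemma coset_add:
  assumes "submodule B R M" "x \<in> carrier M" "y \<in> carrier M"
  shows "(B +>\<^bsub>M\<^esub> x) <+>\<^bsub>M\<^esub> (B +>\<^bsub>M\<^esub> y) = B +>\<^bsub>M\<^esub> (x \<oplus>\<^bsub>M\<^esub> y)"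
  using abelian_subgroup.a_rcos_sum[OF submodule_abelian_subgroup] assms by blast

lemma mem_coset_iff:
  assumes "submodule B R M" "x \<in> carrier M"
  shows "y \<in> B +>\<^bsub>M\<^esub> x \<longleftrightarrow> y \<in> carrier M \<and> y \<ominus>\<^bsub>M\<^esub> x \<in> B"
proof -
  interpret abelian_subgroup B M by (rule submodule_abelian_subgroup[OF assms(1)])
  show ?thesis
    using a_rcos_module[of x y] a_elemrcos_carrier[of x y] assms(2) M.abelian_group_axioms
    unfolding a_minus_def by blast
qed

lemma coset_eq_iff:
  assumes "submodule B R M" "x \<in> carrier M" "y \<in> carrier M"
  shows "B +>\<^bsub>M\<^esub> x = B +>\<^bsub>M\<^esub> y \<longleftrightarrow> x \<ominus>\<^bsub>M\<^esub> y \<in> B"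
proof -
  interpret abelian_subgroup B M by (rule submodule_abelian_subgroup[OF assms(1)])
  show ?thesis
    using mem_coset_iff[OF assms(1,3)] assms(2) a_rcos_self[OF assms(2)] a_repr_independence'[of x
      y] assms(3) by metis
qed

lemma coset_self: "submodule B R M \<Longrightarrow> x \<in> carrier M \<Longrightarrow> x \<in> B +>\<^bsub>M\<^esub> x"
  by (simp add: mem_coset_iff submoduleD)

lemma coset_memE:
  assumes "submodule B R M" "x \<in> carrier M" "y \<in> B +>\<^bsub>M\<^esub> x"
  obtains b where "b \<in> B" "y = x \<oplus>\<^bsub>M\<^esub> b" "y \<in> carrier M"
proof (rule that)
  show "y \<ominus>\<^bsub>M\<^esub> x \<in> B" "y \<in> carrier M" using assms by (simp_all add: mem_coset_iff)
  then show "y = x \<oplus>\<^bsub>M\<^esub> (y \<ominus>\<^bsub>M\<^esub> x)" using assms by (simp add: M.ag_simps)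
qed

lemma coset_zero: "submodule B R M \<Longrightarrow> B +>\<^bsub>M\<^esub> \<zero>\<^bsub>M\<^esub> = B"
  by (rule M.a_coset_add_zero) (simp add: submoduleD)

lemma coset_of_mem: "submodule B R M \<Longrightarrow> x \<in> B \<Longrightarrow> B +>\<^bsub>M\<^esub> x = B"
  using coset_eq_iff[of B x "\<zero>\<^bsub>M\<^esub>"] submoduleD(1)[of B] by (auto simp: coset_zero)

lemma coset_add_mem: "submodule B R M \<Longrightarrow> x \<in> carrier M \<Longrightarrow> b \<in> B \<Longrightarrow> B +>\<^bsub>M\<^esub> (x \<oplus>\<^bsub>M\<^esub> b) = B +>\<^bsub>M\<^esub> x"
  using submoduleD(1)[of B] by (subst coset_eq_iff) (auto simp: M.minus_simps a_minus_def M.a_ac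
    M.r_neg M.r_neg1 M.r_neg2)

text \<open>Maps on quotients are unions over representatives; well-definedness means that all
  members of the union agree, and then the union collapses.\<close>

lemma UN_const_eq: "A \<noteq> {} \<Longrightarrow> (\<And>x. x \<in> A \<Longrightarrow> f x = c) \<Longrightarrow> (\<Union>x\<in>A. f x) = c"
  by auto

lemma subquotient_smult:
  assumes "submodule B R M" "x \<in> carrier M" "a \<in> carrier R"
  shows "a \<odot>\<^bsub>subquotient M Z B\<^esub> (B +>\<^bsub>M\<^esub> x) = B +>\<^bsub>M\<^esub> (a \<odot>\<^bsub>M\<^esub> x)"
proof -
  have "(\<Union>y\<in>B +>\<^bsub>M\<^esub> x. B +>\<^bsub>M\<^esub> (a \<odot>\<^bsub>M\<^esub> y)) = B +>\<^bsub>M\<^esub> (a \<odot>\<^bsub>M\<^esub> x)"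
  proof (rule UN_const_eq)
    show "B +>\<^bsub>M\<^esub> x \<noteq> {}" using coset_self[OF assms(1,2)] by auto
    fix y assume "y \<in> B +>\<^bsub>M\<^esub> x"
    then obtain b where b: "b \<in> B" "y = x \<oplus>\<^bsub>M\<^esub> b" using assms by (rule_tac coset_memE) auto
    then have "a \<odot>\<^bsub>M\<^esub> b \<in> B" "b \<in> carrier M" using assms submoduleD[of B] by auto
    then show "B +>\<^bsub>M\<^esub> (a \<odot>\<^bsub>M\<^esub> y) = B +>\<^bsub>M\<^esub> (a \<odot>\<^bsub>M\<^esub> x)"
      using assms b by (simp add: smult_r_distr coset_add_mem)
  qed
  then show ?thesis by (simp add: subquotient_def)
qed

lemma subquotient_simps:
  "carrier (subquotient M Z B) = (\<lambda>z. B +>\<^bsub>M\<^esub> z) ` Z" "\<zero>\<^bsub>subquotient M Z B\<^esub> = B"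
  "X \<oplus>\<^bsub>subquotient M Z B\<^esub> Y = X <+>\<^bsub>M\<^esub> Y"
  by (simp_all add: subquotient_def)

lemma subquotient_module:
  assumes B: "submodule B R M" and Z: "submodule Z R M"
  shows "module R (subquotient M Z B)"
proof -
  note [simp] = subquotient_simps subquotient_smult[OF B] coset_add[OF B]
  have Zc: "z \<in> carrier M" if "z \<in> Z" for z using submoduleD(1)[OF Z] that by auto
  have B0: "B = B +>\<^bsub>M\<^esub> \<zero>\<^bsub>M\<^esub>" using coset_zero[OF B] by simp
  show ?thesis
  proof (rule moduleI[OF R.is_cring abelian_groupI])
    fix X assume "X \<in> carrier (subquotient M Z B)"
    then obtain x where x: "x \<in> Z" "X = B +>\<^bsub>M\<^esub> x" by auto
    have "(B +>\<^bsub>M\<^esub> \<ominus>\<^bsub>M\<^esub> x) <+>\<^bsub>M\<^esub> X = B"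
      using x Zc by (simp add: M.l_neg coset_zero[OF B])
    moreover have "B +>\<^bsub>M\<^esub> \<ominus>\<^bsub>M\<^esub> x \<in> carrier (subquotient M Z B)"
      using x submoduleD(3)[OF Z] by auto
    ultimately show "\<exists>Y\<in>carrier (subquotient M Z B). Y \<oplus>\<^bsub>subquotient M Z B\<^esub> X = \<zero>\<^bsub>subquotient M Z B\<^esub>"
      unfolding subquotient_simps(2,3) by blast
    show "\<zero>\<^bsub>subquotient M Z B\<^esub> \<oplus>\<^bsub>subquotient M Z B\<^esub> X = X"
      using x Zc coset_add[OF B, of "\<zero>\<^bsub>M\<^esub>" x] by (simp add: coset_zero[OF B])
  next
    show "\<zero>\<^bsub>subquotient M Z B\<^esub> \<in> carrier (subquotient M Z B)"
      using submoduleD(2)[OF Z] B0 by auto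
  qed (use Zc submoduleD[OF Z] in \<open>auto simp: M.a_ac smult_l_distr smult_r_distr smult_assoc1\<close>)
qed

lemma subquotient_a_inv:
  assumes B: "submodule B R M" and Z: "submodule Z R M" and x: "x \<in> Z"
  shows "\<ominus>\<^bsub>subquotient M Z B\<^esub> (B +>\<^bsub>M\<^esub> x) = B +>\<^bsub>M\<^esub> \<ominus>\<^bsub>M\<^esub> x"
proof -
  interpret S: module R "subquotient M Z B" by (rule subquotient_module[OF B Z])
  have xc: "x \<in> carrier M" using submoduleD(1)[OF Z] x by auto
  show ?thesis
    by (rule S.M.minus_equality)
      (use x xc submoduleD(3)[OF Z] in \<open>auto simp: subquotient_simps coset_add[OF B] M.l_neg
        coset_zero[OF B]\<close>)
qed

text \<open>The quotient algebra and \<open>ideal_cohomology\<close> extend a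
  \<open>subquotient\<close> record by a further field: they are different records with the same
  module operations.\<close>

lemma subquotient_transfer_module:
  assumes "submodule B R M" "submodule Z R M"
    and "carrier S = carrier (subquotient M Z B)" "\<zero>\<^bsub>S\<^esub> = \<zero>\<^bsub>subquotient M Z B\<^esub>"
    and "\<And>X Y. X \<oplus>\<^bsub>S\<^esub> Y = X \<oplus>\<^bsub>subquotient M Z B\<^esub> Y" "\<And>a X. a \<odot>\<^bsub>S\<^esub> X = a \<odot>\<^bsub>subquotient M Z B\<^esub> X"
  shows "module R S"
proof -
  interpret S: module R "subquotient M Z B" using subquotient_module[OF assms(1,2)] .
  show ?thesis
  proof (rule moduleI[OF R.is_cring abelian_groupI])
    show "\<exists>Y\<in>carrier S. Y \<oplus>\<^bsub>S\<^esub> X = \<zero>\<^bsub>S\<^esub>" if "X \<in> carrier S" for X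
      using that S.l_neg S.a_inv_closed unfolding assms(3-6) by blast
  qed (auto simp: assms(3-6) S.M.a_ac S.smult_l_distr S.smult_r_distr S.smult_assoc1)
qed

end

section \<open>Relative cochains and cohomology\<close>

context ideal_coeff
begin

abbreviation "rel K n \<equiv> rel_cochains F R K M n"
abbreviation "cyc K n \<equiv> cocycles F R K M n"
abbreviation "bnd K n \<equiv> coboundaries F R K M n"
abbreviation "cls K n c \<equiv> cohomology_class F R K M n c"

lemma rel_subset: "f \<in> rel K n \<Longrightarrow> f \<in> carrier (C n)"
  by (simp add: rel_cochains_def)

lemma rel_0: "f \<in> rel K 0 \<longleftrightarrow> f \<in> carrier (C 0) \<and> (\<forall>x\<in>K. \<theta> 0 x f = \<zero>\<^bsub>C 0\<^esub>)"
  by (auto simp: rel_cochains_def tuples_def)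

lemma rel_Suc:
  assumes "K \<subseteq> I"
  shows "f \<in> rel K (Suc n) \<longleftrightarrow>
    f \<in> carrier (C (Suc n)) \<and> (\<forall>x\<in>K. \<iota> n x f = \<zero>\<^bsub>C n\<^esub>) \<and> (\<forall>x\<in>K. \<theta> (Suc n) x f = \<zero>\<^bsub>C (Suc n)\<^esub>)"
proof -
  have "(\<forall>xs. x # xs \<in> tuples R (Suc n) \<longrightarrow> f (x # xs) = \<zero>\<^bsub>M\<^esub>) \<longleftrightarrow> \<iota> n x f = \<zero>\<^bsub>C n\<^esub>"
    if "x \<in> K" for x
  proof -
    have "x \<in> I" using assms that by auto
    then show ?thesis
      by (auto simp: contract_def C_simps fun_eq_iff restrict_def)
  qed
  then show ?thesis by (auto simp: rel_cochains_def)
qed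

lemma rel_theta: "f \<in> rel K n \<Longrightarrow> x \<in> K \<Longrightarrow> \<theta> n x f = \<zero>\<^bsub>C n\<^esub>"
  by (simp add: rel_cochains_def)

lemma rel_contract: "K \<subseteq> I \<Longrightarrow> f \<in> rel K (Suc n) \<Longrightarrow> x \<in> K \<Longrightarrow> \<iota> n x f = \<zero>\<^bsub>C n\<^esub>"
  by (simp add: rel_Suc)

lemma relI:
  assumes "K \<subseteq> I" "f \<in> carrier (C n)" "\<And>x. x \<in> K \<Longrightarrow> \<theta> n x f = \<zero>\<^bsub>C n\<^esub>"
    "\<And>m x. n = Suc m \<Longrightarrow> x \<in> K \<Longrightarrow> \<iota> m x f = \<zero>\<^bsub>C m\<^esub>"
  shows "f \<in> rel K n"
  using assms by (cases n) (auto simp: rel_0 rel_Suc)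

lemma rel_submodule:
  assumes K: "K \<subseteq> I"
  shows "submodule (rel K n) F (C n)"
proof (rule C.submoduleI)
  have KI: "x \<in> I" "x \<in> carrier L" if "x \<in> K" for x using K that by auto
  show "rel K n \<subseteq> carrier (C n)" using rel_subset by auto
  show "\<zero>\<^bsub>C n\<^esub> \<in> rel K n"
    by (rule relI[OF K]) (auto simp: KI theta_zero contract_zero)
  show "\<ominus>\<^bsub>C n\<^esub> f \<in> rel K n" if f: "f \<in> rel K n" for f
    using f rel_subset[OF f]
    by (intro relI[OF K]) (auto simp: KI theta_minus contract_minus rel_theta rel_contract[OF K]
      C.minus_equality)
  show "f \<oplus>\<^bsub>C n\<^esub> g \<in> rel K n" if "f \<in> rel K n" "g \<in> rel K n" for f g
    using that rel_subset[OF that(1)] rel_subset[OF that(2)]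
    by (intro relI[OF K]) (auto simp: KI theta_add contract_add rel_theta rel_contract[OF K])
  show "a \<odot>\<^bsub>C n\<^esub> f \<in> rel K n" if "a \<in> carrier F" "f \<in> rel K n" for a f
    using that rel_subset[OF that(2)]
    by (intro relI[OF K]) (auto simp: KI theta_smult contract_smult rel_theta rel_contract[OF K])
qed

text \<open>On a relative cochain both terms on the right of
  \<open>i_x d = \<theta>_x - d i_x\<close> vanish for \<open>x \<in> K\<close>.\<close>

lemma rel_d:
  assumes K: "K \<subseteq> I" and f: "f \<in> rel K n"
  shows "d n f \<in> rel K (Suc n)"
proof (rule relI[OF K])
  have fc: "f \<in> carrier (C n)" using f by (rule rel_subset)
  then show "d n f \<in> carrier (C (Suc n))" by simp
  have KI: "x \<in> I" "x \<in> carrier L" if "x \<in> K" for x using K that by auto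
  show "\<theta> (Suc n) x (d n f) = \<zero>\<^bsub>C (Suc n)\<^esub>" if "x \<in> K" for x
    using that KI fc f by (simp add: theta_d rel_theta d_zero)
  show "\<iota> m x (d n f) = \<zero>\<^bsub>C m\<^esub>" if "Suc n = Suc m" "x \<in> K" for m x
    using that KI[OF that(2)] fc f
    by (cases n) (auto simp: contract_d_0 contract_d_Suc rel_theta rel_contract[OF K] d_zero)
qed

lemma cyc_iff: "f \<in> cyc K n \<longleftrightarrow> f \<in> rel K n \<and> d n f = \<zero>\<^bsub>C (Suc n)\<^esub>"
  by (auto simp: cocycles_def)

lemma cyc_carrier: "f \<in> cyc K n \<Longrightarrow> f \<in> carrier (C n)"
  using rel_subset by (auto simp: cyc_iff)

lemma cyc_submodule:
  assumes K: "K \<subseteq> I"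
  shows "submodule (cyc K n) F (C n)"
proof -
  note S = C.submoduleD[OF rel_submodule[OF K]]
  show ?thesis
    by (rule C.submoduleI)
      (use S rel_subset in \<open>auto simp: cyc_iff d_zero d_minus d_add d_smult C.minus_equality\<close>)
qed

lemma bnd_0: "bnd K 0 = {\<zero>\<^bsub>C 0\<^esub>}"
  by (simp add: coboundaries_def diff_image_def)

lemma bnd_Suc: "bnd K (Suc n) = d n ` rel K n"
  by (simp add: coboundaries_def diff_image_def)

lemma bnd_submodule:
  assumes K: "K \<subseteq> I"
  shows "submodule (bnd K n) F (C n)"
proof (cases n)
  case 0
  show ?thesis unfolding 0 bnd_0 by (auto intro!: C.submoduleI simp: C.minus_equality)
next
  case (Suc m)
  note S = C.submoduleD[OF rel_submodule[OF K]]
  show ?thesis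
    unfolding Suc bnd_Suc
  proof (rule C.submoduleI)
    show "d m ` rel K m \<subseteq> carrier (C (Suc m))" using rel_subset by auto
    show "\<zero>\<^bsub>C (Suc m)\<^esub> \<in> d m ` rel K m" using S(2) d_zero by (metis image_eqI)
    fix u assume "u \<in> d m ` rel K m"
    then obtain f where f: "f \<in> rel K m" "u = d m f" by auto
    show "\<ominus>\<^bsub>C (Suc m)\<^esub> u \<in> d m ` rel K m"
      unfolding f(2) d_minus[OF rel_subset[OF f(1)], symmetric] using S(3)[OF f(1)] by (rule imageI)
    show "a \<odot>\<^bsub>C (Suc m)\<^esub> u \<in> d m ` rel K m" if "a \<in> carrier F" for a
      unfolding f(2) d_smult[OF rel_subset[OF f(1)] that, symmetric] using S(5)[OF that f(1)]
        by (rule imageI)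
    show "u \<oplus>\<^bsub>C (Suc m)\<^esub> v \<in> d m ` rel K m" if v: "v \<in> d m ` rel K m" for v
    proof -
      obtain g where g: "g \<in> rel K m" "v = d m g" using v by auto
      show ?thesis
        unfolding f(2) g(2) d_add[OF rel_subset[OF f(1)] rel_subset[OF g(1)], symmetric]
        using S(4)[OF f(1) g(1)] by (rule imageI)
    qed
  qed
qed

lemma bnd_cyc:
  assumes K: "K \<subseteq> I" and "f \<in> bnd K n"
  shows "f \<in> cyc K n"
proof (cases n)
  case 0
  then show ?thesis using C.submoduleD(2)[OF cyc_submodule[OF K], of 0] assms bnd_0 by auto
next
  case (Suc m)
  then show ?thesis using assms rel_d[OF K] rel_subset d_d by (auto simp: bnd_Suc cyc_iff)
qed

text \<open>In \<open>\<theta>_k i_x f = i_x \<theta>_k f + i_[k,x] f\<close> the last term is the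
  reason why \<open>x\<close> has to commute with \<open>K\<close>.\<close>

lemma contract_rel:
  assumes K: "K \<subseteq> I" and f: "f \<in> rel K (Suc n)" and x: "x \<in> I"
    and comm: "\<And>k. k \<in> K \<Longrightarrow> bracket L k x = \<zero>\<^bsub>L\<^esub>"
  shows "\<iota> n x f \<in> rel K n"
proof (rule relI[OF K])
  have fc: "f \<in> carrier (C (Suc n))" using f by (rule rel_subset)
  then show "\<iota> n x f \<in> carrier (C n)" using x by simp
  fix k assume k: "k \<in> K"
  then have kI: "k \<in> I" using K by auto
  have "\<theta> n k (\<iota> n x f) = \<iota> n x (\<theta> (Suc n) k f) \<oplus>\<^bsub>C n\<^esub> \<iota> n (bracket L k x) f"
    using fc kI x by (simp add: contract_theta C.ag_simps)
  then show "\<theta> n k (\<iota> n x f) = \<zero>\<^bsub>C n\<^esub>"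
    using fc x f k by (simp add: comm rel_theta contract_zero contract_zero_left)
  show "\<iota> m k (\<iota> n x f) = \<zero>\<^bsub>C m\<^esub>" if n: "n = Suc m" for m
    using contract_swap[of f m k x] fc n kI x rel_contract[OF K f k]
      by (simp add: contract_zero C.minus_equality)
qed

text \<open>As \<theta> represents the bracket, \<theta>_k and \<theta>_x commute when
  \<open>[k,x] = 0\<close>.\<close>

lemma theta_rel:
  assumes K: "K \<subseteq> I" and f: "f \<in> rel K n" and x: "x \<in> carrier L"
    and comm: "\<And>k. k \<in> K \<Longrightarrow> bracket L k x = \<zero>\<^bsub>L\<^esub>"
  shows "\<theta> n x f \<in> rel K n"
proof (rule relI[OF K])
  have fc: "f \<in> carrier (C n)" using f by (rule rel_subset)
  then show "\<theta> n x f \<in> carrier (C n)" using x by simp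
  fix k assume k: "k \<in> K"
  then have kI: "k \<in> I" using K by auto
  have "\<theta> n \<zero>\<^bsub>L\<^esub> f = \<zero>\<^bsub>C n\<^esub>"
    using theta_smult_left[OF fc, of "\<zero>\<^bsub>F\<^esub>" "\<zero>\<^bsub>L\<^esub>"] fc by simp
  then show "\<theta> n k (\<theta> n x f) = \<zero>\<^bsub>C n\<^esub>"
    using theta_bracket[OF fc, of k x] fc kI x comm[OF k] rel_theta[OF f k]
      by (simp add: theta_zero C.ag_simps)
  have "bracket L x k = \<zero>\<^bsub>L\<^esub>" using bracket_swap[of x k] x kI comm[OF k] by (simp add: L.M.minus_equality)
  then show "\<iota> m k (\<theta> n x f) = \<zero>\<^bsub>C m\<^esub>" if n: "n = Suc m" for m
    using fc n kI x rel_contract[OF K _ k, of f m] f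
      by (simp add: contract_theta theta_zero contract_zero_left)
qed

lemma theta_cyc:
  assumes K: "K \<subseteq> I" and f: "f \<in> cyc K n" and x: "x \<in> carrier L"
    and comm: "\<And>k. k \<in> K \<Longrightarrow> bracket L k x = \<zero>\<^bsub>L\<^esub>"
  shows "\<theta> n x f \<in> cyc K n"
  using theta_rel[OF K _ x comm] f theta_d[OF cyc_carrier[OF f] x] x by (auto simp: cyc_iff theta_zero)

lemma theta_bnd:
  assumes K: "K \<subseteq> I" and f: "f \<in> bnd K n" and x: "x \<in> carrier L"
    and comm: "\<And>k. k \<in> K \<Longrightarrow> bracket L k x = \<zero>\<^bsub>L\<^esub>"
  shows "\<theta> n x f \<in> bnd K n"
proof (cases n)
  case 0
  then show ?thesis using f x bnd_0 theta_zero by auto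
next
  case (Suc m)
  then obtain g where g: "g \<in> rel K m" "f = d m g" using f by (auto simp: bnd_Suc)
  then have "\<theta> n x f = d m (\<theta> m x g)" using theta_d rel_subset x Suc by auto
  then show ?thesis using theta_rel[OF K g(1) x comm] Suc by (auto simp: bnd_Suc)
qed

text \<open>By Cartan's formula \<open>\<theta>\<^sub>x c = d (i\<^sub>x c)\<close> on cocycles.\<close>

lemma theta_cyc_bnd:
  assumes K: "K \<subseteq> I" and f: "f \<in> cyc K n" and x: "x \<in> I"
    and comm: "\<And>k. k \<in> K \<Longrightarrow> bracket L k x = \<zero>\<^bsub>L\<^esub>"
  shows "\<theta> n x f \<in> bnd K n"
proof (cases n)
  case 0
  then have "\<theta> n x f = \<zero>\<^bsub>C n\<^esub>" using contract_d_0[of f x] f x cyc_carrier[OF f]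
    by (simp add: cyc_iff contract_zero)
  then show ?thesis using 0 by (simp add: bnd_0)
next
  case (Suc m)
  have fc: "f \<in> carrier (C (Suc m))" using cyc_carrier[OF f] Suc by simp
  have "\<theta> n x f \<ominus>\<^bsub>C n\<^esub> d m (\<iota> m x f) = \<zero>\<^bsub>C n\<^esub>"
    using contract_d_Suc[OF fc x] f Suc x by (simp add: cyc_iff contract_zero)
  then have "\<theta> n x f = d m (\<iota> m x f)" using fc x Suc by (simp add: C.minus_eq_iff)
  then show ?thesis using contract_rel[OF K, of f m x] f Suc x comm by (auto simp: bnd_Suc cyc_iff)
qed

end

section \<open>Cup products in relative cohomology\<close>

context ideal_pairing
begin

lemma cup_rel:
  assumes K: "K \<subseteq> I" and a: "a \<in> CM.rel K r" and b: "b \<in> CN.rel K s"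
  shows "cp r s a b \<in> CP.rel K (r + s)"
proof (rule CP.relI[OF K])
  note ac = CM.rel_subset[OF a] and bc = CN.rel_subset[OF b]
  then show "cp r s a b \<in> carrier (CP.C (r + s))" by simp
  fix x assume x: "x \<in> K"
  then have xI: "x \<in> I" using K by auto
  show "CP.\<theta> (r + s) x (cp r s a b) = \<zero>\<^bsub>CP.C (r + s)\<^esub>"
    using theta_cup[OF ac bc, of x] xI CM.rel_theta[OF a x] CN.rel_theta[OF b x] ac bc
      by (simp add: cup_zero)
  show "CP.\<iota> m x (cp r s a b) = \<zero>\<^bsub>CP.C m\<^esub>" if m: "r + s = Suc m" for m
  proof (cases rule: nat_pair_cases[of r s])
    case (SO r')
    then show ?thesis
      using contract_cup_Suc_0[of a r' b x] ac bc xI m CM.rel_contract[OF K _ x, of a r'] a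
        cup_zero(1)[of b 0 r'] by simp
  next
    case (OS s')
    then show ?thesis
      using contract_cup_0_Suc[of a b s' x] ac bc xI m CN.rel_contract[OF K _ x, of b s'] b
        cup_zero(2)[of a 0 s'] by simp
  next
    case (SS r' s')
    then have m': "m = Suc (r' + s')" using m by simp
    have "CM.\<iota> r' x a = \<zero>\<^bsub>CM.C r'\<^esub>" "CN.\<iota> s' x b = \<zero>\<^bsub>CN.C s'\<^esub>"
      using CM.rel_contract[OF K _ x, of a r'] CN.rel_contract[OF K _ x, of b s'] a b SS by auto
    then show ?thesis
      using contract_cup_Suc_Suc[of a r' b s' x] ac bc xI SS cup_zero(1)[of b "Suc s'" r']
        cup_zero(2)[of a "Suc r'" s']
      unfolding m' by (simp add: CP.C.add_pow_sign CP.C.minus_equality del: power_Suc)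
  qed (use m in simp)
qed

lemma cup_cyc:
  assumes K: "K \<subseteq> I" and a: "a \<in> CM.cyc K r" and b: "b \<in> CN.cyc K s"
  shows "cp r s a b \<in> CP.cyc K (r + s)"
  using a b CM.cyc_carrier[OF a] CN.cyc_carrier[OF b] cup_rel[OF K] d_cup[of a r b s] cup_zero(1)[of
    b s "Suc r"] cup_zero(2)[of a r "Suc s"]
  by (simp add: CM.cyc_iff CN.cyc_iff CP.cyc_iff CP.C.add_pow_sign CP.C.minus_equality)

lemma cup_bnd_left:
  assumes K: "K \<subseteq> I" and a: "a \<in> CM.bnd K r" and b: "b \<in> CN.cyc K s"
  shows "cp r s a b \<in> CP.bnd K (r + s)"
proof (cases r)
  case 0
  then show ?thesis
    using a CN.cyc_carrier[OF b] cup_zero(1)[of b s 0] CP.C.submoduleD(2)[OF CP.bnd_submodule[OF K],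
      of s] by (simp add: CM.bnd_0)
next
  case (Suc r')
  then obtain u where u: "u \<in> CM.rel K r'" "a = CM.d r' u" using a by (auto simp: CM.bnd_Suc)
  have "CP.d (r' + s) (cp r' s u b) = cp r s a b"
    using d_cup[OF CM.rel_subset[OF u(1)] CN.cyc_carrier[OF b]] b u Suc CM.rel_subset[OF u(1)]
      CN.cyc_carrier[OF b]
      cup_zero(2)[of u r' "Suc s"] cup_closed'(1)[of a r' b s]
    by (simp add: CN.cyc_iff CP.C.add_pow_sign CP.C.minus_equality)
  moreover have "cp r' s u b \<in> CP.rel K (r' + s)"
    using cup_rel[OF K u(1)] b by (simp add: CN.cyc_iff)
  ultimately have "cp r s a b \<in> CP.bnd K (Suc (r' + s))"
    by (metis CP.bnd_Suc imageI)
  then show ?thesis using Suc by simp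
qed

text \<open>The Leibniz rule yields \<open>a \<union> d u\<close> only up to the sign
  \<open>(-1)^r\<close>, which the subspace of coboundaries absorbs.\<close>

lemma cup_bnd_right:
  assumes K: "K \<subseteq> I" and a: "a \<in> CM.cyc K r" and b: "b \<in> CN.bnd K s"
  shows "cp r s a b \<in> CP.bnd K (r + s)"
proof (cases s)
  case 0
  then show ?thesis
    using b CM.cyc_carrier[OF a] cup_zero(2)[of a r 0] CP.C.submoduleD(2)[OF CP.bnd_submodule[OF K],
      of r] by (simp add: CN.bnd_0)
next
  case (Suc s')
  then obtain u where u: "u \<in> CN.rel K s'" "b = CN.d s' u" using b by (auto simp: CN.bnd_Suc)
  have cc: "cp r s a b \<in> carrier (CP.C (Suc (r + s')))"
    using cup_closed'(2)[of a r b s'] CM.cyc_carrier[OF a] u CN.rel_subset[OF u(1)] Suc by simp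
  have "CP.d (r + s') (cp r s' a u) = [((- 1 :: int) ^ r)] \<cdot>\<^bsub>CP.C (Suc (r + s'))\<^esub> cp r s a b"
    using d_cup[OF CM.cyc_carrier[OF a] CN.rel_subset[OF u(1)]] a u Suc CN.rel_subset[OF u(1)] cc
      cup_zero(1)[of u s' "Suc r"]
    by (simp add: CM.cyc_iff CP.C.add_pow_sign)
  moreover have "cp r s' a u \<in> CP.rel K (r + s')"
    using cup_rel[OF K _ u(1), of a r] a by (simp add: CM.cyc_iff)
  ultimately have "[((- 1 :: int) ^ r)] \<cdot>\<^bsub>CP.C (Suc (r + s'))\<^esub> cp r s a b \<in> CP.bnd K (Suc (r + s'))"
    by (metis CP.bnd_Suc imageI)
  then have "cp r s a b \<in> CP.bnd K (Suc (r + s')) \<or>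
    \<ominus>\<^bsub>CP.C (Suc (r + s'))\<^esub> cp r s a b \<in> CP.bnd K (Suc (r + s'))"
    using cc by (auto simp: CP.C.add_pow_sign split: if_splits)
  then show ?thesis
    using CP.C.submoduleD(3)[OF CP.bnd_submodule[OF K]] cc Suc by (metis CP.C.minus_minus add_Suc_right)
qed

theorem cohomology_cup_class:
  assumes K: "K \<subseteq> I" and a: "a \<in> CM.cyc K r" and b: "b \<in> CN.cyc K s"
  shows "cohomology_cup F CM.R K P \<mu> r s (CM.cls K r a) (CN.cls K s b) = CP.cls K (r + s) (cp r s a b)"
proof -
  note ac = CM.cyc_carrier[OF a] and bc = CN.cyc_carrier[OF b]
  note SM = CM.bnd_submodule[OF K] and SN = CN.bnd_submodule[OF K] and SP = CP.bnd_submodule[OF K]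
  have "CP.cls K (r + s) (cp r s a' b') = CP.cls K (r + s) (cp r s a b)"
    if a'_mem: "a' \<in> CM.cls K r a" and b'_mem: "b' \<in> CN.cls K s b" for a' b'
  proof -
    obtain u where u: "u \<in> CM.bnd K r" "a' = a \<oplus>\<^bsub>CM.C r\<^esub> u" using CM.C.coset_memE[OF SM ac a'_mem]
      by metis
    obtain v where v: "v \<in> CN.bnd K s" "b' = b \<oplus>\<^bsub>CN.C s\<^esub> v" using CN.C.coset_memE[OF SN bc b'_mem]
      by metis
    have uc: "u \<in> carrier (CM.C r)" and vc: "v \<in> carrier (CN.C s)"
      using CM.C.submoduleD(1)[OF SM] CN.C.submoduleD(1)[OF SN] u v by auto
    have a': "a' \<in> CM.cyc K r"
      unfolding u(2) using CM.C.submoduleD(4)[OF CM.cyc_submodule[OF K]] a CM.bnd_cyc[OF K u(1)]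
        by blast
    \<comment> \<open>The factors are changed one after the other: \<open>v\<close> is multiplied
      with the altered \<open>a'\<close>, which is still a cocycle.\<close>
    have "cp r s a' b' = cp r s a' b \<oplus>\<^bsub>CP.C (r + s)\<^esub> cp r s a' v"
      unfolding v(2) using CM.cyc_carrier[OF a'] bc vc by (rule cup_add_right)
    also have "cp r s a' b = cp r s a b \<oplus>\<^bsub>CP.C (r + s)\<^esub> cp r s u b"
      unfolding u(2) using ac uc bc by (rule cup_add_left)
    finally show ?thesis
      using CP.C.coset_add_mem[OF SP] cup_bnd_left[OF K u(1) b] cup_bnd_right[OF K a' v(1)] ac bc uc
        by simp
  qed
  then show ?thesis
    unfolding cohomology_cup_def
    using CM.C.coset_self[OF SM ac] CN.C.coset_self[OF SN bc] by (intro equalityI; blast)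
qed

end

section \<open>The quotient Lie algebra\<close>

text \<open>The properties of a decomposition in the form in which the arguments consume them:
  \<open>J\<close> stands for \<open>JK + JL\<close>, and \<open>K_rep\<close> reflects the summand
  \<open>JK\<close> of \<open>K\<close>.\<close>

locale lie_splitting = lie_algebra F L
  for F :: "'f ring" and L :: "('f, 'g) lie" +
  fixes I K J :: "'g set"
  assumes I_ideal: "lie_ideal F L I"
    and J_submodule: "submodule J F L"
    and K_subset: "K \<subseteq> carrier L"
    and J_rep: "x \<in> carrier L \<Longrightarrow> \<exists>j\<in>J. x \<ominus>\<^bsub>L\<^esub> j \<in> I"
    and I_J_disjoint: "x \<in> I \<Longrightarrow> x \<in> J \<Longrightarrow> x = \<zero>\<^bsub>L\<^esub>"
    and I_K_J_commute: "k \<in> I \<inter> K \<Longrightarrow> x \<in> J \<Longrightarrow> bracket L k x = \<zero>\<^bsub>L\<^esub>"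
    and K_rep: "k \<in> K \<Longrightarrow> \<exists>j\<in>J \<inter> K. k \<ominus>\<^bsub>L\<^esub> j \<in> I"
begin

abbreviation "Q \<equiv> quotient_lie L I"
abbreviation "coset x \<equiv> I +>\<^bsub>L\<^esub> x"
abbreviation "IK \<equiv> I \<inter> K"

lemma ideal_submodule: "submodule I F L"
  using I_ideal by (simp add: lie_ideal_def)

lemmas ideal_facts = L.submoduleD[OF ideal_submodule]

lemma ideal_carrier: "x \<in> I \<Longrightarrow> x \<in> carrier L"
  using ideal_facts by auto

lemma ideal_bracket: "x \<in> carrier L \<Longrightarrow> y \<in> I \<Longrightarrow> bracket L x y \<in> I" "x \<in> carrier L \<Longrightarrow> y \<in> I
  \<Longrightarrow> bracket L y x \<in> I"
proof -
  show *: "bracket L x y \<in> I" if "x \<in> carrier L" "y \<in> I" for x y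
    using I_ideal that by (auto simp: lie_ideal_def)
  show "bracket L y x \<in> I" if "x \<in> carrier L" "y \<in> I"
    using *[OF that] that bracket_swap[of y x] ideal_carrier ideal_facts(3) by simp
qed

lemma quotient_simps:
  "carrier Q = coset ` carrier L" "\<zero>\<^bsub>Q\<^esub> = I" "X \<oplus>\<^bsub>Q\<^esub> Y = X <+>\<^bsub>L\<^esub> Y"
  "a \<odot>\<^bsub>Q\<^esub> X = a \<odot>\<^bsub>subquotient L (carrier L) I\<^esub> X"
  "bracket Q X Y = (\<Union>x\<in>X. \<Union>y\<in>Y. coset (bracket L x y))"
  by (simp_all add: quotient_lie_def module.defs lie.defs subquotient_simps)

lemma coset_carrier [simp, intro]: "x \<in> carrier L \<Longrightarrow> coset x \<in> carrier Q"
  by (simp add: quotient_simps)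

lemma coset_add: "x \<in> carrier L \<Longrightarrow> y \<in> carrier L \<Longrightarrow> coset x \<oplus>\<^bsub>Q\<^esub> coset y = coset (x \<oplus>\<^bsub>L\<^esub> y)"
  by (simp add: quotient_simps L.coset_add[OF ideal_submodule])

lemma coset_smult: "x \<in> carrier L \<Longrightarrow> a \<in> carrier F \<Longrightarrow> a \<odot>\<^bsub>Q\<^esub> coset x = coset (a \<odot>\<^bsub>L\<^esub> x)"
  by (simp add: quotient_simps L.subquotient_smult[OF ideal_submodule])

lemma coset_zero: "\<zero>\<^bsub>Q\<^esub> = coset \<zero>\<^bsub>L\<^esub>"
  by (simp add: quotient_simps L.coset_zero[OF ideal_submodule])

lemma coset_eq_iff: "x \<in> carrier L \<Longrightarrow> y \<in> carrier L \<Longrightarrow> coset x = coset y \<longleftrightarrow> x \<ominus>\<^bsub>L\<^esub> y \<in> I"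
  by (rule L.coset_eq_iff[OF ideal_submodule])

lemma mem_coset_carrier: "x \<in> carrier L \<Longrightarrow> y \<in> coset x \<Longrightarrow> y \<in> carrier L \<and> coset y = coset x"
  using L.mem_coset_iff[OF ideal_submodule, of x y] coset_eq_iff[of y x] by auto

text \<open>Changing representatives alters the bracket by \<open>[x,b] + [a,y] + [a,b]\<close>,
  which lies in the ideal.\<close>

lemma coset_bracket:
  assumes "x \<in> carrier L" "y \<in> carrier L"
  shows "bracket Q (coset x) (coset y) = coset (bracket L x y)"
proof -
  have "coset (bracket L x' y') = coset (bracket L x y)" if m: "x' \<in> coset x" "y' \<in> coset y" for x' y'
  proof -
    obtain a where a: "a \<in> I" "x' = x \<oplus>\<^bsub>L\<^esub> a" using L.coset_memE[OF ideal_submodule assms(1) m(1)]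
      by metis
    obtain b where b: "b \<in> I" "y' = y \<oplus>\<^bsub>L\<^esub> b" using L.coset_memE[OF ideal_submodule assms(2) m(2)]
      by metis
    have c: "a \<in> carrier L" "b \<in> carrier L" using a b ideal_carrier by auto
    have "bracket L x' y' = bracket L x y \<oplus>\<^bsub>L\<^esub> (bracket L x b \<oplus>\<^bsub>L\<^esub> bracket L a y \<oplus>\<^bsub>L\<^esub> bracket L a b)"
      using assms c unfolding a b by (simp add: bracket_add_left bracket_add_right bracket_closed
        L.M.a_ac)
    moreover have "bracket L x b \<oplus>\<^bsub>L\<^esub> bracket L a y \<oplus>\<^bsub>L\<^esub> bracket L a b \<in> I"
      using assms a b c by (intro ideal_facts(4) ideal_bracket) auto
    ultimately show ?thesis
      using L.coset_add_mem[OF ideal_submodule bracket_closed[OF assms]] by simp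
  qed
  then show ?thesis
    unfolding quotient_simps
    using L.coset_self[OF ideal_submodule assms(1)] L.coset_self[OF ideal_submodule assms(2)]
      by (intro equalityI; blast)
qed

lemma carrier_QE:
  assumes "X \<in> carrier Q"
  obtains x where "x \<in> carrier L" "X = coset x"
  using assms by (auto simp: quotient_simps)

lemma quotient_module: "module F Q"
  by (rule L.subquotient_transfer_module[OF ideal_submodule L.carrier_is_submodule])
    (simp_all add: quotient_simps L.subquotient_simps)

lemma quotient_lie_algebra: "lie_algebra F Q"
proof -
  interpret Q: module F Q by (rule quotient_module)
  note [simp] = coset_add coset_smult coset_bracket bracket_closed coset_zero
  show ?thesis
  proof unfold_locales
    fix X Y assume "X \<in> carrier Q" "Y \<in> carrier Q"
    then obtain x y where x: "x \<in> carrier L" "X = coset x" and y: "y \<in> carrier L" "Y = coset y"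
      by (metis carrier_QE)
    show "bracket Q X Y \<in> carrier Q" using x y by simp
    show "bracket Q X X = \<zero>\<^bsub>Q\<^esub>" using x by (simp add: bracket_self)
    show "bracket Q (a \<odot>\<^bsub>Q\<^esub> X) Y = a \<odot>\<^bsub>Q\<^esub> bracket Q X Y" if "a \<in> carrier F" for a
      using x y that by (simp add: bracket_smult_left)
    show "bracket Q X (a \<odot>\<^bsub>Q\<^esub> Y) = a \<odot>\<^bsub>Q\<^esub> bracket Q X Y" if "a \<in> carrier F" for a
      using x y that by (simp add: bracket_smult_right)
    fix Z assume "Z \<in> carrier Q"
    then obtain z where z: "z \<in> carrier L" "Z = coset z" by (metis carrier_QE)
    show "bracket Q (X \<oplus>\<^bsub>Q\<^esub> Y) Z = bracket Q X Z \<oplus>\<^bsub>Q\<^esub> bracket Q Y Z"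
      using x y z by (simp add: bracket_add_left)
    show "bracket Q X (Y \<oplus>\<^bsub>Q\<^esub> Z) = bracket Q X Y \<oplus>\<^bsub>Q\<^esub> bracket Q X Z"
      using x y z by (simp add: bracket_add_right)
    show "bracket Q X (bracket Q Y Z) \<oplus>\<^bsub>Q\<^esub> bracket Q Y (bracket Q Z X) \<oplus>\<^bsub>Q\<^esub> bracket Q Z (bracket Q X Y)
      = \<zero>\<^bsub>Q\<^esub>"
      using x y z by (simp add: jacobi)
  qed
qed

text \<open>
  The centralizer of \<open>I \<inter> K\<close>.  It contains \<open>J\<close>, so it meets every coset of \<open>I\<close>, and unlike \<open>J\<close> it
  is closed under the bracket.
\<close>

definition "cent = {x \<in> carrier L. \<forall>k\<in>IK. bracket L k x = \<zero>\<^bsub>L\<^esub>}"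

lemma cent_carrier [simp, intro]: "x \<in> cent \<Longrightarrow> x \<in> carrier L"
  unfolding cent_def by blast

lemma cent_commute: "x \<in> cent \<Longrightarrow> k \<in> IK \<Longrightarrow> bracket L k x = \<zero>\<^bsub>L\<^esub>"
  unfolding cent_def by blast

lemma centI: "x \<in> carrier L \<Longrightarrow> (\<And>k. k \<in> IK \<Longrightarrow> k \<in> carrier L \<Longrightarrow> bracket L k x = \<zero>\<^bsub>L\<^esub>) \<Longrightarrow> x \<in> cent"
  unfolding cent_def using K_subset by blast

lemma J_cent: "x \<in> J \<Longrightarrow> x \<in> cent"
  by (rule centI) (use I_K_J_commute L.submoduleD(1)[OF J_submodule] in blast)+

lemma cent_add: "x \<in> cent \<Longrightarrow> y \<in> cent \<Longrightarrow> x \<oplus>\<^bsub>L\<^esub> y \<in> cent"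
  by (rule centI) (simp_all add: bracket_add_right cent_commute)

lemma cent_smult: "a \<in> carrier F \<Longrightarrow> x \<in> cent \<Longrightarrow> a \<odot>\<^bsub>L\<^esub> x \<in> cent"
  by (rule centI) (simp_all add: bracket_smult_right cent_commute)

lemma cent_minus: "x \<in> cent \<Longrightarrow> y \<in> cent \<Longrightarrow> x \<ominus>\<^bsub>L\<^esub> y \<in> cent"
  by (rule centI) (simp_all add: a_minus_def bracket_add_right bracket_minus cent_commute
    L.M.minus_equality)

text \<open>By the Jacobi identity. The lemma keeps the contractions with \<open>[x,z]\<close>
  produced by \<open>contract_theta\<close> within reach, and provides a centralizing representative
  of a bracket of classes.\<close>

lemma cent_bracket:
  assumes "x \<in> cent" "y \<in> cent"
  shows "bracket L x y \<in> cent"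
proof -
  have "bracket L k (bracket L x y) = \<zero>\<^bsub>L\<^esub>" if k: "k \<in> IK" and kc: "k \<in> carrier L" for k
  proof -
    have "bracket L y k = \<zero>\<^bsub>L\<^esub>"
      using bracket_swap[of y k] cent_commute[OF assms(2) k] kc assms by (simp add: L.M.minus_equality)
    then show ?thesis
      using jacobi[of k x y] kc assms cent_commute[OF assms(1) k]
        by (simp add: bracket_minus bracket_closed)
  qed
  then show ?thesis using assms by (intro centI) (simp_all add: bracket_closed)
qed

text \<open>The description by \<open>THE\<close> is legitimate because two candidates differ by an
  element of \<open>I \<inter> J\<close>.\<close>

lemma proj_compl:
  assumes "x \<in> carrier L"
  shows "proj_compl L I J x \<in> J" "x \<ominus>\<^bsub>L\<^esub> proj_compl L I J x \<in> I"
proof -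
  obtain j where j: "j \<in> J" "x \<ominus>\<^bsub>L\<^esub> j \<in> I" using J_rep[OF assms] by auto
  have "y = j" if y: "y \<in> J \<and> x \<ominus>\<^bsub>L\<^esub> y \<in> I" for y
  proof -
    have c: "y \<in> carrier L" "j \<in> carrier L" using y j L.submoduleD(1)[OF J_submodule] by auto
    have "y \<ominus>\<^bsub>L\<^esub> j = (x \<ominus>\<^bsub>L\<^esub> j) \<ominus>\<^bsub>L\<^esub> (x \<ominus>\<^bsub>L\<^esub> y)"
      using c assms by (simp add: L.M.ag_simps)
    then have "y \<ominus>\<^bsub>L\<^esub> j \<in> I" using ideal_facts(6) j y by auto
    then have "y \<ominus>\<^bsub>L\<^esub> j = \<zero>\<^bsub>L\<^esub>" using I_J_disjoint L.submoduleD(6)[OF J_submodule] y j by auto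
    then show ?thesis using c by (simp add: L.M.minus_eq_iff)
  qed
  then have "\<exists>!y. y \<in> J \<and> x \<ominus>\<^bsub>L\<^esub> y \<in> I" using j by blast
  from theI'[OF this] show "proj_compl L I J x \<in> J" "x \<ominus>\<^bsub>L\<^esub> proj_compl L I J x \<in> I"
    unfolding proj_compl_def by auto
qed

lemma proj_compl_cent:
  assumes "x \<in> carrier L"
  shows "proj_compl L I J x \<in> cent" "coset (proj_compl L I J x) = coset x"
proof -
  show p: "proj_compl L I J x \<in> cent" using proj_compl[OF assms] J_cent by auto
  show "coset (proj_compl L I J x) = coset x"
    using coset_eq_iff[of x "proj_compl L I J x"] proj_compl[OF assms] p assms by simp
qed

lemma cent_QE:
  assumes "X \<in> carrier Q"
  obtains x where "x \<in> cent" "X = coset x"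
  using assms proj_compl_cent by (metis carrier_QE)

end

sublocale lie_splitting \<subseteq> Q: lie_algebra F Q
  by (rule quotient_lie_algebra)

section \<open>The action on the cohomology of the ideal\<close>

locale splitting_module = lie_splitting F L I K J + lie_module F L M
  for F :: "'f ring" and L :: "('f, 'g) lie" and I K J :: "'g set" and M :: "('f, 'g, 'm) lmod"

sublocale splitting_module \<subseteq> ideal_coeff F L M I
  by unfold_locales (rule I_ideal)

context splitting_module
begin

abbreviation "H q \<equiv> ideal_cohomology F L I K J M q"
abbreviation "cl q c \<equiv> cohomology_class F R IK M q c"

lemma IK_I: "IK \<subseteq> I" by simp

lemmas cyc_sub = cyc_submodule[OF IK_I] and bnd_sub = bnd_submodule[OF IK_I]

lemma H_simps:
  "carrier (H q) = cl q ` cyc IK q" "\<zero>\<^bsub>H q\<^esub> = bnd IK q" "X \<oplus>\<^bsub>H q\<^esub> Y = X <+>\<^bsub>C q\<^esub> Y"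
  "a \<odot>\<^bsub>H q\<^esub> X = a \<odot>\<^bsub>subquotient (C q) (cyc IK q) (bnd IK q)\<^esub> X"
  "act (H q) U Y = (\<Union>x\<in>U. \<Union>c\<in>Y. cl q (\<theta> q (proj_compl L I J x) c))"
  by (simp_all add: ideal_cohomology_def cohomology_def module.defs lmod.defs C.subquotient_simps)

lemma cl_carrier [simp, intro]: "c \<in> cyc IK q \<Longrightarrow> cl q c \<in> carrier (H q)"
  by (simp add: H_simps)

lemma carrier_HE:
  assumes "X \<in> carrier (H q)"
  obtains c where "c \<in> cyc IK q" "X = cl q c"
  using assms by (auto simp: H_simps)

lemma cl_add: "c \<in> carrier (C q) \<Longrightarrow> c' \<in> carrier (C q) \<Longrightarrow> cl q c \<oplus>\<^bsub>H q\<^esub> cl q c' = cl q (c \<oplus>\<^bsub>C q\<^esub> c')"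
  by (simp add: H_simps C.coset_add[OF bnd_sub])

lemma cl_smult: "c \<in> carrier (C q) \<Longrightarrow> a \<in> carrier F \<Longrightarrow> a \<odot>\<^bsub>H q\<^esub> cl q c = cl q (a \<odot>\<^bsub>C q\<^esub> c)"
  by (simp add: H_simps C.subquotient_smult[OF bnd_sub])

lemma cl_zero: "\<zero>\<^bsub>H q\<^esub> = cl q \<zero>\<^bsub>C q\<^esub>"
  by (simp add: H_simps C.coset_zero[OF bnd_sub])

lemma cl_eq_iff: "c \<in> carrier (C q) \<Longrightarrow> c' \<in> carrier (C q) \<Longrightarrow> cl q c = cl q c' \<longleftrightarrow> c \<ominus>\<^bsub>C q\<^esub> c' \<in> bnd IK q"
  by (rule C.coset_eq_iff[OF bnd_sub])

lemma cl_bnd: "c \<in> bnd IK q \<Longrightarrow> cl q c = \<zero>\<^bsub>H q\<^esub>"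
  by (simp add: H_simps C.coset_of_mem[OF bnd_sub])

lemma H_module: "module F (H q)"
  by (rule C.subquotient_transfer_module[OF bnd_sub cyc_sub]) (simp_all add: H_simps
    C.subquotient_simps)

lemma theta_cent_cyc: "x \<in> cent \<Longrightarrow> c \<in> cyc IK q \<Longrightarrow> \<theta> q x c \<in> cyc IK q"
  by (rule theta_cyc[OF IK_I]) (auto simp: cent_commute)

text \<open>Two centralizing representatives of one class differ by an element of \<open>I\<close>
  that still commutes with \<open>I \<inter> K\<close>; by \<open>theta_cyc_bnd\<close> it sends
  cocycles to coboundaries.\<close>

lemma theta_cent_eq:
  assumes "x \<in> cent" "y \<in> cent" "coset x = coset y" "c \<in> cyc IK q"
  shows "cl q (\<theta> q x c) = cl q (\<theta> q y c)"
proof -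
  note cc = cyc_carrier[OF assms(4)]
  have "x \<ominus>\<^bsub>L\<^esub> y \<in> I" using assms coset_eq_iff by auto
  moreover have "x \<ominus>\<^bsub>L\<^esub> y \<in> cent" using assms cent_minus by auto
  ultimately have *: "\<theta> q (x \<ominus>\<^bsub>L\<^esub> y) c \<in> bnd IK q"
    using theta_cyc_bnd[OF IK_I assms(4)] cent_commute by auto
  have "\<theta> q x c = \<theta> q (x \<ominus>\<^bsub>L\<^esub> y) c \<oplus>\<^bsub>C q\<^esub> \<theta> q y c"
    using theta_add_left[OF cc, of "x \<ominus>\<^bsub>L\<^esub> y" y] assms by (simp add: L.M.minus_add_cancel)
  then have "\<theta> q x c \<ominus>\<^bsub>C q\<^esub> \<theta> q y c = \<theta> q (x \<ominus>\<^bsub>L\<^esub> y) c"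
    using cc assms by (simp add: C.minus_eq_iff)
  then show ?thesis using * cc assms by (simp add: cl_eq_iff)
qed

text \<open>Frees the action from the projection used in its definition: any representative in
  \<open>cent\<close> computes it.\<close>

lemma act_H:
  assumes x: "x \<in> cent" and c: "c \<in> cyc IK q"
  shows "act (H q) (coset x) (cl q c) = cl q (\<theta> q x c)"
proof -
  have "cl q (\<theta> q (proj_compl L I J x') c') = cl q (\<theta> q x c)"
    if m: "x' \<in> coset x" "c' \<in> cl q c" for x' c'
  proof -
    have x': "x' \<in> carrier L" "coset x' = coset x" using mem_coset_carrier[OF _ m(1)] x by auto
    let ?p = "proj_compl L I J x'"
    have p: "?p \<in> cent" "coset ?p = coset x" using proj_compl_cent[OF x'(1)] x' by auto
    obtain b where b: "b \<in> bnd IK q" "c' = c \<oplus>\<^bsub>C q\<^esub> b"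
      using C.coset_memE[OF bnd_sub cyc_carrier[OF c] m(2)] by metis
    have bc: "b \<in> carrier (C q)" using C.submoduleD(1)[OF bnd_sub] b by auto
    have "\<theta> q ?p b \<in> bnd IK q" using theta_bnd[OF IK_I b(1)] p cent_commute by auto
    then have "cl q (\<theta> q ?p c') = cl q (\<theta> q ?p c)"
      unfolding b(2) using C.coset_add_mem[OF bnd_sub] cyc_carrier[OF c] bc p by (simp add: theta_add)
    also have "\<dots> = cl q (\<theta> q x c)" by (rule theta_cent_eq[OF p(1) x p(2) c])
    finally show ?thesis .
  qed
  moreover have "x \<in> coset x" "c \<in> cl q c"
    using L.coset_self[OF ideal_submodule] x C.coset_self[OF bnd_sub cyc_carrier[OF c]] by auto
  ultimately show ?thesis unfolding H_simps by (intro equalityI; blast)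
qed

text \<open>With the projection to \<open>J\<close> the bracket axiom would not be immediate, since
  \<open>J\<close> need not be closed under the bracket. With representatives in \<open>cent\<close>
  it is \<open>theta_bracket\<close>.\<close>

theorem H_lie_module: "lie_module F Q (H q)"
proof -
  interpret H: module F "H q" by (rule H_module)
  note [simp] = act_H cl_add cl_smult coset_add coset_smult coset_bracket theta_cent_cyc cent_add
    cent_smult cent_bracket cyc_carrier
  note S = C.submoduleD[OF cyc_sub]
  show ?thesis
  proof unfold_locales
    show "act (H q) X Y \<in> carrier (H q)" if "X \<in> carrier Q" "Y \<in> carrier (H q)" for X Y
      using that by (auto elim!: cent_QE carrier_HE)
    show "act (H q) (X \<oplus>\<^bsub>Q\<^esub> Y) Z = act (H q) X Z \<oplus>\<^bsub>H q\<^esub> act (H q) Y Z"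
      if "X \<in> carrier Q" "Y \<in> carrier Q" "Z \<in> carrier (H q)" for X Y Z
      using that by (auto elim!: cent_QE carrier_HE simp: theta_add_left)
    show "act (H q) X (Y \<oplus>\<^bsub>H q\<^esub> Z) = act (H q) X Y \<oplus>\<^bsub>H q\<^esub> act (H q) X Z"
      if "X \<in> carrier Q" "Y \<in> carrier (H q)" "Z \<in> carrier (H q)" for X Y Z
      using that S(4) by (auto elim!: cent_QE carrier_HE simp: theta_add)
    show "act (H q) (a \<odot>\<^bsub>Q\<^esub> X) Y = a \<odot>\<^bsub>H q\<^esub> act (H q) X Y"
      if "a \<in> carrier F" "X \<in> carrier Q" "Y \<in> carrier (H q)" for a X Y
      using that by (auto elim!: cent_QE carrier_HE simp: theta_smult_left)
    show "act (H q) X (a \<odot>\<^bsub>H q\<^esub> Y) = a \<odot>\<^bsub>H q\<^esub> act (H q) X Y"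
      if "a \<in> carrier F" "X \<in> carrier Q" "Y \<in> carrier (H q)" for a X Y
      using that S(5) by (auto elim!: cent_QE carrier_HE simp: theta_smult)
    show "act (H q) (bracket Q X Y) Z = act (H q) X (act (H q) Y Z) \<ominus>\<^bsub>H q\<^esub> act (H q) Y (act (H q) X Z)"
      if "X \<in> carrier Q" "Y \<in> carrier Q" "Z \<in> carrier (H q)" for X Y Z
    proof -
      obtain x y c where x: "x \<in> cent" "X = coset x" and y: "y \<in> cent" "Y = coset y"
        and c: "c \<in> cyc IK q" "Z = cl q c"
        using \<open>X \<in> carrier Q\<close> \<open>Y \<in> carrier Q\<close> \<open>Z \<in> carrier (H q)\<close> by (metis cent_QE carrier_HE)
      have "act (H q) (bracket Q X Y) Z = cl q (\<theta> q (bracket L x y) c)" using x y c by simp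
      moreover have "act (H q) (bracket Q X Y) Z \<oplus>\<^bsub>H q\<^esub> act (H q) Y (act (H q) X Z)
        = act (H q) X (act (H q) Y Z)"
        using x y c cyc_carrier[OF c(1)] by (simp add: theta_bracket C.minus_add_cancel)
      moreover have "act (H q) X (act (H q) Y Z) \<in> carrier (H q)"
        "act (H q) Y (act (H q) X Z) \<in> carrier (H q)"
        "act (H q) (bracket Q X Y) Z \<in> carrier (H q)"
        using x y c by simp_all
      ultimately show ?thesis by (simp add: H.M.eq_minus_iff)
    qed
  qed
qed

end

text \<open>The outer complex, with the cohomology of \<open>I\<close> as coefficients, becomes an
  instance of the general calculus; \<open>G\<close> below does the same for cochains on the whole
  algebra.\<close>

sublocale splitting_module \<subseteq> HQ: ideal_coeff F Q "ideal_cohomology F L I K J M q" "carrier Q"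
  rewrites "restrict_lie Q (carrier Q) = Q" for q
  by (intro ideal_coeff.intro ideal_coeff_axioms.intro H_lie_module Q.carrier_lie_ideal)
    (rule restrict_lie_carrier)

sublocale splitting_module \<subseteq> G: ideal_coeff F L M "carrier L"
  rewrites "restrict_lie L (carrier L) = L"
  by unfold_locales (auto intro: carrier_lie_ideal)

section \<open>The filtration\<close>

text \<open>The filtration condition without relativity. Contractions need not be relative to
  \<open>K\<close>, so the two conditions are tracked separately; \<open>filt_eq\<close> joins
  them.\<close>

definition vanish ::
    "'f ring \<Rightarrow> ('f, 'g) lie \<Rightarrow> 'g set \<Rightarrow> ('f, 'g, 'm) lmod \<Rightarrow> int \<Rightarrow> nat \<Rightarrow> ('g list \<Rightarrow> 'm) set" where
  "vanish F L I M p n =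
     {f \<in> carrier (cochains F L M n). \<forall>xs\<in>tuples L n.
        int (length (filter (\<lambda>x. x \<in> I) xs)) \<ge> int n - p + 1 \<longrightarrow> f xs = \<zero>\<^bsub>M\<^esub>}"

lemma filt_eq: "filt F L I K M p n = rel_cochains F L K M n \<inter> vanish F L I M p n"
  by (auto simp: filt_def vanish_def rel_cochains_def)

context splitting_module
begin

abbreviation "CG \<equiv> cochains F L M"
abbreviation "dG \<equiv> ce_diff L M"
abbreviation "\<theta>G \<equiv> theta L M"
abbreviation "\<iota>G \<equiv> contract L"
abbreviation "V \<equiv> vanish F L I M"
abbreviation "relG n \<equiv> rel_cochains F L IK M n"

lemma V_carrier [simp, intro]: "f \<in> V p n \<Longrightarrow> f \<in> carrier (CG n)"
  by (simp add: vanish_def)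

lemma V_apply:
  "f \<in> V p n \<Longrightarrow> xs \<in> tuples L n \<Longrightarrow> int (length (filter (\<lambda>x. x \<in> I) xs)) \<ge> int n - p + 1 \<Longrightarrow> f xs = \<zero>\<^bsub>M\<^esub>"
  unfolding vanish_def by blast

lemma V_I:
  "f \<in> carrier (CG n) \<Longrightarrow>
    (\<And>xs. xs \<in> tuples L n \<Longrightarrow> int (length (filter (\<lambda>x. x \<in> I) xs)) \<ge> int n - p + 1 \<Longrightarrow> f xs = \<zero>\<^bsub>M\<^esub>)
    \<Longrightarrow> f \<in> V p n"
  unfolding vanish_def by blast

lemma V_mono: "f \<in> V p n \<Longrightarrow> p' \<le> p \<Longrightarrow> f \<in> V p' n"
  by (rule V_I) (auto intro: V_apply)

lemma V_nonpos: "f \<in> carrier (CG n) \<Longrightarrow> p \<le> 0 \<Longrightarrow> f \<in> V p n"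
proof (rule V_I)
  fix xs assume "xs \<in> tuples L n" "int (length (filter (\<lambda>x. x \<in> I) xs)) \<ge> int n - p + 1" "p \<le> 0"
  moreover have "length (filter (\<lambda>x. x \<in> I) xs) \<le> length xs" by (rule length_filter_le)
  ultimately show "f xs = \<zero>\<^bsub>M\<^esub>" by (simp add: tuples_def)
qed

lemma V_submodule: "submodule (V p n) F (CG n)"
proof (rule G.C.submoduleI)
  show "V p n \<subseteq> carrier (CG n)" using V_carrier by blast
  show "\<zero>\<^bsub>CG n\<^esub> \<in> V p n" by (rule V_I) (simp_all add: G.C_eval)
  show "\<ominus>\<^bsub>CG n\<^esub> f \<in> V p n" if f: "f \<in> V p n" for f
    by (rule V_I) (use f V_apply[OF f] in \<open>simp_all add: G.C_eval M.minus_equality\<close>)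
  show "f \<oplus>\<^bsub>CG n\<^esub> g \<in> V p n" if f: "f \<in> V p n" and g: "g \<in> V p n" for f g
    by (rule V_I) (use f g V_apply[OF f] V_apply[OF g] in \<open>simp_all add: G.C_eval\<close>)
  show "a \<odot>\<^bsub>CG n\<^esub> f \<in> V p n" if a: "a \<in> carrier F" and f: "f \<in> V p n" for a f
    by (rule V_I) (use a f V_apply[OF f] in \<open>simp_all add: G.C_eval\<close>)
qed

lemmas V_closed = G.C.submoduleD[OF V_submodule]

lemma V_0: "f \<in> V p 0 \<longleftrightarrow> f \<in> carrier (CG 0) \<and> (1 \<le> p \<longrightarrow> f [] = \<zero>\<^bsub>M\<^esub>)"
proof (intro iffI conjI impI)
  show "f \<in> V p 0" if f: "f \<in> carrier (CG 0) \<and> (1 \<le> p \<longrightarrow> f [] = \<zero>\<^bsub>M\<^esub>)"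
    using f by (intro V_I) (simp_all add: G.tuples_0)
qed (simp_all add: V_apply[of _ p 0])

text \<open>Deleting an argument from \<open>I\<close> lowers both the degree and the number of
  arguments in \<open>I\<close>, so the bound for \<open>p\<close> persists. Deleting any other
  argument lowers only the degree, which amounts to \<open>p - 1\<close> in place of
  \<open>p\<close>.\<close>

lemma V_Suc:
  "f \<in> V p (Suc n) \<longleftrightarrow> f \<in> carrier (CG (Suc n)) \<and> (\<forall>x\<in>carrier L. \<iota>G n x f \<in> V (p - 1) n)
    \<and> (\<forall>x\<in>I. \<iota>G n x f \<in> V p n)"
proof (intro iffI conjI ballI)
  assume f: "f \<in> V p (Suc n)"
  then show fc: "f \<in> carrier (CG (Suc n))" by simp
  show "\<iota>G n x f \<in> V (p - 1) n" if "x \<in> carrier L" for x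
  proof (rule V_I)
    fix xs assume "xs \<in> tuples L n" "int n - (p - 1) + 1 \<le> int (length (filter (\<lambda>x. x \<in> I) xs))"
    then show "\<iota>G n x f xs = \<zero>\<^bsub>M\<^esub>" using V_apply[OF f, of "x # xs"] that by auto
  qed (use fc that in auto)
  show "\<iota>G n x f \<in> V p n" if x: "x \<in> I" for x
  proof (rule V_I)
    fix xs assume "xs \<in> tuples L n" "int n - p + 1 \<le> int (length (filter (\<lambda>x. x \<in> I) xs))"
    then show "\<iota>G n x f xs = \<zero>\<^bsub>M\<^esub>" using V_apply[OF f, of "x # xs"] x by auto
  qed (use fc x in auto)
next
  assume f: "f \<in> carrier (CG (Suc n)) \<and> (\<forall>x\<in>carrier L. \<iota>G n x f \<in> V (p - 1) n)
    \<and> (\<forall>x\<in>I. \<iota>G n x f \<in> V p n)"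
  show "f \<in> V p (Suc n)"
  proof (rule V_I)
    fix xs assume xs: "xs \<in> tuples L (Suc n)"
      and l: "int (Suc n) - p + 1 \<le> int (length (filter (\<lambda>x. x \<in> I) xs))"
    obtain y ys where y: "xs = y # ys" "y \<in> carrier L" "ys \<in> tuples L n" using xs
      by (rule G.tuples_SucE)
    have "\<iota>G n y f ys = \<zero>\<^bsub>M\<^esub>"
    proof (cases "y \<in> I")
      case True
      then show ?thesis using f y l by (intro V_apply[of _ p n]) auto
    next
      case False
      then show ?thesis using f y l by (intro V_apply[of _ "p - 1" n]) auto
    qed
    then show "f xs = \<zero>\<^bsub>M\<^esub>" using y by simp
  qed (use f in simp)
qed

lemma V_contract: "f \<in> V p (Suc n) \<Longrightarrow> x \<in> carrier L \<Longrightarrow> \<iota>G n x f \<in> V (p - 1) n"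
  "f \<in> V p (Suc n) \<Longrightarrow> x \<in> I \<Longrightarrow> \<iota>G n x f \<in> V p n"
  by (simp_all add: V_Suc)

text \<open>The correction term in \<open>contract_theta\<close> contracts with
  \<open>[x,z]\<close>, which lies in \<open>I\<close> whenever \<open>z\<close> does.\<close>

lemma V_theta:
  assumes "f \<in> V p n" "x \<in> carrier L"
  shows "\<theta>G n x f \<in> V p n"
  using assms(1)
proof (induction n arbitrary: f p)
  case 0
  then show ?case using assms(2) G.theta_closed[of f 0 x] by (auto simp: V_0 G.theta_apply act_zero)
next
  case (Suc n)
  note V_c = V_closed(6)
  show ?case
    unfolding V_Suc
  proof (intro conjI ballI)
    have f: "f \<in> carrier (CG (Suc n))" using Suc.prems by simp
    then show "\<theta>G (Suc n) x f \<in> carrier (CG (Suc n))" using assms(2) by simp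
    show "\<iota>G n z (\<theta>G (Suc n) x f) \<in> V (p - 1) n" if "z \<in> carrier L" for z
      unfolding G.contract_theta[OF f assms(2) that]
      using that assms(2) Suc.prems by (intro V_c Suc.IH V_contract) auto
    show "\<iota>G n z (\<theta>G (Suc n) x f) \<in> V p n" if "z \<in> I" for z
      unfolding G.contract_theta[OF f assms(2) I_carrier[OF that]]
      using that assms(2) Suc.prems by (intro V_c Suc.IH V_contract) auto
  qed
qed

section \<open>Restriction to the ideal\<close>

text \<open>Pullback along the inclusion of \<open>I\<close>. It is \<open>s_p\<close> for
  \<open>p = 0\<close>, from which the inductions on \<open>p\<close> start.\<close>

definition "restr n u = (\<lambda>ys\<in>tuples R n. u ys)"

lemma tuples_R_L: "ys \<in> tuples R n \<Longrightarrow> ys \<in> tuples L n"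
  by (auto simp: tuples_def)

lemma restr_apply [simp]: "ys \<in> tuples R n \<Longrightarrow> restr n u ys = u ys"
  by (simp add: restr_def)

lemma restr_ext: "restr n u \<in> extensional (tuples R n)"
  by (simp add: restr_def)

lemma restr_contract: "x \<in> I \<Longrightarrow> \<iota> n x (restr (Suc n) u) = restr n (\<iota>G n x u)"
  by (auto simp: contract_def restr_def tuples_R_L intro!: restrict_ext)

lemma restr_linear:
  "restr n (u \<oplus>\<^bsub>CG n\<^esub> v) = restr n u \<oplus>\<^bsub>C n\<^esub> restr n v"
  "restr n (a \<odot>\<^bsub>CG n\<^esub> u) = a \<odot>\<^bsub>C n\<^esub> restr n u"
  "restr n \<zero>\<^bsub>CG n\<^esub> = \<zero>\<^bsub>C n\<^esub>"
  by (auto simp: restr_def C_simps G.C_simps tuples_R_L intro!: restrict_ext)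

lemma restr_closed [simp, intro]: "u \<in> carrier (CG n) \<Longrightarrow> restr n u \<in> carrier (C n)"
proof (induction n arbitrary: u)
  case 0
  then show ?case using G.C_closed[of u 0 "[]"] by (intro C_0I restr_ext) simp
next
  case (Suc n)
  show ?case
  proof (rule C_SucI)
    show "\<iota> m x (\<iota> n x (restr (Suc n) u)) = \<zero>\<^bsub>C m\<^esub>" if "n = Suc m" "x \<in> I" for m x
      using Suc.prems that G.contract_self[of u m x] by (simp add: restr_contract restr_linear)
  qed (use Suc in \<open>simp_all add: restr_ext restr_contract G.contract_add_left G.contract_smult_left
    restr_linear\<close>)
qed

lemma restr_minus:
  "u \<in> carrier (CG n) \<Longrightarrow> v \<in> carrier (CG n) \<Longrightarrow> restr n (u \<ominus>\<^bsub>CG n\<^esub> v) = restr n u \<ominus>\<^bsub>C n\<^esub> restr n v"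
  using restr_linear(1)[of n "u \<ominus>\<^bsub>CG n\<^esub> v" v] by (simp add: G.C.minus_add_cancel C.eq_minus_iff)

lemma restr_theta:
  assumes "u \<in> carrier (CG n)" "x \<in> carrier L"
  shows "restr n (\<theta>G n x u) = \<theta> n x (restr n u)"
  using assms(1)
proof (induction n arbitrary: u)
  case 0
  show ?case
    by (rule C_eqI[where n = 0])
      (use 0 assms(2) in \<open>simp_all add: G.theta_apply theta_apply tuples_R_L\<close>)
next
  case (Suc n)
  show ?case
    by (rule contract_eqI[where n = n])
      (use Suc assms(2) in \<open>simp_all add: restr_contract contract_theta G.contract_theta restr_minus\<close>)
qed

lemma restr_d:
  assumes "u \<in> carrier (CG n)"
  shows "restr (Suc n) (dG n u) = d n (restr n u)"
  using assms
proof (induction n arbitrary: u)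
  case 0
  show ?case
    by (rule contract_eqI[where n = 0])
      (use 0 in \<open>simp_all add: restr_contract contract_d_0 G.contract_d_0 restr_theta\<close>)
next
  case (Suc n)
  show ?case
    by (rule contract_eqI[where n = "Suc n"])
      (use Suc in \<open>simp_all add: restr_contract contract_d_Suc G.contract_d_Suc restr_theta
        restr_minus\<close>)
qed

lemma IK_L: "IK \<subseteq> carrier L" by auto

lemma restr_rel: "u \<in> relG n \<Longrightarrow> restr n u \<in> rel IK n"
proof (rule relI[OF IK_I])
  assume u: "u \<in> relG n"
  note uc = G.rel_subset[OF u]
  then show "restr n u \<in> carrier (C n)" by simp
  show "\<theta> n x (restr n u) = \<zero>\<^bsub>C n\<^esub>" if "x \<in> IK" for x
    using that uc G.rel_theta[OF u that] by (simp add: restr_theta[symmetric] restr_linear)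
  show "\<iota> m x (restr n u) = \<zero>\<^bsub>C m\<^esub>" if "n = Suc m" "x \<in> IK" for m x
    using that uc G.rel_contract[OF IK_L _ that(2), of u m] u by (simp add: restr_contract restr_linear)
qed

text \<open>For \<open>p = 1\<close> the bound \<open>n - p + 1\<close> equals \<open>n\<close>:
  values vanish when all arguments lie in \<open>I\<close>.\<close>

lemma restr_V: "u \<in> V 1 n \<Longrightarrow> restr n u = \<zero>\<^bsub>C n\<^esub>"
proof (rule C_eqI[where n = n])
  assume u: "u \<in> V 1 n"
  then show "restr n u \<in> carrier (C n)" by auto
  fix xs assume xs: "xs \<in> tuples R n"
  then have "filter (\<lambda>x. x \<in> I) xs = xs" by (auto simp: tuples_def filter_id_conv)
  then show "restr n u xs = \<zero>\<^bsub>C n\<^esub> xs"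
    using xs V_apply[OF u tuples_R_L[OF xs]] by (simp add: C_eval tuples_def)
qed simp

section \<open>The map from filtered cochains to the double complex\<close>

text \<open>
  Relativity is required with respect to \<open>I \<inter> K\<close> only: contraction with elements of \<open>cent\<close>
  preserves this, but not invariance under \<open>K\<close>.
\<close>

definition "W p q = {u \<in> relG (p + q). u \<in> V (int p) (p + q)
  \<and> dG (p + q) u \<in> V (int p + 1) (Suc (p + q))}"

lemma W_D:
  assumes "u \<in> W p q"
  shows "u \<in> relG (p + q)" "u \<in> V (int p) (p + q)" "dG (p + q) u \<in> V (int p + 1) (Suc (p + q))"
    "u \<in> carrier (CG (p + q))"
  using assms unfolding W_def by blast+

lemma W_I:
  "u \<in> relG (p + q) \<Longrightarrow> u \<in> V (int p) (p + q) \<Longrightarrow> dG (p + q) u \<in> V (int p + 1) (Suc (p + q)) \<Longrightarrow> u \<in> W p q"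
  unfolding W_def by blast

text \<open>For the last condition use \<open>d i_x u = \<theta>_x u - i_x d u\<close>. The first
  term keeps the filtration \<open>p + 1\<close> of \<open>u\<close>; in the second, contraction
  costs one of the \<open>p + 2\<close> steps of \<open>d u\<close>.\<close>

lemma W_contract:
  assumes u: "u \<in> W (Suc p) q" and x: "x \<in> cent"
  shows "\<iota>G (p + q) x u \<in> W p q"
proof (rule W_I)
  have uc: "u \<in> carrier (CG (Suc (p + q)))" using W_D[OF u] by simp
  show "\<iota>G (p + q) x u \<in> relG (p + q)"
    using W_D(1)[OF u] x cent_commute by (intro G.contract_rel[OF IK_L]) auto
  show "\<iota>G (p + q) x u \<in> V (int p) (p + q)"
    using V_contract(1)[of u "int (Suc p)" "p + q" x] W_D(2)[OF u] x by simp
  have "\<iota>G (Suc (p + q)) x (dG (Suc (p + q)) u) = \<theta>G (Suc (p + q)) x u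
    \<ominus>\<^bsub>CG (Suc (p + q))\<^esub> dG (p + q) (\<iota>G (p + q) x u)"
    using uc x by (intro G.contract_d_Suc) auto
  then have e: "dG (p + q) (\<iota>G (p + q) x u) = \<theta>G (Suc (p + q)) x u
    \<ominus>\<^bsub>CG (Suc (p + q))\<^esub> \<iota>G (Suc (p + q)) x (dG (Suc (p + q)) u)"
    using uc x by (simp add: G.C.ag_simps)
  have "\<theta>G (Suc (p + q)) x u \<in> V (int p + 1) (Suc (p + q))"
    using W_D(2)[OF u] x by (intro V_theta) (auto simp: add.commute)
  moreover have "\<iota>G (Suc (p + q)) x (dG (Suc (p + q)) u) \<in> V (int p + 1) (Suc (p + q))"
    using V_contract(1)[OF W_D(3)[OF u, simplified], of x] x by (simp add: add.commute)
  ultimately show "dG (p + q) (\<iota>G (p + q) x u) \<in> V (int p + 1) (Suc (p + q))"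
    unfolding e by (rule V_closed(6))
qed

lemma W_theta:
  assumes u: "u \<in> W p q" and x: "x \<in> cent"
  shows "\<theta>G (p + q) x u \<in> W p q"
proof (rule W_I)
  show "\<theta>G (p + q) x u \<in> relG (p + q)"
    using W_D(1)[OF u] x cent_commute by (intro G.theta_rel[OF IK_L]) auto
  show "\<theta>G (p + q) x u \<in> V (int p) (p + q)" using W_D(2)[OF u] x by (intro V_theta) auto
  show "dG (p + q) (\<theta>G (p + q) x u) \<in> V (int p + 1) (Suc (p + q))"
    unfolding G.theta_d[OF W_D(4)[OF u] cent_carrier[OF x], symmetric]
    using W_D(3)[OF u] x by (intro V_theta) auto
qed

lemma W_d:
  assumes u: "u \<in> W p q"
  shows "dG (p + q) u \<in> W (Suc p) q"
  using G.rel_d[OF IK_L W_D(1)[OF u]] W_D(3)[OF u] G.d_d[OF W_D(4)[OF u]] V_closed(2)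
  by (intro W_I) (simp_all add: add.commute)

text \<open>The purpose of the condition on \<open>d u\<close> in \<open>W\<close>: a differential
  in \<open>F_1\<close> restricts to zero on \<open>I\<close>.\<close>

lemma W_restr_cyc: "u \<in> W 0 q \<Longrightarrow> restr q u \<in> cyc IK q"
  using restr_rel[of u q] restr_d[of u q] restr_V[of "dG q u" "Suc q"] W_D[of u 0 q]
    by (simp add: cyc_iff)

section \<open>The maps \<open>s_p\<close> and \<open>w\<close>, and independence of
  representatives\<close>

abbreviation "s p q u \<equiv> s_map L I p q u"
abbreviation "w p q u \<equiv> alpha_map F L I K M p q (s_map L I p q u)"

lemma some_coset:
  assumes "X \<in> carrier Q"
  shows "(SOME x. x \<in> X) \<in> carrier L" "coset (SOME x. x \<in> X) = X"
proof -
  obtain x where x: "x \<in> carrier L" "X = coset x" using assms by (rule carrier_QE)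
  then have "x \<in> X" using L.coset_self[OF ideal_submodule] by simp
  then have "(SOME x. x \<in> X) \<in> X" by (rule someI)
  then show "(SOME x. x \<in> X) \<in> carrier L" "coset (SOME x. x \<in> X) = X"
    using mem_coset_carrier[OF x(1)] x by auto
qed

lemma s_0: "s 0 q u [] = restr q u"
  by (simp add: s_map_def restr_def)

lemma HQ_tuples_reps:
  assumes "Xs \<in> tuples Q p"
  shows "map (\<lambda>X. SOME x. x \<in> X) Xs \<in> tuples L p"
  using assms some_coset(1) by (auto simp: tuples_def)

lemma tuples_append: "xs \<in> tuples L p \<Longrightarrow> ys \<in> tuples L q \<Longrightarrow> xs @ ys \<in> tuples L (p + q)"
  by (auto simp: tuples_def)

lemma s_apply: "Xs \<in> tuples Q p \<Longrightarrow> ys \<in> tuples R q \<Longrightarrow> s p q u Xs ys = u (map (\<lambda>X. SOME x. x \<in> X) Xs @ ys)"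
  by (simp add: s_map_def)

lemma s_ext: "Xs \<in> tuples Q p \<Longrightarrow> s p q u Xs \<in> extensional (tuples R q)"
  by (simp add: s_map_def)

lemma s_tuple: "Xs \<in> tuples Q p \<Longrightarrow> ys \<in> tuples R q \<Longrightarrow> map (\<lambda>X. SOME x. x \<in> X) Xs @ ys \<in> tuples L (p + q)"
  by (intro tuples_append HQ_tuples_reps tuples_R_L)

lemma s_Suc_some:
  assumes "X \<in> carrier Q" "Xs \<in> tuples Q p"
  shows "s (Suc p) q u (X # Xs) = s p q (\<iota>G (p + q) (SOME x. x \<in> X) u) Xs"
  by (rule extensionalityI[of _ "tuples R q"])
    (use assms s_tuple[OF assms(2)] in \<open>simp_all add: s_apply s_ext\<close>)

lemma s_linear:
  assumes "Xs \<in> tuples Q p"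
  shows "s p q (u \<oplus>\<^bsub>CG (p + q)\<^esub> v) Xs = s p q u Xs \<oplus>\<^bsub>C q\<^esub> s p q v Xs"
    "s p q (a \<odot>\<^bsub>CG (p + q)\<^esub> u) Xs = a \<odot>\<^bsub>C q\<^esub> s p q u Xs"
  by (rule extensionalityI[of _ "tuples R q"], use assms s_tuple[OF assms] in
      \<open>simp_all add: s_apply s_ext C_simps G.C_simps\<close>)+

lemma s_closed [simp, intro]: "u \<in> carrier (CG (p + q)) \<Longrightarrow> Xs \<in> tuples Q p \<Longrightarrow> s p q u Xs \<in> carrier (C q)"
proof (induction p arbitrary: u Xs)
  case 0
  then show ?case by (simp add: HQ.tuples_0 s_0)
next
  case (Suc p)
  obtain X Ys where X: "Xs = X # Ys" "X \<in> carrier Q" "Ys \<in> tuples Q p" using Suc.prems(2)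
    by (rule HQ.tuples_SucE)
  have "\<iota>G (p + q) (SOME x. x \<in> X) u \<in> carrier (CG (p + q))"
    using Suc.prems(1) some_coset(1)[OF X(2)] by (intro G.contract_closed) simp_all
  then show ?case using Suc.IH X by (simp add: s_Suc_some)
qed

text \<open>The last \<open>q\<close> arguments lie in \<open>I\<close>, and \<open>q\<close> is
  exactly the bound \<open>(p + q) - (p + 1) + 1\<close>.\<close>

lemma s_V:
  assumes u: "u \<in> V (int p + 1) (p + q)" and Xs: "Xs \<in> tuples Q p"
  shows "s p q u Xs = \<zero>\<^bsub>C q\<^esub>"
proof (rule extensionalityI[of _ "tuples R q"])
  fix ys assume ys: "ys \<in> tuples R q"
  have "filter (\<lambda>x. x \<in> I) ys = ys" "length ys = q" using ys by (auto simp: tuples_def filter_id_conv)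
  then have "u (map (\<lambda>X. SOME x. x \<in> X) Xs @ ys) = \<zero>\<^bsub>M\<^esub>"
    by (intro V_apply[OF u s_tuple[OF Xs ys]]) simp
  then show "s p q u Xs ys = \<zero>\<^bsub>C q\<^esub> ys" using Xs ys by (simp add: s_apply C_eval)
qed (use Xs in \<open>simp_all add: s_ext C_simps\<close>)

text \<open>Replacing the chosen representative by \<open>x\<close> changes the contraction by one
  with an element of \<open>I\<close>. That one remains in filtration \<open>p + 1\<close>, and
  \<open>s_V\<close> kills it.\<close>

lemma s_Suc:
  assumes u: "u \<in> V (int (Suc p)) (Suc (p + q))" and x: "x \<in> carrier L" and Xs: "Xs \<in> tuples Q p"
  shows "s (Suc p) q u (coset x # Xs) = s p q (\<iota>G (p + q) x u) Xs"
proof -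
  let ?y = "SOME y. y \<in> coset x"
  have y: "?y \<in> carrier L" "coset ?y = coset x" using some_coset[OF coset_carrier[OF x]] by auto
  then have i: "?y \<ominus>\<^bsub>L\<^esub> x \<in> I" using coset_eq_iff x by auto
  have uc: "u \<in> carrier (CG (Suc (p + q)))" using u by simp
  have "\<iota>G (p + q) ?y u = \<iota>G (p + q) x u \<oplus>\<^bsub>CG (p + q)\<^esub> \<iota>G (p + q) (?y \<ominus>\<^bsub>L\<^esub> x) u"
    using G.contract_add_left[OF uc, of x "?y \<ominus>\<^bsub>L\<^esub> x"] x y(1) i L.M.minus_add_cancel[of ?y x]
      by (simp add: L.M.a_comm)
  moreover have "\<iota>G (p + q) (?y \<ominus>\<^bsub>L\<^esub> x) u \<in> V (int p + 1) (p + q)"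
    using V_contract(2)[OF u i] by (simp add: add.commute)
  ultimately have "s p q (\<iota>G (p + q) ?y u) Xs = s p q (\<iota>G (p + q) x u) Xs"
    using Xs uc x s_closed[of "\<iota>G (p + q) x u" p q Xs] by (simp add: s_linear s_V)
  with s_Suc_some[OF coset_carrier[OF x] Xs] show ?thesis by (rule trans)
qed

lemma w_ext: "w p q u \<in> extensional (tuples Q p)"
  by (simp add: alpha_map_def)

lemma w_apply: "Xs \<in> tuples Q p \<Longrightarrow> w p q u Xs = cl q (s p q u Xs)"
  by (simp add: alpha_map_def)

abbreviation "CQ q p \<equiv> cochains F Q (H q) p"

lemma w_add:
  assumes "u \<in> carrier (CG (p + q))" "v \<in> carrier (CG (p + q))"
  shows "w p q (u \<oplus>\<^bsub>CG (p + q)\<^esub> v) = w p q u \<oplus>\<^bsub>CQ q p\<^esub> w p q v"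
  by (rule extensionalityI[of _ "tuples Q p"])
    (use assms in \<open>simp_all add: w_ext w_apply s_linear HQ.C_simps cl_add\<close>)

lemma w_smult:
  assumes "u \<in> carrier (CG (p + q))" "a \<in> carrier F"
  shows "w p q (a \<odot>\<^bsub>CG (p + q)\<^esub> u) = a \<odot>\<^bsub>CQ q p\<^esub> w p q u"
  by (rule extensionalityI[of _ "tuples Q p"])
    (use assms in \<open>simp_all add: w_ext w_apply s_linear HQ.C_simps cl_smult\<close>)

lemma w_V: "u \<in> V (int p + 1) (p + q) \<Longrightarrow> w p q u = \<zero>\<^bsub>CQ q p\<^esub>"
  by (rule extensionalityI[of _ "tuples Q p"])
    (simp_all add: w_ext w_apply s_V HQ.C_simps cl_zero)

lemma w_zero: "w p q \<zero>\<^bsub>CG (p + q)\<^esub> = \<zero>\<^bsub>CQ q p\<^esub>"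
  by (rule w_V) (rule V_closed(2))

lemma contract_w:
  assumes u: "u \<in> V (int (Suc p)) (Suc (p + q))" and x: "x \<in> carrier L"
  shows "contract Q p (coset x) (w (Suc p) q u) = w p q (\<iota>G (p + q) x u)"
  by (rule extensionalityI[of _ "tuples Q p"])
    (use assms in \<open>simp_all add: w_ext w_apply s_Suc contract_def\<close>)

lemma w_0: "w 0 q u [] = cl q (restr q u)"
  by (simp add: w_apply s_0)

text \<open>In outer degree \<open>0\<close> the value is the class of a cocycle by
  \<open>W_restr_cyc\<close>. Above it, contraction with a representative in \<open>cent\<close>
  stays in \<open>W\<close>, so \<open>C_SucI\<close> applies.\<close>

lemma w_closed [simp, intro]: "u \<in> W p q \<Longrightarrow> w p q u \<in> carrier (CQ q p)"
proof (induction p arbitrary: u)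
  case 0
  show ?case by (rule HQ.C_0I) (use W_restr_cyc[OF 0] in \<open>simp_all add: w_ext w_0\<close>)
next
  case (Suc p)
  have u: "u \<in> V (int (Suc p)) (Suc (p + q))" "u \<in> carrier (CG (Suc (p + q)))"
    using W_D[OF Suc.prems] by simp_all
  show ?case
  proof (rule HQ.C_SucI)
    fix X assume "X \<in> carrier Q"
    then obtain x where x: "x \<in> cent" "X = coset x" by (rule cent_QE)
    show "contract Q p X (w (Suc p) q u) \<in> carrier (CQ q p)"
      using contract_w[OF u(1), of x] x Suc.IH W_contract[OF Suc.prems x(1)] by simp
    show "contract Q p (a \<odot>\<^bsub>Q\<^esub> X) (w (Suc p) q u) = a \<odot>\<^bsub>CQ q p\<^esub> contract Q p X (w (Suc p) q u)"
      if "a \<in> carrier F" for a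
      using x that u contract_w[OF u(1)] by (simp add: coset_smult G.contract_smult_left w_smult)
    show "contract Q m X (contract Q p X (w (Suc p) q u)) = \<zero>\<^bsub>CQ q m\<^esub>" if p: "p = Suc m" for m
    proof -
      have "\<iota>G (p + q) x u \<in> V (int (Suc m)) (Suc (m + q))"
        using W_D(2)[OF W_contract[OF Suc.prems x(1)]] p by simp
      then show ?thesis
        using contract_w[OF u(1), of x] contract_w[of "\<iota>G (p + q) x u" m q x] G.contract_self[of u
          "m + q" x] x u p
        by (simp add: w_zero)
    qed
    fix Y assume "Y \<in> carrier Q"
    then obtain y where y: "y \<in> cent" "Y = coset y" by (rule cent_QE)
    show "contract Q p (X \<oplus>\<^bsub>Q\<^esub> Y) (w (Suc p) q u) = contract Q p X (w (Suc p) q u)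
      \<oplus>\<^bsub>CQ q p\<^esub> contract Q p Y (w (Suc p) q u)"
      using x y u contract_w[OF u(1)] by (simp add: coset_add G.contract_add_left w_add)
  qed (rule w_ext)
qed

text \<open>The base case is \<open>act_H\<close>. In the induction step the correction term of
  \<open>contract_theta\<close> stays in \<open>W\<close>, because \<open>cent\<close> is closed
  under the bracket.\<close>

lemma w_theta:
  assumes "u \<in> W p q" "x \<in> cent"
  shows "w p q (\<theta>G (p + q) x u) = theta Q (H q) p (coset x) (w p q u)"
  using assms(1)
proof (induction p arbitrary: u)
  case 0
  note uW = 0
  have uc: "u \<in> carrier (CG q)" using W_D[OF 0] by simp
  show ?case
  proof (rule HQ.C_eqI[where n = 0])
    show "w 0 q (\<theta>G (0 + q) x u) \<in> carrier (CQ q 0)" using W_theta[OF 0 assms(2)] by (rule w_closed)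
    show "theta Q (H q) 0 (coset x) (w 0 q u) \<in> carrier (CQ q 0)" using 0 assms(2) by auto
    fix Xs assume "Xs \<in> tuples Q 0"
    then have [simp]: "Xs = []" by (simp add: HQ.tuples_0)
    have "theta Q (H q) 0 (coset x) (w 0 q u) [] = act (H q) (coset x) (w 0 q u [])"
      using uW w_closed[OF uW] HQ.C_closed[OF w_closed[OF uW], of "[]"] assms(2)
        by (simp add: HQ.theta_0)
    also have "\<dots> = cl q (restr q (\<theta>G q x u))"
      using act_H[OF assms(2) W_restr_cyc[OF uW]] uc assms(2) by (simp add: w_0 restr_theta)
    finally show "w 0 q (\<theta>G (0 + q) x u) Xs = theta Q (H q) 0 (coset x) (w 0 q u) Xs"
      by (simp add: w_0)
  qed
next
  case (Suc p)
  let ?n = "p + q" and ?X = "coset x"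
  have u: "u \<in> V (int (Suc p)) (Suc ?n)" "u \<in> carrier (CG (Suc ?n))" using W_D[OF Suc.prems] by simp_all
  have wc: "w (Suc p) q u \<in> carrier (CQ q (Suc p))" using Suc.prems by (rule w_closed)
  show ?case
  proof (rule HQ.contract_eqI[where n = p])
    show "w (Suc p) q (\<theta>G (Suc p + q) x u) \<in> carrier (CQ q (Suc p))"
      using W_theta[OF Suc.prems assms(2)] by (rule w_closed)
    show "theta Q (H q) (Suc p) ?X (w (Suc p) q u) \<in> carrier (CQ q (Suc p))" using wc assms(2) by auto
    fix Z assume "Z \<in> carrier Q"
    then obtain z where z: "z \<in> cent" "Z = coset z" by (rule cent_QE)
    have b: "bracket L x z \<in> cent" using assms(2) z cent_bracket by auto
    have th: "\<theta>G (Suc ?n) x u \<in> V (int (Suc p)) (Suc ?n)" using u assms(2) by (intro V_theta) auto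
    have "\<theta>G ?n x (\<iota>G ?n z u) = \<iota>G ?n z (\<theta>G (Suc ?n) x u) \<oplus>\<^bsub>CG ?n\<^esub> \<iota>G ?n (bracket L x z) u"
      using G.contract_theta[OF u(2), of x z] assms(2) z u b by (simp add: G.C.minus_add_cancel)
    then have "w p q (\<theta>G ?n x (\<iota>G ?n z u)) = w p q (\<iota>G ?n z (\<theta>G (Suc ?n) x u))
      \<oplus>\<^bsub>CQ q p\<^esub> w p q (\<iota>G ?n (bracket L x z) u)"
      using u assms(2) z b by (simp add: w_add)
    moreover have "w p q (\<theta>G ?n x (\<iota>G ?n z u)) = theta Q (H q) p ?X (w p q (\<iota>G ?n z u))"
      using Suc.IH[OF W_contract[OF Suc.prems z(1)]] .
    moreover have "w p q (\<iota>G ?n z (\<theta>G (Suc ?n) x u)) \<in> carrier (CQ q p)"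
      using W_contract[OF _ z(1), of "\<theta>G (Suc ?n) x u" p q] W_theta[OF Suc.prems assms(2)] by simp
    moreover have "w p q (\<iota>G ?n (bracket L x z) u) \<in> carrier (CQ q p)"
      "w p q (\<iota>G ?n z u) \<in> carrier (CQ q p)"
      using W_contract[OF Suc.prems] b z by auto
    ultimately have "w p q (\<iota>G ?n z (\<theta>G (Suc ?n) x u)) = theta Q (H q) p ?X (w p q (\<iota>G ?n z u))
      \<ominus>\<^bsub>CQ q p\<^esub> w p q (\<iota>G ?n (bracket L x z) u)"
      using assms(2) by (simp add: HQ.C.eq_minus_iff)
    then show "contract Q p Z (w (Suc p) q (\<theta>G (Suc p + q) x u))
      = contract Q p Z (theta Q (H q) (Suc p) ?X (w (Suc p) q u))"
      using HQ.contract_theta[OF wc, of ?X Z] contract_w[OF th, of z] contract_w[OF u(1)] z assms(2) b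
      by (simp add: coset_bracket)
  qed
qed

text \<open>The differential commutes with restriction to \<open>I\<close>, so \<open>d u\<close>
  restricts to a coboundary there. This disposes of \<open>d i_x u\<close> at the start of
  \<open>w_d\<close> and of the coboundaries in \<open>B_2\<close> for \<open>p = 0\<close>.\<close>

lemma w_d_aux: "u \<in> relG q \<Longrightarrow> w 0 (Suc q) (dG q u) = \<zero>\<^bsub>CQ (Suc q) 0\<^esub>"
proof (rule extensionalityI[of _ "tuples Q 0"])
  fix Xs assume u: "u \<in> relG q" and "Xs \<in> tuples Q 0"
  moreover have "restr (Suc q) (dG q u) \<in> bnd IK (Suc q)"
    using restr_rel[OF u] by (simp add: restr_d[OF G.rel_subset[OF u]] bnd_Suc)
  ultimately show "w 0 (Suc q) (dG q u) Xs = \<zero>\<^bsub>CQ (Suc q) 0\<^esub> Xs"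
    by (simp add: HQ.tuples_0 w_0 HQ.C_simps cl_bnd)
qed (simp_all add: w_ext HQ.C_simps)

text \<open>Cartan's formula holds in both complexes; its \<theta>-terms are matched by
  \<open>w_theta\<close> and the terms \<open>d i_x\<close> by the induction hypothesis.\<close>

lemma w_d:
  assumes "u \<in> W p q"
  shows "w (Suc p) q (dG (p + q) u) = ce_diff Q (H q) p (w p q u)"
  using assms
proof (induction p arbitrary: u)
  case 0
  have u: "u \<in> carrier (CG q)" "dG q u \<in> V (int (Suc 0)) (Suc (0 + q))" using W_D[OF 0] by simp_all
  show ?case
  proof (rule HQ.contract_eqI[where n = 0])
    show "w (Suc 0) q (dG (0 + q) u) \<in> carrier (CQ q (Suc 0))" using W_d[OF 0] by (rule w_closed)
    show "ce_diff Q (H q) 0 (w 0 q u) \<in> carrier (CQ q (Suc 0))" using 0 by auto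
    fix X assume "X \<in> carrier Q"
    then obtain x where x: "x \<in> cent" "X = coset x" by (rule cent_QE)
    \<comment> \<open>For \<open>q > 0\<close> Cartan's formula produces \<open>d i_x u\<close>,
      which has no counterpart over the quotient, where outer degree \<open>0\<close> admits no
      contraction; \<open>w_d_aux\<close> removes it.\<close>
    have "w 0 q (\<iota>G q x (dG q u)) = w 0 q (\<theta>G q x u)"
    proof (cases q)
      case 0
      then show ?thesis using G.contract_d_0[of u x] u x by simp
    next
      case (Suc k)
      have k: "\<iota>G k x u \<in> relG k"
        using W_D(1)[OF \<open>u \<in> W 0 q\<close>] Suc x cent_commute by (intro G.contract_rel[OF IK_L]) auto
      have "\<theta>G q x u = \<iota>G q x (dG q u) \<oplus>\<^bsub>CG q\<^esub> dG k (\<iota>G k x u)"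
        using G.contract_d_Suc[of u k x] u x Suc by (simp add: G.C.minus_add_cancel)
      then have "w 0 q (\<theta>G q x u) = w 0 q (\<iota>G q x (dG q u)) \<oplus>\<^bsub>CQ q 0\<^esub> w 0 q (dG k (\<iota>G k x u))"
        using w_add[of "\<iota>G q x (dG q u)" 0 q "dG k (\<iota>G k x u)"] u x Suc by simp
      moreover have "w 0 q (\<iota>G q x (dG q u)) \<in> carrier (CQ q 0)"
        using W_contract[OF W_d[OF \<open>u \<in> W 0 q\<close>] x(1)] by (simp add: w_closed)
      ultimately show ?thesis using w_d_aux[OF k] Suc by simp
    qed
    then show "contract Q 0 X (w (Suc 0) q (dG (0 + q) u))
      = contract Q 0 X (ce_diff Q (H q) 0 (w 0 q u))"
      using contract_w[OF u(2), of x] w_theta[OF 0 x(1)] HQ.contract_d_0[OF w_closed[OF 0], of X] x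
        by simp
  qed
next
  case (Suc p)
  let ?n = "Suc (p + q)"
  have u: "u \<in> carrier (CG ?n)" "dG ?n u \<in> V (int (Suc (Suc p))) (Suc ?n)" "u \<in> V (int (Suc p)) ?n"
    using W_D[OF Suc.prems] by (simp_all add: add.commute)
  have wc: "w (Suc p) q u \<in> carrier (CQ q (Suc p))" using Suc.prems by (rule w_closed)
  show ?case
  proof (rule HQ.contract_eqI[where n = "Suc p"])
    show "w (Suc (Suc p)) q (dG (Suc p + q) u) \<in> carrier (CQ q (Suc (Suc p)))"
      using W_d[OF Suc.prems] by (rule w_closed)
    show "ce_diff Q (H q) (Suc p) (w (Suc p) q u) \<in> carrier (CQ q (Suc (Suc p)))" using wc by auto
    fix X assume "X \<in> carrier Q"
    then obtain x where x: "x \<in> cent" "X = coset x" by (rule cent_QE)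
    have "\<theta>G ?n x u = \<iota>G ?n x (dG ?n u) \<oplus>\<^bsub>CG ?n\<^esub> dG (p + q) (\<iota>G (p + q) x u)"
      using G.contract_d_Suc[of u "p + q" x] u x by (simp add: G.C.minus_add_cancel)
    then have "w (Suc p) q (\<theta>G ?n x u) = w (Suc p) q (\<iota>G ?n x (dG ?n u))
      \<oplus>\<^bsub>CQ q (Suc p)\<^esub> w (Suc p) q (dG (p + q) (\<iota>G (p + q) x u))"
      using w_add[of "\<iota>G ?n x (dG ?n u)" "Suc p" q "dG (p + q) (\<iota>G (p + q) x u)"] u x by simp
    moreover have "w (Suc p) q (dG (p + q) (\<iota>G (p + q) x u))
      = ce_diff Q (H q) p (w p q (\<iota>G (p + q) x u))"
      by (rule Suc.IH[OF W_contract[OF Suc.prems x(1)]])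
    moreover have "w (Suc p) q (\<iota>G ?n x (dG ?n u)) \<in> carrier (CQ q (Suc p))"
      using W_contract[OF W_d[OF Suc.prems] x(1)] by simp
    moreover have "w p q (\<iota>G (p + q) x u) \<in> carrier (CQ q p)" using W_contract[OF Suc.prems x(1)]
      by (rule w_closed)
    ultimately have "w (Suc p) q (\<iota>G ?n x (dG ?n u)) = w (Suc p) q (\<theta>G ?n x u)
      \<ominus>\<^bsub>CQ q (Suc p)\<^esub> ce_diff Q (H q) p (w p q (\<iota>G (p + q) x u))"
      using HQ.d_closed[of "w p q (\<iota>G (p + q) x u)" q p] by (simp add: HQ.C.eq_minus_iff)
    then show "contract Q (Suc p) X (w (Suc (Suc p)) q (dG (Suc p + q) u))
      = contract Q (Suc p) X (ce_diff Q (H q) (Suc p) (w (Suc p) q u))"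
      using contract_w[of "dG ?n u" "Suc p" q x] u contract_w[OF u(3), of x] w_theta[OF Suc.prems
        x(1)] HQ.contract_d_Suc[OF wc, of X] x by simp
  qed
qed

abbreviation "KQ \<equiv> image_in_quotient L I K"

text \<open>Both properties are needed at once in \<open>w_rel\<close>: membership in
  \<open>cent\<close> lets \<theta> pass through \<open>w\<close>, and membership in
  \<open>K\<close> brings in the relativity of \<open>u\<close>.\<close>

lemma KQ_QE:
  assumes "X \<in> KQ"
  obtains x where "x \<in> cent" "x \<in> K" "X = coset x"
proof -
  obtain k where k: "k \<in> K" "X = coset k" using assms by (auto simp: image_in_quotient_def)
  obtain j where j: "j \<in> J" "j \<in> K" "k \<ominus>\<^bsub>L\<^esub> j \<in> I" using K_rep[OF k(1)] by auto
  have "coset k = coset j" using coset_eq_iff[of k j] k j K_subset by auto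
  then show thesis using that[of j] J_cent j k by simp
qed

lemma KQ_Q: "KQ \<subseteq> carrier Q"
  using K_subset by (auto simp: image_in_quotient_def)

lemma w_rel:
  assumes u: "u \<in> rel_cochains F L K M (p + q)" and W: "u \<in> W p q"
  shows "w p q u \<in> rel_cochains F Q KQ (H q) p"
proof (rule HQ.relI[OF KQ_Q])
  show "w p q u \<in> carrier (CQ q p)" using W by (rule w_closed)
  fix X assume "X \<in> KQ"
  then obtain x where x: "x \<in> cent" "x \<in> K" "X = coset x" by (rule KQ_QE)
  show "theta Q (H q) p X (w p q u) = \<zero>\<^bsub>CQ q p\<^esub>"
    using w_theta[OF W x(1)] G.rel_theta[OF u x(2)] x by (simp add: w_zero)
  show "contract Q m X (w p q u) = \<zero>\<^bsub>CQ q m\<^esub>" if p: "p = Suc m" for m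
    using contract_w[of u m q x] W_D(2)[OF W] G.rel_contract[OF K_subset _ x(2), of u "m + q"] u x p
    by (simp add: w_zero)
qed

end

section \<open>The map on spectral sequence classes\<close>

context splitting_module
begin

abbreviation "bndQ p q \<equiv> coboundaries F Q KQ (H q) p"
abbreviation "cycQ p q \<equiv> cocycles F Q KQ (H q) p"
abbreviation "clQ p q z \<equiv> cohomology_class F Q KQ (H q) p z"

lemmas bndQ_sub = HQ.bnd_submodule[OF KQ_Q] and cycQ_sub = HQ.cyc_submodule[OF KQ_Q]

lemma page_D:
  assumes "c \<in> filt_page F L I K M r p n"
  shows "c \<in> rel_cochains F L K M n" "c \<in> V p n" "dG n c \<in> V (p + r) (Suc n)" "c \<in> carrier (CG n)"
  using assms by (auto simp: filt_page_def filt_eq)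

lemma rel_K_IK: "c \<in> rel_cochains F L K M n \<Longrightarrow> c \<in> relG n"
  by (auto simp: rel_cochains_def)

lemma page_W: "c \<in> filt_page F L I K M r (int p) (p + q) \<Longrightarrow> 1 \<le> r \<Longrightarrow> c \<in> W p q"
  by (rule W_I) (auto intro: rel_K_IK page_D V_mono[OF page_D(3)])

text \<open>Here the page number \<open>2\<close> enters: \<open>d c\<close> lies in
  \<open>F_{p+2}\<close>, which \<open>w (Suc p) q\<close> kills.\<close>

lemma w_page_cyc:
  assumes c: "c \<in> filt_page F L I K M 2 (int p) (p + q)"
  shows "w p q c \<in> cycQ p q"
proof -
  have W: "c \<in> W p q" using page_W[OF c] by simp
  have "w (Suc p) q (dG (p + q) c) = \<zero>\<^bsub>CQ q (Suc p)\<^esub>"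
    by (rule w_V) (use page_D(3)[OF c] in \<open>simp add: add.commute\<close>)
  then show ?thesis using w_rel[OF page_D(1)[OF c] W] w_d[OF W] by (simp add: HQ.cyc_iff)
qed

lemma page_zero: "\<zero>\<^bsub>CG n\<^esub> \<in> filt_page F L I K M r p n"
  using V_closed(2) G.C.submoduleD(2)[OF G.rel_submodule[OF K_subset]] G.d_zero
  by (simp add: filt_page_def filt_eq)

lemma spec_B_mem:
  assumes "v \<in> filt F L I K M (int p + 1) (p + q)"
  shows "v \<in> spec_B F L I K M 2 p q"
proof -
  let ?D = "diff_image F L M (filt_page F L I K M (2 - 1) (int p - 2 + 1)) (p + q)"
  have "\<zero>\<^bsub>CG (p + q)\<^esub> \<in> ?D"
  proof (cases "p + q")
    case (Suc n)
    have "dG n \<zero>\<^bsub>CG n\<^esub> \<in> dG n ` filt_page F L I K M (2 - 1) (int p - 2 + 1) n"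
      by (rule imageI) (rule page_zero)
    then show ?thesis using Suc G.d_zero by (simp add: diff_image_def)
  qed (simp add: diff_image_def)
  moreover have "v = \<zero>\<^bsub>CG (p + q)\<^esub> \<oplus>\<^bsub>CG (p + q)\<^esub> v" using assms by (auto simp: filt_eq)
  ultimately show ?thesis using assms unfolding spec_B_def set_add_def' by blast
qed

text \<open>Up to \<open>F_{p+1}\<close>, an element of \<open>B_2\<close> is \<open>d c\<close>
  with \<open>c\<close> in \<open>F_{p-1}\<close> and \<open>d c\<close> in \<open>F_p\<close>. For
  \<open>p = 0\<close> it restricts to a coboundary on \<open>I\<close>. For
  \<open>p = Suc p'\<close> the cochain \<open>c\<close> lies in \<open>W p' q\<close>, and
  \<open>w_d\<close> exhibits the image as a coboundary over the quotient.\<close>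

lemma w_spec_B:
  assumes "h \<in> spec_B F L I K M 2 p q"
  shows "h \<in> carrier (CG (p + q))" "w p q h \<in> bndQ p q"
proof -
  obtain u v where h: "h = u \<oplus>\<^bsub>CG (p + q)\<^esub> v" and v: "v \<in> filt F L I K M (int p + 1) (p + q)"
    and u: "u \<in> diff_image F L M (filt_page F L I K M 1 (int p - 1)) (p + q)"
    using assms unfolding spec_B_def set_add_def' by auto
  have vV: "v \<in> V (int p + 1) (p + q)" using v by (simp add: filt_eq)
  have uw: "u \<in> carrier (CG (p + q)) \<and> w p q u \<in> bndQ p q"
  proof (cases "p + q")
    \<comment> \<open>There are no cochains of degree \<open>-1\<close>: in total degree
      \<open>0\<close> the image of the differential is zero alone.\<close>
    case 0
    then show ?thesis
      using u w_zero[of p q] HQ.C.submoduleD(2)[OF bndQ_sub] by (simp add: diff_image_def)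
  next
    case (Suc n)
    then obtain c where c: "c \<in> filt_page F L I K M 1 (int p - 1) n" "u = dG n c"
      using u by (auto simp: diff_image_def)
    have uc: "u \<in> carrier (CG (p + q))" using page_D(4)[OF c(1)] c(2) Suc by simp
    show ?thesis
    proof (cases p)
      case 0
      then have "w p q u = \<zero>\<^bsub>CQ q p\<^esub>"
        using w_d_aux[of c n] rel_K_IK[OF page_D(1)[OF c(1)]] c(2) Suc by simp
      then show ?thesis using uc HQ.C.submoduleD(2)[OF bndQ_sub] by simp
    next
      case p': (Suc p')
      then have n: "n = p' + q" using Suc by simp
      have cW: "c \<in> W p' q" using page_W[of c 1 p' q] c(1) p' n by simp
      have "w p q u = ce_diff Q (H q) p' (w p' q c)" using w_d[OF cW] c(2) n p' by simp
      moreover have "w p' q c \<in> rel_cochains F Q KQ (H q) p'"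
        using w_rel[OF _ cW] page_D(1)[OF c(1)] n by simp
      ultimately show ?thesis using uc p' by (simp add: HQ.bnd_Suc)
    qed
  qed
  then show "h \<in> carrier (CG (p + q))" "w p q h \<in> bndQ p q"
    using h vV w_add[of u p q v] w_V[OF vV] HQ.C.submoduleD(1)[OF bndQ_sub, of q p] by auto
qed

text \<open>Stated for any \<open>x\<close> whose image under \<open>w\<close> is a cochain, so that
  it applies directly to a cup product known to lie in \<open>W\<close>.\<close>

lemma psi_coset:
  assumes x: "x \<in> carrier (CG (p + q))" and wx: "w p q x \<in> carrier (CQ q p)"
  shows "psi F L I K J M p q (spec_B F L I K M 2 p q +>\<^bsub>CG (p + q)\<^esub> x) = clQ p q (w p q x)"
proof -
  have "clQ p q (w p q c) = clQ p q (w p q x)" if "c \<in> spec_B F L I K M 2 p q +>\<^bsub>CG (p + q)\<^esub> x" for c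
  proof -
    obtain h where h: "h \<in> spec_B F L I K M 2 p q" "c = h \<oplus>\<^bsub>CG (p + q)\<^esub> x"
      using \<open>c \<in> _\<close> unfolding a_r_coset_def' by auto
    have "w p q c = w p q x \<oplus>\<^bsub>CQ q p\<^esub> w p q h"
      using w_spec_B[OF h(1)] h(2) x wx HQ.C.submoduleD(1)[OF bndQ_sub, of q p]
        by (simp add: w_add subset_iff HQ.C.a_comm)
    then show ?thesis using HQ.C.coset_add_mem[OF bndQ_sub wx] w_spec_B(2)[OF h(1)] by simp
  qed
  moreover have "x \<in> spec_B F L I K M 2 p q +>\<^bsub>CG (p + q)\<^esub> x"
  proof -
    have "\<zero>\<^bsub>CG (p + q)\<^esub> \<in> spec_B F L I K M 2 p q"
      by (rule spec_B_mem) (use page_zero[of "p + q" 0 "int p + 1"] in \<open>simp add: filt_page_def\<close>)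
    moreover have "x = \<zero>\<^bsub>CG (p + q)\<^esub> \<oplus>\<^bsub>CG (p + q)\<^esub> x" using x by simp
    ultimately show ?thesis unfolding a_r_coset_def' by blast
  qed
  ultimately show ?thesis unfolding psi_def beta_map_def by (intro equalityI; blast)
qed

text \<open>The pairing on the page uses representatives in \<open>F_pC^{p+q}(2)\<close> only; their
  existence keeps the unions in \<open>spec_cup\<close> from being empty.\<close>

lemma spec_E_rep:
  assumes "e \<in> carrier (spec_E F L I K M 2 p q)"
  shows "e \<inter> filt_page F L I K M 2 (int p) (p + q) \<noteq> {}"
    and "a \<in> e \<inter> filt_page F L I K M 2 (int p) (p + q) \<Longrightarrow> psi F L I K J M p q e = clQ p q (w p q a)"
proof -
  obtain z where z: "z \<in> spec_Z F L I K M 2 p q" "e = spec_B F L I K M 2 p q +>\<^bsub>CG (p + q)\<^esub> z"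
    using assms by (auto simp: spec_E_def subquotient_def)
  obtain a0 v where a0: "a0 \<in> filt_page F L I K M 2 (int p) (p + q)"
    and v: "v \<in> filt F L I K M (int p + 1) (p + q)"
    and z_eq: "z = a0 \<oplus>\<^bsub>CG (p + q)\<^esub> v"
    using z(1) unfolding spec_Z_def set_add_def' by auto
  have vV: "v \<in> V (int p + 1) (p + q)" "v \<in> carrier (CG (p + q))" using v by (auto simp: filt_eq)
  have a0c: "a0 \<in> carrier (CG (p + q))" using page_D(4)[OF a0] .
  have zc: "z \<in> carrier (CG (p + q))" using z_eq a0c vV by simp
  have wa0: "w p q a0 \<in> carrier (CQ q p)" using page_W[OF a0] by (simp add: w_closed)
  have wz: "w p q z = w p q a0" using z_eq w_add[OF a0c vV(2)] w_V[OF vV(1)] wa0 by simp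
  have psi: "psi F L I K J M p q e = clQ p q (w p q z)"
    unfolding z(2) using zc wz wa0 by (intro psi_coset) simp_all
  show "psi F L I K J M p q e = clQ p q (w p q a)" if a: "a \<in> e \<inter> filt_page F L I K M 2 (int p) (p + q)"
  proof -
    obtain h where h: "h \<in> spec_B F L I K M 2 p q" "a = h \<oplus>\<^bsub>CG (p + q)\<^esub> z"
      using a unfolding z(2) a_r_coset_def' by auto
    have "w p q a = w p q z \<oplus>\<^bsub>CQ q p\<^esub> w p q h"
      using w_spec_B[OF h(1)] h(2) zc wz wa0 HQ.C.submoduleD(1)[OF bndQ_sub, of q p]
        by (simp add: w_add subset_iff HQ.C.a_comm)
    then show ?thesis using HQ.C.coset_add_mem[OF bndQ_sub, of "w p q z"] w_spec_B(2)[OF h(1)] wz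
      wa0 psi by simp
  qed
  have "\<ominus>\<^bsub>CG (p + q)\<^esub> v \<in> filt F L I K M (int p + 1) (p + q)"
    using v V_closed(3) G.C.submoduleD(3)[OF G.rel_submodule[OF K_subset]] by (simp add: filt_eq)
  then have "\<ominus>\<^bsub>CG (p + q)\<^esub> v \<in> spec_B F L I K M 2 p q" by (rule spec_B_mem)
  moreover have "a0 = \<ominus>\<^bsub>CG (p + q)\<^esub> v \<oplus>\<^bsub>CG (p + q)\<^esub> z"
    using z_eq a0c vV(2) by (simp add: G.C.ag_simps)
  \<comment> \<open>The class was given by \<open>a0 + v\<close> with \<open>v\<close> in
    \<open>F_{p+1}\<close>. As \<open>-v\<close> lies in \<open>B_2\<close>, the summand
    \<open>a0\<close> represents the same class.\<close>
  ultimately have "a0 \<in> e" unfolding z(2) a_r_coset_def' by blast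
  then show "e \<inter> filt_page F L I K M 2 (int p) (p + q) \<noteq> {}" using a0 by blast
qed

lemma V_sign: "f \<in> V p n \<Longrightarrow> [((- 1 :: int) ^ k)] \<cdot>\<^bsub>CG n\<^esub> f \<in> V p n"
  using V_closed(3)[of f p n] by (simp add: G.C.add_pow_sign V_carrier)

text \<open>Negation is multiplication by the scalar \<open>-1\<close>, so it passes through
  \<open>w\<close> by \<open>w_smult\<close>.\<close>

lemma w_sign:
  assumes "u \<in> W p q"
  shows "w p q ([((- 1 :: int) ^ k)] \<cdot>\<^bsub>CG (p + q)\<^esub> u) = [((- 1 :: int) ^ k)] \<cdot>\<^bsub>CQ q p\<^esub> w p q u"
proof -
  have uc: "u \<in> carrier (CG (p + q))" and wc: "w p q u \<in> carrier (CQ q p)"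
    using W_D(4)[OF assms] w_closed[OF assms] .
  have "\<ominus>\<^bsub>CG (p + q)\<^esub> u = (\<ominus>\<^bsub>F\<^esub> \<one>\<^bsub>F\<^esub>) \<odot>\<^bsub>CG (p + q)\<^esub> u"
    using G.C.smult_l_minus[OF F.one_closed uc] uc by simp
  then have "w p q (\<ominus>\<^bsub>CG (p + q)\<^esub> u) = (\<ominus>\<^bsub>F\<^esub> \<one>\<^bsub>F\<^esub>) \<odot>\<^bsub>CQ q p\<^esub> w p q u"
    using w_smult[OF uc, of "\<ominus>\<^bsub>F\<^esub> \<one>\<^bsub>F\<^esub>"] by simp
  also have "\<dots> = \<ominus>\<^bsub>CQ q p\<^esub> w p q u"
    using HQ.C.smult_l_minus[OF F.one_closed wc] wc by simp
  finally show ?thesis using uc wc by (simp add: G.C.add_pow_sign HQ.C.add_pow_sign)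
qed

text \<open>The sign of the final formula is an integer multiple in the quotient module; this moves
  it to a representative.\<close>

lemma clQ_sign:
  assumes "z \<in> cycQ p q"
  shows "[((- 1 :: int) ^ k)] \<cdot>\<^bsub>double_cohomology F L I K J M p q\<^esub> clQ p q z
    = clQ p q ([((- 1 :: int) ^ k)] \<cdot>\<^bsub>CQ q p\<^esub> z)"
proof -
  interpret S: module F "subquotient (CQ q p) (cycQ p q) (bndQ p q)"
    using HQ.C.subquotient_module[OF bndQ_sub cycQ_sub] .
  have "clQ p q z \<in> carrier (subquotient (CQ q p) (cycQ p q) (bndQ p q))"
    using assms by (simp add: HQ.C.subquotient_simps)
  then show ?thesis
    unfolding double_cohomology_def cohomology_def
    using HQ.C.subquotient_a_inv[OF bndQ_sub cycQ_sub assms] HQ.cyc_carrier[OF assms]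
    by (simp add: S.M.add_pow_sign HQ.C.add_pow_sign)
qed

end

section \<open>Compatibility with cup products\<close>

locale splitting_pairing = lie_splitting F L I K J + lie_pairing F L M N P \<mu>
  for F :: "'f ring" and L :: "('f, 'g) lie" and I K J :: "'g set"
    and M :: "('f, 'g, 'm) lmod" and N :: "('f, 'g, 'n) lmod" and P :: "('f, 'g, 'p) lmod"
    and \<mu> :: "'m \<Rightarrow> 'n \<Rightarrow> 'p"

sublocale splitting_pairing \<subseteq> SM: splitting_module F L I K J M by unfold_locales
sublocale splitting_pairing \<subseteq> SN: splitting_module F L I K J N by unfold_locales
sublocale splitting_pairing \<subseteq> SP: splitting_module F L I K J P by unfold_locales
sublocale splitting_pairing \<subseteq> PI: ideal_pairing F L M N P \<mu> I
  by unfold_locales (rule I_ideal)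
sublocale splitting_pairing \<subseteq> PG: ideal_pairing F L M N P \<mu> "carrier L"
  rewrites "restrict_lie L (carrier L) = L"
  by unfold_locales (auto intro: carrier_lie_ideal)

context splitting_pairing
begin

abbreviation "\<mu>H q1 q2 \<equiv> cohomology_cup F (restrict_lie L I) IK P \<mu> q1 q2"
abbreviation "cpI \<equiv> cup (restrict_lie L I) P \<mu>"
abbreviation "cpG \<equiv> cup L P \<mu>"

lemma \<mu>H_class:
  "a \<in> SM.cyc IK r \<Longrightarrow> b \<in> SN.cyc IK s \<Longrightarrow> \<mu>H r s (SM.cl r a) (SN.cl s b) = SP.cl (r + s) (cpI r s a b)"
  by (rule PI.cohomology_cup_class) auto

text \<open>Equivariance is \<open>theta_cup\<close> on the ideal, evaluated at one representative
  in \<open>cent\<close> that computes all three actions.\<close>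

lemma \<mu>H_pairing: "lie_pairing F Q (SM.H q1) (SN.H q2) (SP.H (q1 + q2)) (\<mu>H q1 q2)"
proof (intro lie_pairing.intro lie_pairing_axioms.intro SM.H_lie_module SN.H_lie_module SP.H_lie_module)
  note MS = SM.C.submoduleD[OF SM.cyc_sub] and NS = SN.C.submoduleD[OF SN.cyc_sub]
  note [simp] = \<mu>H_class SM.cl_add SN.cl_add SP.cl_add SM.cl_smult SN.cl_smult SP.cl_smult
    SM.cyc_carrier SN.cyc_carrier
    PI.cup_add_left PI.cup_add_right PI.cup_smult_left PI.cup_smult_right
  fix m assume "m \<in> carrier (SM.H q1)"
  then obtain a where a: "a \<in> SM.cyc IK q1" "m = SM.cl q1 a" by (rule SM.carrier_HE)
  fix n assume "n \<in> carrier (SN.H q2)"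
  then obtain b where b: "b \<in> SN.cyc IK q2" "n = SN.cl q2 b" by (rule SN.carrier_HE)
  have "cpI q1 q2 a b \<in> SP.cyc IK (q1 + q2)" using PI.cup_cyc[OF SM.IK_I a(1) b(1)] .
  then show "\<mu>H q1 q2 m n \<in> carrier (SP.H (q1 + q2))" using a b by simp
  show "\<mu>H q1 q2 (c \<odot>\<^bsub>SM.H q1\<^esub> m) n = c \<odot>\<^bsub>SP.H (q1 + q2)\<^esub> \<mu>H q1 q2 m n" if "c \<in> carrier F" for c
    using a b that MS(5) by simp
  show "\<mu>H q1 q2 m (c \<odot>\<^bsub>SN.H q2\<^esub> n) = c \<odot>\<^bsub>SP.H (q1 + q2)\<^esub> \<mu>H q1 q2 m n" if "c \<in> carrier F" for c
    using a b that NS(5) by simp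
  show "\<mu>H q1 q2 (m \<oplus>\<^bsub>SM.H q1\<^esub> m') n = \<mu>H q1 q2 m n \<oplus>\<^bsub>SP.H (q1 + q2)\<^esub> \<mu>H q1 q2 m' n"
    if m': "m' \<in> carrier (SM.H q1)" for m'
  proof -
    obtain a' where a': "a' \<in> SM.cyc IK q1" "m' = SM.cl q1 a'" using m' by (rule SM.carrier_HE)
    then show ?thesis using a b MS(4) by simp
  qed
  show "\<mu>H q1 q2 m (n \<oplus>\<^bsub>SN.H q2\<^esub> n') = \<mu>H q1 q2 m n \<oplus>\<^bsub>SP.H (q1 + q2)\<^esub> \<mu>H q1 q2 m n'"
    if n': "n' \<in> carrier (SN.H q2)" for n'
  proof -
    obtain b' where b': "b' \<in> SN.cyc IK q2" "n' = SN.cl q2 b'" using n' by (rule SN.carrier_HE)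
    then show ?thesis using a b NS(4) by simp
  qed
  fix X assume "X \<in> carrier Q"
  then obtain x where x: "x \<in> cent" "X = coset x" by (rule cent_QE)
  show "act (SP.H (q1 + q2)) X (\<mu>H q1 q2 m n) = \<mu>H q1 q2 (act (SM.H q1) X m) n
    \<oplus>\<^bsub>SP.H (q1 + q2)\<^esub> \<mu>H q1 q2 m (act (SN.H q2) X n)"
    using a b x PI.cup_cyc[OF SM.IK_I a(1) b(1)]
    by (simp add: SP.act_H SM.act_H SN.act_H SM.theta_cent_cyc SN.theta_cent_cyc PI.theta_cup)
qed

end

text \<open>The outer cup product, whose coefficient pairing is the inner one, becomes an instance
  of the general calculus, product rule for contraction included.\<close>

sublocale splitting_pairing \<subseteq> PQ: ideal_pairing F Q "ideal_cohomology F L I K J M q1"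
  "ideal_cohomology F L I K J N q2"
    "ideal_cohomology F L I K J P (q1 + q2)" "cohomology_cup F (restrict_lie L I) IK P \<mu> q1 q2"
      "carrier Q"
  rewrites "restrict_lie Q (carrier Q) = Q" for q1 q2
  by (intro ideal_pairing.intro ideal_pairing_axioms.intro \<mu>H_pairing Q.carrier_lie_ideal)
    (rule restrict_lie_carrier)

context splitting_pairing
begin

section \<open>Filtration of cup products and the sign rule for \<open>w\<close>\<close>

abbreviation "cpQ q1 q2 \<equiv> cup Q (SP.H (q1 + q2)) (\<mu>H q1 q2)"

text \<open>Multiplicativity of the filtration by the recursion \<open>V_Suc\<close>: contraction
  lowers the index of the contracted factor by at most one, and elements of \<open>I\<close> do not
  lower it at all. In degree \<open>0\<close>, \<open>p + p' \<ge> 1\<close> forces one index to be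
  positive.\<close>

lemma V_cup:
  "a \<in> SM.V p r \<Longrightarrow> b \<in> SN.V p' s \<Longrightarrow> cpG r s a b \<in> SP.V (p + p') (r + s)"
proof (induction "r + s" arbitrary: r s a b p p' rule: less_induct)
  case less
  note a = less.prems(1) and b = less.prems(2)
  have ac: "a \<in> carrier (cochains F L M r)" and bc: "b \<in> carrier (cochains F L N s)" using a b by auto
  show ?case
  proof (cases rule: nat_pair_cases[of r s])
    case OO
    have "\<mu> (a []) (b []) = \<zero>\<^bsub>P\<^esub>" if "1 \<le> p + p'"
    proof (cases "1 \<le> p")
      case True
      then show ?thesis using a OO SM.V_0 SN.G.C_closed[of b 0 "[]"] bc PI.pair_zero by simp
    next
      case False
      then show ?thesis using b that OO SN.V_0 SM.G.C_closed[of a 0 "[]"] ac PI.pair_zero by simp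
    qed
    then show ?thesis
      using ac bc OO PG.cup_closed'(3)[of a b 0] PG.cup_0_0_Nil[of a b] by (simp add: SP.V_0)
  next
    case (SO r')
    have c: "a \<in> carrier (cochains F L M (Suc r'))" "b \<in> carrier (cochains F L N 0)" using ac bc SO
      by auto
    have "cpG (Suc r') 0 a b \<in> SP.V (p + p') (Suc r')"
    proof (rule SP.V_Suc[THEN iffD2], intro conjI ballI)
      show "cpG (Suc r') 0 a b \<in> carrier (cochains F L P (Suc r'))" using c by (rule PG.cup_closed'(4))
      show "contract L r' x (cpG (Suc r') 0 a b) \<in> SP.V (p + p' - 1) r'" if "x \<in> carrier L" for x
        unfolding PG.contract_cup_Suc_0[OF c that]
        using less.hyps[of r' 0 "contract L r' x a" "p - 1" b p'] SM.V_contract(1)[of a p r' x] a b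
          that SO
        by (simp add: algebra_simps)
      show "contract L r' x (cpG (Suc r') 0 a b) \<in> SP.V (p + p') r'" if "x \<in> I" for x
        unfolding PG.contract_cup_Suc_0[OF c ideal_carrier[OF that]]
        using less.hyps[of r' 0 "contract L r' x a" p b p'] SM.V_contract(2)[of a p r' x] a b that SO
        by simp
    qed
    then show ?thesis using SO by simp
  next
    case (OS s')
    have c: "a \<in> carrier (cochains F L M 0)" "b \<in> carrier (cochains F L N (Suc s'))" using ac bc OS
      by auto
    have "cpG 0 (Suc s') a b \<in> SP.V (p + p') (Suc s')"
    proof (rule SP.V_Suc[THEN iffD2], intro conjI ballI)
      show "cpG 0 (Suc s') a b \<in> carrier (cochains F L P (Suc s'))" using c by (rule PG.cup_closed'(3))
      show "contract L s' x (cpG 0 (Suc s') a b) \<in> SP.V (p + p' - 1) s'" if "x \<in> carrier L" for x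
        unfolding PG.contract_cup_0_Suc[OF c that]
        using less.hyps[of 0 s' a p "contract L s' x b" "p' - 1"] SN.V_contract(1)[of b p' s' x] a b
          that OS
        by (simp add: algebra_simps)
      show "contract L s' x (cpG 0 (Suc s') a b) \<in> SP.V (p + p') s'" if "x \<in> I" for x
        unfolding PG.contract_cup_0_Suc[OF c ideal_carrier[OF that]]
        using less.hyps[of 0 s' a p "contract L s' x b" p'] SN.V_contract(2)[of b p' s' x] a b that OS
        by simp
    qed
    then show ?thesis using OS by simp
  next
    case (SS r' s')
    let ?n = "Suc (r' + s')"
    have c: "a \<in> carrier (cochains F L M (Suc r'))" "b \<in> carrier (cochains F L N (Suc s'))"
      using ac bc SS by auto
    have "cpG (Suc r') (Suc s') a b \<in> SP.V (p + p') (Suc ?n)"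
    proof (rule SP.V_Suc[THEN iffD2], intro conjI ballI)
      show "cpG (Suc r') (Suc s') a b \<in> carrier (cochains F L P (Suc ?n))" using c
        by (rule PG.cup_closed'(5))
      show "contract L ?n x (cpG (Suc r') (Suc s') a b) \<in> SP.V (p + p' - 1) ?n" if "x \<in> carrier L" for x
        unfolding PG.contract_cup_Suc_Suc[OF c that]
        using less.hyps[of r' "Suc s'" "contract L r' x a" "p - 1" b p'] less.hyps[of "Suc r'" s' a
          p "contract L s' x b" "p' - 1"]
          SM.V_contract(1)[of a p r' x] SN.V_contract(1)[of b p' s' x] a b that SS
        by (intro SP.V_closed(4) SP.V_sign) (simp_all add: algebra_simps)
      show "contract L ?n x (cpG (Suc r') (Suc s') a b) \<in> SP.V (p + p') ?n" if "x \<in> I" for x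
        unfolding PG.contract_cup_Suc_Suc[OF c ideal_carrier[OF that]]
        using less.hyps[of r' "Suc s'" "contract L r' x a" p b p'] less.hyps[of "Suc r'" s' a p
          "contract L s' x b" p']
          SM.V_contract(2)[of a p r' x] SN.V_contract(2)[of b p' s' x] a b that SS
        by (intro SP.V_closed(4) SP.V_sign) simp_all
    qed
    then show ?thesis using SS by simp
  qed
qed

text \<open>Each summand of the Leibniz rule contains \<open>d a\<close> or \<open>d b\<close>,
  which supplies the extra step of filtration.\<close>

lemma W_cup:
  assumes a: "a \<in> SM.W p1 q1" and b: "b \<in> SN.W p2 q2"
  shows "cpG (p1 + q1) (p2 + q2) a b \<in> SP.W (p1 + p2) (q1 + q2)"
proof -
  note ac = SM.W_D(4)[OF a] and bc = SN.W_D(4)[OF b]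
  have deg: "p1 + p2 + (q1 + q2) = p1 + q1 + (p2 + q2)" by simp
  have "cpG (p1 + q1) (p2 + q2) a b \<in> SP.V (int p1 + int p2) (p1 + q1 + (p2 + q2))"
    using V_cup[OF SM.W_D(2)[OF a] SN.W_D(2)[OF b]] .
  moreover have "cpG (p1 + q1) (p2 + q2) a b \<in> rel_cochains F L IK P (p1 + q1 + (p2 + q2))"
    using PG.cup_rel[OF SM.IK_L SM.W_D(1)[OF a] SN.W_D(1)[OF b]] .
  moreover have "ce_diff L P (p1 + q1 + (p2 + q2)) (cpG (p1 + q1) (p2 + q2) a b)
      \<in> SP.V (int p1 + int p2 + 1) (Suc (p1 + q1 + (p2 + q2)))"
    unfolding PG.d_cup[OF ac bc]
    using V_cup[OF SM.W_D(3)[OF a] SN.W_D(2)[OF b]] V_cup[OF SM.W_D(2)[OF a] SN.W_D(3)[OF b]]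
    by (intro SP.V_closed(4) SP.V_sign) (simp_all add: algebra_simps)
  ultimately show ?thesis unfolding SP.W_def deg by simp
qed

text \<open>For \<open>p2 = 0\<close> the outer product has no term with \<open>b\<close>
  contracted, whereas the total one has \<open>a \<union> i_x b\<close> when \<open>q2 > 0\<close>;
  this term is \<open>v\<close> up to sign. It keeps the full index \<open>p1 = p + 1\<close> of
  \<open>a\<close>. For \<open>p1 = 0\<close> the roles are exchanged, and the sign
  \<open>(-1)^q1\<close> from passing \<open>a\<close> survives.\<close>

lemma contract_cup_V:
  assumes a: "a \<in> SM.V (int p1) (p1 + q1)" and b: "b \<in> SN.V (int p2) (p2 + q2)" and x: "x \<in> carrier L"
  shows "p1 = Suc p \<Longrightarrow> p2 = 0 \<Longrightarrow> \<exists>v\<in>SP.V (int p + 1) (p + (q1 + q2)).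
      contract L (p + (q1 + q2)) x (cpG (p1 + q1) (p2 + q2) a b) = cpG (p + q1) (p2 + q2) (contract
        L (p + q1) x a) b \<oplus>\<^bsub>cochains F L P (p + (q1 + q2))\<^esub> v"
    and "p1 = 0 \<Longrightarrow> p2 = Suc p \<Longrightarrow> \<exists>v\<in>SP.V (int p + 1) (p + (q1 + q2)).
      contract L (p + (q1 + q2)) x (cpG (p1 + q1) (p2 + q2) a b) = v \<oplus>\<^bsub>cochains F L P (p + (q1 + q2))\<^esub>
        [((- 1 :: int) ^ q1)] \<cdot>\<^bsub>cochains F L P (p + (q1 + q2))\<^esub> cpG (p1 + q1) (p + q2) a (contract L
          (p + q2) x b)"
proof -
  let ?n = "p + (q1 + q2)"
  have ac: "a \<in> carrier (cochains F L M (p1 + q1))" and bc: "b \<in> carrier (cochains F L N (p2 + q2))"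
    using a b by auto
  {
    assume p: "p1 = Suc p" "p2 = 0"
    have ac': "a \<in> carrier (cochains F L M (Suc (p + q1)))" using ac p by simp
    note ia = SM.G.contract_closed[OF ac' x]
    show "\<exists>v\<in>SP.V (int p + 1) ?n.
      contract L ?n x (cpG (p1 + q1) (p2 + q2) a b) = cpG (p + q1) (p2 + q2) (contract L (p + q1) x
        a) b \<oplus>\<^bsub>cochains F L P ?n\<^esub> v"
    proof (cases q2)
      case 0
      then have "contract L ?n x (cpG (p1 + q1) (p2 + q2) a b)
        = cpG (p + q1) (p2 + q2) (contract L (p + q1) x a) b \<oplus>\<^bsub>cochains F L P ?n\<^esub> \<zero>\<^bsub>cochains F L P ?n\<^esub>"
        using PG.contract_cup_Suc_0[OF ac' _ x, of b] bc p PG.cup_closed'(4)[OF ia, of b] by simp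
      then show ?thesis using SP.V_closed(2) by blast
    next
      case (Suc k)
      have bc': "b \<in> carrier (cochains F L N (Suc k))" using bc p Suc by simp
      let ?v = "cpG (Suc (p + q1)) k a (contract L k x b)"
      \<comment> \<open>For \<open>i_x b\<close> only the trivial index \<open>0\<close> is claimed;
        the whole filtration comes from \<open>a\<close>.\<close>
      have "?v \<in> SP.V (int p1 + 0) (Suc (p + q1) + k)"
        using V_cup[of a "int p1" "Suc (p + q1)" "contract L k x b" 0 k] a p SN.V_nonpos
          SN.G.contract_closed[OF bc' x] by simp
      then have "[((- 1 :: int) ^ Suc (p + q1))] \<cdot>\<^bsub>cochains F L P ?n\<^esub> ?v \<in> SP.V (int p + 1) ?n"
        using p Suc SP.V_sign[of ?v "int p + 1" ?n "Suc (p + q1)"]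
          by (simp add: add.commute add.left_commute)
      then show ?thesis
        using PG.contract_cup_Suc_Suc[OF ac' bc' x] p Suc by (auto simp: add.assoc simp del: power_Suc)
    qed
  next
    assume p: "p1 = 0" "p2 = Suc p"
    have bc': "b \<in> carrier (cochains F L N (Suc (p + q2)))" using bc p by simp
    note ib = SN.G.contract_closed[OF bc' x]
    show "\<exists>v\<in>SP.V (int p + 1) ?n.
      contract L ?n x (cpG (p1 + q1) (p2 + q2) a b) = v \<oplus>\<^bsub>cochains F L P ?n\<^esub>
        [((- 1 :: int) ^ q1)] \<cdot>\<^bsub>cochains F L P ?n\<^esub> cpG (p1 + q1) (p + q2) a (contract L (p + q2) x b)"
    proof (cases q1)
      case 0
      then have "contract L ?n x (cpG (p1 + q1) (p2 + q2) a b) = \<zero>\<^bsub>cochains F L P ?n\<^esub> \<oplus>\<^bsub>cochains F L P ?n\<^esub>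
        [((- 1 :: int) ^ q1)] \<cdot>\<^bsub>cochains F L P ?n\<^esub> cpG (p1 + q1) (p + q2) a (contract L (p + q2) x b)"
        using PG.contract_cup_0_Suc[OF _ bc' x, of a] ac p PG.cup_closed'(3)[OF _ ib, of a] by simp
      then show ?thesis using SP.V_closed(2) by blast
    next
      case (Suc k)
      have ac': "a \<in> carrier (cochains F L M (Suc k))" using ac p Suc by simp
      let ?v = "cpG k (Suc (p + q2)) (contract L k x a) b"
      have "?v \<in> SP.V (0 + int p2) (k + Suc (p + q2))"
        using V_cup[of "contract L k x a" 0 k b "int p2" "Suc (p + q2)"] b p SM.V_nonpos
          SM.G.contract_closed[OF ac' x] by simp
      then have "?v \<in> SP.V (int p + 1) ?n"
        using p Suc by (simp add: add.commute add.left_commute)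
      moreover have "contract L ?n x (cpG (p1 + q1) (p2 + q2) a b) = ?v \<oplus>\<^bsub>cochains F L P ?n\<^esub>
        [((- 1 :: int) ^ q1)] \<cdot>\<^bsub>cochains F L P ?n\<^esub> cpG (p1 + q1) (p + q2) a (contract L (p + q2) x b)"
        using PG.contract_cup_Suc_Suc[OF ac' bc' x] p Suc
          by (simp add: add.commute add.left_commute del: power_Suc)
      ultimately show ?thesis by blast
    qed
  }
qed

lemma restr_cup:
  assumes "a \<in> carrier (cochains F L M r)" "b \<in> carrier (cochains F L N s)"
  shows "SP.restr (r + s) (cpG r s a b) = cpI r s (SM.restr r a) (SN.restr s b)"
proof (rule extensionalityI[of _ "tuples (restrict_lie L I) (r + s)"])
  fix xs assume xs: "xs \<in> tuples (restrict_lie L I) (r + s)"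
  have "PG.cup_summand r s a b xs \<sigma> = PI.cup_summand r s (SM.restr r a) (SN.restr s b) xs \<sigma>"
    if "\<sigma> \<in> shuffle_perms r s" for \<sigma>
    using PI.tuples_shuffle[OF xs that] by simp
  moreover have "PG.cup_summand r s a b xs \<sigma> \<in> carrier P" if "\<sigma> \<in> shuffle_perms r s" for \<sigma>
    using PG.cup_summand_closed[OF assms SP.tuples_R_L[OF xs] that] .
  ultimately have "(\<Oplus>\<^bsub>P\<^esub>\<sigma>\<in>shuffle_perms r s. PG.cup_summand r s a b xs \<sigma>)
      = (\<Oplus>\<^bsub>P\<^esub>\<sigma>\<in>shuffle_perms r s. PI.cup_summand r s (SM.restr r a) (SN.restr s b) xs \<sigma>)"
    by (intro P.M.finsum_cong') auto
  then show "SP.restr (r + s) (cpG r s a b) xs = cpI r s (SM.restr r a) (SN.restr s b) xs"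
    using xs by (simp add: PG.cup_apply[OF SP.tuples_R_L[OF xs]] PI.cup_apply[OF xs])
qed (simp_all add: SP.restr_ext PI.cup_ext)

theorem w_cup:
  assumes "a \<in> SM.W p1 q1" "b \<in> SN.W p2 q2"
  shows "SP.w (p1 + p2) (q1 + q2) (cpG (p1 + q1) (p2 + q2) a b)
    = [((- 1 :: int) ^ (p2 * q1))] \<cdot>\<^bsub>SP.CQ (q1 + q2) (p1 + p2)\<^esub> cpQ q1 q2 p1 p2 (SM.w p1 q1 a) (SN.w
      p2 q2 b)"
  using assms
proof (induction "p1 + p2" arbitrary: p1 p2 a b rule: less_induct)
  case less
  note a = less.prems(1) and b = less.prems(2)
  note wa = SM.w_closed[OF a] and wb = SN.w_closed[OF b]
  note wab = PQ.cup_closed[OF wa wb]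
  have Wab: "cpG (p1 + q1) (p2 + q2) a b \<in> SP.W (p1 + p2) (q1 + q2)" using a b by (rule W_cup)
  show ?case
  proof (cases rule: nat_pair_cases[of p1 p2])
    case OO
    have W: "a \<in> SM.W 0 q1" "b \<in> SN.W 0 q2" using a b OO by simp_all
    \<comment> \<open>Without outer arguments both sides are classes of cup products on
      \<open>I\<close>, compared by \<open>restr_cup\<close> and \<open>\<mu>H_class\<close>; the
      exponent is \<open>0\<close>.\<close>
    have "SP.w 0 (q1 + q2) (cpG q1 q2 a b) = cpQ q1 q2 0 0 (SM.w 0 q1 a) (SN.w 0 q2 b)"
    proof (rule extensionalityI[of _ "tuples Q 0"])
      fix Xs assume "Xs \<in> tuples Q 0"
      then have "Xs = []" by (simp add: SM.HQ.tuples_0)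
      then show "SP.w 0 (q1 + q2) (cpG q1 q2 a b) Xs = cpQ q1 q2 0 0 (SM.w 0 q1 a) (SN.w 0 q2 b) Xs"
        using PQ.cup_0_0_Nil[OF SM.w_closed[OF W(1)] SN.w_closed[OF W(2)]] SM.W_D(4)[OF W(1)]
          SN.W_D(4)[OF W(2)]
        by (simp add: SP.w_0 SM.w_0 SN.w_0 restr_cup \<mu>H_class[OF SM.W_restr_cyc[OF W(1)]
          SN.W_restr_cyc[OF W(2)]])
    qed (use PQ.cup_ext[of q1 q2 0 0] in \<open>simp_all add: SP.w_ext\<close>)
    then show ?thesis using OO wab by simp
  next
    case (SO p)
    let ?n = "p + (q1 + q2)"
    have V: "cpG (p1 + q1) (p2 + q2) a b \<in> SP.V (int (Suc p)) (Suc ?n)" using SP.W_D(2)[OF Wab] SO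
      by simp
    have aW: "a \<in> SM.W (Suc p) q1" and aV: "a \<in> SM.V (int (Suc p)) (Suc (p + q1))"
      using a SM.W_D(2)[OF a] SO by simp_all
    have "SP.w (Suc p) (q1 + q2) (cpG (p1 + q1) (p2 + q2) a b)
      = cpQ q1 q2 (Suc p) 0 (SM.w (Suc p) q1 a) (SN.w 0 q2 b)"
    proof (rule SP.HQ.contract_eqI[where n = p])
      show "SP.w (Suc p) (q1 + q2) (cpG (p1 + q1) (p2 + q2) a b) \<in> carrier (SP.CQ (q1 + q2) (Suc
        p))" using SP.w_closed[OF Wab] SO by simp
      show "cpQ q1 q2 (Suc p) 0 (SM.w (Suc p) q1 a) (SN.w 0 q2 b) \<in> carrier (SP.CQ (q1 + q2) (Suc
        p))" using wab SO by simp
      fix X assume "X \<in> carrier Q"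
      then obtain x where x: "x \<in> cent" "X = coset x" by (rule cent_QE)
      let ?a = "contract L (p + q1) x a"
      have aW': "?a \<in> SM.W p q1" using SM.W_contract[OF aW x(1)] .
      have Wab': "cpG (p + q1) (p2 + q2) ?a b \<in> SP.W p (q1 + q2)" using W_cup[OF aW' b] SO by simp
      \<comment> \<open>The stray term \<open>v\<close> has index \<open>p + 1\<close> in outer
        degree \<open>p\<close>, so \<open>w_V\<close> removes it.\<close>
      obtain v where v: "v \<in> SP.V (int p + 1) ?n" "contract L ?n x (cpG (p1 + q1) (p2 + q2) a b)
        = cpG (p + q1) (p2 + q2) ?a b \<oplus>\<^bsub>cochains F L P ?n\<^esub> v"
        using contract_cup_V(1)[OF SM.W_D(2)[OF a] SN.W_D(2)[OF b] cent_carrier[OF x(1)] SO] by auto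
      have "contract Q p X (SP.w (Suc p) (q1 + q2) (cpG (p1 + q1) (p2 + q2) a b))
        = SP.w p (q1 + q2) (cpG (p + q1) (p2 + q2) ?a b)"
        using SP.contract_w[OF V, of x] x SP.w_add[OF SP.W_D(4)[OF Wab'] SP.V_carrier[OF v(1)]]
          SP.w_V[OF v(1)] SP.w_closed[OF Wab'] v(2) by simp
      also have "\<dots> = cpQ q1 q2 p 0 (SM.w p q1 ?a) (SN.w 0 q2 b)"
        using less.hyps[of p p2 ?a b] aW' b SO PQ.cup_closed[OF SM.w_closed[OF aW'] wb] by simp
      also have "\<dots> = contract Q p X (cpQ q1 q2 (Suc p) 0 (SM.w (Suc p) q1 a) (SN.w 0 q2 b))"
        using PQ.contract_cup_Suc_0[OF SM.w_closed[OF aW], of "SN.w 0 q2 b" q2 X] wb SO x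
          SM.contract_w[OF aV, of x] by simp
      finally show "contract Q p X (SP.w (Suc p) (q1 + q2) (cpG (p1 + q1) (p2 + q2) a b))
        = contract Q p X (cpQ q1 q2 (Suc p) 0 (SM.w (Suc p) q1 a) (SN.w 0 q2 b))" .
    qed
    then show ?thesis using SO wab by simp
  next
    case (OS p)
    let ?n = "p + (q1 + q2)" and ?sg = "\<lambda>k z. [((- 1 :: int) ^ k)] \<cdot>\<^bsub>SP.CQ (q1 + q2) p\<^esub> z"
    have V: "cpG (p1 + q1) (p2 + q2) a b \<in> SP.V (int (Suc p)) (Suc ?n)" using SP.W_D(2)[OF Wab] OS
      by simp
    have bW: "b \<in> SN.W (Suc p) q2" and bV: "b \<in> SN.V (int (Suc p)) (Suc (p + q2))"
      using b SN.W_D(2)[OF b] OS by simp_all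
    have c: "cpQ q1 q2 0 (Suc p) (SM.w 0 q1 a) (SN.w (Suc p) q2 b) \<in> carrier (SP.CQ (q1 + q2) (Suc
      p))" using wab OS by simp
    have "SP.w (Suc p) (q1 + q2) (cpG (p1 + q1) (p2 + q2) a b)
      = [((- 1 :: int) ^ (Suc p * q1))] \<cdot>\<^bsub>SP.CQ (q1 + q2) (Suc p)\<^esub> cpQ q1 q2 0 (Suc p) (SM.w 0 q1 a)
        (SN.w (Suc p) q2 b)"
    proof (rule SP.HQ.contract_eqI[where n = p])
      show "SP.w (Suc p) (q1 + q2) (cpG (p1 + q1) (p2 + q2) a b) \<in> carrier (SP.CQ (q1 + q2) (Suc
        p))" using SP.w_closed[OF Wab] OS by simp
      show "[((- 1 :: int) ^ (Suc p * q1))] \<cdot>\<^bsub>SP.CQ (q1 + q2) (Suc p)\<^esub> cpQ q1 q2 0 (Suc p) (SM.w 0 q1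
        a) (SN.w (Suc p) q2 b) \<in> carrier (SP.CQ (q1 + q2) (Suc p))"
        using c by (rule SP.HQ.C.add.int_pow_closed)
      fix X assume X: "X \<in> carrier Q"
      then obtain x where x: "x \<in> cent" "X = coset x" by (rule cent_QE)
      let ?b = "contract L (p + q2) x b"
      have bW': "?b \<in> SN.W p q2" using SN.W_contract[OF bW x(1)] .
      have Wab': "cpG (p1 + q1) (p + q2) a ?b \<in> SP.W p (q1 + q2)" using W_cup[OF a bW'] OS by simp
      have z: "cpQ q1 q2 0 p (SM.w 0 q1 a) (SN.w p q2 ?b) \<in> carrier (SP.CQ (q1 + q2) p)"
        using PQ.cup_closed[OF wa SN.w_closed[OF bW']] OS by simp
      obtain v where v: "v \<in> SP.V (int p + 1) ?n" "contract L ?n x (cpG (p1 + q1) (p2 + q2) a b) = v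
        \<oplus>\<^bsub>cochains F L P ?n\<^esub>
          [((- 1 :: int) ^ q1)] \<cdot>\<^bsub>cochains F L P ?n\<^esub> cpG (p1 + q1) (p + q2) a ?b"
        using contract_cup_V(2)[OF SM.W_D(2)[OF a] SN.W_D(2)[OF b] cent_carrier[OF x(1)] OS] by auto
      have "contract Q p X (SP.w (Suc p) (q1 + q2) (cpG (p1 + q1) (p2 + q2) a b))
        = ?sg q1 (SP.w p (q1 + q2) (cpG (p1 + q1) (p + q2) a ?b))"
        using SP.contract_w[OF V, of x] x SP.w_add[OF SP.V_carrier[OF v(1)]
          SP.G.C.add.int_pow_closed[OF SP.W_D(4)[OF Wab']]]
          SP.w_V[OF v(1)] SP.w_closed[OF Wab'] v(2) SP.w_sign[OF Wab', of q1] by simp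
      also have "SP.w p (q1 + q2) (cpG (p1 + q1) (p + q2) a ?b)
        = ?sg (p * q1) (cpQ q1 q2 0 p (SM.w 0 q1 a) (SN.w p q2 ?b))"
        using less.hyps[of p1 p a ?b] a bW' OS by simp
      \<comment> \<open>One more argument of \<open>b\<close> has passed the \<open>q1\<close> inner
        arguments of \<open>a\<close>: \<open>q1 + p q1 = (p + 1) q1\<close>.\<close>
      also have "?sg q1 (?sg (p * q1) (cpQ q1 q2 0 p (SM.w 0 q1 a) (SN.w p q2 ?b)))
        = ?sg (Suc p * q1) (cpQ q1 q2 0 p (SM.w 0 q1 a) (SN.w p q2 ?b))"
        using z by (simp add: SP.HQ.C.add_pow_sign)
      also have "\<dots> = contract Q p X ([((- 1 :: int) ^ (Suc p * q1))] \<cdot>\<^bsub>SP.CQ (q1 + q2) (Suc p)\<^esub> cpQ q1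
        q2 0 (Suc p) (SM.w 0 q1 a) (SN.w (Suc p) q2 b))"
        using PQ.contract_cup_0_Suc[OF _ SN.w_closed[OF bW], of "SM.w 0 q1 a" q1 X] wa OS x X c
          SN.contract_w[OF bV, of x]
        by (cases "even q1"; cases "even p") (use z in \<open>simp_all add: SP.HQ.C.add_pow_minus_one
          SP.HQ.contract_minus\<close>)
      finally show "contract Q p X (SP.w (Suc p) (q1 + q2) (cpG (p1 + q1) (p2 + q2) a b))
        = contract Q p X ([((- 1 :: int) ^ (Suc p * q1))] \<cdot>\<^bsub>SP.CQ (q1 + q2) (Suc p)\<^esub> cpQ q1 q2 0 (Suc
          p) (SM.w 0 q1 a) (SN.w (Suc p) q2 b))" .
    qed
    then show ?thesis using OS by simp
  next
    case (SS p p')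
    let ?m = "Suc (p + p')"
    let ?n = "?m + (q1 + q2)" and ?sg = "\<lambda>k z. [((- 1 :: int) ^ k)] \<cdot>\<^bsub>SP.CQ (q1 + q2) (Suc (p + p'))\<^esub> z"
    have V: "cpG (p1 + q1) (p2 + q2) a b \<in> SP.V (int (Suc ?m)) (Suc ?n)" using SP.W_D(2)[OF Wab] SS
      by simp
    have aW: "a \<in> SM.W (Suc p) q1" and aV: "a \<in> SM.V (int (Suc p)) (Suc (p + q1))"
      and ac: "a \<in> carrier (cochains F L M (Suc (p + q1)))"
      using a SM.W_D(2,4)[OF a] SS by simp_all
    have bW: "b \<in> SN.W (Suc p') q2" and bV: "b \<in> SN.V (int (Suc p')) (Suc (p' + q2))"
      and bc: "b \<in> carrier (cochains F L N (Suc (p' + q2)))"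
      using b SN.W_D(2,4)[OF b] SS by simp_all
    have c: "cpQ q1 q2 (Suc p) (Suc p') (SM.w (Suc p) q1 a) (SN.w (Suc p') q2 b) \<in> carrier (SP.CQ
      (q1 + q2) (Suc ?m))" using wab SS by simp
    have "SP.w (Suc ?m) (q1 + q2) (cpG (p1 + q1) (p2 + q2) a b)
      = [((- 1 :: int) ^ (Suc p' * q1))] \<cdot>\<^bsub>SP.CQ (q1 + q2) (Suc ?m)\<^esub> cpQ q1 q2 (Suc p) (Suc p') (SM.w
        (Suc p) q1 a) (SN.w (Suc p') q2 b)"
    proof (rule SP.HQ.contract_eqI[where n = ?m])
      show "SP.w (Suc ?m) (q1 + q2) (cpG (p1 + q1) (p2 + q2) a b) \<in> carrier (SP.CQ (q1 + q2) (Suc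
        ?m))" using SP.w_closed[OF Wab] SS by simp
      show "[((- 1 :: int) ^ (Suc p' * q1))] \<cdot>\<^bsub>SP.CQ (q1 + q2) (Suc ?m)\<^esub> cpQ q1 q2 (Suc p) (Suc p')
        (SM.w (Suc p) q1 a) (SN.w (Suc p') q2 b) \<in> carrier (SP.CQ (q1 + q2) (Suc ?m))"
        using c by (rule SP.HQ.C.add.int_pow_closed)
      fix X assume X: "X \<in> carrier Q"
      then obtain x where x: "x \<in> cent" "X = coset x" by (rule cent_QE)
      let ?a = "contract L (p + q1) x a" and ?b = "contract L (p' + q2) x b"
      have aW': "?a \<in> SM.W p q1" using SM.W_contract[OF aW x(1)] .
      have bW': "?b \<in> SN.W p' q2" using SN.W_contract[OF bW x(1)] .
      have W1: "cpG (p + q1) (p2 + q2) ?a b \<in> SP.W ?m (q1 + q2)" using W_cup[OF aW' b] SS by simp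
      have W2: "cpG (p1 + q1) (p' + q2) a ?b \<in> SP.W ?m (q1 + q2)" using W_cup[OF a bW'] SS by simp
      define z1 where "z1 = cpQ q1 q2 p (Suc p') (SM.w p q1 ?a) (SN.w (Suc p') q2 b)"
      define z2 where "z2 = cpQ q1 q2 (Suc p) p' (SM.w (Suc p) q1 a) (SN.w p' q2 ?b)"
      have z: "z1 \<in> carrier (SP.CQ (q1 + q2) ?m)" "z2 \<in> carrier (SP.CQ (q1 + q2) ?m)"
        unfolding z1_def z2_def
        using PQ.cup_closed'(2)[OF SM.w_closed[OF aW'] SN.w_closed[OF bW]] PQ.cup_closed'(1)[OF
          SM.w_closed[OF aW] SN.w_closed[OF bW']] by simp_all
      have deg: "Suc (p + q1 + (p' + q2)) = ?n" by simp
      have e: "contract L ?n x (cpG (p1 + q1) (p2 + q2) a b) = cpG (p + q1) (p2 + q2) ?a b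
        \<oplus>\<^bsub>cochains F L P ?n\<^esub>
          [((- 1 :: int) ^ (Suc p + q1))] \<cdot>\<^bsub>cochains F L P ?n\<^esub> cpG (p1 + q1) (p' + q2) a ?b"
        using PG.contract_cup_Suc_Suc[OF ac bc cent_carrier[OF x(1)]] SS unfolding deg
          by (simp del: power_Suc)
      have IH1: "SP.w ?m (q1 + q2) (cpG (p + q1) (p2 + q2) ?a b) = ?sg (Suc p' * q1) z1"
        using less.hyps[of p p2 ?a b] aW' b SS unfolding z1_def by simp
      have IH2: "SP.w ?m (q1 + q2) (cpG (p1 + q1) (p' + q2) a ?b) = ?sg (p' * q1) z2"
        using less.hyps[of p1 p' a ?b] a bW' SS unfolding z2_def by simp
      have "contract Q ?m X (SP.w (Suc ?m) (q1 + q2) (cpG (p1 + q1) (p2 + q2) a b))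
          = ?sg (Suc p' * q1) z1 \<oplus>\<^bsub>SP.CQ (q1 + q2) ?m\<^esub> ?sg (Suc p + q1) (?sg (p' * q1) z2)"
        unfolding x(2) SP.contract_w[OF V cent_carrier[OF x(1)]] e
          SP.w_add[OF SP.W_D(4)[OF W1] SP.G.C.add.int_pow_closed[OF SP.W_D(4)[OF W2]]] SP.w_sign[OF
            W2] IH1 IH2 ..
      \<comment> \<open>The exponents agree:
        \<open>(p + 1 + q1) + p' q1 = (p' + 1) q1 + (p + 1)\<close>. The part \<open>p + 1\<close>
        is the sign of contraction in the outer product; the rest is the asserted sign.\<close>
      also have "\<dots> = ?sg (Suc p' * q1) (z1 \<oplus>\<^bsub>SP.CQ (q1 + q2) ?m\<^esub> ?sg (Suc p) z2)"
        using z by (cases "even q1"; cases "even p"; cases "even p'") (simp_all add: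
          SP.HQ.C.add_pow_minus_one SP.HQ.C.minus_add)
      also have "z1 \<oplus>\<^bsub>SP.CQ (q1 + q2) ?m\<^esub> ?sg (Suc p) z2
        = contract Q ?m X (cpQ q1 q2 (Suc p) (Suc p') (SM.w (Suc p) q1 a) (SN.w (Suc p') q2 b))"
        using PQ.contract_cup_Suc_Suc[OF SM.w_closed[OF aW] SN.w_closed[OF bW] X] SM.contract_w[OF
          aV, of x] SN.contract_w[OF bV, of x] x
        unfolding z1_def z2_def by (simp del: power_Suc)
      also have "?sg (Suc p' * q1) \<dots> = contract Q ?m X ([((- 1 :: int) ^ (Suc p' * q1))]
        \<cdot>\<^bsub>SP.CQ (q1 + q2) (Suc ?m)\<^esub> cpQ q1 q2 (Suc p) (Suc p') (SM.w (Suc p) q1 a) (SN.w (Suc p') q2 b))"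
        by (cases "even q1"; cases "even p'") (use c X in \<open>simp_all add: SP.HQ.C.add_pow_minus_one
          SP.HQ.contract_minus\<close>)
      finally show "contract Q ?m X (SP.w (Suc ?m) (q1 + q2) (cpG (p1 + q1) (p2 + q2) a b))
        = contract Q ?m X ([((- 1 :: int) ^ (Suc p' * q1))] \<cdot>\<^bsub>SP.CQ (q1 + q2) (Suc ?m)\<^esub> cpQ q1 q2 (Suc
          p) (Suc p') (SM.w (Suc p) q1 a) (SN.w (Suc p') q2 b))" .
    qed
    then show ?thesis using SS by simp
  qed
qed

theorem psi_spec_cup:
  assumes e: "e \<in> carrier (spec_E F L I K M 2 p1 q1)" and e': "e' \<in> carrier (spec_E F L I K N 2 p2 q2)"
  shows "psi F L I K J P (p1 + p2) (q1 + q2) (spec_cup F L I K M N P \<mu> 2 p1 q1 p2 q2 e e')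
    = [((- 1 :: int) ^ (p2 * q1))] \<cdot>\<^bsub>double_cohomology F L I K J P (p1 + p2) (q1 + q2)\<^esub>
        double_cup F L I K J P \<mu> p1 q1 p2 q2 (psi F L I K J M p1 q1 e) (psi F L I K J N p2 q2 e')"
proof -
  let ?A = "e \<inter> filt_page F L I K M 2 (int p1) (p1 + q1)"
    and ?B = "e' \<inter> filt_page F L I K N 2 (int p2) (p2 + q2)"
  let ?Y = "\<lambda>a b. spec_B F L I K P 2 (p1 + p2) (q1 + q2) +>\<^bsub>cochains F L P ((p1 + p2) + (q1 + q2))\<^esub>
    cpG (p1 + q1) (p2 + q2) a b"
  let ?rhs = "[((- 1 :: int) ^ (p2 * q1))] \<cdot>\<^bsub>double_cohomology F L I K J P (p1 + p2) (q1 + q2)\<^esub>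
        double_cup F L I K J P \<mu> p1 q1 p2 q2 (psi F L I K J M p1 q1 e) (psi F L I K J N p2 q2 e')"
  \<comment> \<open>Each pair of representatives is treated alone; the right-hand side does not
    mention it, so the value is independent of the choice.\<close>
  have psi_Y: "psi F L I K J P (p1 + p2) (q1 + q2) (?Y a b) = ?rhs" if ab: "a \<in> ?A" "b \<in> ?B" for a b
  proof -
    have a: "a \<in> SM.W p1 q1" using SM.page_W ab(1) by auto
    have b: "b \<in> SN.W p2 q2" using SN.page_W ab(2) by auto
    have W: "cpG (p1 + q1) (p2 + q2) a b \<in> SP.W (p1 + p2) (q1 + q2)" using a b by (rule W_cup)
    have za: "SM.w p1 q1 a \<in> SM.cycQ p1 q1" using SM.w_page_cyc ab(1) by auto
    have zb: "SN.w p2 q2 b \<in> SN.cycQ p2 q2" using SN.w_page_cyc ab(2) by auto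
    let ?z = "cpQ q1 q2 p1 p2 (SM.w p1 q1 a) (SN.w p2 q2 b)"
    have z: "?z \<in> SP.cycQ (p1 + p2) (q1 + q2)" using PQ.cup_cyc[OF SM.KQ_Q za zb] .
    have "double_cup F L I K J P \<mu> p1 q1 p2 q2 (psi F L I K J M p1 q1 e) (psi F L I K J N p2 q2 e')
      = SP.clQ (p1 + p2) (q1 + q2) ?z"
      unfolding double_cup_def SM.spec_E_rep(2)[OF e ab(1)] SN.spec_E_rep(2)[OF e' ab(2)]
      using PQ.cohomology_cup_class[OF SM.KQ_Q za zb] .
    then have "?rhs = SP.clQ (p1 + p2) (q1 + q2) ([((- 1 :: int) ^ (p2 * q1))]
      \<cdot>\<^bsub>SP.CQ (q1 + q2) (p1 + p2)\<^esub> ?z)"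
      using SP.clQ_sign[OF z] by simp
    moreover have "psi F L I K J P (p1 + p2) (q1 + q2) (?Y a b)
      = SP.clQ (p1 + p2) (q1 + q2) (SP.w (p1 + p2) (q1 + q2) (cpG (p1 + q1) (p2 + q2) a b))"
      by (rule SP.psi_coset[OF SP.W_D(4)[OF W] SP.w_closed[OF W]])
    ultimately show ?thesis using w_cup[OF a b] by simp
  qed
  \<comment> \<open>Both \<open>psi\<close> and \<open>spec_cup\<close> are unions over members, so
    \<open>psi\<close> distributes over the union, which collapses because both index sets are
    nonempty.\<close>
  have "psi F L I K J P (p1 + p2) (q1 + q2) (spec_cup F L I K M N P \<mu> 2 p1 q1 p2 q2 e e')
    = (\<Union>a\<in>?A. \<Union>b\<in>?B. psi F L I K J P (p1 + p2) (q1 + q2) (?Y a b))"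
    unfolding psi_def spec_cup_def by blast
  also have "\<dots> = ?rhs"
    using psi_Y SM.spec_E_rep(1)[OF e] SN.spec_E_rep(1)[OF e'] by blast
  finally show ?thesis .
qed

end

theorem proposition6p15:
  fixes F :: "'f ring" and \<gg> :: "('f, 'g) lie"
    and I \<kk> IL JK JL :: "'g set"
    and M :: "('f, 'g, 'm) lmod" and N :: "('f, 'g, 'n) lmod" and P :: "('f, 'g, 'p) lmod"
    and \<mu> :: "'m \<Rightarrow> 'n \<Rightarrow> 'p"
    and p1 q1 p2 q2 :: nat
    and e :: "('g list \<Rightarrow> 'm) set" and e' :: "('g list \<Rightarrow> 'n) set"
  defines "J \<equiv> JK <+>\<^bsub>\<gg>\<^esub> JL"
  assumes "field F"
    and "lie_algebra F \<gg>"
    and "lie_ideal F \<gg> I"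
    and "lie_subalgebra F \<gg> \<kk>"
    and "reductive_in F \<gg> \<kk>"
    and "decomposition F \<gg> I \<kk> IL JK JL"
    and "lie_module F \<gg> M" and "lie_module F \<gg> N" and "lie_module F \<gg> P"
    and "lie_pairing F \<gg> M N P \<mu>"
    and "e \<in> carrier (spec_E F \<gg> I \<kk> M 2 p1 q1)"
    and "e' \<in> carrier (spec_E F \<gg> I \<kk> N 2 p2 q2)"
  shows "psi F \<gg> I \<kk> J P (p1 + p2) (q1 + q2)
           (spec_cup F \<gg> I \<kk> M N P \<mu> 2 p1 q1 p2 q2 e e')
       = [((- 1 :: int) ^ (p2 * q1))] \<cdot>\<^bsub>double_cohomology F \<gg> I \<kk> J P (p1 + p2) (q1 + q2)\<^esub>
           double_cup F \<gg> I \<kk> J P \<mu> p1 q1 p2 q2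
             (psi F \<gg> I \<kk> J M p1 q1 e) (psi F \<gg> I \<kk> J N p2 q2 e')"
proof -
  interpret g: lie_algebra F \<gg> by fact
  interpret pair: lie_pairing F \<gg> M N P \<mu> by fact
  have dec: "ad_submodule F \<gg> \<kk> JK" "ad_submodule F \<gg> \<kk> JL"
    "direct_sum_of \<gg> \<kk> (I \<inter> \<kk>) JK" "direct_sum_of \<gg> (carrier \<gg>) I J"
    using assms(7) unfolding decomposition_def J_def by blast+
  have K: "\<kk> \<subseteq> carrier \<gg>" using assms(5) g.L.submoduleD(1) by (auto simp: lie_subalgebra_def)
  have I: "submodule I F \<gg>" using assms(4) by (simp add: lie_ideal_def)
  note IS = g.L.submoduleD[OF I]
  have JK: "submodule JK F \<gg>" and JL: "submodule JL F \<gg>" using dec by (simp_all add: ad_submodule_def)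
  note JKS = g.L.submoduleD[OF JK] and JLS = g.L.submoduleD[OF JL]
  have JI: "\<exists>x\<in>JK. \<exists>y\<in>JL. z = x \<oplus>\<^bsub>\<gg>\<^esub> y" if "z \<in> J" for z
    using that unfolding J_def set_add_def' by auto
  have IJ: "x \<oplus>\<^bsub>\<gg>\<^esub> y \<in> J" if "x \<in> JK" "y \<in> JL" for x y
    using that unfolding J_def set_add_def' by auto
  have J: "submodule J F \<gg>"
  proof (rule g.L.submoduleI)
    show "J \<subseteq> carrier \<gg>" using JI JKS(1) JLS(1) by fastforce
    show "\<zero>\<^bsub>\<gg>\<^esub> \<in> J" using IJ[OF JKS(2) JLS(2)] by simp
    fix z assume "z \<in> J"
    then obtain x y where z: "x \<in> JK" "y \<in> JL" "z = x \<oplus>\<^bsub>\<gg>\<^esub> y" using JI by blast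
    then have c: "x \<in> carrier \<gg>" "y \<in> carrier \<gg>" using JKS(1) JLS(1) by auto
    show "\<ominus>\<^bsub>\<gg>\<^esub> z \<in> J" using IJ[OF JKS(3)[OF z(1)] JLS(3)[OF z(2)]] z(3) c by (simp add: g.L.M.minus_add)
    show "a \<odot>\<^bsub>\<gg>\<^esub> z \<in> J" if "a \<in> carrier F" for a
      using IJ[OF JKS(5)[OF that z(1)] JLS(5)[OF that z(2)]] z(3) c that
        by (simp add: g.L.smult_r_distr)
    fix z' assume "z' \<in> J"
    then obtain x' y' where z': "x' \<in> JK" "y' \<in> JL" "z' = x' \<oplus>\<^bsub>\<gg>\<^esub> y'" using JI by blast
    then have c': "x' \<in> carrier \<gg>" "y' \<in> carrier \<gg>" using JKS(1) JLS(1) by auto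
    show "z \<oplus>\<^bsub>\<gg>\<^esub> z' \<in> J"
      using IJ[OF JKS(4)[OF z(1) z'(1)] JLS(4)[OF z(2) z'(2)]] z(3) z'(3) c c'
        by (simp add: g.L.M.add_middle)
  qed
  note JS = g.L.submoduleD[OF J]
  have disj: "x = \<zero>\<^bsub>\<gg>\<^esub>" if "x \<in> I" "x \<in> J" for x
    using dec(4) that by (auto simp: direct_sum_of_def)
  \<comment> \<open>It remains to read off the splitting from the decomposition into four summands,
    with \<open>JK + JL\<close> as the complement of \<open>I\<close>.\<close>
  have split: "lie_splitting F \<gg> I \<kk> J"
  proof (intro lie_splitting.intro lie_splitting_axioms.intro assms(3,4) J K)
    show "x = \<zero>\<^bsub>\<gg>\<^esub>" if "x \<in> I" "x \<in> J" for x using that by (rule disj)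
    show "\<exists>j\<in>J. x \<ominus>\<^bsub>\<gg>\<^esub> j \<in> I" if x: "x \<in> carrier \<gg>" for x
    proof -
      obtain i j where ij: "i \<in> I" "j \<in> J" "x = i \<oplus>\<^bsub>\<gg>\<^esub> j"
        using dec(4) x unfolding direct_sum_of_def set_add_def' by blast
      then have "i \<in> carrier \<gg>" "j \<in> carrier \<gg>" using IS(1) JS(1) by auto
      then have "x \<ominus>\<^bsub>\<gg>\<^esub> j = i" using ij by (simp add: g.L.M.minus_eq_iff)
      then show ?thesis using ij(1,2) by metis
    qed
    show "\<exists>j\<in>J \<inter> \<kk>. k \<ominus>\<^bsub>\<gg>\<^esub> j \<in> I" if k: "k \<in> \<kk>" for k
    proof -
      obtain i j where ij: "i \<in> I \<inter> \<kk>" "j \<in> JK" "k = i \<oplus>\<^bsub>\<gg>\<^esub> j"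
        using dec(3) k unfolding direct_sum_of_def set_add_def' by blast
      have c: "i \<in> carrier \<gg>" "j \<in> carrier \<gg>" using ij IS(1) JKS(1) by auto
      \<comment> \<open>\<open>JK\<close> is contained in the sum of \<open>I \<inter> \<kk>\<close>
        and \<open>JK\<close>, which is \<open>\<kk>\<close>, through the summand zero.\<close>
      have "j \<in> \<kk>"
      proof -
        have "\<zero>\<^bsub>\<gg>\<^esub> \<in> I \<inter> \<kk>" using dec(3) by (auto simp: direct_sum_of_def)
        then have "\<zero>\<^bsub>\<gg>\<^esub> \<oplus>\<^bsub>\<gg>\<^esub> j \<in> \<kk>" using dec(3) ij(2) unfolding direct_sum_of_def set_add_def' by blast
        then show ?thesis using c by simp
      qed
      moreover have "j \<in> J" using IJ[OF ij(2) JLS(2)] c by simp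
      moreover have "k \<ominus>\<^bsub>\<gg>\<^esub> j = i" using ij(3) c by (simp add: g.L.M.minus_eq_iff)
      ultimately show ?thesis using ij(1) by (metis IntD1 IntI)
    qed
    \<comment> \<open>The ideal property puts the bracket into \<open>I\<close>, stability of
      \<open>JK\<close> and \<open>JL\<close> under \<open>\<kk>\<close> puts it into
      \<open>J\<close>, and these two meet only in zero.\<close>
    show "bracket \<gg> k x = \<zero>\<^bsub>\<gg>\<^esub>" if k: "k \<in> I \<inter> \<kk>" and x: "x \<in> J" for k x
    proof (rule disj)
      have c: "k \<in> carrier \<gg>" "x \<in> carrier \<gg>" using k x IS(1) JS(1) by auto
      have "bracket \<gg> x k \<in> I" using assms(4) c k by (auto simp: lie_ideal_def)
      then show "bracket \<gg> k x \<in> I" using g.bracket_swap[OF c] IS(3) by simp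
      obtain y z where yz: "y \<in> JK" "z \<in> JL" "x = y \<oplus>\<^bsub>\<gg>\<^esub> z" using JI[OF x] by blast
      have "bracket \<gg> k y \<in> JK" "bracket \<gg> k z \<in> JL" using dec(1,2) k yz
        by (auto simp: ad_submodule_def)
      moreover have "y \<in> carrier \<gg>" "z \<in> carrier \<gg>" using yz JKS(1) JLS(1) by auto
      ultimately show "bracket \<gg> k x \<in> J" using IJ c yz(3) by (simp add: g.bracket_add_right)
    qed
  qed
  interpret splitting_pairing F \<gg> I \<kk> J M N P \<mu>
    by (intro splitting_pairing.intro split assms(11))
  show ?thesis using assms(12,13) by (rule psi_spec_cup)
qed

end
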